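(* Let $\beta>0$ and let $Q:\mathbb{C}\to\mathbb{R}\cup\{+\infty\}$ be an external potential satisfying: (i) $Q$ is finite on a set of positive Lebesgue measure, and its equilibrium measure $\sigma_Q$ is of the form $d\sigma_Q(z)=\frac{1}{4\pi}\chi_S(z)\,\Delta Q(z)\,dm(z)$, where $S$ is the droplet; (ii) $\displaystyle\liminf_{|z|\to\infty}\frac{Q(z)}{|z|^2}>0$; (iii) $Q$ can be decomposed as $Q=\tilde Q+h$, where $\tilde Q$ is a twice differentiable function satisfying $\displaystyle\limsup_{|z|\to\infty}\frac{1}{\tilde Q(z)}\sup_{|w-z|<1}\Delta\tilde Q(w)<4$, and $h$ is a superharmonic function. For each $n$ let $\{\zeta_i\}_{1\le i\le n}$ be the corresponding 2D Coulomb gas ensemble, i.e. the random vector $(\zeta_1,\dots,\zeta_n)$ with law $$d\mathbf{P}_n^\beta(\zeta_1,\dots,\zeta_n)=\frac{1}{Z_n^\beta}\prod_{j<k}|\zeta_j-\zeta_k|^{2\beta}\,e^{-\beta n\sum_{i}Q(\zeta_i)}\,d\mathrm{vol}_{2n},$$ and define $$P_n(z):=(z-\zeta_1)\cdots(z-\zeta_n).$$ Then for any $k\in\mathbb{N}$, as $n\to\infty$, $$\mathcal{M}(P_n^{(k)})\to\frac{1}{4\pi}\chi_S\cdot\Delta Q(z)\,dm(z)\quad\text{in probability.}$$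
   Context: $m$ is Lebesgue measure on $\mathbb{C}$, $d\mathrm{vol}_{2n}$ is Lebesgue measure on $\mathbb{C}^n\cong\mathbb{R}^{2n}$, $Z_n^\beta$ is the normalizing constant (partition function), and $\Delta=\partial_x^2+\partial_y^2$. The equilibrium measure $\sigma_Q$ is the unique probability measure on $\mathbb{C}$ minimizing the weighted logarithmic energy $$I_Q[\mu]=\iint_{\mathbb{C}^2}\log\frac{1}{|\zeta-\eta|^2}\,d\mu(\zeta)\,d\mu(\eta)+2\int_{\mathbb{C}}Q\,d\mu$$ over all probability measures $\mu$ on $\mathbb{C}$; the droplet is the compact set $S=\operatorname{supp}(\sigma_Q)$, with indicator function $\chi_S$. For a non-constant polynomial $P$, $\mathcal{M}(P)$ denotes the uniform probability measure on the multiset of zeros of $P$ (zeros counted with multiplicity). $P_n^{(k)}$ is the $k$-th derivative (so $\mathcal{M}(P_n^{(k)})$ is considered for $n>k$). Convergence in probability of random probability measures is with respect to the topology of weak convergence of probability measures on $\mathbb{C}$. *)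

theory Defs
  imports
    "HOL-Probability.Probability"
    "HOL-Computational_Algebra.Polynomial"
begin

text \<open>
  Positive part minus negative part. The convention \<open>\<infinity> - \<infinity> = \<infinity>\<close> of \<^typ>\<open>ereal\<close> can only take
  effect if both parts diverge.
\<close>

definition ereal_integral :: "'a measure \<Rightarrow> ('a \<Rightarrow> ereal) \<Rightarrow> ereal" where
  "ereal_integral M f =
     enn2ereal (\<integral>\<^sup>+ x. e2ennreal (f x) \<partial>M) - enn2ereal (\<integral>\<^sup>+ x. e2ennreal (- f x) \<partial>M)"

definition complex_prob_measures :: "complex measure set" where
  "complex_prob_measures = {\<mu>. prob_space \<mu> \<and> sets \<mu> = sets borel}"

definition log_kernel :: "complex \<Rightarrow> complex \<Rightarrow> ereal" where
  "log_kernel z w = (if z = w then \<infinity> else ereal (ln (1 / (cmod (z - w))\<^sup>2)))"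

text \<open>
  For a lower semicontinuous \<open>Q\<close> with at least quadratic growth, the integral of \<open>Q\<close> is never \<open>-\<infinity>\<close>.
  If it is finite, then the negative part of the logarithmic energy is finite as well; if it is
  \<open>\<infinity>\<close>, then the sum is \<open>\<infinity>\<close>, also when the first term is \<open>-\<infinity>\<close>.
\<close>

definition weighted_energy :: "(complex \<Rightarrow> ereal) \<Rightarrow> complex measure \<Rightarrow> ereal" where
  "weighted_energy Q \<mu> =
     ereal_integral (\<mu> \<Otimes>\<^sub>M \<mu>) (\<lambda>(z, w). log_kernel z w) + 2 * ereal_integral \<mu> Q"

definition energy_minimizer :: "(complex \<Rightarrow> ereal) \<Rightarrow> complex measure \<Rightarrow> bool" where
  "energy_minimizer Q \<mu> \<longleftrightarrow> \<mu> \<in> complex_prob_measures \<and>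
     (\<forall>\<nu>\<in>complex_prob_measures. weighted_energy Q \<mu> \<le> weighted_energy Q \<nu>)"

definition is_equilibrium_measure :: "(complex \<Rightarrow> ereal) \<Rightarrow> complex measure \<Rightarrow> bool" where
  "is_equilibrium_measure Q \<sigma> \<longleftrightarrow> energy_minimizer Q \<sigma> \<and> (\<forall>\<mu>. energy_minimizer Q \<mu> \<longrightarrow> \<mu> = \<sigma>)"

definition measure_support :: "complex measure \<Rightarrow> complex set" where
  "measure_support \<mu> = {z. \<forall>e>0. emeasure \<mu> (ball z e) > 0}"

text \<open>
  Pointwise second derivatives of extended real valued functions: the function has to be finite
  and differentiable near \<open>t\<close>.
\<close>

definition has_second_derivative :: "(real \<Rightarrow> ereal) \<Rightarrow> real \<Rightarrow> real \<Rightarrow> bool" where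
  "has_second_derivative g D t \<longleftrightarrow> (\<exists>g'.
     (\<forall>\<^sub>F s in nhds t. \<bar>g s\<bar> \<noteq> \<infinity> \<and> ((\<lambda>u. real_of_ereal (g u)) has_real_derivative g' s) (at s)) \<and>
     (g' has_real_derivative D) (at t))"

definition has_laplacian :: "(complex \<Rightarrow> ereal) \<Rightarrow> real \<Rightarrow> complex \<Rightarrow> bool" where
  "has_laplacian f L z \<longleftrightarrow> (\<exists>a b. L = a + b \<and>
     has_second_derivative (\<lambda>x. f (Complex x (Im z))) a (Re z) \<and>
     has_second_derivative (\<lambda>y. f (Complex (Re z) y)) b (Im z))"

definition laplacian :: "(complex \<Rightarrow> ereal) \<Rightarrow> complex \<Rightarrow> real" where
  "laplacian f z = (THE L. has_laplacian f L z)"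

definition laplacian_density :: "(complex \<Rightarrow> ereal) \<Rightarrow> complex set \<Rightarrow> complex \<Rightarrow> real" where
  "laplacian_density Q S z = 1 / (4 * pi) * indicator S z * laplacian Q z"

text \<open>
  The density is taken with respect to the completed Lebesgue measure, so it may be arbitrary on
  null sets; the outer \<^const>\<open>distr\<close> restricts the resulting measure to the Borel sets.
\<close>

definition laplacian_measure :: "(complex \<Rightarrow> ereal) \<Rightarrow> complex set \<Rightarrow> complex measure" where
  "laplacian_measure Q S =
     distr (density lebesgue (\<lambda>z. ennreal (laplacian_density Q S z))) borel (\<lambda>z. z)"

text \<open>
  The first three conjuncts say that the formula for the density makes sense: the Laplacian exists
  almost everywhere on \<open>S\<close>, is measurable there and nonnegative (\<^const>\<open>ennreal\<close> would silently
  truncate negative values).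
\<close>

definition has_laplacian_form ::
    "complex measure \<Rightarrow> (complex \<Rightarrow> ereal) \<Rightarrow> complex set \<Rightarrow> bool" where
  "has_laplacian_form \<sigma> Q S \<longleftrightarrow>
     (AE z in lebesgue. z \<in> S \<longrightarrow> (\<exists>L. has_laplacian Q L z)) \<and>
     laplacian_density Q S \<in> borel_measurable lebesgue \<and>
     (AE z in lebesgue. 0 \<le> laplacian_density Q S z) \<and>
     \<sigma> = laplacian_measure Q S"

definition twice_differentiable :: "(complex \<Rightarrow> real) \<Rightarrow> bool" where
  "twice_differentiable f \<longleftrightarrow> (\<exists>G :: complex \<Rightarrow> complex.
     \<forall>z. (f has_derivative (\<lambda>v. G z \<bullet> v)) (at z) \<and> G differentiable (at z))"

definition circle_mean :: "(complex \<Rightarrow> ereal) \<Rightarrow> complex \<Rightarrow> real \<Rightarrow> ereal" where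
  "circle_mean h z r =
     ereal (1 / (2 * pi)) *
     ereal_integral (restrict_space lborel {0..2 * pi}) (\<lambda>t. h (z + of_real r * cis t))"

definition superharmonic :: "(complex \<Rightarrow> ereal) \<Rightarrow> bool" where
  "superharmonic h \<longleftrightarrow>
     (\<forall>z. h z \<noteq> -\<infinity>) \<and> (\<exists>z. h z \<noteq> \<infinity>) \<and>
     (\<forall>z. h z \<le> Liminf (at z) h) \<and>
     (\<forall>z r. 0 < r \<longrightarrow> circle_mean h z r \<le> h z)"

definition exp_neg :: "ereal \<Rightarrow> real" where
  "exp_neg x = (if x = \<infinity> then 0 else exp (- real_of_ereal x))"

definition gas_weight ::
    "real \<Rightarrow> (complex \<Rightarrow> ereal) \<Rightarrow> nat \<Rightarrow> (nat \<Rightarrow> complex) \<Rightarrow> real" where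
  "gas_weight \<beta> Q n \<zeta> =
     (\<Prod>k\<in>{1..n}. \<Prod>j\<in>{1..<k}. cmod (\<zeta> j - \<zeta> k) powr (2 * \<beta>)) *
     exp_neg (ereal (\<beta> * real n) * (\<Sum>i\<in>{1..n}. Q (\<zeta> i)))"

text \<open>\<open>\<complex>\<^sup>n\<close> is the space of functions on \<open>{1..n}\<close>, with the \<open>n\<close>-fold product of planar Lebesgue measure.\<close>

abbreviation vol :: "nat \<Rightarrow> (nat \<Rightarrow> complex) measure" where
  "vol n \<equiv> Pi\<^sub>M {1..n} (\<lambda>_. lborel)"

definition partition_function :: "real \<Rightarrow> (complex \<Rightarrow> ereal) \<Rightarrow> nat \<Rightarrow> ennreal" where
  "partition_function \<beta> Q n = (\<integral>\<^sup>+ \<zeta>. ennreal (gas_weight \<beta> Q n \<zeta>) \<partial>vol n)"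

definition gas_density ::
    "real \<Rightarrow> (complex \<Rightarrow> ereal) \<Rightarrow> nat \<Rightarrow> (nat \<Rightarrow> complex) \<Rightarrow> ennreal" where
  "gas_density \<beta> Q n \<zeta> = ennreal (gas_weight \<beta> Q n \<zeta>) / partition_function \<beta> Q n"

definition gas_poly :: "nat \<Rightarrow> (nat \<Rightarrow> complex) \<Rightarrow> complex poly" where
  "gas_poly n \<zeta> = (\<Prod>i\<in>{1..n}. [:- \<zeta> i, 1:])"

text \<open>Meaningful for nonconstant \<open>P\<close> only, as \<^const>\<open>pmf_of_multiset\<close> requires a nonempty multiset.\<close>

definition zero_measure :: "complex poly \<Rightarrow> complex measure" where
  "zero_measure P = distr (measure_pmf (pmf_of_multiset (proots P))) borel (\<lambda>z. z)"

text \<open>The case \<open>V = UNIV\<close> makes \<^const>\<open>complex_prob_measures\<close> the underlying space.\<close>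

definition weak_topology :: "complex measure topology" where
  "weak_topology = topology_generated_by
     {{\<mu> \<in> complex_prob_measures. (\<integral>z. \<phi> z \<partial>\<mu>) \<in> V} | \<phi> V.
        continuous_on UNIV (\<phi> :: complex \<Rightarrow> real) \<and> bounded (range \<phi>) \<and> open V}"

text \<open>
  The probability of each neighbourhood tends to one. It is not phrased by complements, because
  \<^const>\<open>measure\<close> is zero on nonmeasurable sets.
\<close>

definition converges_weakly_in_probability ::
    "(nat \<Rightarrow> 'w measure) \<Rightarrow> (nat \<Rightarrow> 'w \<Rightarrow> complex measure) \<Rightarrow> complex measure \<Rightarrow> bool" where
  "converges_weakly_in_probability M X \<mu> \<longleftrightarrow> \<mu> \<in> complex_prob_measures \<and>
     (\<forall>U. openin weak_topology U \<and> \<mu> \<in> U \<longrightarrow>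
        (\<lambda>n. measure (M n) {\<omega> \<in> space (M n). X n \<omega> \<in> U}) \<longlonglongrightarrow> 1)"

end

theory Submission
  imports Defs "HOL-Complex_Analysis.Complex_Analysis" "HOL-Real_Asymp.Real_Asymp"
    "HOL-Computational_Algebra.Fundamental_Theorem_Algebra"
begin

text \<open>
  The empirical measure of the gas concentrates at \<open>\<sigma>\<close> with speed \<open>n\<^sup>2\<close>: outside an event of exponentially
  small probability the discrete energy exceeds \<open>n\<^sup>2\<close> times the minimal energy by at most \<open>\<eta> n\<^sup>2\<close>, and since
  the (regularised) logarithmic kernel is positive definite on differences of probability measures,
  the Euler--Lagrange inequality for \<open>\<sigma>\<close> turns this into closeness of integrals of test functions.

  For the zeros of \<open>P = P\<^sub>n\<close> and of its derivatives the logarithmic potentials are compared. On a disc,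
  \<open>\<integral>\<bar>ln \<bar>P\<^sup>(\<^sup>k\<^sup>) / P\<bar>\<bar>\<close> is \<open>o(n)\<close> with probability tending to one. The positive part is at most
  \<open>k ln (\<Sum>i. 1 / \<bar>z - \<zeta>\<^sub>i\<bar>)\<close>. For the negative part, the product rule shows that
  \<open>P\<^sup>(\<^sup>k\<^sup>) = (z - w) R\<^sup>(\<^sup>k\<^sup>) + k R\<^sup>(\<^sup>k\<^sup>-\<^sup>1\<^sup>)\<close> when one zero \<open>w\<close> is split off; the right-hand side vanishes at a single
  value of \<open>w\<close>, while the conditional density of \<open>w\<close> given the other points is at most \<open>exp (\<delta> n)\<close>,
  because the mean of \<open>Q\<close> over a small disc barely exceeds its value at the centre (\<open>h\<close> is
  superharmonic). Hence the quotients \<open>(z - w) R\<^sup>(\<^sup>k\<^sup>-\<^sup>1\<^sup>) / P\<^sup>(\<^sup>k\<^sup>)\<close>, integrated over the disc, have expectation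
  at most of order \<open>exp (\<delta> n)\<close>, and removing \<open>k\<close> points leads from \<open>P\<^sup>(\<^sup>k\<^sup>)\<close> to a product.
\<close>

section \<open>Planar Lebesgue measure\<close>

text \<open>The logarithm is unbounded in both directions, so energies need not make sense as
  integrals. Hence \<open>ell z = ln (1 + |z|^2)\<close> is taken from the potential and given to
  the kernel: \<open>kap\<close> is the negative logarithm of the chordal distance, the remaining
  potential \<open>q\<close> is nonnegative after adding a constant, and all energies live in
  \<open>ennreal\<close>.

  The scales decide what is affordable. Energies are of order n^2, so factors exponential in n are
  negligible there. Logarithms of polynomials are of order n, so factors exp (\<delta> n) with small
  \<delta>, and polynomially many choices of points, are negligible for the zeros.

  Test functions are merely continuous. Instead of taking Laplacians of them, they are convolved
  with kernels made of logarithms: \<open>bump\<close> for the gas points, a combination of positive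
  definite kernels, and \<open>tent\<close> for the zeros, the potential of a difference of two
  uniform circle distributions, which Jensen's formula computes.\<close>

lemma lborel_complex: "(lborel :: complex measure) = distr (lborel \<Otimes>\<^sub>M lborel) borel (\<lambda>(x, y). Complex x y)"
proof (rule lborel_eqI)
 have [measurable]: "(\<lambda>(x, y). Complex x y) \<in> borel_measurable (lborel \<Otimes>\<^sub>M lborel)"
  by (simp add: lborel_prod) (auto intro!: borel_measurable_continuous_onI continuous_intros simp: split_beta)
 fix l u :: complex
 assume le: "\<And>b. b \<in> Basis \<Longrightarrow> l \<bullet> b \<le> u \<bullet> b"
 have le': "Re l \<le> Re u" "Im l \<le> Im u" using le[of 1] le[of \<i>] by (auto simp: Basis_complex_def)
 have "(\<lambda>(x, y). Complex x y) -` box l u = {Re l<..<Re u} \<times> {Im l<..<Im u}"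
  by (auto simp: box_def Basis_complex_def)
 then have "emeasure (distr (lborel \<Otimes>\<^sub>M lborel) borel (\<lambda>(x, y). Complex x y)) (box l u)
   = emeasure (lborel \<Otimes>\<^sub>M lborel) ({Re l<..<Re u} \<times> {Im l<..<Im u})"
  by (subst emeasure_distr) (auto simp: space_pair_measure)
 also have "\<dots> = ennreal ((Re u - Re l) * (Im u - Im l))"
  using le' by (subst lborel.emeasure_pair_measure_Times) (auto simp: ennreal_mult)
 also have "(Re u - Re l) * (Im u - Im l) = (\<Prod>b\<in>Basis. (u - l) \<bullet> b)"
  by (simp add: Basis_complex_def)
 finally show "emeasure (distr (lborel \<Otimes>\<^sub>M lborel) borel (\<lambda>(x, y). Complex x y)) (box l u) = (\<Prod>b\<in>Basis. (u - l) \<bullet> b)" .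
qed simp

lemma measurable_Complex [measurable]: 
 "(\<lambda>p. Complex (fst p) (snd p)) \<in> borel_measurable (borel \<Otimes>\<^sub>M borel)"
 by (simp add: borel_prod) (auto intro!: borel_measurable_continuous_onI continuous_intros)

lemma measurable_Complex2 [measurable (raw)]: 
 "f \<in> borel_measurable M \<Longrightarrow> g \<in> borel_measurable M \<Longrightarrow> (\<lambda>x. Complex (f x) (g x)) \<in> borel_measurable M"
 using measurable_compose[OF measurable_Pair measurable_Complex, of f M g] by simp

lemma nn_integral_complex:
 assumes [measurable]: "f \<in> borel_measurable borel"
 shows "(\<integral>\<^sup>+ z. f z \<partial>lborel) = (\<integral>\<^sup>+ x. \<integral>\<^sup>+ y. f (Complex x y) \<partial>lborel \<partial>lborel)"
proof -
 have "(\<integral>\<^sup>+ z. f z \<partial>lborel) = (\<integral>\<^sup>+ p. f (case p of (x, y) \<Rightarrow> Complex x y) \<partial>(lborel \<Otimes>\<^sub>M lborel))"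
  by (subst lborel_complex, subst nn_integral_distr) (auto simp: split_beta)
 also have "\<dots> = (\<integral>\<^sup>+ x. \<integral>\<^sup>+ y. f (Complex x y) \<partial>lborel \<partial>lborel)"
  by (subst lborel.nn_integral_fst[symmetric]) (auto simp: split_beta)
 finally show ?thesis .
qed

lemma nn_integral_complex':
 assumes [measurable]: "f \<in> borel_measurable borel"
 shows "(\<integral>\<^sup>+ z. f z \<partial>lborel) = (\<integral>\<^sup>+ y. \<integral>\<^sup>+ x. f (Complex x y) \<partial>lborel \<partial>lborel)"
proof -
 have "(\<lambda>(x, y). f (Complex x y)) \<in> borel_measurable (lborel \<Otimes>\<^sub>M lborel)"
  by measurable
 from lborel_pair.Fubini'[OF this] show ?thesis by (simp add: nn_integral_complex)
qed

text \<open>Rotation is a composition of affine changes of one variable at a time. The inner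
  substitution turns the first coordinate into a free variable at the cost of
  \<open>\<bar>1/c\<bar>\<close>; after exchanging the integrals the second coordinate is affine in
  \<open>y\<close> with slope \<open>1/c\<close>, which removes that factor again. Both
  substitutions divide by \<open>cos t\<close>.\<close>

lemma nn_integral_rotate_cos:
 fixes f :: "complex \<Rightarrow> ennreal"
 assumes [measurable]: "f \<in> borel_measurable borel" and c: "cos t \<noteq> 0"
 shows "(\<integral>\<^sup>+ z. f (cis t * z) \<partial>lborel) = (\<integral>\<^sup>+ z. f z \<partial>lborel)"
proof -
 define c s where "c = cos t" and "s = sin t"
 have c0: "c \<noteq> 0" using c by (simp add: c_def)
 have cs: "c * c + s * s = 1" by (simp add: c_def s_def flip: power2_eq_square)
 have "(\<integral>\<^sup>+ z. f (cis t * z) \<partial>lborel) = (\<integral>\<^sup>+ y. \<integral>\<^sup>+ x. f (Complex (c * x - s * y) (s * x + c * y)) \<partial>lborel \<partial>lborel)"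
  by (subst nn_integral_complex') (auto simp: c_def s_def cis.ctr complex_mult algebra_simps intro!: nn_integral_cong arg_cong[of _ _ f])
 also have "\<dots> = (\<integral>\<^sup>+ y. ennreal \<bar>1/c\<bar> * \<integral>\<^sup>+ x. f (Complex x (s/c * x + y / c)) \<partial>lborel \<partial>lborel)"
 proof (rule nn_integral_cong)
  fix y :: real
  have "(\<integral>\<^sup>+ x. f (Complex (c * x - s * y) (s * x + c * y)) \<partial>lborel)
   = ennreal \<bar>1/c\<bar> * \<integral>\<^sup>+ x. f (Complex (c * (s*y/c + (1/c) * x) - s * y) (s * (s*y/c + (1/c) * x) + c * y)) \<partial>lborel"
   by (subst nn_integral_real_affine[where c="1/c" and t="s*y/c"]) (use c0 in auto)
  moreover have "Complex (c * (s*y/c + (1/c) * x) - s * y) (s * (s*y/c + (1/c) * x) + c * y) = Complex x (s/c * x + y / c)" for x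
  proof -
   have "s * (s*y/c) + c*y = y * (c * c + s * s) / c" using c0 by (simp add: field_simps)
   then show ?thesis using c0 cs by (simp add: field_simps)
  qed
  ultimately show "(\<integral>\<^sup>+ x. f (Complex (c * x - s * y) (s * x + c * y)) \<partial>lborel)
   = ennreal \<bar>1/c\<bar> * \<integral>\<^sup>+ x. f (Complex x (s/c * x + y / c)) \<partial>lborel" by simp
 qed
 also have "\<dots> = (\<integral>\<^sup>+ y. \<integral>\<^sup>+ x. ennreal \<bar>1/c\<bar> * f (Complex x (s/c * x + y / c)) \<partial>lborel \<partial>lborel)"
  by (auto intro!: nn_integral_cong simp: nn_integral_cmult)
 also have "\<dots> = (\<integral>\<^sup>+ x. \<integral>\<^sup>+ y. ennreal \<bar>1/c\<bar> * f (Complex x (s/c * x + y / c)) \<partial>lborel \<partial>lborel)"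
  by (rule lborel_pair.Fubini') measurable
 also have "\<dots> = (\<integral>\<^sup>+ x. \<integral>\<^sup>+ y. f (Complex x y) \<partial>lborel \<partial>lborel)"
 proof (rule nn_integral_cong)
  fix x :: real
  have "(\<integral>\<^sup>+ y. f (Complex x y) \<partial>lborel) = ennreal \<bar>1/c\<bar> * (\<integral>\<^sup>+ y. f (Complex x (s/c * x + 1 / c * y)) \<partial>lborel)"
   by (subst nn_integral_real_affine[where c="1/c" and t="s/c * x"]) (use c0 in auto)
  then show "(\<integral>\<^sup>+ y. ennreal \<bar>1/c\<bar> * f (Complex x (s/c * x + y / c)) \<partial>lborel) = (\<integral>\<^sup>+ y. f (Complex x y) \<partial>lborel)"
   by (simp add: nn_integral_cmult)
 qed
 also have "\<dots> = (\<integral>\<^sup>+ z. f z \<partial>lborel)" by (simp add: nn_integral_complex)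
 finally show ?thesis .
qed

text \<open>When \<open>cos t = 0\<close>, the angle is split into \<open>pi/4\<close> and
  \<open>t - pi/4\<close>, whose cosines do not vanish.\<close>

lemma nn_integral_rotate:
 fixes f :: "complex \<Rightarrow> ennreal"
 assumes [measurable]: "f \<in> borel_measurable borel"
 shows "(\<integral>\<^sup>+ z. f (cis t * z) \<partial>lborel) = (\<integral>\<^sup>+ z. f z \<partial>lborel)"
proof (cases "cos t = 0")
 case False then show ?thesis by (rule nn_integral_rotate_cos[rotated]) simp
next
 case True
 have c1: "cos (pi/4) \<noteq> (0::real)" by (simp add: cos_45)
 have "sin t \<noteq> 0" using True sin_cos_squared_add[of t] by auto
 then have c2: "cos (t - pi/4) \<noteq> 0" using True by (simp add: cos_diff sin_45)
 have "(\<integral>\<^sup>+ z. f (cis t * z) \<partial>lborel) = (\<integral>\<^sup>+ z. f (cis (pi/4) * (cis (t - pi/4) * z)) \<partial>lborel)"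
  by (simp add: mult.assoc[symmetric] cis_mult)
 also have "\<dots> = (\<integral>\<^sup>+ z. f (cis (pi/4) * z) \<partial>lborel)"
  by (rule nn_integral_rotate_cos[OF _ c2, of "\<lambda>z. f (cis (pi/4) * z)"]) measurable
 also have "\<dots> = (\<integral>\<^sup>+ z. f z \<partial>lborel)"
  by (rule nn_integral_rotate_cos[OF _ c1]) measurable
 finally show ?thesis .
qed

lemma nn_integral_translate:
 fixes f :: "'a::euclidean_space \<Rightarrow> ennreal"
 assumes [measurable]: "f \<in> borel_measurable borel"
 shows "(\<integral>\<^sup>+ z. f (a + z) \<partial>lborel) = (\<integral>\<^sup>+ z. f z \<partial>lborel)"
 by (subst (2) lborel_distr_plus[of a, symmetric], subst nn_integral_distr) auto

lemma nn_integral_reflect: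
 fixes f :: "complex \<Rightarrow> ennreal"
 assumes [measurable]: "f \<in> borel_measurable borel"
 shows "(\<integral>\<^sup>+ z. f (a - z) \<partial>lborel) = (\<integral>\<^sup>+ z. f z \<partial>lborel)"
proof -
 have "(\<integral>\<^sup>+ z. f (a - z) \<partial>lborel) = (\<integral>\<^sup>+ z. f (a + cis pi * z) \<partial>lborel)" by simp
 also have "\<dots> = (\<integral>\<^sup>+ z. f (a + z) \<partial>lborel)"
  by (rule nn_integral_rotate[of "\<lambda>z. f (a + z)"]) measurable
 finally show ?thesis by (simp add: nn_integral_translate)
qed

lemma emeasure_ball_complex: "0 \<le> r \<Longrightarrow> emeasure lborel (ball (c::complex) r) = ennreal (pi * r\<^sup>2)"
 by (simp add: emeasure_ball unit_ball_vol_2)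

lemma emeasure_cball_complex: "0 \<le> r \<Longrightarrow> emeasure lborel (cball (c::complex) r) = ennreal (pi * r\<^sup>2)"
 by (simp add: emeasure_cball unit_ball_vol_2)


text \<open>Polar coordinates in the variable |z|^2: discs have area \<open>pi * r\<^sup>2\<close>,
  so the image of area under |z|^2 agrees with \<open>pi\<close> times length on all half-lines, and
  these determine the measure.\<close>

lemma nn_integral_radial:
 fixes f :: "real \<Rightarrow> ennreal"
 assumes [measurable]: "f \<in> borel_measurable borel"
 shows "(\<integral>\<^sup>+ z. f ((cmod z)\<^sup>2) \<partial>lborel) = ennreal pi * (\<integral>\<^sup>+ s\<in>{0..}. f s \<partial>lborel)"
proof -
 define M where "M = distr (lborel :: complex measure) borel (\<lambda>z. (cmod z)\<^sup>2)"
 define N where "N = density (lborel :: real measure) (\<lambda>s. ennreal pi * indicator {0..} s)"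
 have m: "emeasure M {..a} = (if a \<ge> 0 then ennreal (pi * a) else 0)" for a
 proof -
  have "(\<lambda>z. (cmod z)\<^sup>2) -` {..a} = (if a \<ge> 0 then cball 0 (sqrt a) else {})"
   by (auto simp: real_le_rsqrt real_sqrt_le_iff dest: real_le_rsqrt sqrt_ge_absD)
     (metis norm_ge_zero power_mono real_sqrt_pow2, smt (verit) zero_le_power2)
  then show ?thesis unfolding M_def by (subst emeasure_distr) (auto simp: emeasure_cball_complex)
 qed
 have n: "emeasure N {..a} = (if a \<ge> 0 then ennreal (pi * a) else 0)" for a
 proof -
  have "emeasure N {..a} = ennreal pi * emeasure lborel ({0..} \<inter> {..a})"
   unfolding N_def by (subst emeasure_density) (auto simp: nn_integral_cmult mult.assoc simp flip: indicator_inter_arith)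
  also have "{0..} \<inter> {..a} = {0..a}" by auto
  finally show ?thesis by (auto simp: ennreal_mult)
 qed
 have "M = N"
 proof (rule measure_eqI_generator_eq[where E="range atMost" and \<Omega>=UNIV and A="\<lambda>i. {..real i}"])
  show "Int_stable (range (atMost :: real \<Rightarrow> real set))" by (auto simp: Int_stable_def min_def intro: rev_image_eqI)
  show "sets M = sigma_sets UNIV (range atMost)" "sets N = sigma_sets UNIV (range atMost)"
   by (auto simp: M_def N_def borel_eq_atMost)
  show "(\<Union>i. {..real i}) = UNIV" by (auto intro: real_arch_simple)
 qed (auto simp: m n)
 have "(\<integral>\<^sup>+ z. f ((cmod z)\<^sup>2) \<partial>lborel) = (\<integral>\<^sup>+ s. f s \<partial>M)"
  unfolding M_def by (subst nn_integral_distr) auto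
 also have "\<dots> = ennreal pi * (\<integral>\<^sup>+ s\<in>{0..}. f s \<partial>lborel)"
  unfolding \<open>M = N\<close> N_def by (subst nn_integral_density) (auto simp: nn_integral_cmult[symmetric] ac_simps)
 finally show ?thesis .
qed

section \<open>Circle and disc means of the logarithm\<close>

lemma ball_measurable [measurable]: "ball a r \<in> sets (borel :: 'a::metric_space measure)"
 and cball_measurable [measurable]: "cball a r \<in> sets (borel :: 'a::metric_space measure)"
 by auto

lemma cis_measurable [measurable]: "cis \<in> borel_measurable borel"
 by (intro borel_measurable_continuous_onI continuous_intros)

lemma nn_integral_inverse_sqrt: "(\<integral>\<^sup>+ s. ennreal (1 / sqrt s) * indicator {0..1} s \<partial>lborel) = 2"
proof -
 have "((\<lambda>x. x powr (-1/2)) has_integral (1 powr (-1/2+1) / (-1/2+1))) {0..1::real}"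
  by (rule has_integral_powr_from_0) auto
 then have "((\<lambda>x. if x \<in> {0..1} then x powr (-1/2) else 0) has_integral 2) (UNIV :: real set)"
  by (subst has_integral_restrict_UNIV) simp
 then have "(\<integral>\<^sup>+ x. ennreal (if x \<in> {0..1} then x powr (-1/2) else 0) \<partial>lborel) = ennreal 2"
  by (intro nn_integral_has_integral_lborel) auto
 also have "(\<integral>\<^sup>+ x. ennreal (if x \<in> {0..1} then x powr (-1/2) else 0) \<partial>lborel) = (\<integral>\<^sup>+ s. ennreal (1 / sqrt s) * indicator {0..1} s \<partial>lborel)"
  by (intro nn_integral_cong) (auto simp: indicator_def powr_minus powr_half_sqrt divide_simps)
 finally show ?thesis by simp
qed

lemma nn_integral_inverse_cmod_ball:
 "(\<integral>\<^sup>+ z. ennreal (1 / cmod z) * indicator (cball 0 1) z \<partial>lborel) = ennreal (2 * pi)"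
proof -
 have "(\<integral>\<^sup>+ z. ennreal (1 / cmod z) * indicator (cball 0 1) z \<partial>lborel)
  = (\<integral>\<^sup>+ z. (\<lambda>s. ennreal (1 / sqrt s) * indicator {0..1} s) ((cmod z)\<^sup>2) \<partial>lborel)"
  by (intro nn_integral_cong) (auto simp: indicator_def power_le_one_iff)
 also have "\<dots> = ennreal pi * (\<integral>\<^sup>+ s\<in>{0..}. ennreal (1 / sqrt s) * indicator {0..1} s \<partial>lborel)"
  by (rule nn_integral_radial) measurable
 also have "(\<integral>\<^sup>+ s\<in>{0..}. ennreal (1 / sqrt s) * indicator {0..1} s \<partial>lborel)
  = (\<integral>\<^sup>+ s. ennreal (1 / sqrt s) * indicator {0..1} s \<partial>lborel)"
  by (intro nn_integral_cong) (auto simp: indicator_def)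
 also have "\<dots> = ennreal 2" using nn_integral_inverse_sqrt by simp
 finally show ?thesis by (simp add: ennreal_mult' mult.commute)
qed

text \<open>Within distance 1 of the pole the integral is at most \<open>2 * pi\<close>, elsewhere
  the integrand is at most 1. The bound does not depend on the pole \<open>c\<close>, and the later
  estimates of logarithms inherit from it their uniformity in the configuration.\<close>

lemma nn_integral_inverse_cmod_le:
 fixes c :: complex
 assumes [measurable]: "A \<in> sets borel"
 shows "(\<integral>\<^sup>+ z\<in>A. ennreal (1 / cmod (z - c)) \<partial>lborel) \<le> ennreal (2 * pi) + emeasure lborel A"
proof -
 have "(\<integral>\<^sup>+ z\<in>A. ennreal (1 / cmod (z - c)) \<partial>lborel)
  \<le> (\<integral>\<^sup>+ z. ennreal (1 / cmod (- c + z)) * indicator (cball 0 1) (- c + z) + indicator A z \<partial>lborel)"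
  by (intro nn_integral_mono) (auto simp: indicator_def divide_simps)
 also have "\<dots> = (\<integral>\<^sup>+ z. ennreal (1 / cmod (- c + z)) * indicator (cball 0 1) (- c + z) \<partial>lborel) + emeasure lborel A"
  by (subst nn_integral_add) auto
 also have "(\<integral>\<^sup>+ z. ennreal (1 / cmod (- c + z)) * indicator (cball 0 1) (- c + z) \<partial>lborel)
  = (\<integral>\<^sup>+ z. ennreal (1 / cmod z) * indicator (cball 0 1) z \<partial>lborel)"
  by (rule nn_integral_translate[of "\<lambda>z. ennreal (1 / cmod z) * indicator (cball 0 1) z"]) measurable
 finally show ?thesis by (simp add: nn_integral_inverse_cmod_ball)
qed

lemma nn_integral_exp_neg_square:
 assumes "0 < a"
 shows "(\<integral>\<^sup>+ z. ennreal (exp (- a * (cmod z)\<^sup>2)) \<partial>lborel) = ennreal (pi / a)"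
proof -
 have "(\<integral>\<^sup>+ z. ennreal (exp (- a * (cmod z)\<^sup>2)) \<partial>lborel)
   = ennreal pi * (\<integral>\<^sup>+ s\<in>{0..}. ennreal (exp (- a * s)) \<partial>lborel)"
  by (rule nn_integral_radial) measurable
 also have "(\<integral>\<^sup>+ s\<in>{0..}. ennreal (exp (- a * s)) \<partial>lborel) = ennreal (0 - (- exp (- a * 0) / a))"
 proof (rule nn_integral_FTC_atLeast)
  show "((\<lambda>x. - exp (- a * x) / a) has_real_derivative exp (- a * x)) (at x)" for x
   using assms by (auto intro!: derivative_eq_intros)
  show "((\<lambda>x. - exp (- a * x) / a) \<longlongrightarrow> 0) at_top" using assms by real_asymp
 qed auto
 finally show ?thesis using assms by (simp add: ennreal_mult'[symmetric])
qed

text \<open>Lets the argument of a point be absorbed when its orbit under rotations is parametrised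
  from angle 0.\<close>

lemma nn_integral_periodic_shift:
 fixes f :: "real \<Rightarrow> ennreal"
 assumes [measurable]: "f \<in> borel_measurable borel" and per: "\<And>t. f (2 * pi + t) = f t"
  and s: "0 \<le> s" "s < 2 * pi"
 shows "(\<integral>\<^sup>+ t\<in>{0..2*pi}. f (s + t) \<partial>lborel) = (\<integral>\<^sup>+ t\<in>{0..2*pi}. f t \<partial>lborel)"
proof -
 have nul: "(\<integral>\<^sup>+ t\<in>{a..b}. g t \<partial>lborel) = (\<integral>\<^sup>+ t\<in>{a..<b}. g t \<partial>lborel)" for a b :: real and g
  by (intro nn_integral_cong_AE AE_I[where N="{b}"]) (auto simp: indicator_def)
 have "(\<integral>\<^sup>+ t\<in>{0..<2*pi}. f (s + t) \<partial>lborel) = (\<integral>\<^sup>+ t. f t * indicator {s..<s+2*pi} t \<partial>lborel)"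
  by (subst nn_integral_translate[symmetric, where a=s]) (auto simp: indicator_def intro!: nn_integral_cong)
 also have "\<dots> = (\<integral>\<^sup>+ t. f t * indicator {s..<2*pi} t + f t * indicator {2*pi..<2*pi+s} t \<partial>lborel)"
  using s by (intro nn_integral_cong) (auto simp: indicator_def)
 also have "\<dots> = (\<integral>\<^sup>+ t. f t * indicator {s..<2*pi} t \<partial>lborel) + (\<integral>\<^sup>+ t. f t * indicator {2*pi..<2*pi+s} t \<partial>lborel)"
  by (rule nn_integral_add) auto
 also have "(\<integral>\<^sup>+ t. f t * indicator {2*pi..<2*pi+s} t \<partial>lborel) = (\<integral>\<^sup>+ t. f t * indicator {0..<s} t \<partial>lborel)"
  by (subst nn_integral_translate[symmetric, where a="2*pi"]) (auto simp: indicator_def per intro!: nn_integral_cong)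
 also have "(\<integral>\<^sup>+ t. f t * indicator {s..<2*pi} t \<partial>lborel) + (\<integral>\<^sup>+ t. f t * indicator {0..<s} t \<partial>lborel)
  = (\<integral>\<^sup>+ t. f t * indicator {s..<2*pi} t + f t * indicator {0..<s} t \<partial>lborel)"
  by (rule nn_integral_add[symmetric]) auto
 also have "\<dots> = (\<integral>\<^sup>+ t. f t * indicator {0..<2*pi} t \<partial>lborel)"
  using s by (intro nn_integral_cong) (auto simp: indicator_def)
 finally show ?thesis by (simp add: nul)
qed

text \<open>Averaging over rotations replaces a polar change of variables: the integral over the
  disc is the same after rotation by any angle, and for fixed \<open>v\<close> the rotated points
  run through the circle of radius |v|.\<close>

lemma nn_integral_rotation_average:
 fixes H :: "complex \<Rightarrow> ennreal"
 assumes [measurable]: "H \<in> borel_measurable borel"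
 shows "ennreal (2 * pi) * (\<integral>\<^sup>+ v\<in>ball 0 r. H v \<partial>lborel)
  = (\<integral>\<^sup>+ v\<in>ball 0 r. (\<integral>\<^sup>+ t\<in>{0..2*pi}. H (of_real (cmod v) * cis t) \<partial>lborel) \<partial>lborel)"
proof -
 have [measurable]: "(\<lambda>(v, t). H (cis t * v)) \<in> borel_measurable (borel \<Otimes>\<^sub>M borel)"
  by measurable
 have "(\<integral>\<^sup>+ v\<in>ball 0 r. (\<integral>\<^sup>+ t\<in>{0..2*pi}. H (of_real (cmod v) * cis t) \<partial>lborel) \<partial>lborel)
  = (\<integral>\<^sup>+ v\<in>ball 0 r. (\<integral>\<^sup>+ t\<in>{0..2*pi}. H (cis t * v) \<partial>lborel) \<partial>lborel)"
 proof (rule nn_integral_cong)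
  fix v :: complex
  let ?f = "\<lambda>t. H (of_real (cmod v) * cis t)"
  have v: "v = of_real (cmod v) * cis (Arg2pi v)"
   using Arg2pi_eq[of v] by (simp add: cis_conv_exp)
  have "(\<integral>\<^sup>+ t\<in>{0..2*pi}. ?f (Arg2pi v + t) \<partial>lborel) = (\<integral>\<^sup>+ t\<in>{0..2*pi}. ?f t \<partial>lborel)"
  proof (rule nn_integral_periodic_shift)
   show "?f (2 * pi + t) = ?f t" for t by (simp add: cis_mult[symmetric])
  qed (auto simp: Arg2pi_ge_0 Arg2pi_lt_2pi)
  moreover have "of_real (cmod v) * cis (Arg2pi v + t) = cis t * v" for t
  proof -
   have "of_real (cmod v) * cis (Arg2pi v + t) = cis t * (of_real (cmod v) * cis (Arg2pi v))"
    by (simp add: cis_mult[symmetric] mult_ac)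
   also have "\<dots> = cis t * v" using v by simp
   finally show ?thesis .
  qed
  ultimately have "(\<integral>\<^sup>+ t\<in>{0..2*pi}. ?f t \<partial>lborel) = (\<integral>\<^sup>+ t\<in>{0..2*pi}. H (cis t * v) \<partial>lborel)" by simp
  then show "(\<integral>\<^sup>+ t\<in>{0..2*pi}. ?f t \<partial>lborel) * indicator (ball 0 r) v = (\<integral>\<^sup>+ t\<in>{0..2*pi}. H (cis t * v) \<partial>lborel) * indicator (ball 0 r) v"
   by (rule arg_cong)
 qed
 also have "\<dots> = (\<integral>\<^sup>+ v. \<integral>\<^sup>+ t. H (cis t * v) * indicator (ball 0 r) (cis t * v) * indicator {0..2*pi} t \<partial>lborel \<partial>lborel)"
  by (intro nn_integral_cong) (auto simp: indicator_def norm_mult)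
 also have "\<dots> = (\<integral>\<^sup>+ t. \<integral>\<^sup>+ v. H (cis t * v) * indicator (ball 0 r) (cis t * v) * indicator {0..2*pi} t \<partial>lborel \<partial>lborel)"
  by (rule lborel_pair.Fubini') measurable
 also have "\<dots> = (\<integral>\<^sup>+ t. indicator {0..2*pi} t * (\<integral>\<^sup>+ v\<in>ball 0 r. H v \<partial>lborel) \<partial>lborel)"
 proof (rule nn_integral_cong)
  fix t :: real
  have "(\<integral>\<^sup>+ v. H (cis t * v) * indicator (ball 0 r) (cis t * v) * indicator {0..2*pi} t \<partial>lborel)
   = (\<integral>\<^sup>+ v. H v * indicator (ball 0 r) v * indicator {0..2*pi} t \<partial>lborel)"
   by (rule nn_integral_rotate[of "\<lambda>v. H v * indicator (ball 0 r) v * indicator {0..2*pi} t"]) measurable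
  then show "(\<integral>\<^sup>+ v. H (cis t * v) * indicator (ball 0 r) (cis t * v) * indicator {0..2*pi} t \<partial>lborel)
   = indicator {0..2*pi} t * (\<integral>\<^sup>+ v\<in>ball 0 r. H v \<partial>lborel)"
   by (simp add: nn_integral_multc mult.commute)
 qed
 also have "\<dots> = ennreal (2 * pi) * (\<integral>\<^sup>+ v\<in>ball 0 r. H v \<partial>lborel)"
  by (subst nn_integral_multc) auto
 finally show ?thesis by simp
qed

text \<open>On the closed unit disc 1 + b u has positive real part, so Ln (1 + b u) is holomorphic
  there. By Cauchy's formula its mean over the circle is its value at 0, namely Ln 1 = 0; the real
  part is the claim.\<close>

lemma circle_mean_ln_one_plus:
 assumes b: "cmod b < 1"
 shows "((\<lambda>t. ln (cmod (1 + b * cis t))) has_integral 0) {0..2*pi}"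
proof -
 have re: "0 < Re (1 + b * u)" if "u \<in> cball 0 1" for u
 proof -
  have "cmod (b * u) < 1" using that b by (simp add: norm_mult) (use mult_left_le[of "cmod u" "cmod b"] in auto)
  then show ?thesis using complex_Re_le_cmod[of "- (b * u)"] abs_Re_le_cmod[of "b * u"] by simp
 qed
 have nz: "1 + b * u \<notin> \<real>\<^sub>\<le>\<^sub>0" if "u \<in> cball 0 1" for u
  using re[OF that] by (auto simp: complex_nonpos_Reals_iff)
 have "(\<lambda>u. Ln (1 + b * u)) holomorphic_on cball 0 1"
  by (intro holomorphic_intros) (use nz in auto)
 then have "((\<lambda>u. Ln (1 + b * u) / (u - 0)) has_contour_integral (2 * of_real pi * \<i> * Ln (1 + b * 0))) (circlepath 0 1)"
  by (rule Cauchy_integral_circlepath_simple) auto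
 then have "((\<lambda>t. Ln (1 + b * cis t) / cis t * \<i> * cis t) has_integral 0) {0..2*pi}"
  unfolding circlepath_def by (subst (asm) has_contour_integral_part_circlepath_iff) auto
 then have "((\<lambda>t. \<i> * Ln (1 + b * cis t)) has_integral 0) {0..2*pi}"
  by (rule has_integral_eq[rotated]) auto
 then have "((\<lambda>t. Im (\<i> * Ln (1 + b * cis t))) has_integral Im 0) {0..2*pi}"
  by (rule has_integral_linear[OF _ bounded_linear_Im, unfolded o_def])
 then have "((\<lambda>t. Im (\<i> * Ln (1 + b * cis t))) has_integral 0) {0..2*pi}" by simp
 moreover have "Im (\<i> * Ln (1 + b * cis t)) = ln (cmod (1 + b * cis t))" for t
 proof -
  have "cis t \<in> cball 0 1" by simp
  have "1 + b * cis t \<noteq> 0"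
  proof
   assume "1 + b * cis t = 0"
   with re[OF \<open>cis t \<in> cball 0 1\<close>] show False by (simp only: zero_complex.sel less_irrefl)
  qed
  then show ?thesis by simp
 qed
 ultimately show ?thesis by simp
qed

text \<open>Jensen's formula for one linear factor. The larger of |v| and \<open>e\<close> is pulled
  out, and what remains is a perturbation of 1 as in \<open>circle_mean_ln_one_plus\<close>.\<close>

lemma circle_mean_ln:
 assumes "0 < e" "cmod v \<noteq> e"
 shows "((\<lambda>t. ln (cmod (v + of_real e * cis t))) has_integral 2 * pi * ln (max (cmod v) e)) {0..2*pi}"
proof (cases "cmod v < e")
 case True
 \<comment> \<open>Dividing \<open>v\<close> by \<open>cis t\<close> produces the opposite angle;
   taking conjugates, which keeps the modulus, restores the form 1 + b cis t.\<close>
 define b where "b = cnj v / of_real e"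
 have b: "cmod b < 1" using True assms by (simp add: b_def norm_divide)
 have "v + of_real e * cis t = of_real e * cis t * cnj (1 + b * cis t)" for t
  using assms by (simp add: b_def field_simps cis_cnj) (simp add: cis_mult[symmetric] flip: cis_inverse)
 then have "cmod (v + of_real e * cis t) = e * cmod (1 + b * cis t)" for t
  using assms complex_mod_cnj[of "1 + b * cis t"] by (simp add: norm_mult del: complex_cnj_add complex_cnj_mult complex_mod_cnj)
 moreover have "cmod (1 + b * cis t) > 0" for t
  using b norm_diff_ineq[of 1 "b * cis t"] by (simp only: norm_mult norm_cis norm_one mult_1_right; linarith)
 ultimately have eq: "ln (cmod (v + of_real e * cis t)) = ln e + ln (cmod (1 + b * cis t))" for t
  using assms by (simp add: ln_mult)
 have "((\<lambda>t. ln e + ln (cmod (1 + b * cis t))) has_integral (2 * pi - 0) *\<^sub>R ln e + 0) {0..2*pi}"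
  using has_integral_const_real[of "ln e" 0 "2*pi"] by (intro has_integral_add circle_mean_ln_one_plus b) simp
 then show ?thesis using True by (simp add: eq)
next
 case False
 define b where "b = of_real e / v"
 have v0: "v \<noteq> 0" and ve: "cmod v > e" using False assms by auto
 have b: "cmod b < 1" using ve assms by (simp add: b_def norm_divide divide_less_eq)
 have "v + of_real e * cis t = v * (1 + b * cis t)" for t
  using v0 by (simp add: b_def field_simps)
 then have "cmod (v + of_real e * cis t) = cmod v * cmod (1 + b * cis t)" for t
  by (simp add: norm_mult)
 moreover have "cmod (1 + b * cis t) > 0" for t
  using b norm_diff_ineq[of 1 "b * cis t"] by (simp only: norm_mult norm_cis norm_one mult_1_right; linarith)
 ultimately have eq: "ln (cmod (v + of_real e * cis t)) = ln (cmod v) + ln (cmod (1 + b * cis t))" for t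
  using v0 by (simp add: ln_mult)
 have "((\<lambda>t. ln (cmod v) + ln (cmod (1 + b * cis t))) has_integral (2 * pi - 0) *\<^sub>R ln (cmod v) + 0) {0..2*pi}"
  using has_integral_const_real[of "ln (cmod v)" 0 "2*pi"] by (intro has_integral_add circle_mean_ln_one_plus b) simp
 then show ?thesis using ve by (simp add: eq)
qed

lemma AE_cmod_neq: "AE v in lborel. cmod (v - c) \<noteq> a"
proof (rule AE_I[where N="sphere c a"])
 have "sphere c a \<in> null_sets lborel"
  using negligible_sphere[of c a] by (auto simp: negligible_iff_null_sets null_sets_completion_iff)
 then show "emeasure lborel (sphere c a) = 0" by auto
qed (auto simp: dist_norm norm_minus_commute)

text \<open>Superharmonicity of -ln |v - w| in \<open>v\<close>, integrated over radii: each circle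
  mean is -ln of the larger of |v| and |w|. The constant \<open>M\<close> bounds the logarithm on
  the disc and makes the integrand nonnegative, so that \<open>ennreal\<close> truncates nothing off
  the pole.\<close>

lemma disc_mean_ln_le:
 assumes r: "0 < r" and w: "w \<noteq> 0" and M: "\<And>v. v \<in> ball 0 r \<Longrightarrow> v \<noteq> w \<Longrightarrow> ln (cmod (v - w)) \<le> M"
 shows "(\<integral>\<^sup>+ v\<in>ball 0 r. ennreal (M - ln (cmod (v - w))) \<partial>lborel) \<le> ennreal (pi * r\<^sup>2) * ennreal (M - ln (cmod w))"
proof -
 let ?H = "\<lambda>v. ennreal (M - ln (cmod (v - w)))"
 have "ennreal (2 * pi) * (\<integral>\<^sup>+ v\<in>ball 0 r. ?H v \<partial>lborel)
  = (\<integral>\<^sup>+ v\<in>ball 0 r. (\<integral>\<^sup>+ t\<in>{0..2*pi}. ?H (of_real (cmod v) * cis t) \<partial>lborel) \<partial>lborel)"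
  by (rule nn_integral_rotation_average) measurable
 also have "\<dots> \<le> (\<integral>\<^sup>+ v\<in>ball (0::complex) r. ennreal (2 * pi) * ennreal (M - ln (cmod w)) \<partial>lborel)"
 proof (rule nn_integral_mono_AE)
  \<comment> \<open>Excluded are the circle through \<open>w\<close>, where
    \<open>circle_mean_ln\<close> does not apply, and the centre, a circle of radius 0.\<close>
  have "AE v in lborel. cmod (v - 0) \<noteq> cmod w" "AE v in lborel. cmod (v - 0) \<noteq> 0"
   by (rule AE_cmod_neq)+
  then show "AE v in lborel. (\<integral>\<^sup>+ t\<in>{0..2*pi}. ?H (of_real (cmod v) * cis t) \<partial>lborel) * indicator (ball 0 r) v
    \<le> ennreal (2 * pi) * ennreal (M - ln (cmod w)) * indicator (ball 0 r) v"
  proof eventually_elim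
   case (elim v)
   show ?case
   proof (cases "v \<in> ball 0 r")
    case True
    let ?f = "\<lambda>t. M - ln (cmod (- w + of_real (cmod v) * cis t))"
    have f0: "0 \<le> ?f t" for t
    proof -
     have "cmod (of_real (cmod v) * cis t) \<noteq> cmod w" using elim by (simp add: norm_mult)
     then have "of_real (cmod v) * cis t \<noteq> w" by metis
     moreover have "of_real (cmod v) * cis t \<in> ball 0 r" using True by (simp add: norm_mult)
     ultimately show ?thesis using M[of "of_real (cmod v) * cis t"] by simp
    qed
    have "((\<lambda>t. M - ln (cmod (- w + of_real (cmod v) * cis t))) has_integral 
      (2 * pi - 0) *\<^sub>R M - 2 * pi * ln (max (cmod (- w)) (cmod v))) {0..2*pi}"
     using elim has_integral_const_real[of M 0 "2*pi"] by (intro has_integral_diff circle_mean_ln) auto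
    then have "((\<lambda>t. if t \<in> {0..2*pi} then ?f t else 0) has_integral 
      (2 * pi * M - 2 * pi * ln (max (cmod w) (cmod v)))) UNIV"
     by (subst has_integral_restrict_UNIV) simp
    then have "(\<integral>\<^sup>+ t. ennreal (if t \<in> {0..2*pi} then ?f t else 0) \<partial>lborel) = ennreal (2 * pi * M - 2 * pi * ln (max (cmod w) (cmod v)))"
     using f0 by (intro nn_integral_has_integral_lborel) auto
    also have "(\<integral>\<^sup>+ t. ennreal (if t \<in> {0..2*pi} then ?f t else 0) \<partial>lborel)
      = (\<integral>\<^sup>+ t\<in>{0..2*pi}. ?H (of_real (cmod v) * cis t) \<partial>lborel)"
     by (intro nn_integral_cong) (auto simp: indicator_def)
    also have "ennreal (2 * pi * M - 2 * pi * ln (max (cmod w) (cmod v))) \<le> ennreal (2 * pi * (M - ln (cmod w)))"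
     using w by (intro ennreal_leI) (auto simp: algebra_simps intro!: ln_mono)
    finally show ?thesis using True by (simp add: ennreal_mult')
   qed auto
  qed
 qed
 also have "\<dots> = ennreal (2 * pi) * (ennreal (M - ln (cmod w)) * ennreal (pi * r\<^sup>2))"
  using r by (subst nn_integral_cmult) (auto simp: emeasure_ball_complex mult.assoc)
 finally have "ennreal (2 * pi) * (\<integral>\<^sup>+ v\<in>ball 0 r. ?H v \<partial>lborel) \<le> ennreal (2 * pi) * (ennreal (M - ln (cmod w)) * ennreal (pi * r\<^sup>2))" .
 then show ?thesis by (subst (asm) ennreal_mult_le_mult_iff) (auto simp: mult.commute)
qed

section \<open>The nonnegative logarithmic kernel\<close>

definition ell :: "complex \<Rightarrow> real" where
 "ell z = ln (1 + (cmod z)\<^sup>2)"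

text \<open>The negative logarithm of the chordal distance |z - w| / sqrt ((1 + |z|^2) (1 + |w|^2))
  on the Riemann sphere. It is nonnegative, whereas -ln |z - w| is unbounded below at
  infinity.\<close>

definition kap :: "complex \<Rightarrow> complex \<Rightarrow> ennreal" where
 "kap z w = (if z = w then \<infinity> else ennreal ((ell z + ell w) / 2 - ln (cmod (z - w))))"

lemma ell_nonneg [simp]: "0 \<le> ell z" by (simp add: ell_def)

lemma continuous_on_ell [continuous_intros]: 
 "continuous_on S f \<Longrightarrow> continuous_on S (\<lambda>x. ell (f x))"
 unfolding ell_def by (intro continuous_intros) (auto simp: add_nonneg_eq_0_iff)

lemma ell_measurable [measurable]: "ell \<in> borel_measurable borel"
 by (intro borel_measurable_continuous_onI continuous_intros)

lemma ell_le: "ell z \<le> (cmod z)\<^sup>2"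
 unfolding ell_def by (rule ln_add_one_self_le_self) simp

lemma kap_sym: "kap z w = kap w z"
 by (auto simp: kap_def norm_minus_commute add.commute)

lemma kap_measurable [measurable]: "(\<lambda>(z, w). kap z w) \<in> borel_measurable (borel \<Otimes>\<^sub>M borel)"
 unfolding kap_def split_beta' by measurable

lemma cmod_diff_square_le: "(cmod (z - w))\<^sup>2 \<le> (1 + (cmod z)\<^sup>2) * (1 + (cmod w)\<^sup>2)"
proof -
 have "(cmod (z - w))\<^sup>2 \<le> (cmod z + cmod w)\<^sup>2" by (intro power_mono norm_triangle_ineq4) auto
 \<comment> \<open>The right-hand side exceeds the square of |z| + |w| by (1 - |z| |w|)^2.\<close>
 also have "\<dots> \<le> (1 + (cmod z)\<^sup>2) * (1 + (cmod w)\<^sup>2)"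
  using sum_squares_ge_zero[of "1 - cmod z * cmod w" 0] by (simp add: power2_eq_square algebra_simps)
 finally show ?thesis .
qed

lemma ln_cmod_diff_le: "z \<noteq> w \<Longrightarrow> ln (cmod (z - w)) \<le> (ell z + ell w) / 2"
proof -
 assume "z \<noteq> w"
 then have "ln ((cmod (z - w))\<^sup>2) \<le> ln ((1 + (cmod z)\<^sup>2) * (1 + (cmod w)\<^sup>2))"
  by (subst ln_le_cancel_iff) (auto intro!: cmod_diff_square_le mult_pos_pos intro: add_pos_nonneg)
 moreover have "ln ((1 + (cmod z)\<^sup>2) * (1 + (cmod w)\<^sup>2)) = ell z + ell w"
  unfolding ell_def by (intro ln_mult_pos) (auto intro: add_pos_nonneg)
 moreover have "ln ((cmod (z - w))\<^sup>2) = 2 * ln (cmod (z - w))" using \<open>z \<noteq> w\<close> by (simp add: ln_realpow)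
 ultimately show ?thesis by simp
qed

text \<open>The bound \<open>r \<le> 1\<close> keeps all the discs inside one larger compact
  disc.\<close>

lemma uniform_close_on_balls:
 fixes f :: "complex \<Rightarrow> real"
 assumes "continuous_on UNIV f" "0 < e"
 shows "\<exists>r>0. r \<le> 1 \<and> (\<forall>z\<in>cball 0 R. \<forall>u\<in>ball z r. \<bar>f u - f z\<bar> \<le> e)"
proof -
 have "uniformly_continuous_on (cball 0 (R + 1)) f"
  using assms by (intro compact_uniformly_continuous) (auto intro: continuous_on_subset)
 then obtain d where d: "d > 0" "\<And>x x'. x \<in> cball 0 (R+1) \<Longrightarrow> x' \<in> cball 0 (R+1) \<Longrightarrow> dist x' x < d \<Longrightarrow> dist (f x') (f x) < e"
  using assms(2) unfolding uniformly_continuous_on_def by metis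
 show ?thesis
 proof (intro exI[of _ "min d 1"] conjI ballI)
  fix z u :: complex assume z: "z \<in> cball 0 R" and u: "u \<in> ball z (min d 1)"
  have "cmod u \<le> cmod z + cmod (u - z)" using norm_triangle_ineq[of z "u - z"] by simp
  then have "u \<in> cball 0 (R+1)" "z \<in> cball 0 (R+1)" using z u by (auto simp: dist_norm norm_minus_commute)
  then show "\<bar>f u - f z\<bar> \<le> e" using d(2)[of z u] u by (auto simp: dist_real_def dist_commute)
 qed (use d in auto)
qed

lemma nn_integral_ball_shift:
 fixes f :: "complex \<Rightarrow> ennreal"
 assumes [measurable]: "f \<in> borel_measurable borel"
 shows "(\<integral>\<^sup>+ u\<in>ball z r. f u \<partial>lborel) = (\<integral>\<^sup>+ v\<in>ball 0 r. f (z + v) \<partial>lborel)"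
proof -
 have "(\<integral>\<^sup>+ u\<in>ball z r. f u \<partial>lborel) = (\<integral>\<^sup>+ v. f (z + v) * indicator (ball z r) (z + v) \<partial>lborel)"
  by (rule nn_integral_translate[symmetric, of "\<lambda>u. f u * indicator (ball z r) u"]) measurable
 also have "\<dots> = (\<integral>\<^sup>+ v\<in>ball 0 r. f (z + v) \<partial>lborel)"
  by (intro nn_integral_cong) (auto simp: indicator_def dist_norm)
 finally show ?thesis .
qed

text \<open>The logarithmic part does not increase under disc means, and only \<open>ell u\<close>
  contributes an error, by continuity. Neither depends on \<open>w\<close>, which makes the radius
  uniform over all positions of the other point.\<close>

lemma disc_mean_kap:
 assumes "0 < e"
 obtains r0 where "0 < r0" "\<And>r z w. 0 < r \<Longrightarrow> r \<le> r0 \<Longrightarrow> z \<in> cball 0 R \<Longrightarrow> 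
  (\<integral>\<^sup>+ u\<in>ball z r. kap u w \<partial>lborel) \<le> ennreal (pi * r\<^sup>2) * (kap z w + ennreal e)"
proof -
 obtain r0 where r0: "0 < r0" "\<forall>z\<in>cball 0 R. \<forall>u\<in>ball z r0. \<bar>ell u - ell z\<bar> \<le> e"
  using uniform_close_on_balls[of ell e R, OF continuous_on_ell[OF continuous_on_id] assms] by auto
 show ?thesis
 proof (rule that[OF r0(1)])
  fix r z w assume r: "0 < r" "r \<le> r0" and z: "z \<in> cball (0::complex) R"
  show "(\<integral>\<^sup>+ u\<in>ball z r. kap u w \<partial>lborel) \<le> ennreal (pi * r\<^sup>2) * (kap z w + ennreal e)"
  proof (cases "z = w")
   case True then show ?thesis using r by (simp add: kap_def ennreal_mult_top)
  next
   case False
   \<comment> \<open>Large enough for \<open>disc_mean_ln_le\<close> on the whole disc, and such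
     that \<open>M - ln (cmod (w - z))\<close> is exactly \<open>kap z w + e\<close>.\<close>
   define M where "M = (ell z + ell w) / 2 + e"
   have ell: "ell (z + v) \<le> ell z + e" if "v \<in> ball 0 r" for v
    using r0(2)[THEN bspec[OF _ z], THEN bspec[of _ _ "z + v"]] that r by (auto simp: dist_norm)
   have M: "ln (cmod (v - (w - z))) \<le> M" if "v \<in> ball 0 r" "v \<noteq> w - z" for v
   proof -
    have "z + v \<noteq> w" using that by auto
    from ln_cmod_diff_le[OF this] ell[OF that(1)] assms
    have "ln (cmod (z + v - w)) \<le> M" unfolding M_def by (simp add: field_simps)
    also have "z + v - w = v - (w - z)" by simp
    finally show ?thesis .
   qed
   have "(\<integral>\<^sup>+ u\<in>ball z r. kap u w \<partial>lborel) = (\<integral>\<^sup>+ v\<in>ball 0 r. kap (z + v) w \<partial>lborel)"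
    by (rule nn_integral_ball_shift) measurable
   also have "\<dots> \<le> (\<integral>\<^sup>+ v\<in>ball 0 r. ennreal (M - ln (cmod (v - (w - z)))) \<partial>lborel)"
   proof (rule nn_integral_mono_AE)
    have "AE v in lborel. cmod (v - (w - z)) \<noteq> 0" by (rule AE_cmod_neq)
    then show "AE v in lborel. kap (z + v) w * indicator (ball 0 r) v \<le> ennreal (M - ln (cmod (v - (w - z)))) * indicator (ball 0 r) v"
    proof eventually_elim
     case (elim v)
     have "(ell (z + v) + ell w) / 2 - ln (cmod (z + v - w)) \<le> M - ln (cmod (v - (w - z)))" if "v \<in> ball 0 r"
     proof -
      have "(ell (z + v) + ell w) / 2 \<le> M" using ell[OF that] assms by (simp add: M_def field_simps)
      then show ?thesis by (simp add: algebra_simps)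
     qed
     moreover have "z + v \<noteq> w" using elim by auto
     ultimately show ?case by (auto simp: indicator_def kap_def intro!: ennreal_leI)
    qed
   qed
   also have "\<dots> \<le> ennreal (pi * r\<^sup>2) * ennreal (M - ln (cmod (w - z)))"
    using r False M by (intro disc_mean_ln_le) auto
   also have "ennreal (M - ln (cmod (w - z))) = kap z w + ennreal e"
    using False ln_cmod_diff_le[OF False] assms
    by (simp add: kap_def M_def norm_minus_commute flip: ennreal_plus) (simp add: algebra_simps)
   finally show ?thesis .
  qed
 qed
qed

section \<open>Positive definiteness of logarithmic ratios\<close>

text \<open>The integral of 1 / (|x - y|^2 + c) over \<open>c\<close> from \<open>a\<close> to
  \<open>b\<close>, hence a superposition of Gaussian kernels. It is twice the difference of two
  regularised logarithms, but bounded.\<close>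

definition log_ratio :: "real \<Rightarrow> real \<Rightarrow> complex \<Rightarrow> complex \<Rightarrow> real" where
 "log_ratio a b x y = ln (((cmod (x - y))\<^sup>2 + b) / ((cmod (x - y))\<^sup>2 + a))"

text \<open>A square root of the kernel with parameters \<open>(c, t, u)\<close>: 1 / (d + c) is the
  integral of exp (- t (d + c)) over \<open>t\<close>, and exp (- t |x - y|^2) is, up to its mass,
  the convolution over \<open>u\<close> of exp (- 2 t |x - u|^2) with itself. That mass explains
  \<open>4 * t / pi\<close>; the square root shares the coefficient between the two factors.\<close>

definition gauss_feature :: "real \<Rightarrow> real \<Rightarrow> real \<times> real \<times> complex \<Rightarrow> complex \<Rightarrow> ennreal" where
 "gauss_feature a b = (\<lambda>(c, t, u) x. indicator {a..b} c * indicator {0..} t *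
   ennreal (sqrt (exp (- t * c) * (4 * t / pi)) * exp (- 2 * t * (cmod (x - u))\<^sup>2)))"

lemma gauss_feature_measurable [measurable]:
 "(\<lambda>(\<omega>, x). gauss_feature a b \<omega> x) \<in> borel_measurable ((lborel \<Otimes>\<^sub>M lborel \<Otimes>\<^sub>M lborel) \<Otimes>\<^sub>M borel)"
proof -
 show ?thesis unfolding gauss_feature_def split_beta' by measurable
qed

lemma nn_integral_gauss_product:
 assumes "0 < t"
 shows "(\<integral>\<^sup>+ u. ennreal (exp (- 2 * t * (cmod (x - u))\<^sup>2)) * ennreal (exp (- 2 * t * (cmod (y - u))\<^sup>2)) \<partial>lborel)
  = ennreal (pi / (4 * t) * exp (- t * (cmod (x - y))\<^sup>2))"
proof -
 define m where "m = (x + y) / 2"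
 \<comment> \<open>Parallelogram law at the midpoint \<open>m\<close>, which completes the square in
   \<open>u\<close>.\<close>
 have par: "(cmod (x - u))\<^sup>2 + (cmod (y - u))\<^sup>2 = (cmod (x - y))\<^sup>2 / 2 + 2 * (cmod (m - u))\<^sup>2" for u
  unfolding m_def cmod_power2 by (simp add: power2_eq_square field_simps)
 have "(\<integral>\<^sup>+ u. ennreal (exp (- 2 * t * (cmod (x - u))\<^sup>2)) * ennreal (exp (- 2 * t * (cmod (y - u))\<^sup>2)) \<partial>lborel)
  = (\<integral>\<^sup>+ u. ennreal (exp (- t * (cmod (x - y))\<^sup>2)) * ennreal (exp (- (4 * t) * (cmod (m - u))\<^sup>2)) \<partial>lborel)"
 proof (rule nn_integral_cong)
  fix u
  have "- 2 * t * (cmod (x - u))\<^sup>2 + - 2 * t * (cmod (y - u))\<^sup>2 = - 2 * t * ((cmod (x - u))\<^sup>2 + (cmod (y - u))\<^sup>2)"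
   by (simp add: algebra_simps)
  also have "\<dots> = - t * (cmod (x - y))\<^sup>2 + - (4 * t) * (cmod (m - u))\<^sup>2"
   unfolding par by (simp add: algebra_simps)
  finally show "ennreal (exp (- 2 * t * (cmod (x - u))\<^sup>2)) * ennreal (exp (- 2 * t * (cmod (y - u))\<^sup>2))
   = ennreal (exp (- t * (cmod (x - y))\<^sup>2)) * ennreal (exp (- (4 * t) * (cmod (m - u))\<^sup>2))"
   by (simp add: ennreal_mult'[symmetric] exp_add[symmetric])
 qed
 also have "\<dots> = ennreal (exp (- t * (cmod (x - y))\<^sup>2)) * (\<integral>\<^sup>+ u. ennreal (exp (- (4 * t) * (cmod (m - u))\<^sup>2)) \<partial>lborel)"
  by (rule nn_integral_cmult) measurable
 also have "(\<integral>\<^sup>+ u. ennreal (exp (- (4 * t) * (cmod (m - u))\<^sup>2)) \<partial>lborel) = ennreal (pi / (4 * t))"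
  using assms by (subst nn_integral_reflect[of "\<lambda>u. ennreal (exp (- (4 * t) * (cmod u)\<^sup>2))"])
   (auto intro!: nn_integral_exp_neg_square[of "4 * t", simplified])
 finally show ?thesis using assms by (simp add: ennreal_mult'[symmetric] mult.commute)
qed

text \<open>The three integrations are a Gaussian convolution in \<open>u\<close>, a Laplace
  transform in \<open>t\<close> and a logarithmic primitive in \<open>c\<close>.\<close>

lemma log_ratio_eq_feature:
 assumes "0 < a" "a \<le> b"
 shows "ennreal (log_ratio a b x y) = 
  (\<integral>\<^sup>+ \<omega>. gauss_feature a b \<omega> x * gauss_feature a b \<omega> y \<partial>(lborel \<Otimes>\<^sub>M lborel \<Otimes>\<^sub>M lborel))"
proof -
 interpret p: pair_sigma_finite "lborel :: real measure" "lborel :: complex measure" ..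
 interpret p2: pair_sigma_finite "lborel :: real measure" "lborel \<Otimes>\<^sub>M lborel :: (real \<times> complex) measure" ..
 define d where "d = (cmod (x - y))\<^sup>2"
 have d: "0 \<le> d" by (simp add: d_def)
 \<comment> \<open>At \<open>t = 0\<close> the feature vanishes but the exponential is 1; this null
   set is left out.\<close>
 have 1: "(\<integral>\<^sup>+ u. gauss_feature a b (c, t, u) x * gauss_feature a b (c, t, u) y \<partial>lborel)
   = indicator {a..b} c * (ennreal (exp (- t * (d + c))) * indicator {0..} t)" if "t \<noteq> 0" for c t
 proof (cases "c \<in> {a..b} \<and> 0 < t")
  case True
  have "(\<integral>\<^sup>+ u. gauss_feature a b (c, t, u) x * gauss_feature a b (c, t, u) y \<partial>lborel)
   = (\<integral>\<^sup>+ u. ennreal (exp (- t * c) * (4 * t / pi)) * (ennreal (exp (- 2 * t * (cmod (x - u))\<^sup>2)) * ennreal (exp (- 2 * t * (cmod (y - u))\<^sup>2))) \<partial>lborel)"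
  proof (rule nn_integral_cong)
   fix u
   have *: "ennreal (S * X) * ennreal (S * Y) = ennreal (S * S) * (ennreal X * ennreal Y)" if "0 \<le> S" "0 \<le> X" "0 \<le> Y" for S X Y
    using that by (simp add: ennreal_mult mult_ac)
   have "sqrt (exp (- t * c) * (4 * t / pi)) * sqrt (exp (- t * c) * (4 * t / pi)) = exp (- t * c) * (4 * t / pi)"
    using True by (intro real_sqrt_mult_self[THEN trans] abs_of_nonneg) auto
   then show "gauss_feature a b (c, t, u) x * gauss_feature a b (c, t, u) y = ennreal (exp (- t * c) * (4 * t / pi)) *
     (ennreal (exp (- 2 * t * (cmod (x - u))\<^sup>2)) * ennreal (exp (- 2 * t * (cmod (y - u))\<^sup>2)))"
    using True *[of "sqrt (exp (- t * c) * (4 * t / pi))" "exp (- 2 * t * (cmod (x - u))\<^sup>2)" "exp (- 2 * t * (cmod (y - u))\<^sup>2)"]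
    by (simp add: gauss_feature_def del: real_sqrt_mult_self)
  qed
  also have "\<dots> = ennreal (exp (- t * c) * (4 * t / pi)) * ennreal (pi / (4 * t) * exp (- t * (cmod (x - y))\<^sup>2))"
   unfolding nn_integral_gauss_product[OF conjunct2[OF True], symmetric] by (rule nn_integral_cmult) measurable
  also have "\<dots> = ennreal (exp (- t * (d + c)))"
   using True by (simp add: ennreal_mult'[symmetric] d_def exp_add[symmetric] field_simps)
  finally show ?thesis using True by simp
 next
  case False
  then have "gauss_feature a b (c, t, u) z = 0" for u z using that by (auto simp: gauss_feature_def)
  then show ?thesis using False that by (auto simp: indicator_def)
 qed
 have 2: "(\<integral>\<^sup>+ t. ennreal (exp (- t * (d + c))) * indicator {0..} t \<partial>lborel) = ennreal (1 / (d + c))" if "c \<in> {a..b}" for c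
 proof -
  have pos: "d + c > 0" using that assms d by auto
  define e where "e = d + c"
  have e: "0 < e" using pos by (simp add: e_def)
  have "(\<integral>\<^sup>+ t. ennreal (exp (- t * e)) * indicator {0..} t \<partial>lborel) = ennreal (0 - (- exp (- 0 * e) / e))"
  proof (rule nn_integral_FTC_atLeast)
   show "((\<lambda>t. - exp (- t * e) / e) has_real_derivative exp (- t * e)) (at t)" for t
    using e by (auto intro!: derivative_eq_intros)
   show "((\<lambda>t. - exp (- t * e) / e) \<longlongrightarrow> 0) at_top" using e by real_asymp
  qed auto
  then show ?thesis by (simp add: e_def)
 qed
 have 3: "(\<integral>\<^sup>+ c. ennreal (1 / (d + c)) * indicator {a..b} c \<partial>lborel) = ennreal (ln (d + b) - ln (d + a))"
  using assms d by (intro nn_integral_FTC_Icc) (auto intro!: derivative_eq_intros)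
 have "(\<integral>\<^sup>+ \<omega>. gauss_feature a b \<omega> x * gauss_feature a b \<omega> y \<partial>(lborel \<Otimes>\<^sub>M lborel \<Otimes>\<^sub>M lborel))
  = (\<integral>\<^sup>+ c. \<integral>\<^sup>+ t. \<integral>\<^sup>+ u. gauss_feature a b (c, t, u) x * gauss_feature a b (c, t, u) y \<partial>lborel \<partial>lborel \<partial>lborel)"
 proof -
  have meas: "(\<lambda>\<omega>. gauss_feature a b \<omega> x * gauss_feature a b \<omega> y) \<in> borel_measurable (lborel \<Otimes>\<^sub>M lborel \<Otimes>\<^sub>M lborel)"
   by measurable
   have sf: "sigma_finite_measure (lborel \<Otimes>\<^sub>M lborel :: (real \<times> complex) measure)"
   by (simp add: lborel_prod sigma_finite_lborel)
  have "(\<integral>\<^sup>+ \<omega>. gauss_feature a b \<omega> x * gauss_feature a b \<omega> y \<partial>(lborel \<Otimes>\<^sub>M lborel \<Otimes>\<^sub>M lborel))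
   = (\<integral>\<^sup>+ c. \<integral>\<^sup>+ q. gauss_feature a b (c, q) x * gauss_feature a b (c, q) y \<partial>(lborel \<Otimes>\<^sub>M lborel) \<partial>lborel)"
   using meas by (rule sigma_finite_measure.nn_integral_fst[OF sf, symmetric])
  also have "\<dots> = (\<integral>\<^sup>+ c. \<integral>\<^sup>+ t. \<integral>\<^sup>+ u. gauss_feature a b (c, t, u) x * gauss_feature a b (c, t, u) y \<partial>lborel \<partial>lborel \<partial>lborel)"
   by (rule nn_integral_cong, rule lborel.nn_integral_fst[symmetric]) measurable
  finally show ?thesis .
 qed
 also have "\<dots> = (\<integral>\<^sup>+ c. ennreal (1 / (d + c)) * indicator {a..b} c \<partial>lborel)"
 proof (rule nn_integral_cong)
  fix c :: real
  have "(\<integral>\<^sup>+ t. \<integral>\<^sup>+ u. gauss_feature a b (c, t, u) x * gauss_feature a b (c, t, u) y \<partial>lborel \<partial>lborel)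
   = (\<integral>\<^sup>+ t. indicator {a..b} c * (ennreal (exp (- t * (d + c))) * indicator {0..} t) \<partial>lborel)"
   by (rule nn_integral_cong_AE, use AE_lborel_singleton[of "0::real"] in eventually_elim) (rule 1)
  also have "\<dots> = indicator {a..b} c * (\<integral>\<^sup>+ t. (ennreal (exp (- t * (d + c))) * indicator {0..} t) \<partial>lborel)"
   by (rule nn_integral_cmult) measurable
  also have "\<dots> = ennreal (1 / (d + c)) * indicator {a..b} c"
   using 2[of c] by (cases "c \<in> {a..b}") auto
  finally show "(\<integral>\<^sup>+ t. \<integral>\<^sup>+ u. gauss_feature a b (c, t, u) x * gauss_feature a b (c, t, u) y \<partial>lborel \<partial>lborel)
   = ennreal (1 / (d + c)) * indicator {a..b} c" .
 qed
 also have "\<dots> = ennreal (log_ratio a b x y)"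
 proof -
  have "0 < d + a" "0 < d + b" using assms d by auto
  then show ?thesis unfolding 3 by (simp add: log_ratio_def d_def ln_div)
 qed
 finally show ?thesis by simp
qed

lemma log_ratio_nonneg: "0 < a \<Longrightarrow> a \<le> b \<Longrightarrow> 0 \<le> log_ratio a b x y"
 unfolding log_ratio_def by (intro ln_ge_zero) (simp add: add_nonneg_pos)

lemma log_ratio_bound: "0 < a \<Longrightarrow> a \<le> b \<Longrightarrow> \<bar>log_ratio a b x y\<bar> \<le> ln (b / a)"
proof -
 assume ab: "0 < a" "a \<le> b"
 have "log_ratio a b x y \<le> ln (b / a)"
  unfolding log_ratio_def using ab
  by (intro ln_mono) (auto simp: divide_simps add_nonneg_pos distrib_left distrib_right mult.commute[of b] mult_left_mono intro!: divide_pos_pos add_nonneg_pos)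
 with log_ratio_nonneg[OF ab] show ?thesis by simp
qed

lemma log_ratio_measurable [measurable]: "(\<lambda>(x, y). log_ratio a b x y) \<in> borel_measurable (borel \<Otimes>\<^sub>M borel)"
 unfolding log_ratio_def split_beta' by measurable

definition bil :: "(complex \<Rightarrow> complex \<Rightarrow> real) \<Rightarrow> complex measure \<Rightarrow> complex measure \<Rightarrow> real" where
 "bil K \<mu> \<nu> = (\<integral>p. K (fst p) (snd p) \<partial>(\<mu> \<Otimes>\<^sub>M \<nu>))"

definition fin_borel :: "complex measure \<Rightarrow> bool" where
 "fin_borel \<mu> \<longleftrightarrow> finite_measure \<mu> \<and> sets \<mu> = sets borel"

lemma sets_pair_borel: "sets \<mu> = sets borel \<Longrightarrow> sets \<nu> = sets borel \<Longrightarrow> sets (\<mu> \<Otimes>\<^sub>M \<nu>) = sets (borel \<Otimes>\<^sub>M borel)"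
 by (rule sets_pair_measure_cong)

lemma integrable_bounded_kernel:
 fixes K :: "complex \<Rightarrow> complex \<Rightarrow> real"
 assumes "fin_borel \<mu>" "fin_borel \<nu>" and K: "(\<lambda>(x, y). K x y) \<in> borel_measurable (borel \<Otimes>\<^sub>M borel)" and B: "\<And>x y. \<bar>K x y\<bar> \<le> B"
 shows "integrable (\<mu> \<Otimes>\<^sub>M \<nu>) (\<lambda>p. K (fst p) (snd p))"
proof -
 interpret finite_measure "\<mu> \<Otimes>\<^sub>M \<nu>" using assms by (intro finite_measure_pair_measure) (auto simp: fin_borel_def)
 have "(\<lambda>p. K (fst p) (snd p)) \<in> borel_measurable (\<mu> \<Otimes>\<^sub>M \<nu>)"
  using K assms(1,2) by (subst measurable_cong_sets[OF sets_pair_borel refl]) (auto simp: fin_borel_def split_beta')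
 then show ?thesis by (intro integrable_const_bound[where B=B]) (auto simp: B)
qed

text \<open>By Fubini the form is the inner product of the mean features of \<open>\<mu>\<close> and
  \<open>\<nu>\<close>, from which both positivity and symmetry follow.\<close>

lemma nn_bil_feature:
 assumes ab: "0 < a" "a \<le> b" and "fin_borel \<mu>" "fin_borel \<nu>"
 shows "ennreal (bil (log_ratio a b) \<mu> \<nu>) = 
  (\<integral>\<^sup>+ \<omega>. (\<integral>\<^sup>+ x. gauss_feature a b \<omega> x \<partial>\<mu>) * (\<integral>\<^sup>+ y. gauss_feature a b \<omega> y \<partial>\<nu>) \<partial>(lborel \<Otimes>\<^sub>M lborel \<Otimes>\<^sub>M lborel))"
proof -
 let ?\<Omega> = "lborel \<Otimes>\<^sub>M lborel \<Otimes>\<^sub>M lborel :: (real \<times> real \<times> complex) measure"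
 let ?G = "gauss_feature a b"
 interpret m: finite_measure \<mu> using assms by (simp add: fin_borel_def)
 interpret n: finite_measure \<nu> using assms by (simp add: fin_borel_def)
 interpret mn: finite_measure "\<mu> \<Otimes>\<^sub>M \<nu>" by (intro finite_measure_pair_measure) unfold_locales
 interpret p: pair_sigma_finite "lborel :: real measure" "lborel :: complex measure" ..
 interpret p2: pair_sigma_finite "lborel :: real measure" "lborel \<Otimes>\<^sub>M lborel :: (real \<times> complex) measure" ..
 interpret q: pair_sigma_finite ?\<Omega> "\<mu> \<Otimes>\<^sub>M \<nu>" ..
 have [measurable_cong]: "sets \<mu> = sets borel" "sets \<nu> = sets borel" using assms by (auto simp: fin_borel_def)
 have "ennreal (bil (log_ratio a b) \<mu> \<nu>) = (\<integral>\<^sup>+ p. ennreal (log_ratio a b (fst p) (snd p)) \<partial>(\<mu> \<Otimes>\<^sub>M \<nu>))"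
  unfolding bil_def using assms log_ratio_nonneg[OF ab]
  by (intro nn_integral_eq_integral[symmetric] integrable_bounded_kernel[OF _ _ log_ratio_measurable log_ratio_bound]) auto
 also have "\<dots> = (\<integral>\<^sup>+ p. \<integral>\<^sup>+ \<omega>. ?G \<omega> (fst p) * ?G \<omega> (snd p) \<partial>?\<Omega> \<partial>(\<mu> \<Otimes>\<^sub>M \<nu>))"
  by (simp add: log_ratio_eq_feature[OF ab])
 also have "\<dots> = (\<integral>\<^sup>+ \<omega>. \<integral>\<^sup>+ p. ?G \<omega> (fst p) * ?G \<omega> (snd p) \<partial>(\<mu> \<Otimes>\<^sub>M \<nu>) \<partial>?\<Omega>)"
  by (rule q.Fubini') measurable
 also have "\<dots> = (\<integral>\<^sup>+ \<omega>. (\<integral>\<^sup>+ x. ?G \<omega> x \<partial>\<mu>) * (\<integral>\<^sup>+ y. ?G \<omega> y \<partial>\<nu>) \<partial>?\<Omega>)"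
 proof (rule nn_integral_cong)
  fix \<omega> :: "real \<times> real \<times> complex"
  have [measurable]: "?G \<omega> \<in> borel_measurable borel"
   using measurable_compose[OF measurable_Pair1'[of \<omega> ?\<Omega>] gauss_feature_measurable[of a b]] by (simp add: space_pair_measure)
  have "(\<integral>\<^sup>+ p. ?G \<omega> (fst p) * ?G \<omega> (snd p) \<partial>(\<mu> \<Otimes>\<^sub>M \<nu>)) = (\<integral>\<^sup>+ x. \<integral>\<^sup>+ y. ?G \<omega> x * ?G \<omega> y \<partial>\<nu> \<partial>\<mu>)"
   by (subst n.nn_integral_fst[symmetric]) auto
  also have "\<dots> = (\<integral>\<^sup>+ x. ?G \<omega> x * (\<integral>\<^sup>+ y. ?G \<omega> y \<partial>\<nu>) \<partial>\<mu>)"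
   by (intro nn_integral_cong nn_integral_cmult) auto
  also have "\<dots> = (\<integral>\<^sup>+ x. ?G \<omega> x \<partial>\<mu>) * (\<integral>\<^sup>+ y. ?G \<omega> y \<partial>\<nu>)"
   by (rule nn_integral_multc) auto
  finally show "(\<integral>\<^sup>+ p. ?G \<omega> (fst p) * ?G \<omega> (snd p) \<partial>(\<mu> \<Otimes>\<^sub>M \<nu>)) = (\<integral>\<^sup>+ x. ?G \<omega> x \<partial>\<mu>) * (\<integral>\<^sup>+ y. ?G \<omega> y \<partial>\<nu>)" .
 qed
 finally show ?thesis .
qed

lemma ennreal_two_mult_le: "2 * (x * y) \<le> x * x + y * (y :: ennreal)"
proof (cases "x = \<infinity> \<or> y = \<infinity>")
 case True then show ?thesis by (auto simp: ennreal_mult_top ennreal_top_mult)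
next
 case False
 then obtain u v where "x = ennreal u" "y = ennreal v" "0 \<le> u" "0 \<le> v" by (metis ennreal_cases infinity_ennreal_def)
 moreover have "2 * (u * v) \<le> u * u + v * v" using sum_squares_bound[of u v] by (simp add: power2_eq_square)
 ultimately show ?thesis
  by (simp flip: ennreal_mult ennreal_plus ennreal_numeral)
qed

lemma bil_nonneg: "(\<And>x y. 0 \<le> K x y) \<Longrightarrow> 0 \<le> bil K \<mu> \<nu>"
 unfolding bil_def by (rule integral_nonneg_AE) auto

text \<open>With f the mean feature, the squared norm of
  \<open>f \<mu> + l f \<gamma> - f \<nu>\<close> is nonnegative; its negative terms stand on the
  left so that the computation in \<open>ennreal\<close> needs no subtraction. The multiple of
  \<open>\<gamma>\<close> serves to test the difference of \<open>\<mu>\<close> and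
  \<open>\<nu>\<close> against \<open>\<gamma>\<close>.\<close>

lemma log_ratio_positive_definite:
 assumes ab: "0 < a" "a \<le> b" and fin: "fin_borel \<mu>" "fin_borel \<nu>" "fin_borel \<gamma>" and l: "0 \<le> l"
 defines "B \<equiv> bil (log_ratio a b)"
 shows "2 * B \<mu> \<nu> + 2 * l * B \<nu> \<gamma> \<le> B \<mu> \<mu> + B \<nu> \<nu> + 2 * l * B \<mu> \<gamma> + l\<^sup>2 * B \<gamma> \<gamma>"
proof -
 let ?\<Omega> = "lborel \<Otimes>\<^sub>M lborel \<Otimes>\<^sub>M lborel :: (real \<times> real \<times> complex) measure"
 define f where "f \<kappa> = (\<lambda>\<omega>. \<integral>\<^sup>+ x. gauss_feature a b \<omega> x \<partial>\<kappa>)" for \<kappa>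
 have fm [measurable]: "f \<kappa> \<in> borel_measurable ?\<Omega>" if "fin_borel \<kappa>" for \<kappa>
 proof -
  interpret finite_measure \<kappa> using that by (simp add: fin_borel_def)
  have [measurable_cong]: "sets \<kappa> = sets borel" using that by (simp add: fin_borel_def)
  show ?thesis unfolding f_def by measurable
 qed
 note [measurable] = fin(1)[THEN fm] fin(2)[THEN fm] fin(3)[THEN fm]
 have B: "ennreal (B \<kappa> \<kappa>') = (\<integral>\<^sup>+ \<omega>. f \<kappa> \<omega> * f \<kappa>' \<omega> \<partial>?\<Omega>)" if "fin_borel \<kappa>" "fin_borel \<kappa>'" for \<kappa> \<kappa>'
  unfolding B_def f_def using nn_bil_feature[OF ab that] .
 have B0: "0 \<le> B \<kappa> \<kappa>'" for \<kappa> \<kappa>'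
  unfolding B_def by (intro bil_nonneg log_ratio_nonneg ab)
 have "ennreal (2 * B \<mu> \<nu> + 2 * l * B \<nu> \<gamma>) = 2 * ennreal (B \<mu> \<nu>) + 2 * ennreal l * ennreal (B \<nu> \<gamma>)"
  using l B0 by (simp flip: ennreal_mult ennreal_plus ennreal_numeral)
 also have "\<dots> = (\<integral>\<^sup>+ \<omega>. 2 * (f \<mu> \<omega> * f \<nu> \<omega>) + 2 * ennreal l * (f \<nu> \<omega> * f \<gamma> \<omega>) \<partial>?\<Omega>)"
  unfolding B[OF fin(1,2)] B[OF fin(2,3)] by (simp add: nn_integral_add nn_integral_cmult)
 also have "\<dots> \<le> (\<integral>\<^sup>+ \<omega>. f \<mu> \<omega> * f \<mu> \<omega> + f \<nu> \<omega> * f \<nu> \<omega> + 2 * ennreal l * (f \<mu> \<omega> * f \<gamma> \<omega>) + ennreal (l\<^sup>2) * (f \<gamma> \<omega> * f \<gamma> \<omega>) \<partial>?\<Omega>)"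
 proof (rule nn_integral_mono)
  fix \<omega>
  have "2 * ((f \<mu> \<omega> + ennreal l * f \<gamma> \<omega>) * f \<nu> \<omega>) \<le> (f \<mu> \<omega> + ennreal l * f \<gamma> \<omega>) * (f \<mu> \<omega> + ennreal l * f \<gamma> \<omega>) + f \<nu> \<omega> * f \<nu> \<omega>"
   by (rule ennreal_two_mult_le)
  then show "2 * (f \<mu> \<omega> * f \<nu> \<omega>) + 2 * ennreal l * (f \<nu> \<omega> * f \<gamma> \<omega>)
   \<le> f \<mu> \<omega> * f \<mu> \<omega> + f \<nu> \<omega> * f \<nu> \<omega> + 2 * ennreal l * (f \<mu> \<omega> * f \<gamma> \<omega>) + ennreal (l\<^sup>2) * (f \<gamma> \<omega> * f \<gamma> \<omega>)"
   using l by (simp add: algebra_simps power2_eq_square ennreal_mult mult_2)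
 qed
 also have "\<dots> = ennreal (B \<mu> \<mu>) + ennreal (B \<nu> \<nu>) + 2 * ennreal l * ennreal (B \<mu> \<gamma>) + ennreal (l\<^sup>2) * ennreal (B \<gamma> \<gamma>)"
  unfolding B[OF fin(1,1)] B[OF fin(2,2)] B[OF fin(1,3)] B[OF fin(3,3)] by (simp add: nn_integral_add nn_integral_cmult)
 also have "\<dots> = ennreal (B \<mu> \<mu> + B \<nu> \<nu> + 2 * l * B \<mu> \<gamma> + l\<^sup>2 * B \<gamma> \<gamma>)"
  using l B0 by (simp flip: ennreal_mult ennreal_plus ennreal_numeral)
 finally show ?thesis using l B0 by (subst (asm) ennreal_le_iff) auto
qed

section \<open>Energy distance and test functions\<close>

lemma distr_reflect: "distr lborel borel (\<lambda>z. x - z) = (lborel :: complex measure)"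
proof (rule measure_eqI)
 fix A :: "complex set" assume A: "A \<in> sets (distr lborel borel (\<lambda>z. x - z))"
 then have [measurable]: "A \<in> sets borel" by simp
 have "emeasure (distr lborel borel (\<lambda>z. x - z)) A = (\<integral>\<^sup>+ z. indicator A (x - z) \<partial>lborel)"
  by (subst nn_integral_indicator[symmetric, OF A], subst nn_integral_distr) auto
 also have "\<dots> = emeasure lborel A"
  by (subst nn_integral_reflect[of "indicator A"]) auto
 finally show "emeasure (distr lborel borel (\<lambda>z. x - z)) A = emeasure lborel A" .
qed simp

text \<open>The error splits at distance \<open>\<rho>\<close>: closer points are governed by the
  modulus of continuity \<open>e\<close>, farther ones by the fraction \<open>\<tau>\<close> of the
  mass of \<open>K\<close>. The kernel keeps its mass \<open>m\<close>, because for
  \<open>bump\<close> and \<open>tent\<close> only bounds on the mass are computed.\<close>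

lemma approximate_identity:
 fixes K \<phi> :: "complex \<Rightarrow> real"
 assumes K [measurable]: "K \<in> borel_measurable borel" and \<phi> [measurable]: "\<phi> \<in> borel_measurable borel"
  and K0: "\<And>v. 0 \<le> K v" and m: "(\<integral>\<^sup>+ v. ennreal (K v) \<partial>lborel) = ennreal m" "0 \<le> m"
  and tail: "(\<integral>\<^sup>+ v. ennreal (K v) * indicator {v. \<rho> \<le> cmod v} v \<partial>lborel) \<le> ennreal (\<tau> * m)" "0 \<le> \<tau>"
  and B: "\<And>x. \<bar>\<phi> x\<bar> \<le> B" and e: "\<And>x y. cmod (x - y) < \<rho> \<Longrightarrow> \<bar>\<phi> x - \<phi> y\<bar> \<le> e" "0 \<le> e"
 shows "\<bar>(\<integral>u. K (x - u) * \<phi> u \<partial>lborel) - m * \<phi> x\<bar> \<le> m * (e + 2 * B * \<tau>)"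
  and "integrable lborel (\<lambda>u. K (x - u) * \<phi> u)"
proof -
 have B0: "0 \<le> B" using B[of 0] by simp
 have iK: "integrable lborel K"
  using m K0 by (intro integrableI_nonneg) auto
 have im: "(\<integral>v. K v \<partial>lborel) = m"
  using m K0 by (subst integral_eq_nn_integral) auto
 have it: "integrable lborel (\<lambda>v. K v * indicator {v. \<rho> \<le> cmod v} v)"
  by (rule Bochner_Integration.integrable_bound[OF iK]) (auto simp: indicator_def K0)
 have "ennreal (\<integral>v. K v * indicator {v. \<rho> \<le> cmod v} v \<partial>lborel) = (\<integral>\<^sup>+ v. ennreal (K v) * indicator {v. \<rho> \<le> cmod v} v \<partial>lborel)"
  by (subst nn_integral_eq_integral[symmetric, OF it]) (auto simp: K0 indicator_def intro!: nn_integral_cong)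
 with tail m have tail': "(\<integral>v. K v * indicator {v. \<rho> \<le> cmod v} v \<partial>lborel) \<le> \<tau> * m"
  by (metis ennreal_le_iff mult_nonneg_nonneg)
 have i1: "integrable lborel (\<lambda>v. K v * \<phi> (x - v))"
 proof (rule Bochner_Integration.integrable_bound[OF integrable_mult_right[OF iK, of B]])
  show "AE v in lborel. norm (K v * \<phi> (x - v)) \<le> norm (B * K v)"
   using B B0 by (intro AE_I2) (auto simp: abs_mult K0 mult.commute[of B] intro!: mult_left_mono)
 qed measurable
 have eq: "(\<lambda>u. K (x - u) * \<phi> u) = (\<lambda>u. (\<lambda>v. K v * \<phi> (x - v)) (x - u))" by auto
 have meas: "(\<lambda>u. x - u) \<in> measurable lborel borel" by measurable
 show "integrable lborel (\<lambda>u. K (x - u) * \<phi> u)"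
  unfolding eq using i1 by (subst integrable_distr_eq[OF meas, symmetric]) (auto simp: distr_reflect)
 have "(\<integral>u. K (x - u) * \<phi> u \<partial>lborel) = (\<integral>v. K v * \<phi> (x - v) \<partial>distr lborel borel (\<lambda>z. x - z))"
  by (subst integral_distr[OF meas]) auto
 also have "\<dots> = (\<integral>v. K v * \<phi> (x - v) \<partial>lborel)" by (simp only: distr_reflect)
 finally have "(\<integral>u. K (x - u) * \<phi> u \<partial>lborel) - m * \<phi> x = (\<integral>v. K v * \<phi> (x - v) - K v * \<phi> x \<partial>lborel)"
  using i1 iK im by simp
 also have "\<bar>\<dots>\<bar> \<le> (\<integral>v. e * K v + 2 * B * (K v * indicator {v. \<rho> \<le> cmod v} v) \<partial>lborel)"
 proof (rule order_trans[OF integral_abs_bound integral_mono])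
  show "\<bar>K v * \<phi> (x - v) - K v * \<phi> x\<bar> \<le> e * K v + 2 * B * (K v * indicator {v. \<rho> \<le> cmod v} v)" for v
  proof -
   have "\<bar>\<phi> (x - v) - \<phi> x\<bar> \<le> e + 2 * B * indicator {v. \<rho> \<le> cmod v} v"
   proof (cases "\<rho> \<le> cmod v")
    case True then show ?thesis using B[of "x - v"] B[of x] e(2) by auto
   next
    case False then show ?thesis using e(1)[of "x - v" x] by simp
   qed
   then have "K v * \<bar>\<phi> (x - v) - \<phi> x\<bar> \<le> K v * (e + 2 * B * indicator {v. \<rho> \<le> cmod v} v)"
    by (rule mult_left_mono) (rule K0)
   moreover have "\<bar>K v * \<phi> (x - v) - K v * \<phi> x\<bar> = K v * \<bar>\<phi> (x - v) - \<phi> x\<bar>"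
    unfolding right_diff_distrib[symmetric] abs_mult using K0[of v] by simp
   ultimately show ?thesis by (simp add: algebra_simps)
  qed
 qed (use i1 iK it in auto)
 also have "\<dots> = e * m + 2 * B * (\<integral>v. K v * indicator {v. \<rho> \<le> cmod v} v \<partial>lborel)"
  using iK it im by simp
 also have "\<dots> \<le> e * m + 2 * B * (\<tau> * m)"
  using tail' B0 by (intro add_left_mono mult_left_mono) auto
 finally show "\<bar>(\<integral>u. K (x - u) * \<phi> u \<partial>lborel) - m * \<phi> x\<bar> \<le> m * (e + 2 * B * \<tau>)" by (simp add: algebra_simps)
qed

text \<open>A single logarithmic ratio decays like c / |v|^2 and is not integrable over the plane.
  This second difference decays like c^2 / |v|^4, so it yields an approximate identity while
  remaining a combination of positive definite kernels.\<close>

definition bump :: "real \<Rightarrow> complex \<Rightarrow> real" where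
 "bump c v = log_ratio c (2 * c) v 0 - log_ratio (2 * c) (3 * c) v 0"

lemma bump_measurable [measurable]: "bump c \<in> borel_measurable borel"
 unfolding bump_def log_ratio_def by measurable

lemma bump_eq:
 assumes "0 < c" and s: "s = (cmod v)\<^sup>2"
 shows "bump c v = ln (1 + c\<^sup>2 / ((s + c) * (s + 3 * c)))"
proof -
 have p: "s + c > 0" "s + 2 * c > 0" "s + 3 * c > 0" using assms by (auto intro: add_nonneg_pos)
 then have "bump c v = ln ((s + 2 * c) * (s + 2 * c) / ((s + c) * (s + 3 * c)))"
  unfolding bump_def log_ratio_def s by (simp add: ln_div ln_mult)
 also have "(s + 2 * c) * (s + 2 * c) / ((s + c) * (s + 3 * c)) = 1 + c\<^sup>2 / ((s + c) * (s + 3 * c))"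
 proof -
  have "(s + c) * (s + 3 * c) > 0" using p by simp
  moreover have "(s + 2 * c) * (s + 2 * c) = (s + c) * (s + 3 * c) + c\<^sup>2" 
   by (simp add: power2_eq_square algebra_simps)
  moreover have "((s + c) * (s + 3 * c)) / ((s + c) * (s + 3 * c)) = 1" using p by (intro divide_self) simp
  ultimately show ?thesis by (simp only: add_divide_distrib)
 qed
 finally show ?thesis .
qed

lemma bump_bounds:
 assumes "0 < c"
 shows "0 \<le> bump c v" "bump c v \<le> c\<^sup>2 / ((cmod v)\<^sup>2 + c)\<^sup>2" "(cmod v)\<^sup>2 \<le> c \<Longrightarrow> ln (9/8) \<le> bump c v"
proof -
 define s where "s = (cmod v)\<^sup>2"
 have s0: "0 \<le> s" by (simp add: s_def)
 have p: "s + c > 0" "s + 3 * c > 0" using assms s0 by auto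
 note eq = bump_eq[OF assms s_def]
 show "0 \<le> bump c v" unfolding eq using p by (intro ln_ge_zero) simp
 have "bump c v \<le> c\<^sup>2 / ((s + c) * (s + 3 * c))" unfolding eq using p by (intro ln_add_one_self_le_self) simp
 also have "\<dots> \<le> c\<^sup>2 / (s + c)\<^sup>2" unfolding power2_eq_square using p assms by (intro divide_left_mono mult_left_mono mult_pos_pos) auto
 finally show "bump c v \<le> c\<^sup>2 / ((cmod v)\<^sup>2 + c)\<^sup>2" by (simp add: s_def)
 assume "(cmod v)\<^sup>2 \<le> c"
 then have sc: "s \<le> c" by (simp add: s_def)
 \<comment> \<open>For \<open>s = c\<close> the fraction equals 1/8, whence the constant
   9/8.\<close>
 have "(s + c) * (s + 3 * c) \<le> (2 * c) * (4 * c)" using sc s0 assms by (intro mult_mono) auto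
 then have "c\<^sup>2 / ((2 * c) * (4 * c)) \<le> c\<^sup>2 / ((s + c) * (s + 3 * c))" using p assms by (intro divide_left_mono) auto
 then have "9/8 \<le> 1 + c\<^sup>2 / ((s + c) * (s + 3 * c))" using assms by (simp add: power2_eq_square)
 then show "ln (9/8) \<le> bump c v" unfolding eq by (intro ln_mono) auto
qed

lemma nn_integral_bump_tail:
 assumes c: "0 < c" and A: "0 \<le> \<rho>"
 shows "(\<integral>\<^sup>+ v. ennreal (bump c v) * indicator {v. \<rho> \<le> cmod v} v \<partial>lborel) \<le> ennreal (pi * c\<^sup>2 / (\<rho>\<^sup>2 + c))"
proof -
 have "(\<integral>\<^sup>+ v. ennreal (bump c v) * indicator {v. \<rho> \<le> cmod v} v \<partial>lborel)
  \<le> (\<integral>\<^sup>+ v. ennreal (c\<^sup>2 / ((cmod v)\<^sup>2 + c)\<^sup>2) * indicator {\<rho>\<^sup>2..} ((cmod v)\<^sup>2) \<partial>lborel)"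
  using bump_bounds(2)[OF c] A by (intro nn_integral_mono) (auto simp: indicator_def intro!: ennreal_leI power_mono)
 also have "\<dots> = ennreal pi * (\<integral>\<^sup>+ s\<in>{0..}. ennreal (c\<^sup>2 / (s + c)\<^sup>2) * indicator {\<rho>\<^sup>2..} s \<partial>lborel)"
  by (rule nn_integral_radial[of "\<lambda>s. ennreal (c\<^sup>2 / (s + c)\<^sup>2) * indicator {\<rho>\<^sup>2..} s"]) measurable
 also have "(\<integral>\<^sup>+ s\<in>{0..}. ennreal (c\<^sup>2 / (s + c)\<^sup>2) * indicator {\<rho>\<^sup>2..} s \<partial>lborel)
  = (\<integral>\<^sup>+ s. ennreal (c\<^sup>2 / (s + c)\<^sup>2) * indicator {\<rho>\<^sup>2..} s \<partial>lborel)"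
  by (intro nn_integral_cong) (auto simp: indicator_def order_trans[OF zero_le_power2])
 also have "\<dots> = ennreal (0 - (- c\<^sup>2 / (\<rho>\<^sup>2 + c)))"
 proof (rule nn_integral_FTC_atLeast)
  show "((\<lambda>s. - c\<^sup>2 / (s + c)) has_real_derivative c\<^sup>2 / (s + c)\<^sup>2) (at s)" if "\<rho>\<^sup>2 \<le> s" for s
  proof -
   have "s + c \<noteq> 0" using that c zero_le_power2[of \<rho>] by linarith
   then show ?thesis by (auto intro!: derivative_eq_intros simp: power2_eq_square)
  qed
  show "((\<lambda>s. - c\<^sup>2 / (s + c)) \<longlongrightarrow> 0) at_top" by real_asymp
 qed auto
 finally show ?thesis by (simp add: ennreal_mult'[symmetric])
qed

text \<open>The lower bound on the mass is linear in \<open>c\<close>, the tail beyond a fixed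
  radius at most quadratic: for small \<open>c\<close> the mass concentrates at 0.\<close>

lemma bump_mass:
 assumes c: "0 < c"
 obtains m where "0 < m" "(\<integral>\<^sup>+ v. ennreal (bump c v) \<partial>lborel) = ennreal m" "pi * c * ln (9/8) \<le> m"
proof -
 let ?I = "\<integral>\<^sup>+ v. ennreal (bump c v) \<partial>lborel"
 have "?I = (\<integral>\<^sup>+ v. ennreal (bump c v) * indicator {v. 0 \<le> cmod v} v \<partial>lborel)" by simp
 also have "\<dots> \<le> ennreal (pi * c\<^sup>2 / (0\<^sup>2 + c))" using c by (intro nn_integral_bump_tail) auto
 finally have "?I < \<infinity>" by (rule le_less_trans) simp
 then obtain m where m: "?I = ennreal m" "0 \<le> m" by (cases ?I) auto
 have "ennreal (ln (9/8)) * ennreal (pi * (sqrt c)\<^sup>2) = (\<integral>\<^sup>+ v. ennreal (ln (9/8)) * indicator (cball (0::complex) (sqrt c)) v \<partial>lborel)"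
  using c by (simp add: nn_integral_cmult emeasure_cball_complex)
 also have "\<dots> \<le> ?I"
 proof (intro nn_integral_mono)
  fix v :: complex
  have "(cmod v)\<^sup>2 \<le> c" if "cmod v \<le> sqrt c" using power_mono[OF that, of 2] c by simp
  then show "ennreal (ln (9/8)) * indicator (cball 0 (sqrt c)) v \<le> ennreal (bump c v)"
   using bump_bounds(3)[OF c, of v] by (auto simp: indicator_def intro!: ennreal_leI)
 qed
 finally have "pi * c * ln (9/8) \<le> m" unfolding m using c m(2)
  by (simp add: ennreal_mult'[symmetric] ennreal_le_iff mult_ac)
 moreover have "0 < pi * c * ln (9/8)" using c by simp
 ultimately show ?thesis using that m by auto
qed

text \<open>The kernel \<open>kap\<close> with |x - y|^2 replaced by |x - y|^2 + d. It is finite on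
  the diagonal, so that empirical measures have finite energy, and it increases to
  \<open>kap\<close> as \<open>d\<close> decreases to 0.\<close>

definition reg_log :: "real \<Rightarrow> complex \<Rightarrow> complex \<Rightarrow> real" where
 "reg_log d x y = (ell x + ell y) / 2 - ln ((cmod (x - y))\<^sup>2 + d) / 2"

lemma reg_log_measurable [measurable]: "(\<lambda>(x, y). reg_log d x y) \<in> borel_measurable (borel \<Otimes>\<^sub>M borel)"
 unfolding reg_log_def split_beta' by measurable

lemma reg_log_measurable2 [measurable (raw)]:
 assumes [measurable]: "f \<in> borel_measurable M" "g \<in> borel_measurable M"
 shows "(\<lambda>x. reg_log d (f x) (g x)) \<in> borel_measurable M"
 unfolding reg_log_def by measurable

lemma log_ratio_measurable2 [measurable (raw)]:
 assumes [measurable]: "f \<in> borel_measurable M" "g \<in> borel_measurable M"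
 shows "(\<lambda>x. log_ratio a b (f x) (g x)) \<in> borel_measurable M"
 unfolding log_ratio_def by measurable

section \<open>Energy distance of probability measures\<close>

definition second_moment :: "complex measure \<Rightarrow> bool" where
 "second_moment \<mu> \<longleftrightarrow> prob_space \<mu> \<and> sets \<mu> = sets borel \<and> integrable \<mu> (\<lambda>x. (cmod x)\<^sup>2)"

lemma second_moment_fin: "second_moment \<mu> \<Longrightarrow> fin_borel \<mu>"
 by (auto simp: second_moment_def fin_borel_def prob_space.finite_measure)

text \<open>For symmetric \<open>K\<close>, the quadratic form of \<open>K\<close> on the signed
  measure \<open>\<mu> - \<nu>\<close>, written without signed measures.\<close>

definition energy_dist :: "(complex \<Rightarrow> complex \<Rightarrow> real) \<Rightarrow> complex measure \<Rightarrow> complex measure \<Rightarrow> real" where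
 "energy_dist K \<mu> \<nu> = bil K \<mu> \<mu> - 2 * bil K \<mu> \<nu> + bil K \<nu> \<nu>"

lemma integral_pair_fst_snd:
 fixes f g :: "complex \<Rightarrow> real"
 assumes "prob_space \<mu>" "prob_space \<nu>" "integrable \<mu> f" "integrable \<nu> g"
 shows "integrable (\<mu> \<Otimes>\<^sub>M \<nu>) (\<lambda>p. f (fst p) + g (snd p))"
  and "(\<integral>p. f (fst p) + g (snd p) \<partial>(\<mu> \<Otimes>\<^sub>M \<nu>)) = (\<integral>x. f x \<partial>\<mu>) + (\<integral>x. g x \<partial>\<nu>)"
proof -
 interpret m: prob_space \<mu> by fact
 interpret n: prob_space \<nu> by fact
 interpret pair_prob_space \<mu> \<nu> ..
 have 1: "distr (\<mu> \<Otimes>\<^sub>M \<nu>) \<mu> fst = \<mu>" by (rule n.distr_pair_fst)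
 have 2: "distr (\<mu> \<Otimes>\<^sub>M \<nu>) \<nu> snd = \<nu>" 
 proof (rule measure_eqI)
  fix A assume "A \<in> sets (distr (\<mu> \<Otimes>\<^sub>M \<nu>) \<nu> snd)"
  then have A: "A \<in> sets \<nu>" by simp
  then have "snd -` A \<inter> space (\<mu> \<Otimes>\<^sub>M \<nu>) = space \<mu> \<times> A" using sets.sets_into_space by (auto simp: space_pair_measure)
  then show "emeasure (distr (\<mu> \<Otimes>\<^sub>M \<nu>) \<nu> snd) A = emeasure \<nu> A"
   using A by (simp add: emeasure_distr n.emeasure_pair_measure_Times m.emeasure_space_1)
 qed simp
 have i: "integrable (\<mu> \<Otimes>\<^sub>M \<nu>) (\<lambda>p. f (fst p))" "integrable (\<mu> \<Otimes>\<^sub>M \<nu>) (\<lambda>p. g (snd p))"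
  using assms(3,4) by (intro integrable_distr[of fst "\<mu> \<Otimes>\<^sub>M \<nu>" \<mu>] integrable_distr[of snd "\<mu> \<Otimes>\<^sub>M \<nu>" \<nu>]; simp add: 1 2)+
 have "(\<integral>p. f (fst p) \<partial>(\<mu> \<Otimes>\<^sub>M \<nu>)) = (\<integral>x. f x \<partial>\<mu>)"
  using assms(3) by (subst (2) 1[symmetric], subst integral_distr) auto
 moreover have "(\<integral>p. g (snd p) \<partial>(\<mu> \<Otimes>\<^sub>M \<nu>)) = (\<integral>x. g x \<partial>\<nu>)"
  using assms(4) by (subst (2) 2[symmetric], subst integral_distr) auto
 ultimately show "integrable (\<mu> \<Otimes>\<^sub>M \<nu>) (\<lambda>p. f (fst p) + g (snd p))"
  "(\<integral>p. f (fst p) + g (snd p) \<partial>(\<mu> \<Otimes>\<^sub>M \<nu>)) = (\<integral>x. f x \<partial>\<mu>) + (\<integral>x. g x \<partial>\<nu>)"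
  using i by simp_all
qed

lemma cmod_diff_square_le': "(cmod (x - y))\<^sup>2 \<le> 2 * (cmod x)\<^sup>2 + 2 * (cmod y)\<^sup>2"
proof -
 have "(cmod (x - y))\<^sup>2 \<le> (cmod x + cmod y)\<^sup>2" by (intro power_mono norm_triangle_ineq4) auto
 also have "\<dots> \<le> 2 * (cmod x)\<^sup>2 + 2 * (cmod y)\<^sup>2"
  using sum_squares_bound[of "cmod x" "cmod y"] by (simp add: power2_eq_square algebra_simps)
 finally show ?thesis .
qed

lemma integrable_quadratic_kernel:
 fixes K :: "complex \<Rightarrow> complex \<Rightarrow> real"
 assumes mu: "second_moment \<mu>" "second_moment \<nu>" and K: "(\<lambda>(x, y). K x y) \<in> borel_measurable (borel \<Otimes>\<^sub>M borel)"
  and B: "\<And>x y. \<bar>K x y\<bar> \<le> A + C * ((cmod x)\<^sup>2 + (cmod y)\<^sup>2)"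
 shows "integrable (\<mu> \<Otimes>\<^sub>M \<nu>) (\<lambda>p. K (fst p) (snd p))"
proof -
 interpret m: prob_space \<mu> using mu by (simp add: second_moment_def)
 interpret n: prob_space \<nu> using mu by (simp add: second_moment_def)
 interpret pair_prob_space \<mu> \<nu> ..
 have "(\<lambda>p. K (fst p) (snd p)) \<in> borel_measurable (\<mu> \<Otimes>\<^sub>M \<nu>)"
  using K mu by (subst measurable_cong_sets[OF sets_pair_borel refl]) (auto simp: second_moment_def split_beta')
 moreover have "integrable (\<mu> \<Otimes>\<^sub>M \<nu>) (\<lambda>p. A + C * ((cmod (fst p))\<^sup>2 + (cmod (snd p))\<^sup>2))"
  using integral_pair_fst_snd(1)[OF m.prob_space_axioms n.prob_space_axioms, of "\<lambda>x. (cmod x)\<^sup>2" "\<lambda>x. (cmod x)\<^sup>2"] mu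
  by (intro Bochner_Integration.integrable_add[of _ "\<lambda>_. A"] integrable_mult_right) (simp_all add: second_moment_def)
 moreover have "norm (K (fst p) (snd p)) \<le> norm (A + C * ((cmod (fst p))\<^sup>2 + (cmod (snd p))\<^sup>2))" for p
  using order_trans[OF B[of "fst p" "snd p"] abs_ge_self] by simp
 ultimately show ?thesis
  by (metis (no_types, lifting) AE_I2 Bochner_Integration.integrable_bound)
qed

lemma ln_sum_bound: "0 < (d::real) \<Longrightarrow> 0 \<le> s \<Longrightarrow> \<bar>ln (s + d)\<bar> \<le> s + d + \<bar>ln d\<bar>"
proof -
 assume "0 < d" "0 \<le> s"
 then have "ln d \<le> ln (s + d)" "ln (s + d) \<le> s + d - 1" using ln_le_minus_one[of "s + d"] by auto
 then show ?thesis using \<open>0 < d\<close> \<open>0 \<le> s\<close> by (intro abs_leI) linarith+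
qed

lemma reg_log_bound: 
 assumes "0 < d"
 shows "\<bar>reg_log d x y\<bar> \<le> (d + \<bar>ln d\<bar>) + 2 * ((cmod x)\<^sup>2 + (cmod y)\<^sup>2)"
proof -
 define X Y E F L where "X = (cmod x)\<^sup>2" and "Y = (cmod y)\<^sup>2" and "E = ell x" and "F = ell y" and "L = ln ((cmod (x - y))\<^sup>2 + d)"
 have "L \<le> 2 * X + 2 * Y + d + \<bar>ln d\<bar>" "- L \<le> 2 * X + 2 * Y + d + \<bar>ln d\<bar>" "E \<le> X" "F \<le> Y" "0 \<le> E" "0 \<le> F"
  using ln_sum_bound[OF assms, of "(cmod (x - y))\<^sup>2"] cmod_diff_square_le'[of x y]
  by (auto simp: X_def Y_def E_def F_def L_def ell_le)
 moreover have "0 \<le> \<bar>ln d\<bar>" by simp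
 ultimately have "\<bar>(E + F) / 2 - L / 2\<bar> \<le> (d + \<bar>ln d\<bar>) + 2 * (X + Y)"
  using assms by (intro abs_leI) (simp_all add: field_simps)
 then show ?thesis by (simp add: reg_log_def X_def Y_def E_def F_def L_def)
qed

lemma reg_log_diff: "0 < a \<Longrightarrow> a \<le> b \<Longrightarrow> reg_log a x y = reg_log b x y + log_ratio a b x y / 2"
proof -
 assume "0 < a" "a \<le> b"
 then have "0 < (cmod (x - y))\<^sup>2 + a" "0 < (cmod (x - y))\<^sup>2 + b" by (auto intro: add_nonneg_pos)
 then show ?thesis unfolding reg_log_def log_ratio_def by (simp add: ln_div field_simps)
qed

lemma energy_dist_add:
 assumes "\<And>\<kappa> \<kappa>'. \<kappa> \<in> {\<mu>, \<nu>} \<Longrightarrow> \<kappa>' \<in> {\<mu>, \<nu>} \<Longrightarrow> integrable (\<kappa> \<Otimes>\<^sub>M \<kappa>') (\<lambda>p. K (fst p) (snd p))"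
  and "\<And>\<kappa> \<kappa>'. \<kappa> \<in> {\<mu>, \<nu>} \<Longrightarrow> \<kappa>' \<in> {\<mu>, \<nu>} \<Longrightarrow> integrable (\<kappa> \<Otimes>\<^sub>M \<kappa>') (\<lambda>p. L (fst p) (snd p))"
 shows "energy_dist (\<lambda>x y. K x y + c * L x y) \<mu> \<nu> = energy_dist K \<mu> \<nu> + c * energy_dist L \<mu> \<nu>"
proof -
 have "bil (\<lambda>x y. K x y + c * L x y) \<kappa> \<kappa>' = bil K \<kappa> \<kappa>' + c * bil L \<kappa> \<kappa>'" if "\<kappa> \<in> {\<mu>, \<nu>}" "\<kappa>' \<in> {\<mu>, \<nu>}" for \<kappa> \<kappa>'
  unfolding bil_def using assms(1)[OF that] assms(2)[OF that] by simp
 then show ?thesis by (simp add: energy_dist_def algebra_simps)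
qed

lemma energy_dist_log_ratio_nonneg:
 assumes "0 < a" "a \<le> b" "second_moment \<mu>" "second_moment \<nu>"
 shows "0 \<le> energy_dist (log_ratio a b) \<mu> \<nu>"
 using log_ratio_positive_definite[OF assms(1,2) second_moment_fin[OF assms(3)] second_moment_fin[OF assms(4)] second_moment_fin[OF assms(3)], of 0]
 by (simp add: energy_dist_def)

lemma integrable_log_ratio:
 assumes "0 < a" "a \<le> b" "second_moment \<mu>" "second_moment \<nu>"
 shows "integrable (\<mu> \<Otimes>\<^sub>M \<nu>) (\<lambda>p. log_ratio a b (fst p) (snd p))"
 using assms by (intro integrable_bounded_kernel[OF second_moment_fin second_moment_fin log_ratio_measurable log_ratio_bound])

lemma integrable_reg_log:
 assumes "0 < d" "second_moment \<mu>" "second_moment \<nu>"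
 shows "integrable (\<mu> \<Otimes>\<^sub>M \<nu>) (\<lambda>p. reg_log d (fst p) (snd p))"
 by (rule integrable_quadratic_kernel[OF assms(2,3) reg_log_measurable reg_log_bound[OF assms(1)]])

lemma energy_dist_reg_log_split:
 assumes "0 < a" "a \<le> b" "second_moment \<mu>" "second_moment \<nu>"
 shows "energy_dist (reg_log a) \<mu> \<nu> = energy_dist (reg_log b) \<mu> \<nu> + energy_dist (log_ratio a b) \<mu> \<nu> / 2"
proof -
 have "reg_log a = (\<lambda>x y. reg_log b x y + 1/2 * log_ratio a b x y)"
  using assms by (intro ext) (simp add: reg_log_diff)
 moreover have "energy_dist (\<lambda>x y. reg_log b x y + 1/2 * log_ratio a b x y) \<mu> \<nu> = energy_dist (reg_log b) \<mu> \<nu> + 1/2 * energy_dist (log_ratio a b) \<mu> \<nu>"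
  using assms by (intro energy_dist_add) (auto intro!: integrable_reg_log integrable_log_ratio)
 ultimately show ?thesis by simp
qed

text \<open>Passing from \<open>reg_log b\<close> to \<open>reg_log C\<close> with large
  \<open>C\<close> only removes half of the nonnegative distance for \<open>log_ratio b C\<close>.
  What remains is a sum of functions of one variable, which cancels for two probability measures,
  and a term of order |x - y|^2 / C, which vanishes in the limit by the second moments.\<close>

lemma energy_dist_reg_log_nonneg:
 assumes b: "0 < b" and mu: "second_moment \<mu>" "second_moment \<nu>"
 shows "0 \<le> energy_dist (reg_log b) \<mu> \<nu>"
proof -
 define D where "D = bil (\<lambda>x y. (cmod (x - y))\<^sup>2) \<mu> \<mu> + bil (\<lambda>x y. (cmod (x - y))\<^sup>2) \<nu> \<nu>"
 have D0: "0 \<le> D" unfolding D_def by (intro add_nonneg_nonneg bil_nonneg) auto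
 interpret m: prob_space \<mu> using mu by (simp add: second_moment_def)
 interpret n: prob_space \<nu> using mu by (simp add: second_moment_def)
 have low: "- D / (2 * C) \<le> energy_dist (reg_log b) \<mu> \<nu>" if C: "b \<le> C" for C
 proof -
  have C0: "0 < C" using C b by simp
  \<comment> \<open>\<open>reg_log C = K1 - K2 / 2\<close>: here \<open>K1\<close> is additive and
    contributes no distance, and \<open>K2\<close> is of order 1 / C.\<close>
  define K1 where "K1 x y = (ell x / 2 - ln C / 2) + ell y / 2" for x y :: complex
  define K2 where "K2 x y = ln (1 + (cmod (x - y))\<^sup>2 / C)" for x y :: complex
  have K2b: "0 \<le> K2 x y" "K2 x y \<le> (cmod (x - y))\<^sup>2 / C" for x y
   using C0 by (auto simp: K2_def intro!: ln_add_one_self_le_self)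
  have [measurable]: "(\<lambda>(x, y). K2 x y) \<in> borel_measurable (borel \<Otimes>\<^sub>M borel)"
   unfolding K2_def split_beta' by measurable
  have "reg_log C = (\<lambda>x y. K1 x y + (-1/2) * K2 x y)"
  proof (intro ext)
   fix x y
   have "(cmod (x - y))\<^sup>2 + C = C * (1 + (cmod (x - y))\<^sup>2 / C)" using C0 by (simp add: field_simps)
   moreover have "0 < 1 + (cmod (x - y))\<^sup>2 / C" using C0 by (auto intro: add_pos_nonneg)
   ultimately have "ln ((cmod (x - y))\<^sup>2 + C) = ln C + K2 x y" using C0 by (simp add: ln_mult K2_def)
   then show "reg_log C x y = K1 x y + (-1/2) * K2 x y" by (simp add: reg_log_def K1_def field_simps)
  qed
  moreover have il: "integrable \<kappa> ell" if "second_moment \<kappa>" for \<kappa>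
  proof (rule Bochner_Integration.integrable_bound)
   show "integrable \<kappa> (\<lambda>x. (cmod x)\<^sup>2)" using that by (simp add: second_moment_def)
   show "ell \<in> borel_measurable \<kappa>" using that measurable_cong_sets[of \<kappa> borel "borel :: real measure" borel] ell_measurable by (simp add: second_moment_def)
  qed (auto simp: ell_le)
  have K1i: "integrable (\<kappa> \<Otimes>\<^sub>M \<kappa>') (\<lambda>p. K1 (fst p) (snd p))"
    "bil K1 \<kappa> \<kappa>' = ((\<integral>x. ell x \<partial>\<kappa>) / 2 - ln C / 2) + (\<integral>x. ell x \<partial>\<kappa>') / 2" if "second_moment \<kappa>" "second_moment \<kappa>'" for \<kappa> \<kappa>'
  proof -
   interpret k: prob_space \<kappa> using that by (simp add: second_moment_def)
   interpret k': prob_space \<kappa>' using that by (simp add: second_moment_def)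
   have "integrable \<kappa> (\<lambda>x. ell x / 2 - ln C / 2)" "integrable \<kappa>' (\<lambda>x. ell x / 2)"
    using il that by auto
   from integral_pair_fst_snd[OF k.prob_space_axioms k'.prob_space_axioms this]
   show "integrable (\<kappa> \<Otimes>\<^sub>M \<kappa>') (\<lambda>p. K1 (fst p) (snd p))"
    "bil K1 \<kappa> \<kappa>' = ((\<integral>x. ell x \<partial>\<kappa>) / 2 - ln C / 2) + (\<integral>x. ell x \<partial>\<kappa>') / 2"
    using il that by (simp_all add: K1_def bil_def k.prob_space)
  qed
  have K2i: "integrable (\<kappa> \<Otimes>\<^sub>M \<kappa>') (\<lambda>p. K2 (fst p) (snd p))" if "second_moment \<kappa>" "second_moment \<kappa>'" for \<kappa> \<kappa>'
  proof (rule integrable_quadratic_kernel[OF that])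
   show "\<bar>K2 x y\<bar> \<le> 0 + (2 / C) * ((cmod x)\<^sup>2 + (cmod y)\<^sup>2)" for x y
   proof -
    have "(cmod (x - y))\<^sup>2 / C \<le> (2 * (cmod x)\<^sup>2 + 2 * (cmod y)\<^sup>2) / C" using C0 cmod_diff_square_le' by (intro divide_right_mono) auto
    with K2b[of x y] show ?thesis by (simp add: add_divide_distrib distrib_left)
   qed
  qed measurable
  have "energy_dist (\<lambda>x y. K1 x y + (-1/2) * K2 x y) \<mu> \<nu> = energy_dist K1 \<mu> \<nu> + (-1/2) * energy_dist K2 \<mu> \<nu>"
   using mu by (intro energy_dist_add) (auto intro!: K1i K2i)
  moreover have "energy_dist K1 \<mu> \<nu> = 0" using mu by (simp add: energy_dist_def K1i)
  moreover have "bil K2 \<kappa> \<kappa> \<le> bil (\<lambda>x y. (cmod (x - y))\<^sup>2) \<kappa> \<kappa> / C" if "second_moment \<kappa>" for \<kappa>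
  proof -
   have id: "integrable (\<kappa> \<Otimes>\<^sub>M \<kappa>) (\<lambda>p. (cmod (fst p - snd p))\<^sup>2)"
   proof (rule integrable_quadratic_kernel[OF that that, of "\<lambda>x y. (cmod (x - y))\<^sup>2" 0 2])
    show "\<bar>(cmod (x - y))\<^sup>2\<bar> \<le> 0 + 2 * ((cmod x)\<^sup>2 + (cmod y)\<^sup>2)" for x y
     using cmod_diff_square_le'[of x y] by simp
   qed measurable
   have "bil K2 \<kappa> \<kappa> \<le> (\<integral>p. (cmod (fst p - snd p))\<^sup>2 / C \<partial>(\<kappa> \<Otimes>\<^sub>M \<kappa>))"
    unfolding bil_def using K2i that id K2b(2) by (intro integral_mono) auto
   then show ?thesis by (simp add: bil_def)
  qed
  from this[OF mu(1)] this[OF mu(2)] have "bil K2 \<mu> \<mu> + bil K2 \<nu> \<nu> \<le> D / C" by (simp add: D_def add_divide_distrib)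
  moreover have "0 \<le> bil K2 \<mu> \<nu>" by (intro bil_nonneg K2b)
  ultimately have "- D / (2 * C) \<le> energy_dist (reg_log C) \<mu> \<nu>"
   by (simp add: energy_dist_def field_simps)
  also have "\<dots> \<le> energy_dist (reg_log b) \<mu> \<nu>"
   using energy_dist_reg_log_split[OF b C mu] energy_dist_log_ratio_nonneg[OF b C mu] by simp
  finally show ?thesis .
 qed
 show ?thesis
 proof (rule tendsto_upperbound[where f="\<lambda>C. - D / (2 * C)" and F=at_top])
  show "((\<lambda>C. - D / (2 * C)) \<longlongrightarrow> 0) at_top" by real_asymp
  show "\<forall>\<^sub>F C in at_top. - D / (2 * C) \<le> energy_dist (reg_log b) \<mu> \<nu>"
   using eventually_ge_at_top[of b] by eventually_elim (rule low)
 qed simp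
qed

section \<open>Integrals of test functions from the energy distance\<close>

lemma continuous_compact_support:
 fixes \<phi> :: "complex \<Rightarrow> real"
 assumes c: "continuous_on UNIV \<phi>" and supp: "\<And>x. R < cmod x \<Longrightarrow> \<phi> x = 0"
 shows "\<exists>B>0. \<forall>x. \<bar>\<phi> x\<bar> \<le> B" "0 < e \<Longrightarrow> \<exists>\<rho>>0. \<forall>x y. cmod (x - y) < \<rho> \<longrightarrow> \<bar>\<phi> x - \<phi> y\<bar> \<le> e"
proof -
 have "compact (\<phi> ` cball 0 R)" using c by (intro compact_continuous_image) (auto intro: continuous_on_subset)
 then obtain B where B: "\<And>x. x \<in> cball 0 R \<Longrightarrow> \<bar>\<phi> x\<bar> \<le> B" using compact_imp_bounded by (fastforce simp: bounded_iff)
 have "\<bar>\<phi> x\<bar> \<le> max B 1" for x using B[of x] supp[of x] by (cases "R < cmod x") auto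
 then show "\<exists>B>0. \<forall>x. \<bar>\<phi> x\<bar> \<le> B" by (intro exI[of _ "max B 1"]) auto
 assume "0 < e"
 from uniform_close_on_balls[OF c this, of R] obtain r where r: "r > 0" "r \<le> 1" 
  "\<And>z u. z \<in> cball 0 R \<Longrightarrow> u \<in> ball z r \<Longrightarrow> \<bar>\<phi> u - \<phi> z\<bar> \<le> e" by blast
 have "\<bar>\<phi> x - \<phi> y\<bar> \<le> e" if "cmod (x - y) < r" for x y
 proof -
  consider "x \<in> cball 0 R" | "y \<in> cball 0 R" | "R < cmod x" "R < cmod y" by fastforce
  then show ?thesis
  proof cases
   case 1 then show ?thesis using r(3)[of x y] that by (auto simp: dist_norm abs_minus_commute)
  next
   case 2 then show ?thesis using r(3)[of y x] that by (auto simp: dist_norm norm_minus_commute)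
  next
   case 3 then show ?thesis using supp \<open>0 < e\<close> by simp
  qed
 qed
 then show "\<exists>\<rho>>0. \<forall>x y. cmod (x - y) < \<rho> \<longrightarrow> \<bar>\<phi> x - \<phi> y\<bar> \<le> e" using r(1) by blast
qed

lemma log_ratio_translate: "log_ratio a b x y = log_ratio a b (x - y) 0"
 by (simp add: log_ratio_def)

lemma bil_log_ratio_commute:
 assumes "0 < a" "a \<le> b" "fin_borel \<mu>" "fin_borel \<nu>"
 shows "bil (log_ratio a b) \<mu> \<nu> = bil (log_ratio a b) \<nu> \<mu>"
proof -
 have "ennreal (bil (log_ratio a b) \<mu> \<nu>) = ennreal (bil (log_ratio a b) \<nu> \<mu>)"
  using assms by (simp add: nn_bil_feature mult.commute)
 then show ?thesis
  using assms by (subst (asm) ennreal_inj) (auto intro!: bil_nonneg log_ratio_nonneg)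
qed

lemma bil_density_bump:
 fixes \<phi> :: "complex \<Rightarrow> real"
 assumes c: "0 < c" and \<kappa>: "second_moment \<kappa>" and fin: "fin_borel (density lborel (\<lambda>x. ennreal (\<phi> x)))"
  and \<phi> [measurable]: "\<phi> \<in> borel_measurable borel" "\<And>x. 0 \<le> \<phi> x"
 shows "bil (log_ratio c (2 * c)) \<kappa> (density lborel (\<lambda>x. ennreal (\<phi> x))) - bil (log_ratio (2 * c) (3 * c)) \<kappa> (density lborel (\<lambda>x. ennreal (\<phi> x)))
  = (\<integral>x. (\<integral>u. bump c (x - u) * \<phi> u \<partial>lborel) \<partial>\<kappa>)"
  and "integrable \<kappa> (\<lambda>x. \<integral>u. bump c (x - u) * \<phi> u \<partial>lborel)"
proof -
 let ?\<gamma> = "density lborel (\<lambda>x. ennreal (\<phi> x))"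
 interpret k: prob_space \<kappa> using \<kappa> by (simp add: second_moment_def)
 interpret g: finite_measure ?\<gamma> using fin by (simp add: fin_borel_def)
 interpret pair_sigma_finite \<kappa> ?\<gamma> ..
 have i: "integrable (\<kappa> \<Otimes>\<^sub>M ?\<gamma>) (\<lambda>p. log_ratio a b (fst p) (snd p))" if "0 < a" "a \<le> b" for a b
  using that by (intro integrable_bounded_kernel[OF second_moment_fin[OF \<kappa>] fin log_ratio_measurable log_ratio_bound])
 have i': "integrable (\<kappa> \<Otimes>\<^sub>M ?\<gamma>) (\<lambda>p. bump c (fst p - snd p))"
  using i[of c "2 * c"] i[of "2 * c" "3 * c"] c unfolding bump_def log_ratio_translate[symmetric]
  by (intro Bochner_Integration.integrable_diff) auto
 have eq: "(\<integral>u. bump c (x - u) \<partial>?\<gamma>) = (\<integral>u. bump c (x - u) * \<phi> u \<partial>lborel)" for x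
  by (subst integral_density) (auto simp: \<phi>(2) mult.commute)
 have "bil (log_ratio c (2 * c)) \<kappa> ?\<gamma> - bil (log_ratio (2 * c) (3 * c)) \<kappa> ?\<gamma>
  = (\<integral>p. bump c (fst p - snd p) \<partial>(\<kappa> \<Otimes>\<^sub>M ?\<gamma>))"
  using i[of c "2 * c"] i[of "2 * c" "3 * c"] c unfolding bump_def log_ratio_translate[symmetric] bil_def
  by (intro Bochner_Integration.integral_diff[symmetric]) auto
 also have "\<dots> = (\<integral>x. (\<integral>u. bump c (x - u) \<partial>?\<gamma>) \<partial>\<kappa>)"
  using integral_fst'[OF i'] by simp
 finally show "bil (log_ratio c (2 * c)) \<kappa> ?\<gamma> - bil (log_ratio (2 * c) (3 * c)) \<kappa> ?\<gamma>
  = (\<integral>x. (\<integral>u. bump c (x - u) * \<phi> u \<partial>lborel) \<partial>\<kappa>)" by (simp add: eq)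
 show "integrable \<kappa> (\<lambda>x. \<integral>u. bump c (x - u) * \<phi> u \<partial>lborel)"
  using integrable_fst'[OF i'] by (simp add: eq)
qed

lemma fin_borel_density:
 fixes \<phi> :: "complex \<Rightarrow> real"
 assumes c: "continuous_on UNIV \<phi>" and supp: "\<And>x. R < cmod x \<Longrightarrow> \<phi> x = 0"
 shows "fin_borel (density lborel (\<lambda>x. ennreal (\<phi> x)))"
proof -
 have [measurable]: "\<phi> \<in> borel_measurable borel" by (rule borel_measurable_continuous_onI[OF c])
 obtain B where B: "B > 0" "\<And>x. \<bar>\<phi> x\<bar> \<le> B" using continuous_compact_support(1)[OF c supp] by blast
 have "(\<integral>\<^sup>+ x. ennreal (\<phi> x) \<partial>lborel) \<le> (\<integral>\<^sup>+ x. ennreal B * indicator (cball (0::complex) (max R 0)) x \<partial>lborel)"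
  using B supp by (intro nn_integral_mono) (auto simp: indicator_def abs_le_iff not_le intro!: ennreal_leI)
 also have "\<dots> < \<infinity>" by (simp add: nn_integral_cmult emeasure_cball_complex ennreal_mult_less_top)
 finally show ?thesis
  unfolding fin_borel_def by (auto intro!: finite_measureI simp: emeasure_density)
qed

text \<open>Pairing \<open>\<mu> - \<nu>\<close> with the measure of density \<open>\<phi>\<close>
  through the two kernels in \<open>bump c\<close> is controlled by a Cauchy--Schwarz argument for
  their forms. The difference of the two pairings integrates the convolution of
  \<open>bump c\<close> with \<open>\<phi>\<close>, which is \<open>m * \<phi>\<close> up to a small
  error. The thresholds depend neither on the measures nor on \<open>\<delta>\<close>, which is
  chosen only when the lemma is applied.\<close>

lemma close_of_energy_dist_pos:
 fixes \<phi> :: "complex \<Rightarrow> real"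
 assumes c\<phi>: "continuous_on UNIV \<phi>" and supp: "\<And>x. R < cmod x \<Longrightarrow> \<phi> x = 0" and pos: "\<And>x. 0 \<le> \<phi> x" and e: "0 < e"
 shows "\<exists>\<theta>>0. \<exists>c>0. \<forall>\<mu> \<nu> \<delta>. second_moment \<mu> \<longrightarrow> second_moment \<nu> \<longrightarrow> 0 < \<delta> \<longrightarrow> \<delta> \<le> c \<longrightarrow> energy_dist (reg_log \<delta>) \<mu> \<nu> \<le> \<theta> \<longrightarrow>
   \<bar>(\<integral>x. \<phi> x \<partial>\<mu>) - (\<integral>x. \<phi> x \<partial>\<nu>)\<bar> \<le> e"
proof -
 have [measurable]: "\<phi> \<in> borel_measurable borel" by (rule borel_measurable_continuous_onI[OF c\<phi>])
 obtain B where B: "B > 0" "\<And>x. \<bar>\<phi> x\<bar> \<le> B" using continuous_compact_support(1)[OF c\<phi> supp] by blast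
 obtain \<rho> where \<rho>: "\<rho> > 0" "\<And>x y. cmod (x - y) < \<rho> \<Longrightarrow> \<bar>\<phi> x - \<phi> y\<bar> \<le> e / 8"
  using continuous_compact_support(2)[OF c\<phi> supp, of R "e / 8"] e by auto
 \<comment> \<open>Solves \<open>e / 8 + 2 * B * \<tau> = e / 4\<close>, the error in
   \<open>approximate_identity\<close>.\<close>
 define \<tau> where "\<tau> = e / (16 * B)"
 have \<tau>: "0 < \<tau>" using B e by (simp add: \<tau>_def)
 \<comment> \<open>Makes the tail bound \<open>pi * c\<^sup>2 / \<rho>\<^sup>2\<close> equal to
   \<open>\<tau>\<close> times the lower bound \<open>pi * c * ln (9/8)\<close> for the
   mass.\<close>
 define c where "c = \<tau> * \<rho>\<^sup>2 * ln (9/8)"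
 have c: "0 < c" using \<tau> \<rho> by (simp add: c_def)
 obtain m where m: "0 < m" "(\<integral>\<^sup>+ v. ennreal (bump c v) \<partial>lborel) = ennreal m" "pi * c * ln (9/8) \<le> m"
  using bump_mass[OF c] .
 have tail: "(\<integral>\<^sup>+ v. ennreal (bump c v) * indicator {v. \<rho> \<le> cmod v} v \<partial>lborel) \<le> ennreal (\<tau> * m)"
 proof (rule order_trans[OF nn_integral_bump_tail[OF c]])
  have "pi * c\<^sup>2 / (\<rho>\<^sup>2 + c) \<le> pi * c\<^sup>2 / \<rho>\<^sup>2" using \<rho> c by (intro divide_left_mono mult_pos_pos) (auto intro: add_pos_pos)
  also have "\<dots> = \<tau> * (pi * c * ln (9/8))" using \<rho> by (simp add: c_def power2_eq_square field_simps)
  also have "\<dots> \<le> \<tau> * m" using m \<tau> by (intro mult_left_mono) auto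
  finally show "ennreal (pi * c\<^sup>2 / (\<rho>\<^sup>2 + c)) \<le> ennreal (\<tau> * m)" by (rule ennreal_leI)
 qed (use \<rho> in auto)
 have smooth: "\<bar>(\<integral>u. bump c (x - u) * \<phi> u \<partial>lborel) - m * \<phi> x\<bar> \<le> m * (e / 4)" for x
 proof -
  have "e / 8 + 2 * B * \<tau> = e / 4" using B by (simp add: \<tau>_def)
  with approximate_identity(1)[of "bump c" \<phi> m \<rho> \<tau> B "e / 8" x, OF _ _ bump_bounds(1)[OF c] m(2) _ tail _ B(2) \<rho>(2)] m \<tau> e
  show ?thesis by simp
 qed
 define \<gamma> where "\<gamma> = density lborel (\<lambda>x. ennreal (\<phi> x))"
 have fin\<gamma>: "fin_borel \<gamma>" unfolding \<gamma>_def by (rule fin_borel_density[OF c\<phi> supp])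
 define G where "G = bil (log_ratio c (2 * c)) \<gamma> \<gamma> + bil (log_ratio (2 * c) (3 * c)) \<gamma> \<gamma>"
 have G: "0 \<le> G" "bil (log_ratio c (2 * c)) \<gamma> \<gamma> \<le> G" "bil (log_ratio (2 * c) (3 * c)) \<gamma> \<gamma> \<le> G"
  unfolding G_def using c by (auto intro!: bil_nonneg log_ratio_nonneg add_nonneg_nonneg)
 \<comment> \<open>The free parameter of \<open>log_ratio_positive_definite\<close>, small enough
   for the quadratic term: \<open>l * G \<le> m * e / 4\<close>. The 1 keeps the denominator
   positive.\<close>
 define l where "l = m * e / 4 / (G + 1)"
 have l: "0 < l" using m e G by (simp add: l_def)
 have lG: "l * G \<le> m * e / 4"
 proof -
  have "l * G \<le> l * (G + 1)" using l by simp
  also have "\<dots> = m * e / 4"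
  proof -
   have "G + 1 \<noteq> 0" using G(1) by linarith
   from iffD1[OF nonzero_eq_divide_eq[OF this] refl] show ?thesis unfolding l_def .
  qed
  finally show ?thesis .
 qed
 \<comment> \<open>After division by \<open>l\<close>, the energy term \<open>2 * \<theta>\<close>
   also amounts to \<open>m * e / 4\<close>.\<close>
 define \<theta> where "\<theta> = l * m * e / 8"
 have \<theta>: "0 < \<theta>" using l m e by (simp add: \<theta>_def)
 have "\<bar>(\<integral>x. \<phi> x \<partial>\<mu>) - (\<integral>x. \<phi> x \<partial>\<nu>)\<bar> \<le> e"
  if mu: "second_moment \<mu>" "second_moment \<nu>" and \<delta>: "0 < \<delta>" "\<delta> \<le> c" and E: "energy_dist (reg_log \<delta>) \<mu> \<nu> \<le> \<theta>" for \<mu> \<nu> \<delta>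
 proof -
  \<comment> \<open>The distance for \<open>reg_log \<delta>\<close> telescopes into that for
    \<open>reg_log b\<close> and halves of those for \<open>log_ratio \<delta> a\<close> and
    \<open>log_ratio a b\<close>, all of them nonnegative.\<close>
  have El: "energy_dist (log_ratio a b) \<mu> \<nu> \<le> 2 * \<theta>" if "c \<le> a" "a \<le> b" for a b
  proof -
   have "energy_dist (reg_log b) \<mu> \<nu> + energy_dist (log_ratio a b) \<mu> \<nu> / 2 + energy_dist (log_ratio \<delta> a) \<mu> \<nu> / 2 \<le> \<theta>"
    using energy_dist_reg_log_split[of a b \<mu> \<nu>] energy_dist_reg_log_split[of \<delta> a \<mu> \<nu>] E mu \<delta> c that by simp
   moreover have "0 \<le> energy_dist (reg_log b) \<mu> \<nu>" "0 \<le> energy_dist (log_ratio \<delta> a) \<mu> \<nu>"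
    using energy_dist_reg_log_nonneg[of b \<mu> \<nu>] energy_dist_log_ratio_nonneg[of \<delta> a \<mu> \<nu>] mu \<delta> c that by auto
   ultimately show ?thesis by simp
  qed
  have D: "\<bar>bil (log_ratio a b) \<mu> \<gamma> - bil (log_ratio a b) \<nu> \<gamma>\<bar> \<le> m * e / 4" 
   if ab: "c \<le> a" "a \<le> b" and Gab: "bil (log_ratio a b) \<gamma> \<gamma> \<le> G" for a b
  proof -
   let ?B = "bil (log_ratio a b)"
   note fin = second_moment_fin[OF mu(1)] second_moment_fin[OF mu(2)]
   have a: "0 < a" using ab c by simp
   have "2 * ?B \<mu> \<nu> + 2 * l * ?B \<nu> \<gamma> \<le> ?B \<mu> \<mu> + ?B \<nu> \<nu> + 2 * l * ?B \<mu> \<gamma> + l\<^sup>2 * ?B \<gamma> \<gamma>"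
    using log_ratio_positive_definite[OF a ab(2) fin fin\<gamma>] l by simp
   \<comment> \<open>Exchanging \<open>\<mu>\<close> and \<open>\<nu>\<close> gives the other sign
     of the difference.\<close>
   moreover have "2 * ?B \<nu> \<mu> + 2 * l * ?B \<mu> \<gamma> \<le> ?B \<nu> \<nu> + ?B \<mu> \<mu> + 2 * l * ?B \<nu> \<gamma> + l\<^sup>2 * ?B \<gamma> \<gamma>"
    using log_ratio_positive_definite[OF a ab(2) fin(2,1) fin\<gamma>] l by simp
   moreover have "?B \<nu> \<mu> = ?B \<mu> \<nu>" using bil_log_ratio_commute[OF a ab(2) fin(2,1)] .
   ultimately have "2 * l * \<bar>?B \<mu> \<gamma> - ?B \<nu> \<gamma>\<bar> \<le> energy_dist (log_ratio a b) \<mu> \<nu> + l\<^sup>2 * ?B \<gamma> \<gamma>"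
    unfolding energy_dist_def by (cases "?B \<mu> \<gamma> \<ge> ?B \<nu> \<gamma>") (auto simp: algebra_simps)
   also have "\<dots> \<le> 2 * \<theta> + l\<^sup>2 * G"
    using El[OF ab] Gab by (intro add_mono mult_left_mono) auto
   also have "\<dots> = l * (m * e / 4 + l * G)" by (simp add: \<theta>_def power2_eq_square algebra_simps)
   also have "\<dots> \<le> l * (m * e / 4 + m * e / 4)" using lG l by (intro mult_left_mono add_left_mono) auto
   finally have "l * (2 * \<bar>?B \<mu> \<gamma> - ?B \<nu> \<gamma>\<bar>) \<le> l * (m * e / 2)" by (simp add: algebra_simps)
   then show ?thesis using l by simp
  qed
  have D': "\<bar>(\<integral>x. (\<integral>u. bump c (x - u) * \<phi> u \<partial>lborel) \<partial>\<mu>) - (\<integral>x. (\<integral>u. bump c (x - u) * \<phi> u \<partial>lborel) \<partial>\<nu>)\<bar> \<le> m * e / 2"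
  proof -
   have aux: "\<bar>a - b\<bar> \<le> K / 4 \<Longrightarrow> \<bar>c - d\<bar> \<le> K / 4 \<Longrightarrow> \<bar>a - c - (b - d)\<bar> \<le> K / 2" for a b c d K :: real by linarith
   have eq: "(\<integral>x. (\<integral>u. bump c (x - u) * \<phi> u \<partial>lborel) \<partial>\<kappa>) = bil (log_ratio c (2 * c)) \<kappa> \<gamma> - bil (log_ratio (2 * c) (3 * c)) \<kappa> \<gamma>"
    if "second_moment \<kappa>" for \<kappa>
    unfolding \<gamma>_def using bil_density_bump(1)[OF c that fin\<gamma>[unfolded \<gamma>_def]] pos by simp
   show ?thesis unfolding eq[OF mu(1)] eq[OF mu(2)]
    using D[of c "2 * c"] D[of "2 * c" "3 * c"] G(2,3) c by (intro aux) auto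
  qed
  have S: "\<bar>(\<integral>x. (\<integral>u. bump c (x - u) * \<phi> u \<partial>lborel) \<partial>\<kappa>) - m * (\<integral>x. \<phi> x \<partial>\<kappa>)\<bar> \<le> m * (e / 4)" if "second_moment \<kappa>" for \<kappa>
  proof -
   interpret k: prob_space \<kappa> using that by (simp add: second_moment_def)
   have "\<phi> \<in> borel_measurable \<kappa>" using that measurable_cong_sets[of \<kappa> borel "borel :: real measure" borel] by (simp add: second_moment_def)
   then have i\<phi>: "integrable \<kappa> \<phi>" using B by (intro k.integrable_const_bound[of _ B]) auto
   have ib: "integrable \<kappa> (\<lambda>x. \<integral>u. bump c (x - u) * \<phi> u \<partial>lborel)"
    using bil_density_bump(2)[OF c that fin\<gamma>[unfolded \<gamma>_def]] pos by simp
   have "(\<integral>x. (\<integral>u. bump c (x - u) * \<phi> u \<partial>lborel) \<partial>\<kappa>) - m * (\<integral>x. \<phi> x \<partial>\<kappa>)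
    = (\<integral>x. (\<integral>u. bump c (x - u) * \<phi> u \<partial>lborel) - m * \<phi> x \<partial>\<kappa>)"
    using i\<phi> ib by simp
   also have "\<bar>\<dots>\<bar> \<le> (\<integral>x. m * (e / 4) \<partial>\<kappa>)"
    using i\<phi> ib smooth by (intro order_trans[OF integral_abs_bound integral_mono]) auto
   finally show ?thesis by (simp add: k.prob_space)
  qed
  have "m * \<bar>(\<integral>x. \<phi> x \<partial>\<mu>) - (\<integral>x. \<phi> x \<partial>\<nu>)\<bar> = \<bar>m * (\<integral>x. \<phi> x \<partial>\<mu>) - m * (\<integral>x. \<phi> x \<partial>\<nu>)\<bar>"
   using m by (simp add: abs_mult right_diff_distrib[symmetric])
  also have "\<dots> \<le> m * e"
  proof -
   have aux: "\<bar>a - b\<bar> \<le> K / 2 \<Longrightarrow> \<bar>a - c\<bar> \<le> K / 4 \<Longrightarrow> \<bar>b - d\<bar> \<le> K / 4 \<Longrightarrow> \<bar>c - d\<bar> \<le> K" for a b c d K :: real by linarith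
   from D' S[OF mu(1)] S[OF mu(2)] show ?thesis by (intro aux[of _ _ "m * e"]) simp_all
  qed
  finally show ?thesis using m by simp
 qed
 then show ?thesis using \<theta> c by blast
qed

text \<open>A density has to be nonnegative, hence the positive and the negative part of
  \<open>\<phi>\<close> are treated separately.\<close>

lemma close_of_energy_dist:
 fixes \<phi> :: "complex \<Rightarrow> real"
 assumes c\<phi>: "continuous_on UNIV \<phi>" and supp: "\<And>x. R < cmod x \<Longrightarrow> \<phi> x = 0" and e: "0 < e"
 shows "\<exists>\<theta>>0. \<exists>c>0. \<forall>\<mu> \<nu> \<delta>. second_moment \<mu> \<longrightarrow> second_moment \<nu> \<longrightarrow> 0 < \<delta> \<longrightarrow> \<delta> \<le> c \<longrightarrow> energy_dist (reg_log \<delta>) \<mu> \<nu> \<le> \<theta> \<longrightarrow>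
   \<bar>(\<integral>x. \<phi> x \<partial>\<mu>) - (\<integral>x. \<phi> x \<partial>\<nu>)\<bar> \<le> e"
proof -
 let ?p = "\<lambda>x. max (\<phi> x) 0" and ?n = "\<lambda>x. max (- \<phi> x) 0"
 have c: "continuous_on UNIV ?p" "continuous_on UNIV ?n" using c\<phi> by (auto intro!: continuous_intros)
 obtain \<theta>1 c1 where 1: "\<theta>1 > 0" "c1 > 0" "\<And>\<mu> \<nu> \<delta>. second_moment \<mu> \<Longrightarrow> second_moment \<nu> \<Longrightarrow> 0 < \<delta> \<Longrightarrow> \<delta> \<le> c1 \<Longrightarrow> energy_dist (reg_log \<delta>) \<mu> \<nu> \<le> \<theta>1 \<Longrightarrow>
   \<bar>(\<integral>x. ?p x \<partial>\<mu>) - (\<integral>x. ?p x \<partial>\<nu>)\<bar> \<le> e / 2"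
  using close_of_energy_dist_pos[OF c(1), of R "e / 2"] supp e by auto
 obtain \<theta>2 c2 where 2: "\<theta>2 > 0" "c2 > 0" "\<And>\<mu> \<nu> \<delta>. second_moment \<mu> \<Longrightarrow> second_moment \<nu> \<Longrightarrow> 0 < \<delta> \<Longrightarrow> \<delta> \<le> c2 \<Longrightarrow> energy_dist (reg_log \<delta>) \<mu> \<nu> \<le> \<theta>2 \<Longrightarrow>
   \<bar>(\<integral>x. ?n x \<partial>\<mu>) - (\<integral>x. ?n x \<partial>\<nu>)\<bar> \<le> e / 2"
  using close_of_energy_dist_pos[OF c(2), of R "e / 2"] supp e by auto
 obtain B where B: "B > 0" "\<And>x. \<bar>\<phi> x\<bar> \<le> B" using continuous_compact_support(1)[OF c\<phi> supp] by blast
 have spl: "(\<integral>x. \<phi> x \<partial>\<kappa>) = (\<integral>x. ?p x \<partial>\<kappa>) - (\<integral>x. ?n x \<partial>\<kappa>)" if "second_moment \<kappa>" for \<kappa>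
 proof -
  interpret k: prob_space \<kappa> using that by (simp add: second_moment_def)
  have m: "f \<in> borel_measurable \<kappa>" if "continuous_on UNIV f" for f :: "complex \<Rightarrow> real"
   using \<open>second_moment \<kappa>\<close> measurable_cong_sets[of \<kappa> borel "borel :: real measure" borel] borel_measurable_continuous_onI[OF that] by (simp add: second_moment_def)
  have b: "norm (?p x) \<le> B" "norm (?n x) \<le> B" for x using B(1) B(2)[of x] by auto
  have "integrable \<kappa> ?p" "integrable \<kappa> ?n"
   using k.integrable_const_bound[OF AE_I2[OF b(1)] m[OF c(1)]] k.integrable_const_bound[OF AE_I2[OF b(2)] m[OF c(2)]] .
  then have "(\<integral>x. ?p x \<partial>\<kappa>) - (\<integral>x. ?n x \<partial>\<kappa>) = (\<integral>x. ?p x - ?n x \<partial>\<kappa>)" by simp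
  also have "(\<lambda>x. ?p x - ?n x) = \<phi>" by (auto simp: max_def)
  finally show ?thesis by simp
 qed
 have "\<bar>(\<integral>x. \<phi> x \<partial>\<mu>) - (\<integral>x. \<phi> x \<partial>\<nu>)\<bar> \<le> e"
  if "second_moment \<mu>" "second_moment \<nu>" "0 < \<delta>" "\<delta> \<le> min c1 c2" "energy_dist (reg_log \<delta>) \<mu> \<nu> \<le> min \<theta>1 \<theta>2" for \<mu> \<nu> \<delta>
 proof -
  have "\<bar>a - b\<bar> \<le> e / 2 \<Longrightarrow> \<bar>c - d\<bar> \<le> e / 2 \<Longrightarrow> \<bar>a - c - (b - d)\<bar> \<le> e" for a b c d :: real by linarith
  then show ?thesis
   unfolding spl[OF that(1)] spl[OF that(2)] using 1(3)[of \<mu> \<nu> \<delta>] 2(3)[of \<mu> \<nu> \<delta>] that by simp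
 qed
 then show ?thesis using 1 2 by (intro exI[of _ "min \<theta>1 \<theta>2"] conjI exI[of _ "min c1 c2"]) auto
qed

section \<open>The Euler--Lagrange inequality\<close>

lemma ennreal_liminf_add_le: 
 fixes f g :: "nat \<Rightarrow> ennreal"
 shows "liminf f + liminf g \<le> liminf (\<lambda>n. f n + g n)"
proof -
 have "incseq (\<lambda>n. INF m\<in>{n..}. h m)" for h :: "nat \<Rightarrow> ennreal"
  by (auto simp: incseq_def intro!: INF_superset_mono)
 then have "liminf f + liminf g = (SUP n. (INF m\<in>{n..}. f m) + (INF m\<in>{n..}. g m))"
  unfolding liminf_SUP_INF by (intro ennreal_SUP_add[symmetric])
 also have "\<dots> \<le> liminf (\<lambda>n. f n + g n)"
  unfolding liminf_SUP_INF by (intro SUP_mono' INF_greatest add_mono INF_lower)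
 finally show ?thesis .
qed

lemma nn_integral_kap_sym:
 assumes "sigma_finite_measure \<mu>" "sigma_finite_measure \<nu>" and [measurable_cong]: "sets \<mu> = sets borel" "sets \<nu> = sets borel"
 shows "(\<integral>\<^sup>+ x. \<integral>\<^sup>+ y. kap x y \<partial>\<nu> \<partial>\<mu>) = (\<integral>\<^sup>+ y. \<integral>\<^sup>+ x. kap y x \<partial>\<mu> \<partial>\<nu>)"
proof -
 interpret pair_sigma_finite \<nu> \<mu> using assms(1,2) by (simp add: pair_sigma_finite_def)
 have "(\<integral>\<^sup>+ x. \<integral>\<^sup>+ y. kap x y \<partial>\<nu> \<partial>\<mu>) = (\<integral>\<^sup>+ x. \<integral>\<^sup>+ y. kap y x \<partial>\<nu> \<partial>\<mu>)" by (simp add: kap_sym)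
 also have "\<dots> = (\<integral>\<^sup>+ y. \<integral>\<^sup>+ x. kap y x \<partial>\<mu> \<partial>\<nu>)" by (rule Fubini') measurable
 finally show ?thesis .
qed

lemma kap_measurable2 [measurable (raw)]:
 assumes [measurable]: "f \<in> borel_measurable M" "g \<in> borel_measurable M"
 shows "(\<lambda>x. kap (f x) (g x)) \<in> borel_measurable M"
 using measurable_compose[OF measurable_Pair[OF assms] kap_measurable] by simp

definition kap_energy :: "complex measure \<Rightarrow> ennreal" where
 "kap_energy \<mu> = (\<integral>\<^sup>+ z. \<integral>\<^sup>+ w. kap z w \<partial>\<mu> \<partial>\<mu>)"

lemma kap_le: "kap z w \<le> ennreal ((ell z + ell w) / 2) + ennreal (1 / cmod (z - w))" if "z \<noteq> w"
proof -
 have "- ln (cmod (z - w)) = ln (1 / cmod (z - w))" using that by (simp add: ln_div)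
 also have "\<dots> \<le> 1 / cmod (z - w)" using that by (intro ln_bound) simp
 finally have "(ell z + ell w) / 2 - ln (cmod (z - w)) \<le> (ell z + ell w) / 2 + 1 / cmod (z - w)" by simp
 then show ?thesis using that by (simp add: kap_def ennreal_plus[symmetric] ennreal_leI del: ennreal_plus)
qed

lemma nn_integral_kap_bounded:
 assumes [measurable]: "A \<in> sets borel" and AR: "A \<subseteq> cball 0 R" and z: "z \<in> cball 0 R" and "0 \<le> R"
 shows "(\<integral>\<^sup>+ w\<in>A. kap z w \<partial>lborel) \<le> ennreal (R\<^sup>2 * (pi * R\<^sup>2) + (2 * pi + pi * R\<^sup>2))"
proof -
 have "AE w in lborel. cmod (w - z) \<noteq> 0" by (rule AE_cmod_neq)
 then have "(\<integral>\<^sup>+ w\<in>A. kap z w \<partial>lborel) \<le> (\<integral>\<^sup>+ w\<in>cball 0 R. ennreal (R\<^sup>2) + ennreal (1 / cmod (w - z)) \<partial>lborel)"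
 proof (intro nn_integral_mono_AE, eventually_elim)
  case (elim w)
  show ?case
  proof (cases "w \<in> A")
   case True
   then have w: "w \<in> cball 0 R" using AR by auto
   have "(cmod z)\<^sup>2 \<le> R\<^sup>2" "(cmod w)\<^sup>2 \<le> R\<^sup>2" using z w by (auto intro!: power_mono)
   then have "(ell z + ell w) / 2 \<le> R\<^sup>2" using ell_le[of z] ell_le[of w] by simp
   then show ?thesis using kap_le[of z w] elim w True
    by (auto simp: norm_minus_commute intro: order_trans add_mono ennreal_leI elim!: order_trans)
  qed auto
 qed
 also have "\<dots> = (\<integral>\<^sup>+ w\<in>cball (0::complex) R. ennreal (R\<^sup>2) \<partial>lborel) + (\<integral>\<^sup>+ w\<in>cball 0 R. ennreal (1 / cmod (w - z)) \<partial>lborel)"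
  by (subst nn_integral_add[symmetric]) (auto simp: distrib_right)
 also have "\<dots> \<le> ennreal (R\<^sup>2) * ennreal (pi * R\<^sup>2) + (ennreal (2 * pi) + ennreal (pi * R\<^sup>2))"
  using nn_integral_inverse_cmod_le[of "cball 0 R" z] \<open>0 \<le> R\<close>
  by (intro add_mono) (simp_all add: nn_integral_cmult emeasure_cball_complex)
 also have "\<dots> = ennreal (R\<^sup>2 * (pi * R\<^sup>2) + (2 * pi + pi * R\<^sup>2))"
  by (simp add: ennreal_mult'[symmetric] ennreal_plus[symmetric] del: ennreal_plus)
 finally show ?thesis .
qed

text \<open>Uniform distributions on bounded sets are the competitors in the variational
  argument.\<close>

lemma kap_energy_bounded_density:
 assumes [measurable]: "A \<in> sets borel" and AR: "A \<subseteq> cball 0 R" and "0 \<le> R" and c: "c < \<infinity>"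
 shows "kap_energy (density lborel (\<lambda>z. c * indicator A z)) < \<infinity>"
proof -
 let ?\<mu> = "density lborel (\<lambda>z. c * indicator A z)"
 define C where "C = ennreal (R\<^sup>2 * (pi * R\<^sup>2) + (2 * pi + pi * R\<^sup>2))"
 have "kap_energy ?\<mu> = (\<integral>\<^sup>+ z. c * indicator A z * (\<integral>\<^sup>+ w. c * indicator A w * kap z w \<partial>lborel) \<partial>lborel)"
  unfolding kap_energy_def by (simp add: nn_integral_density)
 also have "\<dots> \<le> (\<integral>\<^sup>+ z. c * (c * C) * indicator (cball (0::complex) R) z \<partial>lborel)"
 proof (rule nn_integral_mono)
  fix z :: complex
  have eq: "(\<integral>\<^sup>+ w. c * indicator A w * kap z w \<partial>lborel) = c * (\<integral>\<^sup>+ w\<in>A. kap z w \<partial>lborel)"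
   by (subst nn_integral_cmult[symmetric]) (auto intro!: nn_integral_cong simp: ac_simps)
  have "(\<integral>\<^sup>+ w. c * indicator A w * kap z w \<partial>lborel) \<le> c * C" if "z \<in> A"
   unfolding C_def eq using that AR by (intro mult_left_mono nn_integral_kap_bounded assms) auto
  then show "c * indicator A z * (\<integral>\<^sup>+ w. c * indicator A w * kap z w \<partial>lborel) \<le> c * (c * C) * indicator (cball 0 R) z"
   using AR by (cases "z \<in> A") (auto intro!: mult_left_mono simp: subset_iff simp del: mem_cball)
 qed
 also have "\<dots> = c * (c * C) * ennreal (pi * R\<^sup>2)" using \<open>0 \<le> R\<close> by (simp add: nn_integral_cmult emeasure_cball_complex)
 also have "\<dots> < \<infinity>" using c by (simp add: ennreal_mult_less_top C_def)
 finally show ?thesis .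
qed

text \<open>\<open>q\<close> is what remains of the potential after \<open>ell\<close> has been
  moved into the kernel; \<open>kap_energy\<close> plus the integral of \<open>q\<close> is half the
  weighted energy up to a constant. \<open>q_lsc\<close> serves limits of points.
  \<open>q_disc\<close> bounds disc means by the value at the centre, uniformly on bounded sets; it
  stands in for upper semicontinuity, which superharmonic functions need not have.\<close>

locale equilibrium =
 fixes q :: "complex \<Rightarrow> ennreal" and c1 :: real and \<sigma> :: "complex measure"
 assumes c1: "0 < c1" and q_measurable [measurable]: "q \<in> borel_measurable borel"
  and q_ge: "ennreal (c1 * (cmod z)\<^sup>2) \<le> q z"
  and q_lsc: "X \<longlonglongrightarrow> z \<Longrightarrow> q z \<le> liminf (\<lambda>n. q (X n))"
  and q_disc: "0 < e \<Longrightarrow> \<exists>r0>0. \<forall>r>0. r \<le> r0 \<longrightarrow> (\<forall>z\<in>cball 0 R. (\<integral>\<^sup>+ u\<in>ball z r. q u \<partial>lborel) \<le> ennreal (pi * r\<^sup>2) * (q z + ennreal e))"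
  and prob_sigma: "prob_space \<sigma>" and sets_sigma [measurable_cong]: "sets \<sigma> = sets borel"
  and sigma_ac: "absolutely_continuous lborel \<sigma>"
  and energy_finite: "kap_energy \<sigma> + (\<integral>\<^sup>+ z. q z \<partial>\<sigma>) < \<infinity>"
  and minimal: "prob_space \<nu> \<Longrightarrow> sets \<nu> = sets borel \<Longrightarrow> kap_energy \<sigma> + (\<integral>\<^sup>+ z. q z \<partial>\<sigma>) \<le> kap_energy \<nu> + (\<integral>\<^sup>+ z. q z \<partial>\<nu>)"
begin

sublocale s: prob_space \<sigma> by (rule prob_sigma)

definition pot :: "complex \<Rightarrow> ennreal" where "pot z = (\<integral>\<^sup>+ w. kap z w \<partial>\<sigma>)"

lemma pot_measurable [measurable]: "pot \<in> borel_measurable borel"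
 unfolding pot_def by measurable

text \<open>The Euler--Lagrange constant will be \<open>2 * S0 + q0\<close>, the integral of
  \<open>2 * pot + q\<close> against \<open>\<sigma>\<close>.\<close>

definition S0 :: real where "S0 = enn2real (kap_energy \<sigma>)"
definition q0 :: real where "q0 = enn2real (\<integral>\<^sup>+ z. q z \<partial>\<sigma>)"

lemma S0: "kap_energy \<sigma> = ennreal S0" "0 \<le> S0" and q0: "(\<integral>\<^sup>+ z. q z \<partial>\<sigma>) = ennreal q0" "0 \<le> q0"
 using energy_finite by (auto simp: S0_def q0_def ennreal_enn2real_if)

definition rho :: "complex \<Rightarrow> ennreal" where "rho = RN_deriv lborel \<sigma>"

lemma rho_measurable [measurable]: "rho \<in> borel_measurable borel"
 unfolding rho_def by measurable

lemma sigma_density: "\<sigma> = density lborel rho"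
 unfolding rho_def using sigma_finite_measure.density_RN_deriv[OF sigma_finite_lborel sigma_ac] sets_sigma by simp

lemma nn_integral_sigma: 
 assumes [measurable]: "f \<in> borel_measurable borel"
 shows "(\<integral>\<^sup>+ z. f z \<partial>\<sigma>) = (\<integral>\<^sup>+ z. rho z * f z \<partial>lborel)"
 by (subst sigma_density, subst nn_integral_density) auto

text \<open>First variation: the mixture of \<open>\<sigma>\<close> with weight \<open>t\<close> on
  \<open>density lborel g\<close> has at least the energy of \<open>\<sigma>\<close>; dividing by
  \<open>t\<close> and letting \<open>t\<close> tend to 0 leaves the linear term. Finite energy of
  the competitor makes the quadratic term vanish in the limit.\<close>

lemma variational_inequality:
 assumes [measurable]: "g \<in> borel_measurable borel" and g: "prob_space (density lborel g)"
  and fin: "kap_energy (density lborel g) < \<infinity>"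
 shows "ennreal (2 * S0 + q0) \<le> 2 * (\<integral>\<^sup>+ z. pot z \<partial>density lborel g) + (\<integral>\<^sup>+ z. q z \<partial>density lborel g)"
proof -
 let ?\<nu> = "density lborel g"
 interpret n: prob_space ?\<nu> by (rule g)
 define B where "B = (\<integral>\<^sup>+ z. pot z \<partial>?\<nu>)"
 define N where "N = (\<integral>\<^sup>+ z. q z \<partial>?\<nu>)"
 show ?thesis
 proof (cases "B = \<infinity> \<or> N = \<infinity>")
  case True then show ?thesis by (auto simp: B_def[symmetric] N_def[symmetric] ennreal_mult_top)
 next
  case False
  then obtain b n where bn: "B = ennreal b" "0 \<le> b" "N = ennreal n" "0 \<le> n"
   by (metis ennreal_cases infinity_ennreal_def)
  obtain e where e: "kap_energy ?\<nu> = ennreal e" "0 \<le> e" using fin by (cases "kap_energy ?\<nu>") auto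
  have ineq: "S0 + q0 \<le> (1 - t)\<^sup>2 * S0 + 2 * t * (1 - t) * b + t\<^sup>2 * e + ((1 - t) * q0 + t * n)" if t: "0 < t" "t < 1" for t
  proof -
   \<comment> \<open>The mixture is formed on densities, which \<open>sigma_density\<close> makes
     possible.\<close>
   define h where "h z = ennreal (1 - t) * rho z + ennreal t * g z" for z
   have [measurable]: "h \<in> borel_measurable borel" unfolding h_def by measurable
   let ?m = "density lborel h"
   have int: "(\<integral>\<^sup>+ z. f z \<partial>?m) = ennreal (1 - t) * (\<integral>\<^sup>+ z. f z \<partial>\<sigma>) + ennreal t * (\<integral>\<^sup>+ z. f z \<partial>?\<nu>)" 
    if [measurable]: "f \<in> borel_measurable borel" for f
    unfolding h_def by (simp add: nn_integral_sigma nn_integral_density distrib_right nn_integral_add mult.assoc nn_integral_cmult)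
   have "emeasure ?m (space ?m) = (\<integral>\<^sup>+ z. 1 \<partial>?m)" by simp
   also have "\<dots> = 1" by (subst int) (use t s.emeasure_space_1 n.emeasure_space_1 in \<open>auto simp: ennreal_plus[symmetric] simp del: ennreal_plus\<close>)
   finally have pm: "prob_space ?m" by (rule prob_spaceI)
   have k1: "(\<integral>\<^sup>+ z. kap_pot z \<partial>?\<nu>) = (\<integral>\<^sup>+ z. kap_pot z \<partial>?\<nu>)" for kap_pot :: "complex \<Rightarrow> ennreal" by simp
   have cross: "(\<integral>\<^sup>+ z. \<integral>\<^sup>+ w. kap z w \<partial>?\<nu> \<partial>\<sigma>) = B"
    unfolding B_def pot_def by (rule nn_integral_kap_sym) (use s.sigma_finite_measure_axioms n.sigma_finite_measure_axioms sets_sigma in simp_all)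
   have "kap_energy ?m = (\<integral>\<^sup>+ z. ennreal (1 - t) * pot z + ennreal t * (\<integral>\<^sup>+ w. kap z w \<partial>?\<nu>) \<partial>?m)"
    unfolding kap_energy_def pot_def by (intro nn_integral_cong int) measurable
   also have "\<dots> = ennreal (1 - t) * (ennreal (1 - t) * kap_energy \<sigma> + ennreal t * B)
     + ennreal t * (ennreal (1 - t) * B + ennreal t * kap_energy ?\<nu>)"
    by (subst int) (auto simp: nn_integral_add nn_integral_cmult cross B_def pot_def[symmetric] kap_energy_def)
   also have "\<dots> = ennreal ((1 - t) * ((1 - t) * S0 + t * b) + t * ((1 - t) * b + t * e))"
    using t bn e S0 by (simp add: ennreal_mult'[symmetric] ennreal_plus[symmetric] del: ennreal_plus)
   finally have E: "kap_energy ?m = ennreal ((1 - t) * ((1 - t) * S0 + t * b) + t * ((1 - t) * b + t * e))" .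
   have Q: "(\<integral>\<^sup>+ z. q z \<partial>?m) = ennreal ((1 - t) * q0 + t * n)"
    using t bn q0 by (subst int) (auto simp: N_def[symmetric] ennreal_mult'[symmetric] ennreal_plus[symmetric] simp del: ennreal_plus)
   have "ennreal (S0 + q0) \<le> ennreal ((1 - t) * ((1 - t) * S0 + t * b) + t * ((1 - t) * b + t * e) + ((1 - t) * q0 + t * n))"
    using minimal[OF pm] t bn e q0 S0 by (simp add: E Q ennreal_plus[symmetric] del: ennreal_plus)
   moreover have "0 \<le> (1 - t) * ((1 - t) * S0 + t * b) + t * ((1 - t) * b + t * e) + ((1 - t) * q0 + t * n)"
    using t bn e q0 S0 by (intro add_nonneg_nonneg mult_nonneg_nonneg) auto
   ultimately have "S0 + q0 \<le> (1 - t) * ((1 - t) * S0 + t * b) + t * ((1 - t) * b + t * e) + ((1 - t) * q0 + t * n)"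
    by (simp only: ennreal_le_iff)
   then show ?thesis by (simp add: power2_eq_square algebra_simps)
  qed
  have "2 * S0 + q0 - (2 * b + n) \<le> t * (S0 - 2 * b + e)" if t: "0 < t" "t < 1" for t
  proof -
   have "t * (2 * S0 + q0 - (2 * b + n)) \<le> t * (t * (S0 - 2 * b + e))" using ineq[OF t] by (simp add: power2_eq_square algebra_simps)
   then show ?thesis using t by simp
  qed
  then have ev: "eventually (\<lambda>t. 2 * S0 + q0 - (2 * b + n) \<le> t * (S0 - 2 * b + e)) (at_right 0)"
   using eventually_at_right[of 0 1] by (auto simp: eventually_at_right_field intro!: exI[of _ 1])
  have "((\<lambda>t. t * (S0 - 2 * b + e)) \<longlongrightarrow> 0 * (S0 - 2 * b + e)) (at_right 0)" by (intro tendsto_intros)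
  from tendsto_lowerbound[OF this ev] have "2 * S0 + q0 \<le> 2 * b + n" by simp
  then show ?thesis unfolding B_def[symmetric] N_def[symmetric] using bn S0 q0 
   by (simp add: ennreal_mult'[symmetric] ennreal_plus[symmetric] flip: ennreal_numeral del: ennreal_plus)
 qed
qed

text \<open>If the inequality failed on a set of positive measure, the uniform distribution on that
  set would violate \<open>variational_inequality\<close>. The set is bounded because
  \<open>q\<close> grows quadratically.\<close>

lemma pot_lower_AE: "AE z in lborel. ennreal (2 * S0 + q0) \<le> 2 * pot z + q z"
proof (rule ccontr)
 assume neg: "\<not> (AE z in lborel. ennreal (2 * S0 + q0) \<le> 2 * pot z + q z)"
 define A where "A = {z. 2 * pot z + q z < ennreal (2 * S0 + q0)}"
 have [measurable]: "A \<in> sets borel" unfolding A_def by measurable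
 \<comment> \<open>Outside this radius \<open>c1 * (cmod z)\<^sup>2\<close>, and with it
   \<open>q\<close>, exceeds the constant.\<close>
 define R where "R = sqrt ((2 * S0 + q0) / c1)"
 have R0: "0 \<le> R" using S0 q0 c1 by (simp add: R_def)
 have AR: "A \<subseteq> cball 0 R"
 proof
  fix z assume "z \<in> A"
  then have "2 * pot z + q z < ennreal (2 * S0 + q0)" by (simp add: A_def)
  then have "q z < ennreal (2 * S0 + q0)" by (rule le_less_trans[rotated]) simp
  from le_less_trans[OF q_ge this] have "c1 * (cmod z)\<^sup>2 \<le> 2 * S0 + q0" using S0 q0 by (subst (asm) ennreal_less_iff) (auto simp: c1[THEN less_imp_le])
  then have "(cmod z)\<^sup>2 \<le> (2 * S0 + q0) / c1" using c1 by (simp add: field_simps)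
  then show "z \<in> cball 0 R" by (simp add: R_def real_le_rsqrt)
 qed
 have pos: "emeasure lborel A \<noteq> 0"
  using neg by (subst (asm) AE_iff_measurable[OF _ refl]) (auto simp: A_def not_le)
 have "emeasure lborel A \<le> emeasure lborel (cball (0::complex) R)" by (rule emeasure_mono) (use AR in auto)
 then have fin: "emeasure lborel A < \<infinity>" using R0 by (simp add: emeasure_cball_complex) (metis ennreal_less_top le_less_trans)
 define c where "c = 1 / emeasure lborel A"
 have c: "c < \<infinity>" "c * emeasure lborel A = 1" using pos fin unfolding c_def
  by (auto simp: ennreal_divide_eq_top_iff less_top[symmetric] top_unique ennreal_divide_times)
 let ?\<nu> = "density lborel (\<lambda>z. c * indicator A z)"
 have p: "prob_space ?\<nu>"
  by (rule prob_spaceI) (simp add: emeasure_density nn_integral_cmult c)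
 then interpret n: prob_space ?\<nu> .
 have "ennreal (2 * S0 + q0) \<le> 2 * (\<integral>\<^sup>+ z. pot z \<partial>?\<nu>) + (\<integral>\<^sup>+ z. q z \<partial>?\<nu>)"
  using p kap_energy_bounded_density[OF _ AR R0 c(1)] by (intro variational_inequality) auto
 also have "\<dots> = (\<integral>\<^sup>+ z. 2 * pot z + q z \<partial>?\<nu>)" by (simp add: nn_integral_add nn_integral_cmult)
 also have "\<dots> < (\<integral>\<^sup>+ z. ennreal (2 * S0 + q0) \<partial>?\<nu>)"
 proof (rule nn_integral_less)
  have inA: "AE z in ?\<nu>. z \<in> A" by (subst AE_density) (auto simp: indicator_def)
  show le: "AE z in ?\<nu>. 2 * pot z + q z \<le> ennreal (2 * S0 + q0)"
   using inA by eventually_elim (auto simp: A_def)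
  show "\<not> (AE z in ?\<nu>. ennreal (2 * S0 + q0) \<le> 2 * pot z + q z)"
  proof
   assume "AE z in ?\<nu>. ennreal (2 * S0 + q0) \<le> 2 * pot z + q z"
   with inA have "AE z in ?\<nu>. False" by eventually_elim (auto simp: A_def)
   then show False using n.AE_False by simp
  qed
  have "(\<integral>\<^sup>+ z. 2 * pot z + q z \<partial>?\<nu>) \<le> (\<integral>\<^sup>+ z. ennreal (2 * S0 + q0) \<partial>?\<nu>)"
   by (rule nn_integral_mono_AE[OF le])
  also have "\<dots> < \<infinity>" using n.emeasure_space_1 by simp
  finally show "(\<integral>\<^sup>+ z. 2 * pot z + q z \<partial>?\<nu>) \<noteq> \<infinity>" by simp
 qed measurable
 also have "\<dots> = ennreal (2 * S0 + q0)" using n.emeasure_space_1 by simp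
 finally show False by simp
qed

text \<open>Gas points may lie anywhere, so the exceptional null set has to go. Averaging the almost
  everywhere inequality over a small disc suffices, as the disc means of \<open>pot\<close> and of
  \<open>q\<close> barely exceed the values at the centre.\<close>

lemma pot_lower: "ennreal (2 * S0 + q0) \<le> 2 * pot z + q z"
proof (rule ennreal_le_epsilon)
 fix e :: real assume "0 < e"
 \<comment> \<open>One third for \<open>q\<close> and one for each of the two copies of
   \<open>pot\<close>.\<close>
 then have e3: "0 < e / 3" by simp
 obtain r1 where r1: "0 < r1" "\<And>r z' w. 0 < r \<Longrightarrow> r \<le> r1 \<Longrightarrow> z' \<in> cball 0 (cmod z) \<Longrightarrow> 
  (\<integral>\<^sup>+ u\<in>ball z' r. kap u w \<partial>lborel) \<le> ennreal (pi * r\<^sup>2) * (kap z' w + ennreal (e/3))"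
  using disc_mean_kap[OF e3, of "cmod z"] by metis
 obtain r2 where r2: "0 < r2" "\<forall>r>0. r \<le> r2 \<longrightarrow> (\<forall>z\<in>cball 0 (cmod z). (\<integral>\<^sup>+ u\<in>ball z r. q u \<partial>lborel) \<le> ennreal (pi * r\<^sup>2) * (q z + ennreal (e/3)))"
  using q_disc[OF e3, of "cmod z"] by metis
 define r where "r = min r1 r2"
 have r: "0 < r" "r \<le> r1" "r \<le> r2" using r1 r2 by (auto simp: r_def)
 let ?V = "ennreal (pi * r\<^sup>2)"
 have V: "0 < ?V" "?V < \<infinity>" using r by auto
 have qz: "(\<integral>\<^sup>+ u\<in>ball z r. q u \<partial>lborel) \<le> ?V * (q z + ennreal (e/3))" using r2 r by simp
 have "(\<integral>\<^sup>+ u\<in>ball z r. pot u \<partial>lborel) = (\<integral>\<^sup>+ u. \<integral>\<^sup>+ w. kap u w * indicator (ball z r) u \<partial>\<sigma> \<partial>lborel)"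
  unfolding pot_def by (intro nn_integral_cong) (simp add: nn_integral_multc)
 also have "\<dots> = (\<integral>\<^sup>+ w. \<integral>\<^sup>+ u. kap u w * indicator (ball z r) u \<partial>lborel \<partial>\<sigma>)"
 proof -
  interpret pair_sigma_finite \<sigma> "lborel :: complex measure" ..
  show ?thesis by (rule Fubini') measurable
 qed
 also have "\<dots> \<le> (\<integral>\<^sup>+ w. ?V * (kap z w + ennreal (e/3)) \<partial>\<sigma>)"
  using r1(2)[of r z] r by (intro nn_integral_mono) auto
 also have "\<dots> = ?V * (pot z + ennreal (e/3))"
  by (simp add: nn_integral_cmult nn_integral_add pot_def s.emeasure_space_1)
 finally have pz: "(\<integral>\<^sup>+ u\<in>ball z r. pot u \<partial>lborel) \<le> ?V * (pot z + ennreal (e/3))" .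
 have "?V * ennreal (2 * S0 + q0) = (\<integral>\<^sup>+ u\<in>ball z r. ennreal (2 * S0 + q0) \<partial>lborel)"
  using r by (subst nn_integral_cmult_indicator) (simp_all add: emeasure_ball_complex mult.commute)
 also have "\<dots> \<le> (\<integral>\<^sup>+ u\<in>ball z r. 2 * pot u + q u \<partial>lborel)"
  using pot_lower_AE by (intro nn_integral_mono_AE) (auto simp: indicator_def elim!: eventually_mono)
 also have "\<dots> = 2 * (\<integral>\<^sup>+ u\<in>ball z r. pot u \<partial>lborel) + (\<integral>\<^sup>+ u\<in>ball z r. q u \<partial>lborel)"
  by (simp add: distrib_right nn_integral_add nn_integral_cmult mult.assoc)
 also have "\<dots> \<le> 2 * (?V * (pot z + ennreal (e/3))) + ?V * (q z + ennreal (e/3))"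
  by (intro add_mono mult_left_mono pz qz) auto
 also have "\<dots> = ?V * (2 * pot z + q z + (2 * ennreal (e/3) + ennreal (e/3)))"
  by (simp add: algebra_simps)
 also have "2 * ennreal (e/3) + ennreal (e/3) = ennreal e"
  using \<open>0 < e\<close> by (simp add: ennreal_mult'[symmetric] ennreal_plus[symmetric] del: ennreal_plus flip: ennreal_numeral)
 finally show "ennreal (2 * S0 + q0) \<le> 2 * pot z + q z + ennreal e"
  using V by (subst (asm) ennreal_mult_le_mult_iff) auto
qed

end

section \<open>Configurations of low energy\<close>

lemma reg_log_ge:
 assumes d: "0 < d" shows "- d / 2 \<le> reg_log d x y"
proof -
 have "(cmod (x - y))\<^sup>2 + d \<le> (1 + d) * ((1 + (cmod x)\<^sup>2) * (1 + (cmod y)\<^sup>2))"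
 proof -
  have "1 \<le> (1 + (cmod x)\<^sup>2) * (1 + (cmod y)\<^sup>2)" using mult_mono[of 1 "1 + (cmod x)\<^sup>2" 1 "1 + (cmod y)\<^sup>2"] by simp
  then have "d * 1 \<le> d * ((1 + (cmod x)\<^sup>2) * (1 + (cmod y)\<^sup>2))" using d by (intro mult_left_mono) auto
  then show ?thesis using cmod_diff_square_le[of x y] by (simp add: distrib_right)
 qed
 then have "ln ((cmod (x - y))\<^sup>2 + d) \<le> ln ((1 + d) * ((1 + (cmod x)\<^sup>2) * (1 + (cmod y)\<^sup>2)))"
  using d by (intro ln_mono) (auto intro: add_nonneg_pos)
 also have "\<dots> = ln (1 + d) + (ell x + ell y)"
 proof -
  have "0 < 1 + (cmod x)\<^sup>2" "0 < 1 + (cmod y)\<^sup>2" by (auto intro: add_pos_nonneg)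
  then show ?thesis using d by (simp add: ln_mult ell_def)
 qed
 also have "ln (1 + d) \<le> d" using d by (intro ln_add_one_self_le_self) auto
 finally show ?thesis by (simp add: reg_log_def field_simps)
qed

lemma reg_log_le: "0 < d \<Longrightarrow> x \<noteq> y \<Longrightarrow> reg_log d x y \<le> (ell x + ell y) / 2 - ln (cmod (x - y))"
proof -
 assume "0 < d" "x \<noteq> y"
 then have "ln ((cmod (x - y))\<^sup>2) \<le> ln ((cmod (x - y))\<^sup>2 + d)" by (intro ln_mono) auto
 moreover have "ln ((cmod (x - y))\<^sup>2) = 2 * ln (cmod (x - y))" using \<open>x \<noteq> y\<close> by (simp add: ln_realpow)
 ultimately show ?thesis by (simp add: reg_log_def)
qed

lemma ennreal_reg_log_le_kap: "0 < d \<Longrightarrow> ennreal (reg_log d x y) \<le> kap x y"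
 using reg_log_le[of d x y] by (auto simp: kap_def intro!: ennreal_leI)

text \<open>Prepares Fatou's lemma for regularisation and point converging together. The shift 1/2
  compensates the lower bound \<open>- d / 2\<close> of \<open>reg_log_ge\<close> once
  \<open>d \<le> 1\<close>, so that \<open>ennreal\<close> truncates nothing.\<close>

lemma reg_log_liminf:
 assumes d: "\<And>n. 0 < d n" "d \<longlonglongrightarrow> 0" and Z: "Z \<longlonglongrightarrow> l"
 shows "kap l w + ennreal (1/2) \<le> liminf (\<lambda>n. ennreal (reg_log (d n) (Z n) w + 1/2))"
proof (cases "l = w")
 case False
 have cont: "(\<lambda>n. reg_log (d n) (Z n) w + 1/2) \<longlonglongrightarrow> (ell l + ell w) / 2 - ln ((cmod (l - w))\<^sup>2 + 0) / 2 + 1/2"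
  unfolding reg_log_def
 proof (intro tendsto_intros d Z)
  have "isCont ell l" using continuous_on_ell[OF continuous_on_id, of UNIV] by (simp add: continuous_on_eq_continuous_at)
  from isCont_tendsto_compose[OF this Z] show "(\<lambda>n. ell (Z n)) \<longlonglongrightarrow> ell l" .
 qed (use False in auto)
 have "ln ((cmod (l - w))\<^sup>2 + 0) / 2 = ln (cmod (l - w))" using False by (simp add: ln_realpow)
 with tendsto_ennrealI[OF cont] have "(\<lambda>n. ennreal (reg_log (d n) (Z n) w + 1/2)) \<longlonglongrightarrow> ennreal ((ell l + ell w) / 2 - ln (cmod (l - w)) + 1/2)" by simp
 then have "liminf (\<lambda>n. ennreal (reg_log (d n) (Z n) w + 1/2)) = ennreal ((ell l + ell w) / 2 - ln (cmod (l - w)) + 1/2)"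
  by (rule lim_imp_Liminf[rotated]) simp
 also have "\<dots> = kap l w + ennreal (1/2)"
 proof -
  have "0 \<le> (ell l + ell w) / 2 - ln (cmod (l - w))" using ln_cmod_diff_le[OF False] by simp
  from ennreal_plus[OF this, of "1/2"] show ?thesis using False by (simp add: kap_def)
 qed
 finally show ?thesis by simp
next
 case True
 have "(\<lambda>n. (cmod (Z n - w))\<^sup>2 + d n) \<longlonglongrightarrow> (cmod (l - w))\<^sup>2 + 0"
  by (intro tendsto_intros d Z)
 then have "(\<lambda>n. (cmod (Z n - w))\<^sup>2 + d n) \<longlonglongrightarrow> 0" using True by simp
 then have "filterlim (\<lambda>n. (cmod (Z n - w))\<^sup>2 + d n) (at_right 0) sequentially"
  by (rule tendsto_imp_filterlim_at_right) (auto intro!: always_eventually add_nonneg_pos d)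
 from filterlim_compose[OF ln_at_0 this] have "filterlim (\<lambda>n. ln ((cmod (Z n - w))\<^sup>2 + d n)) at_bot sequentially" .
 then have "filterlim (\<lambda>n. - ln ((cmod (Z n - w))\<^sup>2 + d n)) at_top sequentially"
  by (simp add: filterlim_uminus_at_bot)
 then have "filterlim (\<lambda>n. - ln ((cmod (Z n - w))\<^sup>2 + d n) * (1/2)) at_top sequentially"
  by (rule filterlim_at_top_mult_tendsto_pos[OF tendsto_const, rotated]) simp
 then have "filterlim (\<lambda>n. reg_log (d n) (Z n) w + 1/2) at_top sequentially"
  by (rule filterlim_at_top_mono) (auto simp: reg_log_def intro!: always_eventually)
 then have "(\<lambda>n. ennreal (reg_log (d n) (Z n) w + 1/2)) \<longlonglongrightarrow> \<infinity>"
  by (simp add: ennreal_tendsto_top_eq_at_top)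
 then have "liminf (\<lambda>n. ennreal (reg_log (d n) (Z n) w + 1/2)) = \<infinity>"
  by (rule lim_imp_Liminf[rotated]) simp
 then show ?thesis by simp
qed

context equilibrium
begin

lemma second_moment_sigma: "second_moment \<sigma>"
proof -
 have "(\<integral>\<^sup>+ z. ennreal (c1 * (cmod z)\<^sup>2) \<partial>\<sigma>) \<le> ennreal q0" unfolding q0(1)[symmetric]
  by (intro nn_integral_mono q_ge)
 then have "(\<integral>\<^sup>+ z. ennreal (c1 * (cmod z)\<^sup>2) \<partial>\<sigma>) < \<infinity>" by (rule le_less_trans) simp
 then have "integrable \<sigma> (\<lambda>z. c1 * (cmod z)\<^sup>2)"
  using c1 by (intro integrableI_nonneg) auto
 then have "integrable \<sigma> (\<lambda>z. (1 / c1) * (c1 * (cmod z)\<^sup>2))" by (rule integrable_mult_right)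
 then show ?thesis using c1 prob_sigma sets_sigma by (simp add: second_moment_def)
qed

definition reg_pot :: "real \<Rightarrow> complex \<Rightarrow> real" where
 "reg_pot d z = (\<integral>w. reg_log d z w \<partial>\<sigma>)"

lemma integrable_reg_log_sigma: 
 assumes "0 < d" shows "integrable \<sigma> (\<lambda>w. reg_log d z w)"
proof (rule Bochner_Integration.integrable_bound)
 show "integrable \<sigma> (\<lambda>w. (d + \<bar>ln d\<bar>) + 2 * ((cmod z)\<^sup>2 + (cmod w)\<^sup>2))"
  using second_moment_sigma by (auto simp: second_moment_def)
 show "AE w in \<sigma>. norm (reg_log d z w) \<le> norm ((d + \<bar>ln d\<bar>) + 2 * ((cmod z)\<^sup>2 + (cmod w)\<^sup>2))"
  using order_trans[OF reg_log_bound[OF assms] abs_ge_self] by (intro AE_I2) simp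
qed measurable

lemma reg_pot_ge: "0 < d \<Longrightarrow> - d / 2 \<le> reg_pot d z"
proof -
 assume d: "0 < d"
 have "(\<integral>w. - d / 2 \<partial>\<sigma>) \<le> reg_pot d z" unfolding reg_pot_def
  by (intro integral_mono integrable_reg_log_sigma d reg_log_ge) auto
 then show ?thesis by (simp add: s.prob_space)
qed

lemma nn_integral_reg_pot:
 assumes "0 < d" "d \<le> 1"
 shows "(\<integral>\<^sup>+ w. ennreal (reg_log d z w + 1/2) \<partial>\<sigma>) = ennreal (reg_pot d z + 1/2)"
proof -
 have "0 \<le> reg_log d z w + 1/2" for w using reg_log_ge[OF assms(1), of z w] assms(2) by simp
 then have "(\<integral>\<^sup>+ w. ennreal (reg_log d z w + 1/2) \<partial>\<sigma>) = ennreal (\<integral>w. reg_log d z w + 1/2 \<partial>\<sigma>)"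
  using assms by (intro nn_integral_eq_integral) (auto intro!: integrable_reg_log_sigma)
 also have "(\<integral>w. reg_log d z w + 1/2 \<partial>\<sigma>) = reg_pot d z + 1/2"
  using assms integrable_reg_log_sigma[of d z] by (simp add: reg_pot_def s.prob_space)
 finally show ?thesis .
qed

text \<open>Regularised Euler--Lagrange inequality, uniform in the point. Otherwise there are
  violating points with regularisations tending to 0; the growth of \<open>q\<close> confines them
  to a compact set, and at a limit point Fatou's lemma and lower semicontinuity of \<open>q\<close>
  contradict \<open>pot_lower\<close>.\<close>

lemma reg_pot_lower:
 assumes e: "0 < e"
 shows "\<exists>d0>0. \<forall>d z. 0 < d \<longrightarrow> d \<le> d0 \<longrightarrow> q z < \<infinity> \<longrightarrow> 2 * S0 + q0 - e \<le> 2 * reg_pot d z + enn2real (q z)"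
proof (rule ccontr)
 define F where "F = 2 * S0 + q0"
 have F0: "0 \<le> F" using S0 q0 by (simp add: F_def)
 assume "\<not> ?thesis"
 then have "\<forall>n. \<exists>d z. 0 < d \<and> d \<le> 1 / (real n + 1) \<and> q z < \<infinity> \<and> 2 * reg_pot d z + enn2real (q z) < F - e"
  unfolding F_def by (force simp: not_le)
 then obtain d Z where d: "\<And>n. 0 < d n" "\<And>n. d n \<le> 1 / (real n + 1)" and Z: "\<And>n. q (Z n) < \<infinity>" 
  "\<And>n. 2 * reg_pot (d n) (Z n) + enn2real (q (Z n)) < F - e" by metis
 have d1: "d n \<le> 1" for n
 proof -
  have "1 / (real n + 1) \<le> 1" by simp
  then show ?thesis using d(2)[of n] by linarith
 qed
 have qr: "q (Z n) = ennreal (enn2real (q (Z n)))" for n using Z(1)[of n] by simp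
 \<comment> \<open>As the regularised potential is at least -1/2, at most \<open>F + 1\<close> is
   left for \<open>q\<close> at a violating point, which bounds its modulus.\<close>
 define R where "R = sqrt ((F + 1) / c1)"
 have ZR: "Z n \<in> cball 0 R" for n
 proof -
  have "enn2real (q (Z n)) \<le> F + 1" using Z(2)[of n] reg_pot_ge[OF d(1)[of n], of "Z n"] d1[of n] e by simp
  moreover have "ennreal (c1 * (cmod (Z n))\<^sup>2) \<le> ennreal (enn2real (q (Z n)))" using q_ge[of "Z n"] qr[of n] by simp
  then have "c1 * (cmod (Z n))\<^sup>2 \<le> enn2real (q (Z n))" by (subst (asm) ennreal_le_iff) auto
  ultimately have "(cmod (Z n))\<^sup>2 \<le> (F + 1) / c1" using c1 by (simp add: field_simps)
  then show ?thesis by (simp add: R_def real_le_rsqrt)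
 qed
 obtain l r where r: "strict_mono r" "(Z \<circ> r) \<longlonglongrightarrow> l"
  using compact_cball[of "0::complex" R] ZR unfolding compact_def by metis
 have lim: "(\<lambda>n. 1 / (real n + 1)) \<longlonglongrightarrow> 0" by real_asymp
 have "d \<longlonglongrightarrow> 0"
 proof (rule tendsto_sandwich[OF _ _ tendsto_const lim])
  show "\<forall>\<^sub>F n in sequentially. 0 \<le> d n" using d(1) by (intro always_eventually allI less_imp_le)
  show "\<forall>\<^sub>F n in sequentially. d n \<le> 1 / (real n + 1)" using d(2) by (intro always_eventually allI)
 qed
 then have dr: "(d \<circ> r) \<longlonglongrightarrow> 0" using r(1) by (rule LIMSEQ_subseq_LIMSEQ)
 define g where "g n = ennreal (reg_pot (d (r n)) (Z (r n)) + 1/2)" for n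
 have "pot l + ennreal (1/2) = (\<integral>\<^sup>+ w. kap l w + ennreal (1/2) \<partial>\<sigma>)"
  unfolding pot_def by (simp add: nn_integral_add s.emeasure_space_1)
 also have "\<dots> \<le> (\<integral>\<^sup>+ w. liminf (\<lambda>n. ennreal (reg_log (d (r n)) (Z (r n)) w + 1/2)) \<partial>\<sigma>)"
  using reg_log_liminf[OF _ dr r(2)] d by (intro nn_integral_mono) auto
 also have "\<dots> \<le> liminf (\<lambda>n. \<integral>\<^sup>+ w. ennreal (reg_log (d (r n)) (Z (r n)) w + 1/2) \<partial>\<sigma>)"
  by (rule nn_integral_liminf) measurable
 also have "\<dots> = liminf g" unfolding g_def using d d1 by (simp add: nn_integral_reg_pot)
 finally have 1: "pot l + ennreal (1/2) \<le> liminf g" .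
 have 2: "q l \<le> liminf (\<lambda>n. q (Z (r n)))" using q_lsc[OF r(2)] by simp
 \<comment> \<open>The 1 on both sides pays for the two shifts by 1/2.\<close>
 have "ennreal F + 1 \<le> 2 * pot l + q l + 1" unfolding F_def by (intro add_mono pot_lower) auto
 also have "\<dots> = (pot l + ennreal (1/2)) + (pot l + ennreal (1/2)) + q l"
 proof -
  have "ennreal (1/2) + ennreal (1/2) = ennreal (1/2 + 1/2)" by (rule ennreal_plus[symmetric]) auto
  then have "(1::ennreal) = ennreal (1/2) + ennreal (1/2)" by (simp only: field_sum_of_halves ennreal_1)
  then show ?thesis by (simp add: mult_2 ac_simps)
 qed
 also have "\<dots> \<le> (liminf g + liminf g) + liminf (\<lambda>n. q (Z (r n)))" by (intro add_mono 1 2)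
 also have "\<dots> \<le> liminf (\<lambda>n. g n + g n) + liminf (\<lambda>n. q (Z (r n)))" by (intro add_mono ennreal_liminf_add_le order_refl)
 also have "\<dots> \<le> liminf (\<lambda>n. (g n + g n) + q (Z (r n)))" by (rule ennreal_liminf_add_le)
 also have "\<dots> \<le> liminf (\<lambda>n. ennreal (F - e + 1))"
 proof (intro Liminf_mono always_eventually allI)
  fix n
  have "0 \<le> reg_pot (d (r n)) (Z (r n)) + 1/2" using reg_pot_ge[OF d(1)[of "r n"], of "Z (r n)"] d1[of "r n"] by simp
  then have "(g n + g n) + q (Z (r n)) = ennreal (2 * reg_pot (d (r n)) (Z (r n)) + 1 + enn2real (q (Z (r n))))"
   unfolding g_def by (subst qr) (simp add: ennreal_plus[symmetric] del: ennreal_plus)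
  also have "\<dots> \<le> ennreal (F - e + 1)" using Z(2)[of "r n"] by (intro ennreal_leI) simp
  finally show "(g n + g n) + q (Z (r n)) \<le> ennreal (F - e + 1)" .
 qed
 also have "\<dots> = ennreal (F - e + 1)" by (simp add: Liminf_const)
 finally have "ennreal (F + 1) \<le> ennreal (F - e + 1)" using F0 by (simp add: ennreal_plus)
 then show False using F0 e by (cases "0 \<le> F - e + 1") (auto simp: ennreal_neg simp flip: ennreal_plus ennreal_1)
qed

lemma bil_reg_log_sigma: "0 < d \<Longrightarrow> bil (reg_log d) \<sigma> \<sigma> \<le> S0"
proof -
 assume d: "0 < d"
 have i: "integrable (\<sigma> \<Otimes>\<^sub>M \<sigma>) (\<lambda>p. reg_log d (fst p) (snd p))"
  by (rule integrable_reg_log[OF d second_moment_sigma second_moment_sigma])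
 have "bil (reg_log d) \<sigma> \<sigma> \<le> enn2real (\<integral>\<^sup>+ p. ennreal (reg_log d (fst p) (snd p)) \<partial>(\<sigma> \<Otimes>\<^sub>M \<sigma>))"
  unfolding bil_def by (subst real_lebesgue_integral_def[OF i]) simp
 also have "\<dots> \<le> enn2real (ennreal S0)"
 proof (rule enn2real_mono)
  have "(\<integral>\<^sup>+ p. ennreal (reg_log d (fst p) (snd p)) \<partial>(\<sigma> \<Otimes>\<^sub>M \<sigma>)) \<le> (\<integral>\<^sup>+ p. kap (fst p) (snd p) \<partial>(\<sigma> \<Otimes>\<^sub>M \<sigma>))"
   by (intro nn_integral_mono ennreal_reg_log_le_kap d)
  also have "\<dots> = kap_energy \<sigma>" unfolding kap_energy_def by (subst s.nn_integral_fst[symmetric]) auto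
  finally show "(\<integral>\<^sup>+ p. ennreal (reg_log d (fst p) (snd p)) \<partial>(\<sigma> \<Otimes>\<^sub>M \<sigma>)) \<le> ennreal S0" by (simp add: S0)
 qed simp
 finally show ?thesis using S0 by simp
qed

end

section \<open>Empirical measures and the Hamiltonian\<close>

definition emp :: "nat \<Rightarrow> (nat \<Rightarrow> complex) \<Rightarrow> complex measure" where
 "emp n \<zeta> = distr (uniform_count_measure {1..n}) borel \<zeta>"

lemma emp_measurable: "\<zeta> \<in> measurable (uniform_count_measure {1..n}) borel"
 by (simp add: uniform_count_measure_def point_measure_def)

lemma integral_emp:
 fixes f :: "complex \<Rightarrow> real"
 assumes [measurable]: "f \<in> borel_measurable borel" and n: "1 \<le> n"
 shows "integrable (emp n \<zeta>) f" "(\<integral>x. f x \<partial>emp n \<zeta>) = (\<Sum>i\<in>{1..n}. f (\<zeta> i)) / n"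
proof -
 show "integrable (emp n \<zeta>) f"
  unfolding emp_def
  by (subst integrable_distr_eq[OF emp_measurable]) (auto simp: uniform_count_measure_def integrable_point_measure_finite)
 have "(\<integral>x. f x \<partial>emp n \<zeta>) = (\<integral>i. f (\<zeta> i) \<partial>uniform_count_measure {1..n})"
  unfolding emp_def by (subst integral_distr[OF emp_measurable]) auto
 also have "\<dots> = (\<Sum>i\<in>{1..n}. f (\<zeta> i)) / n"
  unfolding uniform_count_measure_def
  by (subst lebesgue_integral_point_measure_finite) (auto simp: sum_divide_distrib)
 finally show "(\<integral>x. f x \<partial>emp n \<zeta>) = (\<Sum>i\<in>{1..n}. f (\<zeta> i)) / n" .
qed

lemma second_moment_emp: "1 \<le> n \<Longrightarrow> second_moment (emp n \<zeta>)"
proof -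
 assume n: "1 \<le> n"
 have "prob_space (uniform_count_measure {1..n})" using n by (intro prob_space_uniform_count_measure) auto
 then have "prob_space (emp n \<zeta>)" unfolding emp_def by (rule prob_space.prob_space_distr) (rule emp_measurable)
 moreover have "integrable (emp n \<zeta>) (\<lambda>x. (cmod x)\<^sup>2)" by (rule integral_emp(1)[OF _ n]) measurable
 ultimately show ?thesis unfolding second_moment_def by (simp add: emp_def)
qed

lemma bil_emp:
 assumes mu: "second_moment \<mu>" and n: "1 \<le> n" and K [measurable]: "(\<lambda>(x, y). K x y) \<in> borel_measurable (borel \<Otimes>\<^sub>M borel)"
  and i: "integrable (emp n \<zeta> \<Otimes>\<^sub>M \<mu>) (\<lambda>p. K (fst p) (snd p))"
 shows "bil K (emp n \<zeta>) \<mu> = (\<Sum>i\<in>{1..n}. \<integral>w. K (\<zeta> i) w \<partial>\<mu>) / n"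
proof -
 interpret m: prob_space \<mu> using mu by (simp add: second_moment_def)
 interpret e: prob_space "emp n \<zeta>" using second_moment_emp[OF n] by (simp add: second_moment_def)
 interpret pair_prob_space "emp n \<zeta>" \<mu> ..
 have [measurable_cong]: "sets \<mu> = sets borel" using mu by (simp add: second_moment_def)
 have "bil K (emp n \<zeta>) \<mu> = (\<integral>z. (\<integral>w. K z w \<partial>\<mu>) \<partial>emp n \<zeta>)"
  unfolding bil_def using integral_fst'[OF i] by simp
 also have "\<dots> = (\<Sum>i\<in>{1..n}. \<integral>w. K (\<zeta> i) w \<partial>\<mu>) / n"
  by (rule integral_emp(2)[OF _ n]) measurable
 finally show ?thesis .
qed

text \<open>Summing over ordered pairs matches the exponent 2 of the interaction. In the pair sum
  each \<open>ell (\<zeta> i)\<close> has total weight n - 1, while the potential has given up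
  weight n; the last sum makes up for the difference.\<close>

definition hamiltonian :: "(complex \<Rightarrow> ennreal) \<Rightarrow> nat \<Rightarrow> (nat \<Rightarrow> complex) \<Rightarrow> ennreal" where
 "hamiltonian q n \<zeta> = (\<Sum>i\<in>{1..n}. \<Sum>j\<in>{1..n}-{i}. kap (\<zeta> i) (\<zeta> j)) + of_nat n * (\<Sum>i\<in>{1..n}. q (\<zeta> i)) + (\<Sum>i\<in>{1..n}. ennreal (ell (\<zeta> i)))"

context equilibrium
begin

text \<open>Expand the energy distance of the empirical measure to \<open>\<sigma>\<close> for
  \<open>reg_log \<delta>\<close>. The self-interaction is, up to the diagonal, at most the
  Hamiltonian over n^2 less the mean of \<open>q\<close>; the cross term is bounded by
  \<open>reg_pot_lower\<close>, which returns that mean; the last term is at most \<open>S0\<close>.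
  The constants cancel and at most \<open>\<theta>\<close> remains.\<close>

lemma low_energy_close:
 fixes \<phi> :: "complex \<Rightarrow> real"
 assumes c\<phi>: "continuous_on UNIV \<phi>" and supp: "\<And>x. R < cmod x \<Longrightarrow> \<phi> x = 0" and e: "0 < e"
 shows "\<exists>\<eta>>0. \<exists>N. \<forall>n\<ge>N. \<forall>\<zeta>. hamiltonian q n \<zeta> \<le> ennreal ((real n)\<^sup>2 * (S0 + q0 + \<eta>)) \<longrightarrow>
   \<bar>(\<Sum>i\<in>{1..n}. \<phi> (\<zeta> i)) / n - (\<integral>x. \<phi> x \<partial>\<sigma>)\<bar> \<le> e"
proof -
 obtain \<theta> c where \<theta>: "0 < \<theta>" "0 < c" and close: "\<And>\<mu> \<nu> \<delta>. second_moment \<mu> \<Longrightarrow> second_moment \<nu> \<Longrightarrow> 0 < \<delta> \<Longrightarrow> \<delta> \<le> c \<Longrightarrow> energy_dist (reg_log \<delta>) \<mu> \<nu> \<le> \<theta> \<Longrightarrow>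
   \<bar>(\<integral>x. \<phi> x \<partial>\<mu>) - (\<integral>x. \<phi> x \<partial>\<nu>)\<bar> \<le> e"
  using close_of_energy_dist[OF c\<phi> supp e] by blast
 have \<theta>3: "0 < \<theta> / 3" using \<theta> by simp
 obtain d0 where d0: "0 < d0" "\<And>d z. 0 < d \<Longrightarrow> d \<le> d0 \<Longrightarrow> q z < \<infinity> \<Longrightarrow> 2 * S0 + q0 - \<theta> / 3 \<le> 2 * reg_pot d z + enn2real (q z)"
  using reg_pot_lower[OF \<theta>3] by blast
 define \<delta> where "\<delta> = min c d0"
 have \<delta>: "0 < \<delta>" "\<delta> \<le> c" "\<delta> \<le> d0" using \<theta> d0 by (auto simp: \<delta>_def)
 \<comment> \<open>The price of the diagonal: n terms - ln \<delta> / 2, divided by n^2.\<close>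
 have "(\<lambda>n. - ln \<delta> / (2 * real n)) \<longlonglongrightarrow> 0" by real_asymp
 then have "\<forall>\<^sub>F n in sequentially. - ln \<delta> / (2 * real n) < \<theta> / 3" using \<theta>3 by (rule order_tendstoD)
 then obtain N where N: "\<And>n. n \<ge> N \<Longrightarrow> - ln \<delta> / (2 * real n) < \<theta> / 3" by (auto simp: eventually_sequentially)
 have "\<bar>(\<Sum>i\<in>{1..n}. \<phi> (\<zeta> i)) / n - (\<integral>x. \<phi> x \<partial>\<sigma>)\<bar> \<le> e"
  if nN: "max N 1 \<le> n" and H: "hamiltonian q n \<zeta> \<le> ennreal ((real n)\<^sup>2 * (S0 + q0 + \<theta> / 3))" for n \<zeta>
 proof -
  have n: "1 \<le> n" "N \<le> n" using nN by auto
  have Hfin: "hamiltonian q n \<zeta> < \<infinity>" using H by (rule le_less_trans) simp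
  have qf: "q (\<zeta> i) < \<infinity>" if "i \<in> {1..n}" for i
  proof -
   have "q (\<zeta> i) \<le> (\<Sum>i\<in>{1..n}. q (\<zeta> i))" using that by (intro member_le_sum) auto
   also have "\<dots> < \<infinity>"
   proof -
    have "1 * (\<Sum>i\<in>{1..n}. q (\<zeta> i)) \<le> of_nat n * (\<Sum>i\<in>{1..n}. q (\<zeta> i))"
     using of_nat_mono[OF n(1), where 'a=ennreal] by (intro mult_right_mono) simp_all
    also have "\<dots> \<le> hamiltonian q n \<zeta>"
     unfolding hamiltonian_def by (intro add_increasing2 add_increasing order_refl zero_le)
    finally show ?thesis using Hfin by (simp only: mult_1_left)
   qed
   finally show ?thesis .
  qed
  have kf: "kap (\<zeta> i) (\<zeta> j) < \<infinity>" if "i \<in> {1..n}" "j \<in> {1..n} - {i}" for i j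
  proof -
   have "kap (\<zeta> i) (\<zeta> j) \<le> (\<Sum>j\<in>{1..n}-{i}. kap (\<zeta> i) (\<zeta> j))" using that by (intro member_le_sum) auto
   also have "\<dots> \<le> (\<Sum>i\<in>{1..n}. \<Sum>j\<in>{1..n}-{i}. kap (\<zeta> i) (\<zeta> j))"
    using that by (intro member_le_sum[of i _ "\<lambda>i. \<Sum>j\<in>{1..n}-{i}. kap (\<zeta> i) (\<zeta> j)"]) auto
   also have "\<dots> \<le> hamiltonian q n \<zeta>"
    unfolding hamiltonian_def by (intro add_increasing2 order_refl zero_le)
   finally show ?thesis using Hfin by (rule le_less_trans)
  qed
  define qr where "qr i = enn2real (q (\<zeta> i))" for i
  define kr where "kr i j = enn2real (kap (\<zeta> i) (\<zeta> j))" for i j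
  define SK where "SK = (\<Sum>i\<in>{1..n}. \<Sum>j\<in>{1..n}-{i}. kr i j)"
  define SQ where "SQ = (\<Sum>i\<in>{1..n}. qr i)"
  define SL where "SL = (\<Sum>i\<in>{1..n}. ell (\<zeta> i))"
  have "hamiltonian q n \<zeta> = (\<Sum>i\<in>{1..n}. \<Sum>j\<in>{1..n}-{i}. ennreal (kr i j)) + of_nat n * (\<Sum>i\<in>{1..n}. ennreal (qr i)) + (\<Sum>i\<in>{1..n}. ennreal (ell (\<zeta> i)))"
   unfolding hamiltonian_def kr_def qr_def using qf kf by (intro arg_cong2[where f="(+)"] arg_cong2[where f="(*)"] sum.cong refl) (auto simp: less_top)
  also have "\<dots> = ennreal (SK + real n * SQ + SL)"
   by (simp add: SK_def SQ_def SL_def kr_def qr_def sum_nonneg ennreal_mult ennreal_plus ennreal_of_nat_eq_real_of_nat)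
  finally have "ennreal (SK + real n * SQ + SL) \<le> ennreal ((real n)\<^sup>2 * (S0 + q0 + \<theta> / 3))" using H by simp
  then have Hr: "SK + real n * SQ + SL \<le> (real n)\<^sup>2 * (S0 + q0 + \<theta> / 3)"
   using S0 q0 \<theta> by (subst (asm) ennreal_le_iff) auto
  note se = second_moment_emp[OF n(1), of \<zeta>] and ss = second_moment_sigma
  have "bil (reg_log \<delta>) (emp n \<zeta>) (emp n \<zeta>) = (\<Sum>i\<in>{1..n}. (\<Sum>j\<in>{1..n}. reg_log \<delta> (\<zeta> i) (\<zeta> j)) / n) / n"
   by (subst bil_emp[OF se n(1) reg_log_measurable integrable_reg_log[OF \<delta>(1) se se]]) (subst integral_emp(2)[OF _ n(1)], auto)
  also have "\<dots> = (\<Sum>i\<in>{1..n}. \<Sum>j\<in>{1..n}. reg_log \<delta> (\<zeta> i) (\<zeta> j)) / (real n)\<^sup>2"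
   by (simp add: sum_divide_distrib power2_eq_square)
  also have "(\<Sum>i\<in>{1..n}. \<Sum>j\<in>{1..n}. reg_log \<delta> (\<zeta> i) (\<zeta> j)) \<le> (\<Sum>i\<in>{1..n}. (\<Sum>j\<in>{1..n}-{i}. kr i j) + (ell (\<zeta> i) - ln \<delta> / 2))"
  proof (rule sum_mono)
   fix i assume i: "i \<in> {1..n}"
   have "(\<Sum>j\<in>{1..n}. reg_log \<delta> (\<zeta> i) (\<zeta> j)) = reg_log \<delta> (\<zeta> i) (\<zeta> i) + (\<Sum>j\<in>{1..n}-{i}. reg_log \<delta> (\<zeta> i) (\<zeta> j))"
    using i by (intro sum.remove) auto
   \<comment> \<open>The part \<open>ell (\<zeta> i)\<close> of the diagonal is covered by the last
     sum in \<open>hamiltonian\<close>.\<close>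
   also have "reg_log \<delta> (\<zeta> i) (\<zeta> i) = ell (\<zeta> i) - ln \<delta> / 2" by (simp add: reg_log_def)
   also have "(\<Sum>j\<in>{1..n}-{i}. reg_log \<delta> (\<zeta> i) (\<zeta> j)) \<le> (\<Sum>j\<in>{1..n}-{i}. kr i j)"
   proof (rule sum_mono)
    fix j assume j: "j \<in> {1..n} - {i}"
    have ne: "\<zeta> i \<noteq> \<zeta> j" using kf[OF i j] by (auto simp: kap_def)
    then have "kr i j = (ell (\<zeta> i) + ell (\<zeta> j)) / 2 - ln (cmod (\<zeta> i - \<zeta> j))"
     using ln_cmod_diff_le[OF ne] by (simp add: kr_def kap_def)
    then show "reg_log \<delta> (\<zeta> i) (\<zeta> j) \<le> kr i j" using reg_log_le[OF \<delta>(1) ne] by simp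
   qed
   finally show "(\<Sum>j\<in>{1..n}. reg_log \<delta> (\<zeta> i) (\<zeta> j)) \<le> (\<Sum>j\<in>{1..n}-{i}. kr i j) + (ell (\<zeta> i) - ln \<delta> / 2)" by simp
  qed
  also have "(\<Sum>i\<in>{1..n}. (\<Sum>j\<in>{1..n}-{i}. kr i j) + (ell (\<zeta> i) - ln \<delta> / 2)) = SK + SL - n * ln \<delta> / 2"
   by (simp add: SK_def SL_def sum.distrib sum_subtractf)
  also have "\<dots> \<le> (real n)\<^sup>2 * (S0 + q0 + \<theta> / 3) - real n * SQ - n * ln \<delta> / 2" using Hr by simp
  finally have b1: "bil (reg_log \<delta>) (emp n \<zeta>) (emp n \<zeta>) \<le> ((real n)\<^sup>2 * (S0 + q0 + \<theta> / 3) - real n * SQ - n * ln \<delta> / 2) / (real n)\<^sup>2"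
   by (simp add: divide_right_mono)
  also have "\<dots> = S0 + q0 + \<theta> / 3 - SQ / n - ln \<delta> / (2 * n)"
   using n by (simp add: field_simps power2_eq_square)
  finally have b1: "bil (reg_log \<delta>) (emp n \<zeta>) (emp n \<zeta>) \<le> S0 + q0 + \<theta> / 3 - SQ / n - ln \<delta> / (2 * n)" .
  have "bil (reg_log \<delta>) (emp n \<zeta>) \<sigma> = (\<Sum>i\<in>{1..n}. reg_pot \<delta> (\<zeta> i)) / n"
   unfolding reg_pot_def by (rule bil_emp[OF ss n(1) reg_log_measurable integrable_reg_log[OF \<delta>(1) se ss]])
  moreover have "(\<Sum>i\<in>{1..n}. 2 * S0 + q0 - \<theta> / 3) \<le> (\<Sum>i\<in>{1..n}. 2 * reg_pot \<delta> (\<zeta> i) + qr i)"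
   unfolding qr_def using qf by (intro sum_mono d0 \<delta>) auto
  then have "n * (2 * S0 + q0 - \<theta> / 3) \<le> 2 * (\<Sum>i\<in>{1..n}. reg_pot \<delta> (\<zeta> i)) + SQ"
   by (simp add: sum.distrib SQ_def sum_distrib_left)
  then have "2 * S0 + q0 - \<theta> / 3 \<le> 2 * ((\<Sum>i\<in>{1..n}. reg_pot \<delta> (\<zeta> i)) / n) + SQ / n"
   using n by (simp add: field_simps)
  ultimately have b2: "2 * S0 + q0 - \<theta> / 3 \<le> 2 * bil (reg_log \<delta>) (emp n \<zeta>) \<sigma> + SQ / n" by simp
  have "energy_dist (reg_log \<delta>) (emp n \<zeta>) \<sigma> \<le> \<theta>"
   unfolding energy_dist_def using b1 b2 bil_reg_log_sigma[OF \<delta>(1)] N[OF n(2)] by simp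
  from close[OF se ss \<delta>(1,2) this]
  show ?thesis using integral_emp(2)[OF borel_measurable_continuous_onI[OF c\<phi>] n(1)] by simp
 qed
 then show ?thesis using \<theta>3 by blast
qed

end

section \<open>Partition function and large deviations\<close>

definition boltzmann :: "real \<Rightarrow> ennreal \<Rightarrow> ennreal" where
 "boltzmann b x = (if x = \<infinity> then 0 else ennreal (exp (- b * enn2real x)))"

lemma boltzmann_measurable [measurable]: "boltzmann b \<in> borel_measurable borel"
 unfolding boltzmann_def by measurable

lemma boltzmann_ennreal: "0 \<le> x \<Longrightarrow> boltzmann b (ennreal x) = ennreal (exp (- b * x))"
 by (simp add: boltzmann_def)

lemma boltzmann_antimono: "0 < b \<Longrightarrow> x \<le> y \<Longrightarrow> boltzmann b y \<le> boltzmann b x"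
 by (cases x; cases y) (auto simp: boltzmann_def ennreal_leI top_unique)

lemma boltzmann_add: "boltzmann b (x + y) = boltzmann b x * boltzmann b y"
 by (cases x; cases y) (auto simp: boltzmann_def enn2real_plus algebra_simps exp_add[symmetric] ennreal_mult'[symmetric])

text \<open>Jensen's inequality from the tangent of exp (- b y) at \<open>a\<close>, rearranged to
  avoid subtraction; in this form the tangent inequality also holds at y = \<infinity>.\<close>

lemma boltzmann_jensen:
 assumes b: "0 < b" and [measurable]: "f \<in> borel_measurable M" and A [measurable]: "A \<in> sets M"
  and V: "emeasure M A = ennreal V" "0 \<le> V" and a: "0 \<le> a"
  and f: "(\<integral>\<^sup>+ x\<in>A. f x \<partial>M) \<le> ennreal V * ennreal a"
 shows "ennreal V * ennreal (exp (- b * a)) \<le> (\<integral>\<^sup>+ x\<in>A. boltzmann b (f x) \<partial>M)"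
proof -
 let ?e = "exp (- b * a)"
 let ?I = "\<integral>\<^sup>+ x\<in>A. boltzmann b (f x) \<partial>M"
 have "ennreal (?e * (1 + b * a)) \<le> boltzmann b y + ennreal (?e * b) * y" for y
 proof (cases y)
  case (real r)
  have "?e * (1 + (b * a - b * r)) \<le> ?e * exp (b * a - b * r)" by (intro mult_left_mono exp_ge_add_one_self) auto
  also have "\<dots> = exp (- b * r)" by (simp add: exp_add[symmetric])
  finally have "?e * (1 + b * a) \<le> exp (- b * r) + ?e * b * r" by (simp add: algebra_simps)
  then have "ennreal (?e * (1 + b * a)) \<le> ennreal (exp (- b * r) + ?e * b * r)" by (rule ennreal_leI)
  then show ?thesis using real b by (simp add: boltzmann_ennreal ennreal_plus ennreal_mult)
 next
  case top then show ?thesis using b by (simp add: ennreal_mult_top)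
 qed
 then have "(\<integral>\<^sup>+ x\<in>A. ennreal (?e * (1 + b * a)) \<partial>M) \<le> (\<integral>\<^sup>+ x. boltzmann b (f x) * indicator A x + ennreal (?e * b) * (f x * indicator A x) \<partial>M)"
  by (intro nn_integral_mono) (auto simp: indicator_def)
 also have "\<dots> = ?I + ennreal (?e * b) * (\<integral>\<^sup>+ x\<in>A. f x \<partial>M)"
  by (subst nn_integral_add) (auto simp: nn_integral_cmult)
 also have "\<dots> \<le> ?I + ennreal (?e * b) * (ennreal V * ennreal a)"
  by (intro add_left_mono mult_left_mono f) auto
 also have "(\<integral>\<^sup>+ x\<in>A. ennreal (?e * (1 + b * a)) \<partial>M) = ennreal (V * ?e + ?e * b * (V * a))"
  using V a b by (subst nn_integral_cmult_indicator) (auto simp: ennreal_mult'[symmetric] algebra_simps)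
 also have "\<dots> = ennreal V * ennreal ?e + ennreal (?e * b) * (ennreal V * ennreal a)"
  using V a b by (simp add: ennreal_plus ennreal_mult)
 finally have "ennreal (?e * b) * (ennreal V * ennreal a) + ennreal V * ennreal ?e \<le> ennreal (?e * b) * (ennreal V * ennreal a) + ?I"
  by (simp add: add.commute)
 then show ?thesis
  by (subst (asm) ennreal_add_left_cancel_le) (auto simp: ennreal_mult_eq_top_iff)
qed

text \<open>The property \<open>q_disc\<close> of the locale as a predicate, since
  \<open>ell\<close> has to satisfy it as well.\<close>

definition disc_usc :: "(complex \<Rightarrow> ennreal) \<Rightarrow> bool" where
 "disc_usc f \<longleftrightarrow> (\<forall>R. \<forall>e>0. \<exists>r0>0. \<forall>r>0. r \<le> r0 \<longrightarrow> (\<forall>z\<in>cball 0 R. (\<integral>\<^sup>+ u\<in>ball z r. f u \<partial>lborel) \<le> ennreal (pi * r\<^sup>2) * (f z + ennreal e)))"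

lemma disc_usc_ell: "disc_usc (\<lambda>z. ennreal (ell z))"
 unfolding disc_usc_def
proof (intro allI impI)
 fix R e :: real assume e: "0 < e"
 obtain r0 where r0: "0 < r0" "\<forall>z\<in>cball 0 R. \<forall>u\<in>ball z r0. \<bar>ell u - ell z\<bar> \<le> e"
  using uniform_close_on_balls[of ell e R, OF continuous_on_ell[OF continuous_on_id] e] by auto
 have "(\<integral>\<^sup>+ u\<in>ball z r. ennreal (ell u) \<partial>lborel) \<le> ennreal (pi * r\<^sup>2) * (ennreal (ell z) + ennreal e)"
  if "0 < r" "r \<le> r0" "z \<in> cball 0 R" for r z
 proof -
  have "(\<integral>\<^sup>+ u\<in>ball z r. ennreal (ell u) \<partial>lborel) \<le> (\<integral>\<^sup>+ u\<in>ball z r. ennreal (ell z + e) \<partial>lborel)"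
  proof (intro nn_integral_mono)
   fix u
   have "ell u \<le> ell z + e" if "u \<in> ball z r"
    using r0(2)[THEN bspec[OF _ \<open>z \<in> cball 0 R\<close>], THEN bspec[of _ _ u]] that \<open>r \<le> r0\<close> by auto
   then show "ennreal (ell u) * indicator (ball z r) u \<le> ennreal (ell z + e) * indicator (ball z r) u"
    by (auto simp: indicator_def intro!: ennreal_leI)
  qed
  also have "\<dots> = ennreal (pi * r\<^sup>2) * (ennreal (ell z) + ennreal e)"
   using e that by (subst nn_integral_cmult_indicator) (auto simp: emeasure_ball_complex mult.commute ennreal_plus)
  finally show ?thesis .
 qed
 then show "\<exists>r0>0. \<forall>r>0. r \<le> r0 \<longrightarrow> (\<forall>z\<in>cball 0 R. (\<integral>\<^sup>+ u\<in>ball z r. ennreal (ell u) \<partial>lborel) \<le> ennreal (pi * r\<^sup>2) * (ennreal (ell z) + ennreal e))"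
  using r0(1) by blast
qed

text \<open>The partition function is a Lebesgue integral, whereas Markov's inequality will be
  applied under a product of probability measures; this is the passage between them.\<close>

lemma nn_integral_PiM_density_le:
 fixes g :: "complex \<Rightarrow> ennreal" and f :: "(nat \<Rightarrow> complex) \<Rightarrow> ennreal"
 assumes [measurable]: "g \<in> borel_measurable borel" and g: "\<And>z. g z \<le> C" "prob_space (density lborel g)" and I: "finite I"
  and f: "f \<in> borel_measurable (Pi\<^sub>M I (\<lambda>_. lborel))"
 shows "(\<integral>\<^sup>+ x. f x \<partial>Pi\<^sub>M I (\<lambda>_. density lborel g)) \<le> C ^ card I * (\<integral>\<^sup>+ x. f x \<partial>Pi\<^sub>M I (\<lambda>_. lborel))"
 using I f
proof (induction I arbitrary: f)
 case empty
 then show ?case by (simp add: PiM_empty)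
next
 case (insert i I)
 interpret d: prob_space "density lborel g" by (rule g)
 interpret D: product_sigma_finite "\<lambda>_::nat. density lborel g" by standard
 interpret L: product_sigma_finite "\<lambda>_::nat. lborel :: complex measure" by standard
 have s: "sets (Pi\<^sub>M J (\<lambda>_::nat. density lborel g)) = sets (Pi\<^sub>M J (\<lambda>_. lborel))" for J by (intro sets_PiM_cong) auto
 note f [measurable] = insert.prems
 have fm: "f \<in> borel_measurable (Pi\<^sub>M (insert i I) (\<lambda>_. density lborel g))"
  using f by (subst measurable_cong_sets[OF s refl])
 have h [measurable]: "(\<lambda>x. \<integral>\<^sup>+ y. f (x(i := y)) \<partial>lborel) \<in> borel_measurable (Pi\<^sub>M I (\<lambda>_. lborel))"
  by measurable
 have "(\<integral>\<^sup>+ x. f x \<partial>Pi\<^sub>M (insert i I) (\<lambda>_. density lborel g)) = (\<integral>\<^sup>+ x. (\<integral>\<^sup>+ y. f (x(i := y)) \<partial>density lborel g) \<partial>Pi\<^sub>M I (\<lambda>_. density lborel g))"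
  by (rule D.product_nn_integral_insert) (use insert fm in auto)
 also have "\<dots> \<le> (\<integral>\<^sup>+ x. C * (\<integral>\<^sup>+ y. f (x(i := y)) \<partial>lborel) \<partial>Pi\<^sub>M I (\<lambda>_. density lborel g))"
 proof (rule nn_integral_mono)
  fix x assume "x \<in> space (Pi\<^sub>M I (\<lambda>_. density lborel g))"
  then have x: "x \<in> space (Pi\<^sub>M I (\<lambda>_. lborel))" by (simp add: space_PiM)
  have [measurable]: "(\<lambda>y. f (x(i := y))) \<in> borel_measurable borel"
   using measurable_comp[OF measurable_component_update[OF x \<open>i \<notin> I\<close>] f] by (simp add: comp_def)
  have "(\<integral>\<^sup>+ y. f (x(i := y)) \<partial>density lborel g) = (\<integral>\<^sup>+ y. g y * f (x(i := y)) \<partial>lborel)"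
   by (rule nn_integral_density) measurable
  also have "\<dots> \<le> (\<integral>\<^sup>+ y. C * f (x(i := y)) \<partial>lborel)" by (intro nn_integral_mono mult_right_mono g) auto
  also have "\<dots> = C * (\<integral>\<^sup>+ y. f (x(i := y)) \<partial>lborel)" by (rule nn_integral_cmult) measurable
  finally show "(\<integral>\<^sup>+ y. f (x(i := y)) \<partial>density lborel g) \<le> C * (\<integral>\<^sup>+ y. f (x(i := y)) \<partial>lborel)" .
 qed
 also have "\<dots> = C * (\<integral>\<^sup>+ x. (\<integral>\<^sup>+ y. f (x(i := y)) \<partial>lborel) \<partial>Pi\<^sub>M I (\<lambda>_. density lborel g))"
  using h by (intro nn_integral_cmult) (subst measurable_cong_sets[OF s refl])
 also have "\<dots> \<le> C * (C ^ card I * (\<integral>\<^sup>+ x. (\<integral>\<^sup>+ y. f (x(i := y)) \<partial>lborel) \<partial>Pi\<^sub>M I (\<lambda>_. lborel)))"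
  by (intro mult_left_mono insert.IH h) auto
 also have "\<dots> = C ^ card (insert i I) * (\<integral>\<^sup>+ x. f x \<partial>Pi\<^sub>M (insert i I) (\<lambda>_. lborel))"
  using insert by (subst L.product_nn_integral_insert) (auto simp: mult.assoc)
 finally show ?case .
qed

lemma nn_integral_PiM_component:
 fixes \<tau> :: "complex measure" and f :: "complex \<Rightarrow> ennreal"
 assumes p: "prob_space \<tau>" and s: "sets \<tau> = sets borel" and i: "i \<in> I" and [measurable]: "f \<in> borel_measurable borel"
 shows "(\<integral>\<^sup>+ x. f (x i) \<partial>Pi\<^sub>M I (\<lambda>_. \<tau>)) = (\<integral>\<^sup>+ z. f z \<partial>\<tau>)"
proof -
 interpret product_prob_space "\<lambda>_. \<tau>" I using p by (simp add: product_prob_space_def product_prob_space_axioms_def product_sigma_finite_def prob_space_imp_sigma_finite)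
 have [measurable_cong]: "sets \<tau> = sets borel" by (rule s)
 have "(\<integral>\<^sup>+ z. f z \<partial>distr (Pi\<^sub>M I (\<lambda>_. \<tau>)) \<tau> (\<lambda>x. x i)) = (\<integral>\<^sup>+ x. f (x i) \<partial>Pi\<^sub>M I (\<lambda>_. \<tau>))"
  using i by (subst nn_integral_distr) auto
 then show ?thesis by (simp add: PiM_component[OF i])
qed

lemma nn_integral_PiM_kap:
 assumes p: "prob_space \<tau>" and s: "sets \<tau> = sets borel" and I: "finite I" and ij: "i \<in> I" "j \<in> I" "i \<noteq> j"
 shows "(\<integral>\<^sup>+ x. kap (x i) (x j) \<partial>Pi\<^sub>M I (\<lambda>_::nat. \<tau>)) = kap_energy \<tau>"
proof -
 interpret t: prob_space \<tau> by (rule p)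
 interpret D: product_sigma_finite "\<lambda>_::nat. \<tau>" by standard
 have [measurable_cong]: "sets \<tau> = sets borel" by (rule s)
 have I': "I = insert i (I - {i})" using ij by auto
 have "(\<integral>\<^sup>+ x. kap (x i) (x j) \<partial>Pi\<^sub>M I (\<lambda>_::nat. \<tau>)) = (\<integral>\<^sup>+ x. \<integral>\<^sup>+ y. kap y (x j) \<partial>\<tau> \<partial>Pi\<^sub>M (I - {i}) (\<lambda>_::nat. \<tau>))"
  using ij I by (subst I', subst D.product_nn_integral_insert) (auto cong: nn_integral_cong)
 also have "\<dots> = (\<integral>\<^sup>+ z. \<integral>\<^sup>+ y. kap y z \<partial>\<tau> \<partial>\<tau>)"
  using ij by (intro nn_integral_PiM_component[OF p s, of j "I - {i}" "\<lambda>z. \<integral>\<^sup>+ y. kap y z \<partial>\<tau>"]) auto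
 also have "\<dots> = kap_energy \<tau>" unfolding kap_energy_def by (simp add: kap_sym)
 finally show ?thesis .
qed

lemma hamiltonian_measurable_comp:
 assumes q: "q \<in> borel_measurable borel" and f: "\<And>i. i \<in> {1..n} \<Longrightarrow> (\<lambda>x. f x i) \<in> borel_measurable M"
 shows "(\<lambda>x. hamiltonian q n (f x)) \<in> borel_measurable M"
proof -
 have k: "(\<lambda>x. kap (f x i) (f x j)) \<in> borel_measurable M" if "i \<in> {1..n}" "j \<in> {1..n} - {i}" for i j
  using that by (intro kap_measurable2 f) auto
 have qm: "(\<lambda>x. q (f x i)) \<in> borel_measurable M" if "i \<in> {1..n}" for i
  by (rule measurable_compose[OF f[OF that] q])
 have l: "(\<lambda>x. ennreal (ell (f x i))) \<in> borel_measurable M" if "i \<in> {1..n}" for i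
  by (rule measurable_compose[OF f[OF that]]) measurable
 show ?thesis unfolding hamiltonian_def
  by (intro borel_measurable_add borel_measurable_sum borel_measurable_times_ennreal borel_measurable_const k qm l)
qed

lemma hamiltonian_measurable [measurable]:
 assumes q: "q \<in> borel_measurable borel"
 shows "hamiltonian q n \<in> borel_measurable (Pi\<^sub>M {1..n} (\<lambda>_. lborel))"
 by (rule hamiltonian_measurable_comp[OF q])
   (rule measurable_component_singleton[where M="\<lambda>_. lborel :: complex measure", unfolded measurable_lborel1], assumption)

lemma nn_integral_hamiltonian:
 assumes p: "prob_space \<tau>" and s: "sets \<tau> = sets borel" and [measurable]: "q \<in> borel_measurable borel"
 shows "(\<integral>\<^sup>+ x. hamiltonian q n x \<partial>Pi\<^sub>M {1..n} (\<lambda>_. \<tau>))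
  = of_nat n * (of_nat (n - 1) * kap_energy \<tau>) + of_nat n * (of_nat n * (\<integral>\<^sup>+ z. q z \<partial>\<tau>)) + of_nat n * (\<integral>\<^sup>+ z. ennreal (ell z) \<partial>\<tau>)"
proof -
 have [measurable_cong]: "sets \<tau> = sets borel" by (rule s)
 let ?P = "Pi\<^sub>M {1..n} (\<lambda>_. \<tau>)"
 have m1 [measurable]: "(\<lambda>x. x i) \<in> borel_measurable ?P" if "i \<in> {1..n}" for i
  using measurable_component_singleton[OF that, of "\<lambda>_. \<tau>"] measurable_cong_sets[OF refl s] by auto
 have m2: "(\<lambda>x. kap (x i) (x j)) \<in> borel_measurable ?P" if "i \<in> {1..n}" "j \<in> {1..n} - {i}" for i j
  using that by (intro kap_measurable2 m1) auto
 have m3: "(\<lambda>x. q (x i)) \<in> borel_measurable ?P" "(\<lambda>x. ennreal (ell (x i))) \<in> borel_measurable ?P" if "i \<in> {1..n}" for i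
  by (rule measurable_compose[OF m1[OF that] assms(3)])
    (rule measurable_compose[OF m1[OF that], of "\<lambda>z. ennreal (ell z)" borel], measurable)
 have "(\<integral>\<^sup>+ x. hamiltonian q n x \<partial>?P) = (\<Sum>i\<in>{1..n}. \<Sum>j\<in>{1..n}-{i}. \<integral>\<^sup>+ x. kap (x i) (x j) \<partial>?P)
   + of_nat n * (\<Sum>i\<in>{1..n}. \<integral>\<^sup>+ x. q (x i) \<partial>?P) + (\<Sum>i\<in>{1..n}. \<integral>\<^sup>+ x. ennreal (ell (x i)) \<partial>?P)"
 proof -
  have A: "(\<lambda>x. \<Sum>j\<in>{1..n}-{i}. kap (x i) (x j)) \<in> borel_measurable ?P" if "i \<in> {1..n}" for i
   by (intro borel_measurable_sum m2 that)
  have A': "(\<lambda>x. \<Sum>i\<in>{1..n}. \<Sum>j\<in>{1..n}-{i}. kap (x i) (x j)) \<in> borel_measurable ?P"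
   by (intro borel_measurable_sum A)
  have B: "(\<lambda>x. \<Sum>i\<in>{1..n}. q (x i)) \<in> borel_measurable ?P" by (intro borel_measurable_sum m3)
  have C: "(\<lambda>x. \<Sum>i\<in>{1..n}. ennreal (ell (x i))) \<in> borel_measurable ?P" by (intro borel_measurable_sum m3)
  have B': "(\<lambda>x. of_nat n * (\<Sum>i\<in>{1..n}. q (x i))) \<in> borel_measurable ?P"
   by (intro borel_measurable_times_ennreal borel_measurable_const B)
  have "(\<integral>\<^sup>+ x. (\<Sum>i\<in>{1..n}. \<Sum>j\<in>{1..n}-{i}. kap (x i) (x j)) \<partial>?P) = (\<Sum>i\<in>{1..n}. \<Sum>j\<in>{1..n}-{i}. \<integral>\<^sup>+ x. kap (x i) (x j) \<partial>?P)"
   by (rule trans[OF nn_integral_sum[OF A] sum.cong[OF refl nn_integral_sum[OF m2]]])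
  moreover have "(\<integral>\<^sup>+ x. (\<Sum>i\<in>{1..n}. q (x i)) \<partial>?P) = (\<Sum>i\<in>{1..n}. \<integral>\<^sup>+ x. q (x i) \<partial>?P)"
   by (rule nn_integral_sum[OF m3(1)])
  moreover have "(\<integral>\<^sup>+ x. (\<Sum>i\<in>{1..n}. ennreal (ell (x i))) \<partial>?P) = (\<Sum>i\<in>{1..n}. \<integral>\<^sup>+ x. ennreal (ell (x i)) \<partial>?P)"
   by (rule nn_integral_sum[OF m3(2)])
  ultimately show ?thesis
   unfolding hamiltonian_def nn_integral_add[OF borel_measurable_add[OF A' B'] C] nn_integral_add[OF A' B'] nn_integral_cmult[OF B] by simp
 qed
 also have "(\<Sum>i\<in>{1..n}. \<Sum>j\<in>{1..n}-{i}. \<integral>\<^sup>+ x. kap (x i) (x j) \<partial>?P) = (\<Sum>i\<in>{1..n}. \<Sum>j\<in>{1..n}-{i}. kap_energy \<tau>)"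
  by (intro sum.cong refl nn_integral_PiM_kap[OF p s]) auto
 also have "\<dots> = of_nat n * (of_nat (n - 1) * kap_energy \<tau>)" by simp
 also have "(\<Sum>i\<in>{1..n}. \<integral>\<^sup>+ x. q (x i) \<partial>?P) = (\<Sum>i\<in>{1..n}. \<integral>\<^sup>+ z. q z \<partial>\<tau>)"
  by (intro sum.cong refl nn_integral_PiM_component[OF p s]) auto
 also have "(\<Sum>i\<in>{1..n}. \<integral>\<^sup>+ x. ennreal (ell (x i)) \<partial>?P) = (\<Sum>i\<in>{1..n}. \<integral>\<^sup>+ z. ennreal (ell z) \<partial>\<tau>)"
  by (intro sum.cong refl nn_integral_PiM_component[OF p s]) auto
 finally show ?thesis by simp
qed

context equilibrium
begin

text \<open>The density of \<open>\<sigma>\<close> may be unbounded, but comparing a product measure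
  with Lebesgue measure requires a bound. Conditioning \<open>\<sigma>\<close> on the set where the
  density is at most \<open>k\<close> multiplies energies by at most 1 / m^2, and the retained mass
  m tends to 1.\<close>

lemma truncated_equilibrium:
 assumes \<eta>: "0 < \<eta>"
 obtains g C K where "g \<in> borel_measurable borel" "\<forall>z. g z \<le> ennreal C" "0 < C" "prob_space (density lborel g)"
  "kap_energy (density lborel g) + (\<integral>\<^sup>+ z. q z \<partial>density lborel g) \<le> ennreal (S0 + q0 + \<eta>)"
  "(\<integral>\<^sup>+ z. ennreal (ell z) \<partial>density lborel g) \<le> ennreal K" "0 \<le> K"
proof -
 define A where "A k = {z. rho z \<le> of_nat k}" for k :: nat
 have [measurable]: "A k \<in> sets borel" for k unfolding A_def by measurable
 have As: "A k \<in> sets \<sigma>" for k by measurable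
 have "(\<lambda>k. measure \<sigma> (A k)) \<longlonglongrightarrow> measure \<sigma> (\<Union>k. A k)"
  using As by (intro s.finite_Lim_measure_incseq) (auto simp: incseq_def A_def intro: order_trans of_nat_mono)
 moreover have "measure \<sigma> (\<Union>k. A k) = 1"
 proof -
  have "sigma_finite_measure \<sigma>" by (rule s.sigma_finite_measure_axioms)
  then have "AE z in lborel. rho z \<noteq> \<infinity>" unfolding rho_def
   by (rule sigma_finite_measure.RN_deriv_finite[OF sigma_finite_lborel _ sigma_ac]) (simp add: sets_sigma)
  then have "AE z in lborel. z \<in> (\<Union>k. A k)"
  proof eventually_elim
   case (elim z)
   then obtain r where r: "rho z = ennreal r" "0 \<le> r" by (cases "rho z") auto
   obtain k where "r \<le> real k" using real_arch_simple by blast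
   then have "rho z \<le> of_nat k" using r by (simp add: ennreal_leI ennreal_of_nat_eq_real_of_nat)
   then show ?case by (auto simp: A_def)
  qed
  then have "AE z in \<sigma>. z \<in> (\<Union>k. A k)" by (rule absolutely_continuous_AE[rotated 2, OF _ ]) (auto simp: sets_sigma sigma_ac)
  then show ?thesis using As by (intro s.prob_eq_1[THEN iffD2]) auto
 qed
 ultimately have lim: "(\<lambda>k. measure \<sigma> (A k)) \<longlonglongrightarrow> 1" by simp
 define J where "J = S0 + q0"
 have J: "0 \<le> J" using S0 q0 by (simp add: J_def)
 \<comment> \<open>The kernel contributes 1 / m^2 and the potential only 1 / m; the former dominates
   both.\<close>
 have "(\<lambda>k. J / (measure \<sigma> (A k))\<^sup>2) \<longlonglongrightarrow> J / 1\<^sup>2" by (intro tendsto_intros lim) auto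
 then have "\<forall>\<^sub>F k in sequentially. J / (measure \<sigma> (A k))\<^sup>2 < J + \<eta>" using \<eta> by (intro order_tendstoD) auto
 moreover have "\<forall>\<^sub>F k in sequentially. measure \<sigma> (A k) > 0" using order_tendstoD(1)[OF lim, of 0] by simp
 moreover have "\<forall>\<^sub>F k in sequentially. k > 0" by (rule eventually_gt_at_top)
 ultimately have "\<forall>\<^sub>F k in sequentially. J / (measure \<sigma> (A k))\<^sup>2 < J + \<eta> \<and> measure \<sigma> (A k) > 0 \<and> k > 0" by eventually_elim auto
 then obtain k where k: "J / (measure \<sigma> (A k))\<^sup>2 < J + \<eta>" "measure \<sigma> (A k) > 0" "k > 0" 
  using eventually_happens'[OF sequentially_bot] by blast
 define m where "m = measure \<sigma> (A k)"
 have m: "0 < m" "m \<le> 1" using k by (auto simp: m_def)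
 define g where "g z = ennreal (1 / m) * (indicator (A k) z * rho z)" for z
 have gm [measurable]: "g \<in> borel_measurable borel" unfolding g_def by measurable
 let ?\<tau> = "density lborel g"
 have int: "(\<integral>\<^sup>+ z. f z \<partial>?\<tau>) = ennreal (1 / m) * (\<integral>\<^sup>+ z\<in>A k. f z \<partial>\<sigma>)" if [measurable]: "f \<in> borel_measurable borel" for f
  by (simp add: nn_integral_density nn_integral_sigma g_def mult.assoc nn_integral_cmult) (simp add: ac_simps)
 have le: "(\<integral>\<^sup>+ z. f z \<partial>?\<tau>) \<le> ennreal (1 / m) * (\<integral>\<^sup>+ z. f z \<partial>\<sigma>)" if [measurable]: "f \<in> borel_measurable borel" for f
  unfolding int[OF that] by (intro mult_left_mono nn_integral_mono) (auto simp: indicator_def)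
 have p: "prob_space ?\<tau>"
 proof (rule prob_spaceI)
  have "emeasure ?\<tau> (space ?\<tau>) = (\<integral>\<^sup>+ z. 1 \<partial>?\<tau>)" by simp
  also have "\<dots> = ennreal (1 / m) * emeasure \<sigma> (A k)" by (subst int) (auto)
  also have "\<dots> = 1" using m by (simp add: s.emeasure_eq_measure m_def[symmetric] ennreal_mult'[symmetric])
  finally show "emeasure ?\<tau> (space ?\<tau>) = 1" .
 qed
 have E: "kap_energy ?\<tau> \<le> ennreal (1 / m * (1 / m * S0))"
 proof -
  have "kap_energy ?\<tau> \<le> (\<integral>\<^sup>+ z. ennreal (1 / m) * pot z \<partial>?\<tau>)"
   unfolding kap_energy_def pot_def by (intro nn_integral_mono le) measurable
  also have "\<dots> \<le> ennreal (1 / m) * (\<integral>\<^sup>+ z. ennreal (1 / m) * pot z \<partial>\<sigma>)" by (rule le) measurable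
  also have "\<dots> = ennreal (1 / m) * (ennreal (1 / m) * kap_energy \<sigma>)"
   by (simp add: nn_integral_cmult pot_def kap_energy_def)
  also have "\<dots> = ennreal (1 / m * (1 / m * S0))" using m S0 by (simp add: ennreal_mult'[symmetric])
  finally show ?thesis .
 qed
 have Q: "(\<integral>\<^sup>+ z. q z \<partial>?\<tau>) \<le> ennreal (1 / m * q0)"
  using le[of q] m q0 by (simp add: ennreal_mult'[symmetric])
 have "kap_energy ?\<tau> + (\<integral>\<^sup>+ z. q z \<partial>?\<tau>) \<le> ennreal (1 / m * (1 / m * S0) + 1 / m * q0)"
  using add_mono[OF E Q] m S0 q0 by (simp add: ennreal_plus)
 also have "\<dots> \<le> ennreal (S0 + q0 + \<eta>)"
 proof (rule ennreal_leI)
  have "1 / m * q0 \<le> 1 / m * (1 / m * q0)" using m q0 by (intro mult_left_mono) (auto simp: divide_simps mult_left_le)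
  then have "1 / m * (1 / m * S0) + 1 / m * q0 \<le> J / m\<^sup>2" using m by (simp add: J_def power2_eq_square add_divide_distrib)
  then show "1 / m * (1 / m * S0) + 1 / m * q0 \<le> S0 + q0 + \<eta>" using k(1) by (simp add: J_def m_def)
 qed
 finally have EQ: "kap_energy ?\<tau> + (\<integral>\<^sup>+ z. q z \<partial>?\<tau>) \<le> ennreal (S0 + q0 + \<eta>)" .
 have L: "(\<integral>\<^sup>+ z. ennreal (ell z) \<partial>?\<tau>) \<le> ennreal (1 / c1 * (1 / m * q0))"
 proof -
  have "(\<integral>\<^sup>+ z. ennreal (ell z) \<partial>?\<tau>) \<le> (\<integral>\<^sup>+ z. ennreal (1 / c1) * q z \<partial>?\<tau>)"
  proof (rule nn_integral_mono)
   fix z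
   have "ennreal (ell z) \<le> ennreal (1 / c1 * (c1 * (cmod z)\<^sup>2))" using c1 ell_le[of z] by (intro ennreal_leI) simp
   also have "\<dots> = ennreal (1 / c1) * ennreal (c1 * (cmod z)\<^sup>2)" using c1 by (intro ennreal_mult) auto
   also have "\<dots> \<le> ennreal (1 / c1) * q z" by (intro mult_left_mono q_ge) auto
   finally show "ennreal (ell z) \<le> ennreal (1 / c1) * q z" .
  qed
  also have "\<dots> = ennreal (1 / c1) * (\<integral>\<^sup>+ z. q z \<partial>?\<tau>)" by (simp add: nn_integral_cmult)
  also have "\<dots> \<le> ennreal (1 / c1) * ennreal (1 / m * q0)" by (intro mult_left_mono Q) auto
  also have "\<dots> = ennreal (1 / c1 * (1 / m * q0))" using c1 m q0 by (intro ennreal_mult[symmetric]) auto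
  finally show ?thesis .
 qed
 have gle: "g z \<le> ennreal (1 / m * real k)" for z
 proof -
  have "indicator (A k) z * rho z \<le> ennreal (real k)" by (auto simp: indicator_def A_def ennreal_of_nat_eq_real_of_nat)
  then have "g z \<le> ennreal (1 / m) * ennreal (real k)" unfolding g_def by (intro mult_left_mono) auto
  then show ?thesis using m by (simp add: ennreal_mult'[symmetric])
 qed
 show ?thesis
  by (rule that[OF gm allI[OF gle] _ p EQ L]) (use m k c1 q0 in auto)
qed

end

locale gas = equilibrium +
 fixes \<beta> :: real
 assumes \<beta>: "0 < \<beta>"
begin

definition weight :: "nat \<Rightarrow> (nat \<Rightarrow> complex) \<Rightarrow> ennreal" where
 "weight n \<zeta> = boltzmann \<beta> (hamiltonian q n \<zeta>)"

definition Zn :: "nat \<Rightarrow> ennreal" where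
 "Zn n = (\<integral>\<^sup>+ \<zeta>. weight n \<zeta> \<partial>vol n)"

lemma weight_measurable [measurable]: "weight n \<in> borel_measurable (vol n)"
 unfolding weight_def by measurable

text \<open>Draw the points independently from a truncated equilibrium measure. The mean Hamiltonian
  is at most n^2 (S0 + q0 + \<eta>/2) for large n, so by Markov's inequality it stays below n^2 (S0
  + q0 + \<eta>) with a probability bounded from below. Returning to Lebesgue measure costs
  \<open>C ^ n\<close>, negligible on the scale n^2.\<close>

lemma partition_lower:
 assumes \<eta>: "0 < \<eta>"
 obtains p C N where "0 < p" "0 < C" "\<And>n. n \<ge> N \<Longrightarrow> ennreal (p * exp (- \<beta> * ((real n)\<^sup>2 * (S0 + q0 + \<eta>)))) \<le> ennreal C ^ n * Zn n"
proof -
 have \<eta>4: "0 < \<eta> / 4" using \<eta> by simp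
 obtain g C K where g [measurable]: "g \<in> borel_measurable borel" and gC: "\<forall>z. g z \<le> ennreal C" "0 < C" and p: "prob_space (density lborel g)"
  and E: "kap_energy (density lborel g) + (\<integral>\<^sup>+ z. q z \<partial>density lborel g) \<le> ennreal (S0 + q0 + \<eta> / 4)"
  and K: "(\<integral>\<^sup>+ z. ennreal (ell z) \<partial>density lborel g) \<le> ennreal K" "0 \<le> K"
  using truncated_equilibrium[OF \<eta>4] .
 let ?\<tau> = "density lborel g"
 interpret t: prob_space ?\<tau> by (rule p)
 define J where "J = S0 + q0"
 have J: "0 \<le> J" using S0 q0 by (simp add: J_def)
 \<comment> \<open>Such \<open>n\<close> absorb the linear contribution n K of the
   \<open>ell\<close> terms; the factor in front is the complementary Markov probability.\<close>
 have "ennreal ((\<eta> / 2 / (J + \<eta>)) * exp (- \<beta> * ((real n)\<^sup>2 * (J + \<eta>)))) \<le> ennreal C ^ n * Zn n" if n: "max 1 (nat \<lceil>4 * K / \<eta>\<rceil>) \<le> n" for n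
 proof -
  let ?P = "Pi\<^sub>M {1..n} (\<lambda>_. ?\<tau>)"
  interpret P: prob_space ?P by (intro prob_space_PiM p)
  have n1: "1 \<le> n" using n by simp
  have nK: "K \<le> real n * (\<eta> / 4)"
  proof -
   have "4 * K / \<eta> \<le> real n" using n by linarith
   then show ?thesis using \<eta> by (simp add: field_simps)
  qed
  have sP: "sets ?P = sets (vol n)" by (intro sets_PiM_cong) auto
  have hm [measurable]: "hamiltonian q n \<in> borel_measurable ?P" by (subst measurable_cong_sets[OF sP refl]) measurable
  define a where "a = (real n)\<^sup>2 * (J + \<eta>)"
  have a: "0 < a" using n1 J \<eta> by (simp add: a_def)
  have "(\<integral>\<^sup>+ x. hamiltonian q n x \<partial>?P) = of_nat n * (of_nat (n - 1) * kap_energy ?\<tau>) + of_nat n * (of_nat n * (\<integral>\<^sup>+ z. q z \<partial>?\<tau>)) + of_nat n * (\<integral>\<^sup>+ z. ennreal (ell z) \<partial>?\<tau>)"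
   by (rule nn_integral_hamiltonian[OF p]) auto
  also have "\<dots> \<le> of_nat n * (of_nat n * kap_energy ?\<tau>) + of_nat n * (of_nat n * (\<integral>\<^sup>+ z. q z \<partial>?\<tau>)) + of_nat n * ennreal K"
   by (intro add_mono mult_left_mono mult_right_mono of_nat_mono K) auto
  also have "\<dots> = of_nat n * (of_nat n * (kap_energy ?\<tau> + (\<integral>\<^sup>+ z. q z \<partial>?\<tau>))) + of_nat n * ennreal K"
   by (simp add: distrib_left)
  also have "\<dots> \<le> of_nat n * (of_nat n * ennreal (J + \<eta> / 4)) + of_nat n * ennreal K"
   unfolding J_def by (intro add_mono mult_left_mono E) auto
  also have "\<dots> = ennreal (real n * (real n * (J + \<eta> / 4)) + real n * K)"
   using J \<eta> K by (simp add: ennreal_of_nat_eq_real_of_nat ennreal_mult'[symmetric] ennreal_plus[symmetric] del: ennreal_plus)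
  also have "\<dots> \<le> ennreal ((real n)\<^sup>2 * (J + \<eta> / 2))"
  proof (rule ennreal_leI)
   have "real n * K \<le> real n * (real n * (\<eta> / 4))" using nK by (intro mult_left_mono) auto
   then show "real n * (real n * (J + \<eta> / 4)) + real n * K \<le> (real n)\<^sup>2 * (J + \<eta> / 2)" by (simp add: power2_eq_square algebra_simps)
  qed
  finally have EH: "(\<integral>\<^sup>+ x. hamiltonian q n x \<partial>?P) \<le> ennreal ((real n)\<^sup>2 * (J + \<eta> / 2))" .
  define B where "B = {x \<in> space ?P. 1 \<le> ennreal (1 / a) * hamiltonian q n x}"
  have Bm: "B \<in> sets ?P" unfolding B_def by measurable
  have "emeasure ?P B \<le> ennreal (1 / a) * (\<integral>\<^sup>+ x. hamiltonian q n x * indicator (space ?P) x \<partial>?P)"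
   unfolding B_def by (rule nn_integral_Markov_inequality, rule borel_measurable_times_ennreal[OF hm]) (rule borel_measurable_indicator, rule sets.top, rule sets.top)
  also have "(\<integral>\<^sup>+ x. hamiltonian q n x * indicator (space ?P) x \<partial>?P) = (\<integral>\<^sup>+ x. hamiltonian q n x \<partial>?P)"
   by (intro nn_integral_cong) auto
  also have "ennreal (1 / a) * (\<integral>\<^sup>+ x. hamiltonian q n x \<partial>?P) \<le> ennreal (1 / a) * ennreal ((real n)\<^sup>2 * (J + \<eta> / 2))"
   by (intro mult_left_mono EH) auto
  also have "\<dots> = ennreal ((J + \<eta> / 2) / (J + \<eta>))"
   using a J \<eta> n1 by (simp add: ennreal_mult'[symmetric] a_def)
  finally have "measure ?P B \<le> (J + \<eta> / 2) / (J + \<eta>)"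
   using J \<eta> unfolding P.emeasure_eq_measure by (subst (asm) ennreal_le_iff) auto
  moreover have "measure ?P (space ?P - B) = 1 - measure ?P B" using Bm by (rule P.prob_compl)
  moreover have "1 - (J + \<eta> / 2) / (J + \<eta>) = \<eta> / 2 / (J + \<eta>)" using J \<eta> by (simp add: field_simps)
  ultimately have pc: "\<eta> / 2 / (J + \<eta>) \<le> measure ?P (space ?P - B)" by linarith
  have "ennreal ((\<eta> / 2 / (J + \<eta>)) * exp (- \<beta> * a)) \<le> ennreal (exp (- \<beta> * a)) * emeasure ?P (space ?P - B)"
   using pc unfolding P.emeasure_eq_measure by (subst ennreal_mult'[symmetric], simp, subst mult.commute) (intro ennreal_leI mult_left_mono, simp_all)
  also have "\<dots> = (\<integral>\<^sup>+ x. ennreal (exp (- \<beta> * a)) * indicator (space ?P - B) x \<partial>?P)"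
   using Bm by (subst nn_integral_cmult_indicator) auto
  also have "\<dots> \<le> (\<integral>\<^sup>+ x. weight n x \<partial>?P)"
  proof (rule nn_integral_mono)
   fix x assume x: "x \<in> space ?P"
   show "ennreal (exp (- \<beta> * a)) * indicator (space ?P - B) x \<le> weight n x"
   proof (cases "x \<in> B")
    case False
    then have "ennreal (1 / a) * hamiltonian q n x < 1" using x by (simp add: B_def not_le)
    then have "hamiltonian q n x \<noteq> \<infinity>" using a by (auto simp: ennreal_mult_top)
    then obtain r where r: "hamiltonian q n x = ennreal r" "0 \<le> r" by (cases "hamiltonian q n x") auto
    have "r \<le> a" using \<open>ennreal (1 / a) * hamiltonian q n x < 1\<close> r a 
     by (simp add: ennreal_mult'[symmetric] ennreal_less_one_iff divide_less_eq)
    then have "boltzmann \<beta> (ennreal a) \<le> weight n x" unfolding weight_def r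
     by (intro boltzmann_antimono \<beta> ennreal_leI)
    then show ?thesis using a False x by (simp add: boltzmann_ennreal)
   qed simp
  qed
  also have "\<dots> \<le> ennreal C ^ card {1..n} * Zn n"
   unfolding Zn_def by (rule nn_integral_PiM_density_le[OF g gC(1)[rule_format] p finite_atLeastAtMost weight_measurable])
  finally show ?thesis by (simp add: a_def)
 qed
 then show ?thesis using \<eta> J gC(2) unfolding J_def by (intro that[of "\<eta> / 2 / (S0 + q0 + \<eta>)" C "max 1 (nat \<lceil>4 * K / \<eta>\<rceil>)"]) auto
qed

text \<open>The fraction 1 / n of the energy is spared from the tail estimate. Since the Hamiltonian
  is at least n times the sum of c1 |\<zeta> i|^2, that fraction supplies Gaussian factors which
  make the integral over all configurations finite.\<close>

lemma tail_upper:
 assumes n: "1 \<le> n" and a: "0 \<le> a"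
 shows "(\<integral>\<^sup>+ \<zeta>. weight n \<zeta> * indicator {\<zeta>. ennreal ((real n)\<^sup>2 * a) < hamiltonian q n \<zeta>} \<zeta> \<partial>vol n)
  \<le> ennreal (exp (- \<beta> * ((real n)\<^sup>2 * a) * (1 - 1 / n)) * (pi / (\<beta> * c1)) ^ n)"
proof -
 interpret L: product_sigma_finite "\<lambda>_::nat. lborel :: complex measure" by standard
 let ?e = "exp (- \<beta> * ((real n)\<^sup>2 * a) * (1 - 1 / n))"
 have "weight n \<zeta> * indicator {\<zeta>. ennreal ((real n)\<^sup>2 * a) < hamiltonian q n \<zeta>} \<zeta>
   \<le> ennreal ?e * (\<Prod>i\<in>{1..n}. ennreal (exp (- (\<beta> * c1) * (cmod (\<zeta> i))\<^sup>2)))" for \<zeta>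
 proof (cases "ennreal ((real n)\<^sup>2 * a) < hamiltonian q n \<zeta> \<and> hamiltonian q n \<zeta> \<noteq> \<infinity>")
  case True
  then obtain r where r: "hamiltonian q n \<zeta> = ennreal r" "0 \<le> r" by (cases "hamiltonian q n \<zeta>") auto
  have ra: "(real n)\<^sup>2 * a < r" using True a r by (simp add: ennreal_less_iff)
  define s where "s = (\<Sum>i\<in>{1..n}. c1 * (cmod (\<zeta> i))\<^sup>2)"
  have "ennreal (real n * s) = of_nat n * (\<Sum>i\<in>{1..n}. ennreal (c1 * (cmod (\<zeta> i))\<^sup>2))"
   unfolding s_def using c1 by (subst sum_ennreal) (auto simp: ennreal_mult' ennreal_of_nat_eq_real_of_nat sum_nonneg)
  also have "\<dots> \<le> of_nat n * (\<Sum>i\<in>{1..n}. q (\<zeta> i))" by (intro mult_left_mono sum_mono q_ge) auto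
  also have "\<dots> \<le> hamiltonian q n \<zeta>" unfolding hamiltonian_def by (intro add_increasing2 add_increasing order_refl zero_le)
  finally have ns: "real n * s \<le> r" using r by (simp add: ennreal_le_iff)
  then have "s \<le> r / n" using n by (simp add: field_simps)
  moreover have "(real n)\<^sup>2 * a * (1 - 1 / n) \<le> r * (1 - 1 / n)" using ra n by (intro mult_right_mono) auto
  ultimately have "(real n)\<^sup>2 * a * (1 - 1 / n) + s \<le> r" using n by (simp add: right_diff_distrib)
  then have "\<beta> * ((real n)\<^sup>2 * a * (1 - 1 / n) + s) \<le> \<beta> * r" using \<beta> by (intro mult_left_mono) auto
  then have "exp (- \<beta> * r) \<le> ?e * exp (- \<beta> * s)" by (simp add: exp_add[symmetric] algebra_simps)
  also have "exp (- \<beta> * s) = (\<Prod>i\<in>{1..n}. exp (- (\<beta> * c1) * (cmod (\<zeta> i))\<^sup>2))"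
   by (simp add: s_def exp_sum[symmetric] sum_distrib_left sum_negf mult.assoc)
  finally have "ennreal (exp (- \<beta> * r)) \<le> ennreal (?e * (\<Prod>i\<in>{1..n}. exp (- (\<beta> * c1) * (cmod (\<zeta> i))\<^sup>2)))" by (rule ennreal_leI)
  then show ?thesis using True r by (simp add: weight_def boltzmann_ennreal ennreal_mult' prod_ennreal)
 next
  case False
  then show ?thesis by (auto simp: weight_def boltzmann_def)
 qed
 then have "(\<integral>\<^sup>+ \<zeta>. weight n \<zeta> * indicator {\<zeta>. ennreal ((real n)\<^sup>2 * a) < hamiltonian q n \<zeta>} \<zeta> \<partial>vol n)
  \<le> (\<integral>\<^sup>+ \<zeta>. ennreal ?e * (\<Prod>i\<in>{1..n}. ennreal (exp (- (\<beta> * c1) * (cmod (\<zeta> i))\<^sup>2))) \<partial>vol n)"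
  by (intro nn_integral_mono)
 also have "\<dots> = ennreal ?e * (\<integral>\<^sup>+ \<zeta>. (\<Prod>i\<in>{1..n}. ennreal (exp (- (\<beta> * c1) * (cmod (\<zeta> i))\<^sup>2))) \<partial>vol n)"
  by (rule nn_integral_cmult) (auto intro!: borel_measurable_prod_ennreal measurable_compose[OF measurable_component_singleton])
 also have "(\<integral>\<^sup>+ \<zeta>. (\<Prod>i\<in>{1..n}. ennreal (exp (- (\<beta> * c1) * (cmod (\<zeta> i))\<^sup>2))) \<partial>vol n)
   = (\<Prod>i\<in>{1..n}. \<integral>\<^sup>+ z. ennreal (exp (- (\<beta> * c1) * (cmod z)\<^sup>2)) \<partial>lborel)"
  by (rule L.product_nn_integral_prod) auto
 also have "\<dots> = ennreal (pi / (\<beta> * c1)) ^ n"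
  using \<beta> c1 by (subst nn_integral_exp_neg_square) auto
 also have "ennreal ?e * ennreal (pi / (\<beta> * c1)) ^ n = ennreal (?e * (pi / (\<beta> * c1)) ^ n)"
  using \<beta> c1 by (simp add: ennreal_mult' ennreal_power)
 finally show ?thesis .
qed

text \<open>The tail has energy above S0 + q0 + \<eta> per n^2, against S0 + q0 + \<eta>/2 in the
  lower bound for the partition function. This gap is quadratic in the exponent, all other factors
  are exponential of order n.\<close>

lemma tail_small:
 assumes \<eta>: "0 < \<eta>"
 shows "\<exists>f. f \<longlonglongrightarrow> 0 \<and> (\<exists>N. \<forall>n\<ge>N. 0 \<le> f n \<and> (\<integral>\<^sup>+ \<zeta>. weight n \<zeta> * indicator {\<zeta>. ennreal ((real n)\<^sup>2 * (S0 + q0 + \<eta>)) < hamiltonian q n \<zeta>} \<zeta> \<partial>vol n) \<le> ennreal (f n) * Zn n)"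
proof -
 define a where "a = S0 + q0 + \<eta>"
 have a: "0 \<le> a" using S0 q0 \<eta> by (simp add: a_def)
 obtain p C N where pC: "0 < p" "0 < C" and N: "\<And>n. n \<ge> N \<Longrightarrow> ennreal (p * exp (- \<beta> * ((real n)\<^sup>2 * (S0 + q0 + \<eta> / 2)))) \<le> ennreal C ^ n * Zn n"
  using partition_lower[of "\<eta> / 2"] \<eta> by auto
 \<comment> \<open>All exponents linear in n: \<open>\<beta> * a\<close> from the spared fraction of
   the energy, and the bases of the n-th powers in both bounds.\<close>
 define L where "L = \<beta> * a + ln (C * (pi / (\<beta> * c1)))"
 define b where "b = \<beta> * \<eta> / 2"
 have b: "0 < b" using \<beta> \<eta> by (simp add: b_def)
 define D where "D = C * (pi / (\<beta> * c1))"
 have D: "0 < D" using pC \<beta> c1 by (simp add: D_def)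
 define f where "f n = 1 / p * exp (real n * L - b * (real n)\<^sup>2)" for n :: nat
 have f0: "0 \<le> f n" for n using pC by (simp add: f_def)
 have "f \<longlonglongrightarrow> 0" unfolding f_def using b by real_asymp
 moreover have "(\<integral>\<^sup>+ \<zeta>. weight n \<zeta> * indicator {\<zeta>. ennreal ((real n)\<^sup>2 * a) < hamiltonian q n \<zeta>} \<zeta> \<partial>vol n) \<le> ennreal (f n) * Zn n"
  if n: "max 1 N \<le> n" for n
 proof -
  have n1: "1 \<le> n" "N \<le> n" using n by auto
  have eq: "exp (- \<beta> * ((real n)\<^sup>2 * a) * (1 - 1 / n)) * (pi / (\<beta> * c1)) ^ n * C ^ n = f n * (p * exp (- \<beta> * ((real n)\<^sup>2 * (S0 + q0 + \<eta> / 2))))"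
  proof -
   have "(pi / (\<beta> * c1)) ^ n * C ^ n = exp (real n * ln D)"
    using D by (simp add: exp_of_nat_mult D_def power_mult_distrib[symmetric] mult.commute del: power_mult_distrib)
   then have "exp (- \<beta> * ((real n)\<^sup>2 * a) * (1 - 1 / n)) * (pi / (\<beta> * c1)) ^ n * C ^ n = exp (- \<beta> * ((real n)\<^sup>2 * a) * (1 - 1 / n) + real n * ln D)"
    by (simp only: exp_add mult.assoc)
   also have "- \<beta> * ((real n)\<^sup>2 * a) * (1 - 1 / n) + real n * ln D = (real n * L - b * (real n)\<^sup>2) + (- \<beta> * ((real n)\<^sup>2 * (S0 + q0 + \<eta> / 2)))"
    using n1 by (simp add: L_def b_def a_def D_def power2_eq_square field_simps)
   finally have "exp (- \<beta> * ((real n)\<^sup>2 * a) * (1 - 1 / n)) * (pi / (\<beta> * c1)) ^ n * C ^ n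
    = exp (real n * L - b * (real n)\<^sup>2) * exp (- \<beta> * ((real n)\<^sup>2 * (S0 + q0 + \<eta> / 2)))" by (simp only: exp_add)
   then show ?thesis using pC by (simp add: f_def)
  qed
  have "ennreal C ^ n * (\<integral>\<^sup>+ \<zeta>. weight n \<zeta> * indicator {\<zeta>. ennreal ((real n)\<^sup>2 * a) < hamiltonian q n \<zeta>} \<zeta> \<partial>vol n)
   \<le> ennreal C ^ n * ennreal (exp (- \<beta> * ((real n)\<^sup>2 * a) * (1 - 1 / n)) * (pi / (\<beta> * c1)) ^ n)"
   by (intro mult_left_mono tail_upper n1 a) auto
  also have "\<dots> = ennreal (exp (- \<beta> * ((real n)\<^sup>2 * a) * (1 - 1 / n)) * (pi / (\<beta> * c1)) ^ n * C ^ n)"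
   using pC \<beta> c1 by (simp add: ennreal_power ennreal_mult'[symmetric] mult_ac)
  also have "\<dots> = ennreal (f n) * ennreal (p * exp (- \<beta> * ((real n)\<^sup>2 * (S0 + q0 + \<eta> / 2))))"
   unfolding eq by (intro ennreal_mult f0) (use pC in auto)
  also have "\<dots> \<le> ennreal (f n) * (ennreal C ^ n * Zn n)" by (intro mult_left_mono N n1) auto
  also have "\<dots> = ennreal C ^ n * (ennreal (f n) * Zn n)" by (simp add: ac_simps)
  finally show ?thesis using pC by (subst (asm) ennreal_mult_le_mult_iff) (auto simp: ennreal_power)
 qed
 ultimately show ?thesis using f0 unfolding a_def by blast
qed

end

section \<open>Conditional densities\<close>

lemma hamiltonian_update:
 assumes i: "i \<in> {1..n}"
 defines "I \<equiv> {1..n} - {i}"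
 shows "hamiltonian q n (x(i := w)) = 
  ((\<Sum>a\<in>I. \<Sum>b\<in>I-{a}. kap (x a) (x b)) + of_nat n * (\<Sum>a\<in>I. q (x a)) + (\<Sum>a\<in>I. ennreal (ell (x a))))
  + (2 * (\<Sum>j\<in>I. kap w (x j)) + of_nat n * q w + ennreal (ell w))"
proof -
 let ?y = "x(i := w)"
 have fin: "finite I" by (simp add: I_def)
 have split: "(\<Sum>a\<in>{1..n}. F a) = F i + (\<Sum>a\<in>I. F a)" for F :: "nat \<Rightarrow> ennreal"
  using i unfolding I_def by (intro sum.remove) auto
 have "(\<Sum>a\<in>{1..n}. \<Sum>b\<in>{1..n}-{a}. kap (?y a) (?y b)) = (\<Sum>b\<in>I. kap w (x b)) + (\<Sum>a\<in>I. \<Sum>b\<in>{1..n}-{a}. kap (?y a) (?y b))"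
  by (subst split) (auto simp: I_def intro!: sum.cong)
 also have "(\<Sum>a\<in>I. \<Sum>b\<in>{1..n}-{a}. kap (?y a) (?y b)) = (\<Sum>a\<in>I. kap w (x a) + (\<Sum>b\<in>I-{a}. kap (x a) (x b)))"
 proof (rule sum.cong[OF refl])
  fix a assume a: "a \<in> I"
  then have e: "{1..n} - {a} = insert i (I - {a})" using i by (auto simp: I_def)
  have "i \<notin> I - {a}" by (simp add: I_def)
  then have "(\<Sum>b\<in>{1..n}-{a}. kap (?y a) (?y b)) = kap (?y a) (?y i) + (\<Sum>b\<in>I-{a}. kap (?y a) (?y b))"
   unfolding e using fin by (intro sum.insert) auto
  also have "\<dots> = kap w (x a) + (\<Sum>b\<in>I-{a}. kap (x a) (x b))"
   using a by (auto simp: I_def kap_sym intro!: arg_cong2[where f="(+)"] sum.cong)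
  finally show "(\<Sum>b\<in>{1..n}-{a}. kap (?y a) (?y b)) = kap w (x a) + (\<Sum>b\<in>I-{a}. kap (x a) (x b))" .
 qed
 also have "\<dots> = (\<Sum>a\<in>I. kap w (x a)) + (\<Sum>a\<in>I. \<Sum>b\<in>I-{a}. kap (x a) (x b))" by (rule sum.distrib)
 finally have 1: "(\<Sum>a\<in>{1..n}. \<Sum>b\<in>{1..n}-{a}. kap (?y a) (?y b)) = 2 * (\<Sum>a\<in>I. kap w (x a)) + (\<Sum>a\<in>I. \<Sum>b\<in>I-{a}. kap (x a) (x b))"
  by (simp add: mult_2 ac_simps)
 have 2: "(\<Sum>a\<in>{1..n}. F (?y a)) = F w + (\<Sum>a\<in>I. F (x a))" for F :: "complex \<Rightarrow> ennreal"
  by (subst split) (auto simp: I_def intro!: sum.cong)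
 show ?thesis unfolding hamiltonian_def 1 2[of q] 2[of "\<lambda>z. ennreal (ell z)"] by (simp add: distrib_left ac_simps)
qed

context gas
begin

text \<open>The weight divided by the integral is the conditional density of point \<open>i\<close>
  at \<open>w\<close> given the others. Jensen's inequality bounds the integral from below on a
  small disc about \<open>w\<close>, where the energy \<open>\<Phi>\<close> of the moving point has
  mean at most \<open>\<Phi> w\<close> plus a small multiple of n. The radius may not depend on the
  other points, which is why \<open>disc_mean_kap\<close> is uniform in them.\<close>

lemma conditional_density_bound:
 assumes \<delta>: "0 < \<delta>"
 obtains C where "0 < C" "\<And>n i x w. i \<in> {1..n} \<Longrightarrow> w \<in> cball 0 R \<Longrightarrow> 
  weight n (x(i := w)) \<le> ennreal (C * exp (\<delta> * n)) * (\<integral>\<^sup>+ u. weight n (x(i := u)) \<partial>lborel)"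
proof -
 \<comment> \<open>The disc mean incurs 2 (n - 1) + n + 1 errors \<open>e\<close>, from the kernels,
   from n copies of \<open>q\<close> and from \<open>ell\<close>; they are fewer than 3 n, and
   \<open>3 * \<beta> * e = \<delta>\<close>.\<close>
 define e where "e = \<delta> / (3 * \<beta>)"
 have e: "0 < e" using \<delta> \<beta> by (simp add: e_def)
 obtain r1 where r1: "0 < r1" "\<And>r z w. 0 < r \<Longrightarrow> r \<le> r1 \<Longrightarrow> z \<in> cball 0 R \<Longrightarrow> 
  (\<integral>\<^sup>+ u\<in>ball z r. kap u w \<partial>lborel) \<le> ennreal (pi * r\<^sup>2) * (kap z w + ennreal e)"
  using disc_mean_kap[OF e, of R] by metis
 obtain r2 where r2: "0 < r2" "\<forall>r>0. r \<le> r2 \<longrightarrow> (\<forall>z\<in>cball 0 R. (\<integral>\<^sup>+ u\<in>ball z r. q u \<partial>lborel) \<le> ennreal (pi * r\<^sup>2) * (q z + ennreal e))"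
  using q_disc[OF e, of R] by metis
 obtain r3 where r3: "0 < r3" "\<forall>r>0. r \<le> r3 \<longrightarrow> (\<forall>z\<in>cball 0 R. (\<integral>\<^sup>+ u\<in>ball z r. ennreal (ell u) \<partial>lborel) \<le> ennreal (pi * r\<^sup>2) * (ennreal (ell z) + ennreal e))"
  using disc_usc_ell e unfolding disc_usc_def by metis
 define r where "r = min r1 (min r2 r3)"
 have r: "0 < r" "r \<le> r1" "r \<le> r2" "r \<le> r3" using r1 r2 r3 by (auto simp: r_def)
 define V where "V = pi * r\<^sup>2"
 have V: "0 < V" using r by (simp add: V_def)
 have "weight n (x(i := w)) \<le> ennreal (1 / V * exp (\<delta> * n)) * (\<integral>\<^sup>+ u. weight n (x(i := u)) \<partial>lborel)"
  if i: "i \<in> {1..n}" and w: "w \<in> cball 0 R" for n i x w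
 proof -
  define I where "I = {1..n} - {i}"
  define rest where "rest = (\<Sum>a\<in>I. \<Sum>b\<in>I-{a}. kap (x a) (x b)) + of_nat n * (\<Sum>a\<in>I. q (x a)) + (\<Sum>a\<in>I. ennreal (ell (x a)))"
  define \<Phi> where "\<Phi> u = 2 * (\<Sum>j\<in>I. kap u (x j)) + of_nat n * q u + ennreal (ell u)" for u
  have [measurable]: "\<Phi> \<in> borel_measurable borel" unfolding \<Phi>_def by measurable
  have wt: "weight n (x(i := u)) = boltzmann \<beta> rest * boltzmann \<beta> (\<Phi> u)" for u
   unfolding weight_def hamiltonian_update[OF i] boltzmann_add[symmetric] by (simp add: rest_def \<Phi>_def I_def)
  have "(\<integral>\<^sup>+ u\<in>ball w r. \<Phi> u \<partial>lborel) = 2 * (\<Sum>j\<in>I. \<integral>\<^sup>+ u\<in>ball w r. kap u (x j) \<partial>lborel)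
    + of_nat n * (\<integral>\<^sup>+ u\<in>ball w r. q u \<partial>lborel) + (\<integral>\<^sup>+ u\<in>ball w r. ennreal (ell u) \<partial>lborel)"
   unfolding \<Phi>_def by (simp add: distrib_right sum_distrib_right mult.assoc nn_integral_add nn_integral_cmult nn_integral_sum)
  also have "\<dots> \<le> 2 * (\<Sum>j\<in>I. ennreal V * (kap w (x j) + ennreal e)) + of_nat n * (ennreal V * (q w + ennreal e)) + ennreal V * (ennreal (ell w) + ennreal e)"
   unfolding V_def using r1(2)[OF r(1,2) w] r2(2) r3(2) r w by (intro add_mono mult_left_mono sum_mono) auto
  also have "\<dots> = ennreal V * (\<Phi> w + (2 * of_nat (card I) + of_nat n + 1) * ennreal e)"
   by (simp add: \<Phi>_def sum.distrib sum_distrib_left[symmetric] algebra_simps)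
  also have "\<dots> \<le> ennreal V * (\<Phi> w + ennreal (3 * real n * e))"
  proof (intro mult_left_mono add_left_mono)
   have c: "card I = n - 1" using i by (simp add: I_def)
   have n1: "1 \<le> n" using i by auto
   have "(2 * of_nat (card I) + of_nat n + 1) * ennreal e = ennreal ((2 * real (n - 1) + real n + 1) * e)"
    using e by (simp add: c ennreal_mult' ennreal_plus ennreal_of_nat_eq_real_of_nat)
   also have "\<dots> \<le> ennreal (3 * real n * e)" using n1 e by (intro ennreal_leI mult_right_mono) auto
   finally show "(2 * of_nat (card I) + of_nat n + 1) * ennreal e \<le> ennreal (3 * real n * e)" .
  qed auto
  finally have m: "(\<integral>\<^sup>+ u\<in>ball w r. \<Phi> u \<partial>lborel) \<le> ennreal V * (\<Phi> w + ennreal (3 * real n * e))" .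
  have "boltzmann \<beta> (\<Phi> w) \<le> ennreal (1 / V * exp (\<delta> * n)) * (\<integral>\<^sup>+ u. boltzmann \<beta> (\<Phi> u) \<partial>lborel)"
  proof (cases "\<Phi> w")
   case top then show ?thesis by (simp add: boltzmann_def)
  next
   case (real a)
   have "ennreal V * ennreal (exp (- \<beta> * (a + 3 * real n * e))) \<le> (\<integral>\<^sup>+ u\<in>ball w r. boltzmann \<beta> (\<Phi> u) \<partial>lborel)"
   proof (rule boltzmann_jensen[OF \<beta>])
    show "emeasure lborel (ball w r) = ennreal V" using r by (simp add: emeasure_ball_complex V_def)
    show "(\<integral>\<^sup>+ u\<in>ball w r. \<Phi> u \<partial>lborel) \<le> ennreal V * ennreal (a + 3 * real n * e)"
     using m real e by (simp add: ennreal_plus)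
   qed (use V real e in auto)
   also have "\<dots> \<le> (\<integral>\<^sup>+ u. boltzmann \<beta> (\<Phi> u) \<partial>lborel)" by (intro nn_integral_mono) (auto simp: indicator_def)
   finally have "ennreal (1 / V * exp (\<delta> * n)) * (ennreal V * ennreal (exp (- \<beta> * (a + 3 * real n * e)))) \<le> ennreal (1 / V * exp (\<delta> * n)) * (\<integral>\<^sup>+ u. boltzmann \<beta> (\<Phi> u) \<partial>lborel)"
    by (rule mult_left_mono) simp
   also have "ennreal (1 / V * exp (\<delta> * n)) * (ennreal V * ennreal (exp (- \<beta> * (a + 3 * real n * e)))) = ennreal (exp (\<delta> * n) * exp (- \<beta> * (a + 3 * real n * e)))"
    using V by (simp add: ennreal_mult'[symmetric])
   also have "exp (\<delta> * n) * exp (- \<beta> * (a + 3 * real n * e)) = exp (- \<beta> * a)"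
    using \<beta> unfolding exp_add[symmetric] by (simp add: e_def field_simps)
   also have "ennreal (exp (- \<beta> * a)) = boltzmann \<beta> (\<Phi> w)" using real by (simp add: boltzmann_ennreal)
   finally show ?thesis .
  qed
  then have "boltzmann \<beta> rest * boltzmann \<beta> (\<Phi> w) \<le> boltzmann \<beta> rest * (ennreal (1 / V * exp (\<delta> * n)) * (\<integral>\<^sup>+ u. boltzmann \<beta> (\<Phi> u) \<partial>lborel))"
   by (rule mult_left_mono) simp
  also have "\<dots> = ennreal (1 / V * exp (\<delta> * n)) * (\<integral>\<^sup>+ u. boltzmann \<beta> rest * boltzmann \<beta> (\<Phi> u) \<partial>lborel)"
   by (subst nn_integral_cmult) (auto simp: ac_simps)
  finally show ?thesis unfolding wt .
 qed
 then show ?thesis using V by (intro that[of "1 / V"]) auto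
qed

text \<open>Integrate coordinate \<open>i\<close> first and replace its conditional density by the
  bound of \<open>conditional_density_bound\<close>; then only a Lebesgue integral in that
  coordinate has to be controlled, uniformly in the others.\<close>

lemma expectation_bound:
 assumes \<delta>: "0 < \<delta>"
 shows "\<exists>C>0. \<forall>n i B. \<forall>\<Psi>\<in>borel_measurable (vol n). i \<in> {1..n} \<longrightarrow> (\<forall>x\<in>space (Pi\<^sub>M ({1..n} - {i}) (\<lambda>_. lborel)). (\<integral>\<^sup>+ w\<in>cball 0 R. \<Psi> (x(i := w)) \<partial>lborel) \<le> B) \<longrightarrow>
  (\<integral>\<^sup>+ \<zeta>. weight n \<zeta> * (indicator (cball 0 R) (\<zeta> i) * \<Psi> \<zeta>) \<partial>vol n) \<le> ennreal (C * exp (\<delta> * n)) * B * Zn n"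
proof -
 interpret L: product_sigma_finite "\<lambda>_::nat. lborel :: complex measure" by standard
 obtain C where C: "0 < C" "\<And>n i x w. i \<in> {1..n} \<Longrightarrow> w \<in> cball 0 R \<Longrightarrow> 
  weight n (x(i := w)) \<le> ennreal (C * exp (\<delta> * n)) * (\<integral>\<^sup>+ u. weight n (x(i := u)) \<partial>lborel)"
  using conditional_density_bound[OF \<delta>, of R] by metis
 have "(\<integral>\<^sup>+ \<zeta>. weight n \<zeta> * (indicator (cball 0 R) (\<zeta> i) * \<Psi> \<zeta>) \<partial>vol n) \<le> ennreal (C * exp (\<delta> * n)) * B * Zn n"
  if i: "i \<in> {1..n}" and \<Psi>: "\<Psi> \<in> borel_measurable (vol n)" 
   and B: "\<And>x. x \<in> space (Pi\<^sub>M ({1..n} - {i}) (\<lambda>_. lborel)) \<Longrightarrow> (\<integral>\<^sup>+ w\<in>cball 0 R. \<Psi> (x(i := w)) \<partial>lborel) \<le> B" for n i B \<Psi>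
 proof -
  define I where "I = {1..n} - {i}"
  have I: "{1..n} = insert i I" "finite I" "i \<notin> I" using i by (auto simp: I_def)
  let ?P = "Pi\<^sub>M I (\<lambda>_. lborel :: complex measure)"
  let ?K = "ennreal (C * exp (\<delta> * n))"
  have W [measurable]: "weight n \<in> borel_measurable (Pi\<^sub>M (insert i I) (\<lambda>_. lborel))" using weight_measurable[of n] unfolding I(1) .
  have \<Psi>' [measurable]: "\<Psi> \<in> borel_measurable (Pi\<^sub>M (insert i I) (\<lambda>_. lborel))" using \<Psi> unfolding I(1) .
  have ind [measurable]: "(\<lambda>\<zeta>. indicator (cball 0 R) (\<zeta> i) :: ennreal) \<in> borel_measurable (Pi\<^sub>M (insert i I) (\<lambda>_. lborel :: complex measure))"
   by (rule measurable_compose[OF measurable_component_singleton[of i "insert i I" "\<lambda>_. lborel :: complex measure"]]) auto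
  define D where "D x = (\<integral>\<^sup>+ u. weight n (x(i := u)) \<partial>lborel)" for x
  have D [measurable]: "D \<in> borel_measurable ?P" unfolding D_def by measurable
  have upd: "(\<lambda>y. f (x(i := y))) \<in> borel_measurable borel" if "f \<in> borel_measurable (Pi\<^sub>M (insert i I) (\<lambda>_. lborel :: complex measure))" "x \<in> space ?P" for x and f :: "_ \<Rightarrow> ennreal"
   using measurable_comp[OF measurable_component_update[OF that(2) I(3)] that(1)] by (simp add: comp_def)
  have "(\<integral>\<^sup>+ \<zeta>. weight n \<zeta> * (indicator (cball 0 R) (\<zeta> i) * \<Psi> \<zeta>) \<partial>vol n)
   = (\<integral>\<^sup>+ x. (\<integral>\<^sup>+ w. weight n (x(i := w)) * (indicator (cball 0 R) ((x(i := w)) i) * \<Psi> (x(i := w))) \<partial>lborel) \<partial>?P)"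
   unfolding I(1) by (rule L.product_nn_integral_insert[OF I(2,3)]) measurable
  also have "\<dots> \<le> (\<integral>\<^sup>+ x. ?K * B * D x \<partial>?P)"
  proof (rule nn_integral_mono)
   fix x assume x: "x \<in> space ?P"
   note [measurable] = upd[OF \<Psi>' x]
   have "(\<integral>\<^sup>+ w. weight n (x(i := w)) * (indicator (cball 0 R) ((x(i := w)) i) * \<Psi> (x(i := w))) \<partial>lborel)
    \<le> (\<integral>\<^sup>+ w. ?K * D x * (\<Psi> (x(i := w)) * indicator (cball 0 R) w) \<partial>lborel)"
   proof (rule nn_integral_mono)
    fix w
    show "weight n (x(i := w)) * (indicator (cball 0 R) ((x(i := w)) i) * \<Psi> (x(i := w))) \<le> ?K * D x * (\<Psi> (x(i := w)) * indicator (cball 0 R) w)"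
    proof (cases "w \<in> cball 0 R")
     case True
     have "weight n (x(i := w)) \<le> ?K * D x" unfolding D_def by (rule C(2)[OF i True])
     then have "weight n (x(i := w)) * \<Psi> (x(i := w)) \<le> ?K * D x * \<Psi> (x(i := w))" by (rule mult_right_mono) simp
     then show ?thesis using True by simp
    qed simp
   qed
   also have "\<dots> = ?K * D x * (\<integral>\<^sup>+ w. \<Psi> (x(i := w)) * indicator (cball 0 R) w \<partial>lborel)"
    by (rule nn_integral_cmult) measurable
   also have "\<dots> \<le> ?K * D x * B" using B[of x] x unfolding I_def by (intro mult_left_mono) auto
   finally show "(\<integral>\<^sup>+ w. weight n (x(i := w)) * (indicator (cball 0 R) ((x(i := w)) i) * \<Psi> (x(i := w))) \<partial>lborel) \<le> ?K * B * D x"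
    by (simp add: ac_simps)
  qed
  also have "\<dots> = ?K * B * (\<integral>\<^sup>+ x. D x \<partial>?P)" by (rule nn_integral_cmult) measurable
  also have "(\<integral>\<^sup>+ x. D x \<partial>?P) = Zn n"
   unfolding Zn_def D_def I(1) by (rule L.product_nn_integral_insert[OF I(2,3) W, symmetric])
  finally show ?thesis .
 qed
 then show ?thesis using C(1) by (intro exI[of _ C]) auto
qed

end

section \<open>Derivatives of products over sets of points\<close>

definition deriv_val :: "nat set \<Rightarrow> nat \<Rightarrow> complex \<Rightarrow> (nat \<Rightarrow> complex) \<Rightarrow> complex" where
 "deriv_val I j z \<zeta> = poly ((pderiv ^^ j) (\<Prod>i\<in>I. [:- \<zeta> i, 1:])) z"

text \<open>At \<open>j = 0\<close> the truncated \<open>j - 1\<close> is harmless because of the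
  factor \<open>of_nat j\<close>.\<close>

lemma higher_pderiv_linear_mult:
 fixes p :: "complex poly"
 shows "(pderiv ^^ j) ([:- a, 1:] * p) = [:- a, 1:] * (pderiv ^^ j) p + of_nat j * (pderiv ^^ (j - 1)) p"
proof (induction j)
 case (Suc j)
 have "pderiv (of_nat j * (pderiv ^^ (j - 1)) p) = of_nat j * (pderiv ^^ j) p"
  by (cases j) (simp_all add: pderiv_mult pderiv_of_nat del: of_nat_Suc)
 then have "(pderiv ^^ Suc j) ([:- a, 1:] * p) = pderiv ([:- a, 1:] * (pderiv ^^ j) p) + of_nat j * (pderiv ^^ j) p"
  using Suc by (simp add: pderiv_add)
 also have "pderiv ([:- a, 1:] * (pderiv ^^ j) p) = [:- a, 1:] * (pderiv ^^ Suc j) p + (pderiv ^^ j) p"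
  by (subst pderiv_mult) (simp add: pderiv_pCons)
 finally show ?case by (simp add: algebra_simps)
qed simp

text \<open>As a function of one point the derivative is affine, with coefficients depending on the
  other points only; hence it is small only near a single position of that point.\<close>

lemma deriv_val_insert:
 assumes "finite I" "i \<notin> I"
 shows "deriv_val (insert i I) j z \<zeta> = (z - \<zeta> i) * deriv_val I j z \<zeta> + of_nat j * deriv_val I (j - 1) z \<zeta>"
proof -
 have eq: "(\<Prod>i\<in>insert i I. [:- \<zeta> i, 1:]) = [:- \<zeta> i, 1:] * (\<Prod>i\<in>I. [:- \<zeta> i, 1:])" by (rule prod.insert[OF assms])
 show ?thesis unfolding deriv_val_def eq higher_pderiv_linear_mult poly_add poly_mult by (simp add: algebra_simps)
qed

lemma deriv_val_empty: "deriv_val {} j z \<zeta> = (if j = 0 then 1 else 0)"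
proof -
 have "(pderiv ^^ Suc m) (1 :: complex poly) = 0" for m
  by (induction m) auto
 then show ?thesis unfolding deriv_val_def by (cases j) auto
qed

lemma deriv_val_0: "deriv_val I 0 z \<zeta> = (\<Prod>i\<in>I. z - \<zeta> i)"
 by (simp add: deriv_val_def poly_prod)

lemma deriv_val_cong: "(\<And>i. i \<in> I \<Longrightarrow> \<zeta> i = \<xi> i) \<Longrightarrow> deriv_val I j z \<zeta> = deriv_val I j z \<xi>"
 unfolding deriv_val_def by (metis (no_types, lifting) prod.cong)

lemma deriv_val_measurable:
 assumes "finite I" "g \<in> borel_measurable M" "\<And>i. i \<in> I \<Longrightarrow> (\<lambda>x. f x i) \<in> borel_measurable M"
 shows "(\<lambda>x. deriv_val I j (g x) (f x)) \<in> borel_measurable M"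
 using assms(1,3)
proof (induction I arbitrary: j)
 case empty then show ?case by (simp add: deriv_val_empty)
next
 case (insert i I)
 have [measurable]: "(\<lambda>x. deriv_val I j (g x) (f x)) \<in> borel_measurable M" for j by (rule insert.IH) (use insert in auto)
 have [measurable]: "(\<lambda>x. f x i) \<in> borel_measurable M" "g \<in> borel_measurable M" using insert assms by auto
 show ?case by (simp add: deriv_val_insert insert)
qed

lemma deriv_val_continuous:
 assumes "finite I"
 shows "continuous_on UNIV (\<lambda>\<zeta>. deriv_val I j z \<zeta>)"
 using assms
proof (induction I arbitrary: j)
 case empty then show ?case by (simp add: deriv_val_empty)
next
 case (insert i I)
 have c: "continuous_on UNIV (\<lambda>\<zeta>::nat \<Rightarrow> complex. \<zeta> i)" by (rule continuous_on_product_coordinates)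
 show ?case using insert by (auto simp: deriv_val_insert intro!: continuous_intros c)
qed

lemma power_add_ge: "0 \<le> (s::real) \<Longrightarrow> 0 \<le> y \<Longrightarrow> s ^ j + real j * y * s ^ (j - 1) \<le> (s + y) ^ j"
proof (induction j)
 case (Suc j)
 have e: "real j * s ^ j = real j * (s * s ^ (j - 1))" by (cases j) auto
 have "s ^ Suc j + real (Suc j) * y * s ^ j = s * s ^ j + y * s ^ j + y * (real j * s ^ j)" by (simp add: algebra_simps)
 also have "\<dots> = s * s ^ j + y * s ^ j + y * (real j * (s * s ^ (j - 1)))" by (simp only: e)
 also have "\<dots> \<le> s * s ^ j + y * s ^ j + y * (real j * (s * s ^ (j - 1))) + y * (y * (real j * s ^ (j - 1)))" using Suc.prems by simp
 also have "\<dots> = (s + y) * (s ^ j + real j * y * s ^ (j - 1))" by (simp add: algebra_simps)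
 also have "\<dots> \<le> (s + y) * (s + y) ^ j" using Suc by (intro mult_left_mono) auto
 finally show ?case by simp
qed simp

text \<open>P^(j) / P is the sum of products of j factors 1 / (z - \<zeta> i) over ordered tuples of
  distinct indices, hence bounded by the j-th power of the sum of their moduli. The induction adds
  one point at a time.\<close>

lemma cmod_deriv_val_le:
 assumes "finite I" "\<And>i. i \<in> I \<Longrightarrow> z \<noteq> \<zeta> i"
 shows "cmod (deriv_val I j z \<zeta>) \<le> cmod (deriv_val I 0 z \<zeta>) * (\<Sum>i\<in>I. 1 / cmod (z - \<zeta> i)) ^ j"
 using assms
proof (induction I arbitrary: j)
 case empty then show ?case by (simp add: deriv_val_empty)
next
 case (insert i I)
 define s where "s = (\<Sum>i\<in>I. 1 / cmod (z - \<zeta> i))"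
 define x where "x = cmod (z - \<zeta> i)"
 define p where "p = cmod (deriv_val I 0 z \<zeta>)"
 have s: "0 \<le> s" by (simp add: s_def sum_nonneg)
 have x: "0 < x" using insert.prems[of i] by (simp add: x_def)
 have IH: "cmod (deriv_val I j z \<zeta>) \<le> p * s ^ j" for j unfolding p_def s_def by (rule insert.IH) (use insert.prems in auto)
 have "cmod (deriv_val (insert i I) j z \<zeta>) \<le> x * cmod (deriv_val I j z \<zeta>) + real j * cmod (deriv_val I (j - 1) z \<zeta>)"
  unfolding deriv_val_insert[OF insert(1,2)] x_def by (rule order_trans[OF norm_triangle_ineq]) (simp add: norm_mult)
 also have "\<dots> \<le> x * (p * s ^ j) + real j * (p * s ^ (j - 1))"
  using x by (intro add_mono mult_left_mono IH) auto
 also have "\<dots> = x * p * (s ^ j + real j * (1 / x) * s ^ (j - 1))" using x by (simp add: field_simps)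
 also have "\<dots> \<le> x * p * (s + 1 / x) ^ j" using x s by (intro mult_left_mono power_add_ge) (auto simp: p_def)
 also have "x * p = cmod (deriv_val (insert i I) 0 z \<zeta>)"
  by (simp add: deriv_val_insert[OF insert(1,2)] x_def p_def norm_mult)
 also have "s + 1 / x = (\<Sum>i\<in>insert i I. 1 / cmod (z - \<zeta> i))" using insert(1,2) by (simp add: s_def x_def)
 finally show ?case .
qed

text \<open>The quotient that splits off point \<open>i\<close>: with R the product without that
  point, |P / P^(j)| is this quotient times |R / R^(j - 1)|.\<close>

definition deriv_ratio :: "nat \<Rightarrow> nat set \<Rightarrow> nat \<Rightarrow> complex \<Rightarrow> (nat \<Rightarrow> complex) \<Rightarrow> real" where
 "deriv_ratio i I j z \<zeta> = cmod (z - \<zeta> i) * cmod (deriv_val (I - {i}) (j - 1) z \<zeta>) / cmod (deriv_val I j z \<zeta>)"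

text \<open>A Moebius map in \<open>x\<close> with pole at - j b / a. It is bounded by a constant
  plus a multiple of the inverse distance to the pole, and both constants are free of
  \<open>a\<close> and \<open>b\<close>, through which the other points enter.\<close>

lemma linear_fraction_bound:
 fixes a b x :: complex
 assumes x: "cmod x \<le> R" and R: "0 < R" and j: "1 \<le> j"
 shows "cmod x * cmod b / cmod (x * a + of_nat j * b) \<le> 2 * R + 2 * R\<^sup>2 * (1 / cmod (x + of_nat j * b / a))"
proof (cases "b = 0 \<or> a = 0")
 case True
 then show ?thesis
 proof
  assume "b = 0" then show ?thesis using R by simp
 next
  assume a: "a = 0"
  have "cmod x / real j \<le> cmod x" using j by (simp add: divide_le_eq mult_le_cancel_left1)
  then have "cmod x * cmod b / cmod (x * a + of_nat j * b) \<le> R" using a x R by (cases "b = 0") (auto simp: norm_mult)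
  moreover have "0 \<le> 2 * R\<^sup>2 * (1 / cmod (x + of_nat j * b / a))" by simp
  ultimately show ?thesis using R by linarith
 qed
next
 case False
 then have ab: "a \<noteq> 0" "b \<noteq> 0" by auto
 have nn: "0 \<le> 2 * R\<^sup>2 * (1 / cmod (x + of_nat j * b / a))" by simp
 show ?thesis
 \<comment> \<open>In the first case the pole has modulus at least 2 R and the denominator is at
   least |b| / 2; in the second, |b| is at most 2 R |a|.\<close>
 proof (cases "cmod a * R \<le> real j * cmod b / 2")
  case True
  have "cmod (of_nat j * b) - cmod (x * a) \<le> cmod (x * a + of_nat j * b)"
   using norm_diff_ineq[of "of_nat j * b" "x * a"] by (simp add: add.commute)
  moreover have "cmod (x * a) \<le> real j * cmod b / 2" 
   using True mult_right_mono[OF x, of "cmod a"] by (simp add: norm_mult mult.commute)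
  moreover have "cmod b \<le> real j * cmod b" using j by (simp add: mult_le_cancel_right1)
  ultimately have low: "cmod b / 2 \<le> cmod (x * a + of_nat j * b)" by (simp add: norm_mult)
  have "cmod x * cmod b / cmod (x * a + of_nat j * b) \<le> cmod x * cmod b / (cmod b / 2)"
   using low ab by (intro divide_left_mono mult_pos_pos) (auto intro: less_le_trans[OF _ low])
  also have "\<dots> \<le> 2 * R" using ab x by simp
  finally show ?thesis using nn by linarith
 next
  case False
  have "cmod b \<le> real j * cmod b" using j by (simp add: mult_le_cancel_right1)
  then have ba: "cmod b \<le> 2 * R * cmod a" using False by (simp add: mult_ac)
  have "x * a + of_nat j * b = a * (x + of_nat j * b / a)" using ab by (simp add: field_simps)
  then have eq: "cmod (x * a + of_nat j * b) = cmod a * cmod (x + of_nat j * b / a)" by (simp add: norm_mult)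
  have "cmod x * cmod b \<le> R * (2 * R * cmod a)" using x ba R by (intro mult_mono) auto
  then have "cmod x * cmod b / (cmod a * cmod (x + of_nat j * b / a)) \<le> R * (2 * R * cmod a) / (cmod a * cmod (x + of_nat j * b / a))"
   by (rule divide_right_mono) simp
  also have "\<dots> = 2 * R\<^sup>2 * (1 / cmod (x + of_nat j * b / a))" using ab by (simp add: power2_eq_square)
  finally have "cmod x * cmod b / (cmod a * cmod (x + of_nat j * b / a)) \<le> 2 * R\<^sup>2 * (1 / cmod (x + of_nat j * b / a))" .
  then show ?thesis unfolding eq using R by linarith
 qed
qed

lemma deriv_ratio_measurable:
 assumes "finite I" "i \<in> I" and g: "g \<in> borel_measurable M" and f: "\<And>i. i \<in> I \<Longrightarrow> (\<lambda>x. f x i) \<in> borel_measurable M"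
 shows "(\<lambda>x. deriv_ratio i I j (g x) (f x)) \<in> borel_measurable M"
proof -
 have [measurable]: "(\<lambda>x. deriv_val I j (g x) (f x)) \<in> borel_measurable M" "(\<lambda>x. deriv_val (I - {i}) (j - 1) (g x) (f x)) \<in> borel_measurable M"
  using assms by (auto intro!: deriv_val_measurable)
 note [measurable] = g f[OF assms(2)]
 show ?thesis unfolding deriv_ratio_def by measurable
qed

text \<open>\<open>linear_fraction_bound\<close> is applied with \<open>2 * R\<close>, as |z - w|
  may be that large. Only one point is integrated, and the bound does not see the remaining
  ones.\<close>

lemma nn_integral_deriv_ratio:
 assumes I: "finite I" "i \<in> I" and R: "0 < R" and z: "z \<in> cball 0 R" and j: "1 \<le> j"
 shows "(\<integral>\<^sup>+ w\<in>cball 0 R. ennreal (deriv_ratio i I j z (\<zeta>(i := w))) \<partial>lborel) 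
  \<le> ennreal (4 * R * (pi * R\<^sup>2) + 8 * R\<^sup>2 * (2 * pi + pi * R\<^sup>2))"
proof -
 define a where "a = deriv_val (I - {i}) j z \<zeta>"
 define b where "b = deriv_val (I - {i}) (j - 1) z \<zeta>"
 define c where "c = z + of_nat j * b / a"
 have Ii: "I = insert i (I - {i})" using I by auto
 have val: "deriv_val I j z (\<zeta>(i := w)) = (z - w) * a + of_nat j * b" for w
 proof -
  have "deriv_val I j z (\<zeta>(i := w)) = (z - w) * deriv_val (I - {i}) j z (\<zeta>(i := w)) + of_nat j * deriv_val (I - {i}) (j - 1) z (\<zeta>(i := w))"
   by (subst Ii, subst deriv_val_insert) (use I in auto)
  moreover have "deriv_val (I - {i}) m z (\<zeta>(i := w)) = deriv_val (I - {i}) m z \<zeta>" for m by (rule deriv_val_cong) auto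
  ultimately show ?thesis by (simp add: a_def b_def)
 qed
 have ratio: "deriv_ratio i I j z (\<zeta>(i := w)) = cmod (z - w) * cmod b / cmod ((z - w) * a + of_nat j * b)" for w
 proof -
  have "deriv_val (I - {i}) (j - 1) z (\<zeta>(i := w)) = b" unfolding b_def by (rule deriv_val_cong) auto
  then show ?thesis unfolding deriv_ratio_def val by simp
 qed
 have "(\<integral>\<^sup>+ w\<in>cball 0 R. ennreal (deriv_ratio i I j z (\<zeta>(i := w))) \<partial>lborel) 
  \<le> (\<integral>\<^sup>+ w. ennreal (4 * R) * indicator (cball 0 R) w + ennreal (8 * R\<^sup>2) * (ennreal (1 / cmod (w - c)) * indicator (cball 0 R) w) \<partial>lborel)"
 proof (rule nn_integral_mono)
  fix w :: complex
  have "deriv_ratio i I j z (\<zeta>(i := w)) \<le> 4 * R + 8 * R\<^sup>2 * (1 / cmod (w - c))" if "w \<in> cball 0 R"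
  proof -
   have "cmod (z - w) \<le> 2 * R" using norm_triangle_ineq4[of z w] that z by simp
   from linear_fraction_bound[OF this _ j, of b a] R
   have bound: "deriv_ratio i I j z (\<zeta>(i := w)) \<le> 2 * (2 * R) + 2 * (2 * R)\<^sup>2 * (1 / cmod ((z - w) + of_nat j * b / a))"
    unfolding ratio by simp
   have eq: "(z - w) + of_nat j * b / a = - (w - c)" by (simp add: c_def)
   show ?thesis using bound unfolding eq norm_minus_cancel power_mult_distrib by simp
  qed
  moreover have "ennreal (4 * R + 8 * R\<^sup>2 * (1 / cmod (w - c))) = ennreal (4 * R) + ennreal (8 * R\<^sup>2) * ennreal (1 / cmod (w - c))"
  proof -
   have "ennreal (4 * R + 8 * R\<^sup>2 * (1 / cmod (w - c))) = ennreal (4 * R) + ennreal (8 * R\<^sup>2 * (1 / cmod (w - c)))"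
    using R by (intro ennreal_plus) auto
   also have "ennreal (8 * R\<^sup>2 * (1 / cmod (w - c))) = ennreal (8 * R\<^sup>2) * ennreal (1 / cmod (w - c))"
    by (rule ennreal_mult) auto
   finally show ?thesis .
  qed
  ultimately have "ennreal (deriv_ratio i I j z (\<zeta>(i := w))) \<le> ennreal (4 * R) + ennreal (8 * R\<^sup>2) * ennreal (1 / cmod (w - c))" if "w \<in> cball 0 R"
   using ennreal_leI that by metis
  then show "ennreal (deriv_ratio i I j z (\<zeta>(i := w))) * indicator (cball 0 R) w
   \<le> ennreal (4 * R) * indicator (cball 0 R) w + ennreal (8 * R\<^sup>2) * (ennreal (1 / cmod (w - c)) * indicator (cball 0 R) w)"
   by (cases "w \<in> cball 0 R") (simp_all del: mem_cball)
 qed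
 also have "\<dots> = ennreal (4 * R) * emeasure lborel (cball (0::complex) R) + ennreal (8 * R\<^sup>2) * (\<integral>\<^sup>+ w\<in>cball 0 R. ennreal (1 / cmod (w - c)) \<partial>lborel)"
  by (subst nn_integral_add) (auto simp: nn_integral_cmult)
 also have "\<dots> \<le> ennreal (4 * R) * ennreal (pi * R\<^sup>2) + ennreal (8 * R\<^sup>2) * (ennreal (2 * pi) + ennreal (pi * R\<^sup>2))"
  using nn_integral_inverse_cmod_le[of "cball 0 R" c] R by (intro add_mono mult_left_mono) (auto simp: emeasure_cball_complex)
 also have "\<dots> = ennreal (4 * R * (pi * R\<^sup>2) + 8 * R\<^sup>2 * (2 * pi + pi * R\<^sup>2))"
  using R by (simp add: ennreal_mult'[symmetric] ennreal_plus[symmetric] del: ennreal_plus)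
 finally show ?thesis .
qed

section \<open>Quotients of derivatives\<close>

abbreviation log_quotient :: "nat \<Rightarrow> nat \<Rightarrow> complex \<Rightarrow> (nat \<Rightarrow> complex) \<Rightarrow> real" where
 "log_quotient n j z \<zeta> \<equiv> ln (cmod (deriv_val {1..n} j z \<zeta>) / cmod (deriv_val {1..n} 0 z \<zeta>))"

section \<open>Removing points one at a time\<close>

definition ratio_int :: "real \<Rightarrow> nat \<Rightarrow> nat set \<Rightarrow> nat \<Rightarrow> (nat \<Rightarrow> complex) \<Rightarrow> ennreal" where
 "ratio_int R i I j \<zeta> = (\<integral>\<^sup>+ z\<in>cball 0 R. ennreal (deriv_ratio i I j z \<zeta>) \<partial>lborel)"

lemma vol_component_measurable: "i \<in> {1..n} \<Longrightarrow> (\<lambda>\<zeta>. \<zeta> i) \<in> borel_measurable (vol n)"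
 by (rule measurable_component_singleton[where M="\<lambda>_. lborel :: complex measure", unfolded measurable_lborel1])

lemma ratio_int_measurable:
 assumes I: "I \<subseteq> {1..n}" "i \<in> I"
 shows "ratio_int R i I j \<in> borel_measurable (vol n)"
proof -
 have [measurable]: "(\<lambda>p. deriv_ratio i I j (snd p) (fst p)) \<in> borel_measurable (vol n \<Otimes>\<^sub>M lborel)"
 proof (rule deriv_ratio_measurable)
  show "finite I" using I(1) by (rule finite_subset) simp
  show "(\<lambda>x. fst x l) \<in> borel_measurable (vol n \<Otimes>\<^sub>M (lborel :: complex measure))" if "l \<in> I" for l
   using measurable_compose[OF measurable_fst vol_component_measurable[of l n]] that I by auto
 qed (use I in auto)
 show ?thesis unfolding ratio_int_def by measurable
qed

text \<open>\<open>B\<close> holds the points removed so far, fewer than \<open>k\<close>, and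
  \<open>i\<close> is the next one. There are only polynomially many such pairs.\<close>

definition removal_index :: "nat \<Rightarrow> nat \<Rightarrow> (nat set \<times> nat) set" where
 "removal_index k n = (SIGMA B:{B. B \<subseteq> {1..n} \<and> card B < k}. {1..n} - B)"

lemma removal_index_card:
 assumes n: "1 \<le> n"
 shows "finite (removal_index k n)" "card (removal_index k n) \<le> k * n ^ (k + 1)"
proof -
 let ?S = "{B. B \<subseteq> {1..n} \<and> card B < k}"
 have finS: "finite ?S" by (rule finite_subset[of _ "Pow {1..n}"]) auto
 then show "finite (removal_index k n)" unfolding removal_index_def by (intro finite_SigmaI) auto
 have "?S = (\<Union>b<k. {B. B \<subseteq> {1..n} \<and> card B = b})" by auto
 then have "card ?S \<le> (\<Sum>b<k. card {B. B \<subseteq> {1..n} \<and> card B = b})" by (simp add: card_UN_le)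
 also have "\<dots> = (\<Sum>b<k. n choose b)" by (intro sum.cong refl) (simp add: n_subsets)
 also have "\<dots> \<le> (\<Sum>b<k. n ^ k)"
 proof (rule sum_mono)
  fix b assume "b \<in> {..<k}"
  have "n choose b \<le> n ^ b" by (cases "b \<le> n") (auto simp: binomial_le_pow binomial_eq_0)
  also have "\<dots> \<le> n ^ k" using \<open>b \<in> {..<k}\<close> n by (intro power_increasing) auto
  finally show "n choose b \<le> n ^ k" .
 qed
 also have "\<dots> = k * n ^ k" by simp
 finally have S: "card ?S \<le> k * n ^ k" .
 have "card (removal_index k n) = (\<Sum>B\<in>?S. card ({1..n} - B))"
  unfolding removal_index_def using finS by (intro card_SigmaI) auto
 also have "\<dots> \<le> (\<Sum>B\<in>?S. n)"
 proof (rule sum_mono)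
  fix B show "card ({1..n} - B) \<le> n" using card_mono[of "{1..n}" "{1..n} - B"] by simp
 qed
 also have "\<dots> \<le> (k * n ^ k) * n" using S by simp
 finally show "card (removal_index k n) \<le> k * n ^ (k + 1)" by (simp add: mult_ac)
qed

text \<open>Which points will be removed depends on the configuration, so the quotients for all
  possible choices are added. The indicator reflects that \<open>conditional_density_bound\<close>
  is restricted to a disc.\<close>

definition ratio_sum :: "real \<Rightarrow> nat \<Rightarrow> nat \<Rightarrow> (nat \<Rightarrow> complex) \<Rightarrow> ennreal" where
 "ratio_sum R k n \<zeta> = (\<Sum>(B, i)\<in>removal_index k n. indicator (cball 0 R) (\<zeta> i) * ratio_int R i ({1..n} - B) (k - card B) \<zeta>)"

lemma ratio_term_measurable:
 assumes "(B, i) \<in> removal_index k n"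
 shows "(\<lambda>\<zeta>. indicator (cball 0 R) (\<zeta> i) * ratio_int R i ({1..n} - B) (k - card B) \<zeta>) \<in> borel_measurable (vol n)"
proof -
 have i: "i \<in> {1..n} - B" using assms by (auto simp: removal_index_def)
 have 1: "(\<lambda>\<zeta>. indicator (cball 0 R) (\<zeta> i) :: ennreal) \<in> borel_measurable (vol n)"
  by (rule measurable_compose[OF vol_component_measurable]) (use i in auto)
 have 2: "ratio_int R i ({1..n} - B) (k - card B) \<in> borel_measurable (vol n)"
  by (rule ratio_int_measurable) (use i in auto)
 from borel_measurable_times_ennreal[OF 1 2] show ?thesis .
qed

lemma ratio_sum_measurable: "ratio_sum R k n \<in> borel_measurable (vol n)"
 unfolding ratio_sum_def split_beta' by (rule borel_measurable_sum) (rule ratio_term_measurable, simp)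

context gas
begin

text \<open>Exchanging the integrals over \<open>z\<close> and over point \<open>i\<close> reduces
  the matter to \<open>nn_integral_deriv_ratio\<close> for fixed \<open>z\<close>.\<close>

lemma expectation_ratio:
 assumes \<delta>: "0 < \<delta>" and R: "0 < R"
 shows "\<exists>C>0. \<forall>n i I j. I \<subseteq> {1..n} \<longrightarrow> i \<in> I \<longrightarrow> 1 \<le> j \<longrightarrow>
  (\<integral>\<^sup>+ \<zeta>. weight n \<zeta> * (indicator (cball 0 R) (\<zeta> i) * ratio_int R i I j \<zeta>) \<partial>vol n) \<le> ennreal (C * exp (\<delta> * n)) * Zn n"
proof -
 obtain C where C: "0 < C" "\<And>n i B \<Psi>. \<Psi> \<in> borel_measurable (vol n) \<Longrightarrow> i \<in> {1..n} \<Longrightarrow> (\<And>x. x\<in>space (Pi\<^sub>M ({1..n} - {i}) (\<lambda>_. lborel)) \<Longrightarrow> (\<integral>\<^sup>+ w\<in>cball 0 R. \<Psi> (x(i := w)) \<partial>lborel) \<le> B) \<Longrightarrow>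
  (\<integral>\<^sup>+ \<zeta>. weight n \<zeta> * (indicator (cball 0 R) (\<zeta> i) * \<Psi> \<zeta>) \<partial>vol n) \<le> ennreal (C * exp (\<delta> * n)) * B * Zn n"
  using expectation_bound[OF \<delta>, of R] by blast
 define BR where "BR = 4 * R * (pi * R\<^sup>2) + 8 * R\<^sup>2 * (2 * pi + pi * R\<^sup>2)"
 have BR: "0 < BR" using R unfolding BR_def by (intro add_pos_pos mult_pos_pos) auto
 have "(\<integral>\<^sup>+ \<zeta>. weight n \<zeta> * (indicator (cball 0 R) (\<zeta> i) * ratio_int R i I j \<zeta>) \<partial>vol n) \<le> ennreal (C * (BR * (pi * R\<^sup>2)) * exp (\<delta> * n)) * Zn n"
  if I: "I \<subseteq> {1..n}" "i \<in> I" and j: "1 \<le> j" for n i I j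
 proof -
  have fin: "finite I" using I(1) by (rule finite_subset) simp
  have "(\<integral>\<^sup>+ w\<in>cball 0 R. ratio_int R i I j (x(i := w)) \<partial>lborel) \<le> ennreal (BR * (pi * R\<^sup>2))" for x
  proof -
   have [measurable]: "(\<lambda>p. deriv_ratio i I j (snd p) (x(i := fst p))) \<in> borel_measurable (lborel \<Otimes>\<^sub>M lborel)"
   proof (rule deriv_ratio_measurable[OF fin I(2)])
    show "(\<lambda>p. (x(i := fst p)) l) \<in> borel_measurable (lborel \<Otimes>\<^sub>M (lborel :: complex measure))" for l
     by (cases "l = i") auto
   qed measurable
   have "(\<integral>\<^sup>+ w\<in>cball 0 R. ratio_int R i I j (x(i := w)) \<partial>lborel)
    = (\<integral>\<^sup>+ w. \<integral>\<^sup>+ z. ennreal (deriv_ratio i I j z (x(i := w))) * indicator (cball 0 R) z * indicator (cball 0 R) w \<partial>lborel \<partial>lborel)"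
   proof (rule nn_integral_cong)
    fix w :: complex
    have [measurable]: "(\<lambda>z. deriv_ratio i I j z (x(i := w))) \<in> borel_measurable lborel"
     by (rule deriv_ratio_measurable[OF fin I(2)]) auto
    show "ratio_int R i I j (x(i := w)) * indicator (cball 0 R) w
     = (\<integral>\<^sup>+ z. ennreal (deriv_ratio i I j z (x(i := w))) * indicator (cball 0 R) z * indicator (cball 0 R) w \<partial>lborel)"
     unfolding ratio_int_def by (rule nn_integral_multc[symmetric]) measurable
   qed
   also have "\<dots> = (\<integral>\<^sup>+ z. \<integral>\<^sup>+ w. ennreal (deriv_ratio i I j z (x(i := w))) * indicator (cball 0 R) z * indicator (cball 0 R) w \<partial>lborel \<partial>lborel)"
   proof (rule lborel_pair.Fubini')
    have [measurable]: "(\<lambda>p. deriv_ratio i I j (fst p) (x(i := snd p))) \<in> borel_measurable (lborel \<Otimes>\<^sub>M lborel)"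
    proof (rule deriv_ratio_measurable[OF fin I(2)])
     show "(\<lambda>p. (x(i := snd p)) l) \<in> borel_measurable (lborel \<Otimes>\<^sub>M (lborel :: complex measure))" for l
      by (cases "l = i") auto
    qed measurable
    show "(\<lambda>(z, w). ennreal (deriv_ratio i I j z (x(i := w))) * indicator (cball 0 R) z * indicator (cball 0 R) w) \<in> borel_measurable (lborel \<Otimes>\<^sub>M lborel)"
     unfolding split_beta' by measurable
   qed
   also have "\<dots> \<le> (\<integral>\<^sup>+ z. ennreal BR * indicator (cball (0::complex) R) z \<partial>lborel)"
   proof (rule nn_integral_mono)
    fix z :: complex
    show "(\<integral>\<^sup>+ w. ennreal (deriv_ratio i I j z (x(i := w))) * indicator (cball 0 R) z * indicator (cball 0 R) w \<partial>lborel) \<le> ennreal BR * indicator (cball 0 R) z"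
     using nn_integral_deriv_ratio[OF fin I(2) R _ j, of z x] unfolding BR_def[symmetric]
     by (cases "z \<in> cball 0 R") (simp_all del: mem_cball)
   qed
   also have "\<dots> = ennreal (BR * (pi * R\<^sup>2))"
    using BR R by (subst nn_integral_cmult_indicator) (auto simp: emeasure_cball_complex ennreal_mult)
   finally show ?thesis .
  qed
  then have "(\<integral>\<^sup>+ \<zeta>. weight n \<zeta> * (indicator (cball 0 R) (\<zeta> i) * ratio_int R i I j \<zeta>) \<partial>vol n) \<le> ennreal (C * exp (\<delta> * n)) * ennreal (BR * (pi * R\<^sup>2)) * Zn n"
   using I by (intro C(2) ratio_int_measurable) auto
  also have "ennreal (C * exp (\<delta> * n)) * ennreal (BR * (pi * R\<^sup>2)) = ennreal (C * (BR * (pi * R\<^sup>2)) * exp (\<delta> * n))"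
   using C(1) BR by (subst ennreal_mult[symmetric]) (auto simp: mult_ac)
  finally show ?thesis .
 qed
 then show ?thesis using C(1) BR R by (intro exI[of _ "C * (BR * (pi * R\<^sup>2))"]) auto
qed

text \<open>Markov's inequality at level exp (2 \<delta> n), against an expectation of polynomial
  order times exp (\<delta> n).\<close>

lemma ratio_sum_small:
 assumes \<delta>: "0 < \<delta>" and R: "0 < R"
 shows "\<exists>f. f \<longlonglongrightarrow> 0 \<and> (\<exists>N. \<forall>n\<ge>N. 0 \<le> f n \<and> (\<integral>\<^sup>+ \<zeta>. weight n \<zeta> * indicator {\<zeta>. ennreal (exp (2 * \<delta> * n)) < ratio_sum R k n \<zeta>} \<zeta> \<partial>vol n) \<le> ennreal (f n) * Zn n)"
proof -
 obtain C where C: "0 < C" "\<forall>n i I j. I \<subseteq> {1..n} \<longrightarrow> i \<in> I \<longrightarrow> 1 \<le> j \<longrightarrow>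
  (\<integral>\<^sup>+ \<zeta>. weight n \<zeta> * (indicator (cball 0 R) (\<zeta> i) * ratio_int R i I j \<zeta>) \<partial>vol n) \<le> ennreal (C * exp (\<delta> * n)) * Zn n"
  using expectation_ratio[OF \<delta> R] by blast
 define f where "f n = (real k * C / \<delta> ^ (k + 1)) * ((\<delta> * real n) ^ (k + 1) / exp (\<delta> * real n))" for n :: nat
 have f0: "0 \<le> f n" for n unfolding f_def using C \<delta> by (intro mult_nonneg_nonneg divide_nonneg_nonneg) auto
 have "filterlim (\<lambda>n. \<delta> * real n) at_top sequentially" using \<delta> by real_asymp
 from filterlim_compose[OF tendsto_power_div_exp_0 this]
 have "(\<lambda>n. (\<delta> * real n) ^ (k + 1) / exp (\<delta> * real n)) \<longlonglongrightarrow> 0" .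
 from tendsto_mult_right_zero[OF this] have "f \<longlonglongrightarrow> 0" unfolding f_def .
 moreover have "(\<integral>\<^sup>+ \<zeta>. weight n \<zeta> * indicator {\<zeta>. ennreal (exp (2 * \<delta> * n)) < ratio_sum R k n \<zeta>} \<zeta> \<partial>vol n) \<le> ennreal (f n) * Zn n" if n: "1 \<le> n" for n
 proof -
  let ?X = "removal_index k n"
  note fin = removal_index_card[OF n, of k]
  have "(\<integral>\<^sup>+ \<zeta>. weight n \<zeta> * ratio_sum R k n \<zeta> \<partial>vol n)
   = (\<integral>\<^sup>+ \<zeta>. (\<Sum>p\<in>?X. weight n \<zeta> * (indicator (cball 0 R) (\<zeta> (snd p)) * ratio_int R (snd p) ({1..n} - fst p) (k - card (fst p)) \<zeta>)) \<partial>vol n)"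
   unfolding ratio_sum_def split_beta' sum_distrib_left ..
  also have "\<dots> = (\<Sum>p\<in>?X. \<integral>\<^sup>+ \<zeta>. weight n \<zeta> * (indicator (cball 0 R) (\<zeta> (snd p)) * ratio_int R (snd p) ({1..n} - fst p) (k - card (fst p)) \<zeta>) \<partial>vol n)"
   by (rule nn_integral_sum, rule borel_measurable_times_ennreal[OF weight_measurable]) (rule ratio_term_measurable, simp)
  also have "\<dots> \<le> (\<Sum>p\<in>?X. ennreal (C * exp (\<delta> * n)) * Zn n)"
  proof (rule sum_mono)
   fix p assume "p \<in> ?X"
   then have "snd p \<in> {1..n} - fst p" "card (fst p) < k" by (auto simp: removal_index_def)
   then show "(\<integral>\<^sup>+ \<zeta>. weight n \<zeta> * (indicator (cball 0 R) (\<zeta> (snd p)) * ratio_int R (snd p) ({1..n} - fst p) (k - card (fst p)) \<zeta>) \<partial>vol n) \<le> ennreal (C * exp (\<delta> * n)) * Zn n"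
    by (intro C(2)[rule_format]) auto
  qed
  also have "\<dots> = of_nat (card ?X) * (ennreal (C * exp (\<delta> * n)) * Zn n)" by simp
  also have "\<dots> \<le> of_nat (k * n ^ (k + 1)) * (ennreal (C * exp (\<delta> * n)) * Zn n)"
   using fin(2) by (intro mult_right_mono of_nat_mono) auto
  finally have E: "(\<integral>\<^sup>+ \<zeta>. weight n \<zeta> * ratio_sum R k n \<zeta> \<partial>vol n) \<le> of_nat (k * n ^ (k + 1)) * (ennreal (C * exp (\<delta> * n)) * Zn n)" .
  have "(\<integral>\<^sup>+ \<zeta>. weight n \<zeta> * indicator {\<zeta>. ennreal (exp (2 * \<delta> * n)) < ratio_sum R k n \<zeta>} \<zeta> \<partial>vol n)
   \<le> (\<integral>\<^sup>+ \<zeta>. ennreal (exp (- (2 * \<delta> * n))) * (weight n \<zeta> * ratio_sum R k n \<zeta>) \<partial>vol n)"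
  proof (rule nn_integral_mono)
   fix \<zeta>
   have "1 \<le> ennreal (exp (- (2 * \<delta> * n))) * ratio_sum R k n \<zeta>" if "ennreal (exp (2 * \<delta> * n)) < ratio_sum R k n \<zeta>"
   proof -
    have "1 = ennreal (exp (- (2 * \<delta> * n))) * ennreal (exp (2 * \<delta> * n))" by (simp add: ennreal_mult'[symmetric] exp_add[symmetric])
    also have "\<dots> \<le> ennreal (exp (- (2 * \<delta> * n))) * ratio_sum R k n \<zeta>" using that by (intro mult_left_mono) auto
    finally show ?thesis .
   qed
   then have "weight n \<zeta> * 1 \<le> weight n \<zeta> * (ennreal (exp (- (2 * \<delta> * n))) * ratio_sum R k n \<zeta>)" if "ennreal (exp (2 * \<delta> * n)) < ratio_sum R k n \<zeta>"
    using that by (intro mult_left_mono) auto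
   then show "weight n \<zeta> * indicator {\<zeta>. ennreal (exp (2 * \<delta> * n)) < ratio_sum R k n \<zeta>} \<zeta> \<le> ennreal (exp (- (2 * \<delta> * n))) * (weight n \<zeta> * ratio_sum R k n \<zeta>)"
    by (auto simp: indicator_def ac_simps)
  qed
  also have "\<dots> = ennreal (exp (- (2 * \<delta> * n))) * (\<integral>\<^sup>+ \<zeta>. weight n \<zeta> * ratio_sum R k n \<zeta> \<partial>vol n)"
   by (rule nn_integral_cmult) (intro borel_measurable_times_ennreal weight_measurable ratio_sum_measurable)
  also have "\<dots> \<le> ennreal (exp (- (2 * \<delta> * n))) * (of_nat (k * n ^ (k + 1)) * (ennreal (C * exp (\<delta> * n)) * Zn n))"
   by (intro mult_left_mono E) auto
  also have "\<dots> = ennreal (exp (- (2 * \<delta> * n)) * (real (k * n ^ (k + 1)) * (C * exp (\<delta> * n)))) * Zn n"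
   using C(1) by (simp add: ennreal_mult' ennreal_of_nat_eq_real_of_nat mult.assoc)
  also have "exp (- (2 * \<delta> * n)) * (real (k * n ^ (k + 1)) * (C * exp (\<delta> * n))) = f n"
  proof -
   have "exp (- (2 * \<delta> * n)) * exp (\<delta> * n) = 1 / exp (\<delta> * n)" 
    by (simp add: exp_add[symmetric] exp_minus[symmetric] inverse_eq_divide[symmetric])
   moreover have "(\<delta> * real n) ^ (k + 1) = \<delta> ^ (k + 1) * real n ^ (k + 1)" by (rule power_mult_distrib)
   ultimately show ?thesis using \<delta> by (simp add: f_def field_simps del: power_Suc)
  qed
  finally show ?thesis .
 qed
 ultimately show ?thesis using f0 by blast
qed

end

section \<open>Integrals of the logarithmic quotient\<close>

lemma higher_pderiv_degree:
 fixes p :: "complex poly"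
 assumes "j \<le> degree p" "p \<noteq> 0"
 shows "(pderiv ^^ j) p \<noteq> 0" "degree ((pderiv ^^ j) p) = degree p - j"
proof -
 have "(pderiv ^^ j) p \<noteq> 0 \<and> degree ((pderiv ^^ j) p) = degree p - j" using assms
 proof (induction j)
  case (Suc j)
  then have IH: "(pderiv ^^ j) p \<noteq> 0" "degree ((pderiv ^^ j) p) = degree p - j" by auto
  moreover have "degree ((pderiv ^^ j) p) \<noteq> 0" using IH Suc.prems by simp
  ultimately show ?case by (simp add: pderiv_eq_0_iff degree_pderiv)
 qed simp
 then show "(pderiv ^^ j) p \<noteq> 0" "degree ((pderiv ^^ j) p) = degree p - j" by auto
qed

lemma degree_prod_linear: "finite I \<Longrightarrow> degree (\<Prod>i\<in>I. [:- \<zeta> i, 1:] :: complex poly) = card I"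
 by (subst degree_prod_eq_sum_degree) auto

lemma AE_deriv_val_nonzero:
 assumes "finite I" "j \<le> card I"
 shows "AE z in lborel. deriv_val I j z \<zeta> \<noteq> 0"
proof -
 let ?p = "(pderiv ^^ j) (\<Prod>i\<in>I. [:- \<zeta> i, 1:])"
 have "(\<Prod>i\<in>I. [:- \<zeta> i, 1:]) \<noteq> (0 :: complex poly)" using assms by simp
 then have "?p \<noteq> 0" using assms by (intro higher_pderiv_degree) (auto simp: degree_prod_linear)
 then have "finite {z. poly ?p z = 0}" by (rule poly_roots_finite)
 then have "{z. poly ?p z = 0} \<in> null_sets lborel" by (rule finite_imp_null_set_lborel)
 from AE_not_in[OF this] show ?thesis by (simp add: deriv_val_def)
qed

text \<open>\<open>ennreal\<close> cuts off negative values: for the set of all points this is the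
  integral of the negative part of \<open>log_quotient\<close>.\<close>

definition neg_part :: "real \<Rightarrow> nat set \<Rightarrow> nat \<Rightarrow> (nat \<Rightarrow> complex) \<Rightarrow> ennreal" where
 "neg_part R I j \<zeta> = (\<integral>\<^sup>+ z\<in>cball 0 R. ennreal (ln (cmod (deriv_val I 0 z \<zeta>) / cmod (deriv_val I j z \<zeta>))) \<partial>lborel)"

lemma deriv_val_measurable_z [measurable]:
 assumes "finite I" shows "(\<lambda>z. deriv_val I j z \<zeta>) \<in> borel_measurable borel"
 by (rule deriv_val_measurable[OF assms]) auto

text \<open>Splitting off a point writes ln |P / P^(j)| as the logarithm of
  \<open>deriv_ratio\<close> plus the same expression with one point and one derivative fewer.
  Having at least \<open>k\<close> points in the disc guarantees that the next point can be chosen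
  there, where \<open>ratio_sum\<close> controls its quotient. Each removal costs
  \<open>1 + M * (pi * R\<^sup>2)\<close>.\<close>

lemma neg_part_bound:
 assumes R: "0 < R" and M: "0 \<le> M" and sum: "ratio_sum R k n \<zeta> \<le> ennreal (exp M)"
  and good: "k \<le> card {i \<in> {1..n}. \<zeta> i \<in> cball 0 R}" and n: "1 \<le> n"
 shows "B \<subseteq> {1..n} \<Longrightarrow> card B + j = k \<Longrightarrow> neg_part R ({1..n} - B) j \<zeta> \<le> ennreal (j * (1 + M * (pi * R\<^sup>2)))"
proof (induction j arbitrary: B)
 case 0
 \<comment> \<open>True also for x = 0, as 0 / 0 = 0 and ln 0 = 0.\<close>
 have "ln (x / x) = 0" for x :: real by (cases "x = 0") auto
 then show ?case unfolding neg_part_def by (simp only:) simp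
next
 case (Suc m)
 have finB: "finite B" using Suc.prems(1) by (rule finite_subset) simp
 have "card B < card {i \<in> {1..n}. \<zeta> i \<in> cball 0 R}" using good Suc.prems by simp
 then have "\<not> {i \<in> {1..n}. \<zeta> i \<in> cball 0 R} \<subseteq> B" using card_mono[OF finB] not_le by blast
 then obtain i where i: "i \<in> {1..n}" "\<zeta> i \<in> cball 0 R" "i \<notin> B" by blast
 define I where "I = {1..n} - B"
 define I' where "I' = {1..n} - insert i B"
 have I: "finite I" "finite I'" "i \<notin> I'" "I = insert i I'" "I - {i} = I'" using i by (auto simp: I_def I'_def)
 have idx: "(B, i) \<in> removal_index k n" using i Suc.prems by (auto simp: removal_index_def)
 have "indicator (cball 0 R) (\<zeta> i) * ratio_int R i I (k - card B) \<zeta> \<le> ratio_sum R k n \<zeta>"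
  unfolding ratio_sum_def I_def
  using member_le_sum[OF idx, of "\<lambda>(B, i). indicator (cball 0 R) (\<zeta> i) * ratio_int R i ({1..n} - B) (k - card B) \<zeta>"] removal_index_card(1)[OF n] by simp
 moreover have kB: "k - card B = Suc m" using Suc.prems by simp
 ultimately have T: "ratio_int R i I (Suc m) \<zeta> \<le> ennreal (exp M)" using i(2) sum by simp
 have cardI: "Suc m \<le> card I"
 proof -
  have "card {i \<in> {1..n}. \<zeta> i \<in> cball 0 R} \<le> card {1..n}" by (rule card_mono) auto
  then have "k \<le> n" using good by simp
  moreover have "card I = n - card B" unfolding I_def using Suc.prems finB by (subst card_Diff_subset) auto
  ultimately show ?thesis using Suc.prems by simp
 qed
 have cardI': "m \<le> card I'" using cardI I by simp
 have IH: "neg_part R I' m \<zeta> \<le> ennreal (m * (1 + M * (pi * R\<^sup>2)))"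
  unfolding I'_def using i Suc.prems finB by (intro Suc.IH) auto
 have ae: "AE z in lborel. deriv_val I 0 z \<zeta> \<noteq> 0" "AE z in lborel. deriv_val I (Suc m) z \<zeta> \<noteq> 0"
   "AE z in lborel. deriv_val I' 0 z \<zeta> \<noteq> 0" "AE z in lborel. deriv_val I' m z \<zeta> \<noteq> 0"
  using I cardI cardI' by (intro AE_deriv_val_nonzero; simp)+
 have [measurable]: "(\<lambda>z. deriv_ratio i I (Suc m) z \<zeta>) \<in> borel_measurable borel"
  by (rule deriv_ratio_measurable) (use I in auto)
 note [measurable] = deriv_val_measurable_z[OF I(2)]
 have "neg_part R I (Suc m) \<zeta> \<le> (\<integral>\<^sup>+ z. ennreal (exp (- M)) * (ennreal (deriv_ratio i I (Suc m) z \<zeta>) * indicator (cball 0 R) z)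
   + ennreal M * indicator (cball 0 R) z + ennreal (ln (cmod (deriv_val I' 0 z \<zeta>) / cmod (deriv_val I' m z \<zeta>))) * indicator (cball 0 R) z \<partial>lborel)"
  unfolding neg_part_def
 proof (rule nn_integral_mono_AE, use ae in eventually_elim)
  case (elim z)
  define r where "r = deriv_ratio i I (Suc m) z \<zeta>"
  define x where "x = cmod (deriv_val I' 0 z \<zeta>) / cmod (deriv_val I' m z \<zeta>)"
  have p0: "deriv_val I 0 z \<zeta> = (z - \<zeta> i) * deriv_val I' 0 z \<zeta>"
   unfolding I(4) by (subst deriv_val_insert[OF I(2,3)]) simp
  have r: "r = cmod (z - \<zeta> i) * cmod (deriv_val I' m z \<zeta>) / cmod (deriv_val I (Suc m) z \<zeta>)"
   unfolding r_def deriv_ratio_def I(5) by simp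
  have rpos: "0 < r" unfolding r using elim p0 by auto
  have xpos: "0 < x" unfolding x_def using elim by auto
  have "cmod (deriv_val I 0 z \<zeta>) / cmod (deriv_val I (Suc m) z \<zeta>) = r * x"
   unfolding r x_def p0 norm_mult using elim by (simp add: field_simps)
  then have "ln (cmod (deriv_val I 0 z \<zeta>) / cmod (deriv_val I (Suc m) z \<zeta>)) = ln r + ln x"
   using rpos xpos by (simp add: ln_mult)
  \<comment> \<open>From ln y \<le> y - 1 at y = r exp (- M): a bound exp M on the integral of
    \<open>r\<close> becomes a bound of order \<open>M\<close> on that of ln r.\<close>
  moreover have "ln r \<le> exp (- M) * r + M"
  proof -
   have "ln (r * exp (- M)) \<le> r * exp (- M) - 1" using rpos by (intro ln_le_minus_one) simp
   then show ?thesis using rpos by (simp add: ln_mult mult.commute)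
  qed
  ultimately have "ennreal (ln (cmod (deriv_val I 0 z \<zeta>) / cmod (deriv_val I (Suc m) z \<zeta>))) \<le> ennreal (exp (- M) * r + M + max 0 (ln x))"
   by (intro ennreal_leI) simp
  also have "\<dots> = ennreal (exp (- M)) * ennreal r + ennreal M + ennreal (ln x)"
   using rpos M by (simp add: ennreal_plus ennreal_mult max_def ennreal_neg)
  finally show ?case by (auto simp: indicator_def r_def x_def)
 qed
 also have "\<dots> = ennreal (exp (- M)) * ratio_int R i I (Suc m) \<zeta> + ennreal M * emeasure lborel (cball (0::complex) R) + neg_part R I' m \<zeta>"
  unfolding ratio_int_def neg_part_def by (simp add: nn_integral_add nn_integral_cmult)
 also have "\<dots> \<le> ennreal (exp (- M)) * ennreal (exp M) + ennreal M * ennreal (pi * R\<^sup>2) + ennreal (m * (1 + M * (pi * R\<^sup>2)))"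
  using R by (intro add_mono mult_left_mono T IH) (auto simp: emeasure_cball_complex)
 also have "\<dots> = ennreal (1 + M * (pi * R\<^sup>2) + m * (1 + M * (pi * R\<^sup>2)))"
  using M by (simp add: ennreal_mult'[symmetric] ennreal_plus exp_add[symmetric])
 also have "1 + M * (pi * R\<^sup>2) + m * (1 + M * (pi * R\<^sup>2)) = Suc m * (1 + M * (pi * R\<^sup>2))" by (simp add: algebra_simps)
 finally show ?case unfolding I_def .
qed

text \<open>By \<open>cmod_deriv_val_le\<close> the quotient is at most S^j, where S is the sum of 1
  / |z - \<zeta> i| and has an integral of order n. Taking logarithms leaves order ln n, for every
  configuration.\<close>

lemma pos_part_bound:
 assumes n: "1 \<le> n" and R: "0 < R"
 shows "(\<integral>\<^sup>+ z\<in>cball 0 R. ennreal (log_quotient n j z \<zeta>) \<partial>lborel)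
  \<le> ennreal (j * (2 * pi + pi * R\<^sup>2 + ln n * (pi * R\<^sup>2)))"
proof -
 define S where "S z = (\<Sum>i\<in>{1..n}. 1 / cmod (z - \<zeta> i))" for z
 have S0: "0 \<le> S z" for z by (simp add: S_def sum_nonneg)
 have ae: "AE z in lborel. deriv_val {1..n} 0 z \<zeta> \<noteq> 0" by (rule AE_deriv_val_nonzero) auto
 have "(\<integral>\<^sup>+ z\<in>cball 0 R. ennreal (log_quotient n j z \<zeta>) \<partial>lborel)
  \<le> (\<integral>\<^sup>+ z. ennreal (real j / n) * (\<Sum>i\<in>{1..n}. ennreal (1 / cmod (z - \<zeta> i)) * indicator (cball 0 R) z) + ennreal (j * ln n) * indicator (cball 0 R) z \<partial>lborel)"
 proof (rule nn_integral_mono_AE, use ae in eventually_elim)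
  case (elim z)
  let ?x = "cmod (deriv_val {1..n} j z \<zeta>) / cmod (deriv_val {1..n} 0 z \<zeta>)"
  have ne: "z \<noteq> \<zeta> i" if "i \<in> {1..n}" for i using elim that by (auto simp: deriv_val_0)
  have "?x \<le> S z ^ j" using cmod_deriv_val_le[of "{1..n}" z \<zeta> j] ne elim unfolding S_def by (simp add: divide_le_eq mult.commute)
  also have "\<dots> \<le> (1 + S z) ^ j" using S0 by (intro power_mono) auto
  finally have x: "?x \<le> (1 + S z) ^ j" .
  \<comment> \<open>From ln y \<le> y - 1 at y = (1 + S) / n, the typical size of S being n.\<close>
  have l: "ln (1 + S z) \<le> S z / n + ln n"
  proof -
   have "ln ((1 + S z) / n) \<le> (1 + S z) / n - 1" using S0[of z] n by (intro ln_le_minus_one) (auto intro!: divide_pos_pos add_pos_nonneg)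
   moreover have "ln ((1 + S z) / n) = ln (1 + S z) - ln n" 
   proof -
    have "0 < 1 + S z" "0 < real n" using S0[of z] n by auto
    then show ?thesis by (simp add: ln_div)
   qed
   moreover have "(1 + S z) / n - 1 \<le> S z / n" using n by (simp add: field_simps)
   ultimately show ?thesis by linarith
  qed
  have ln0: "0 \<le> ln (1 + S z)" using S0[of z] by simp
  have "ln ?x \<le> j * ln (1 + S z)"
  proof (cases "?x = 0")
   case True
   then have "ln ?x = 0" by (simp only: ln_0)
   then show ?thesis using ln0 by (simp only:) simp
  next
   case False
   then have "0 < ?x" by (simp add: less_le)
   then have "ln ?x \<le> ln ((1 + S z) ^ j)" using x by (intro ln_mono)
   then show ?thesis using S0[of z] by (simp add: ln_realpow)
  qed
  also have "\<dots> \<le> j * (S z / n + ln n)" using l by (intro mult_left_mono) auto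
  finally have "ennreal (ln ?x) \<le> ennreal (real j / n * S z + j * ln n)" by (intro ennreal_leI) (simp add: algebra_simps)
  also have "\<dots> = ennreal (real j / n) * (\<Sum>i\<in>{1..n}. ennreal (1 / cmod (z - \<zeta> i))) + ennreal (j * ln n)"
  proof -
   have s: "(\<Sum>i\<in>{1..n}. ennreal (1 / cmod (z - \<zeta> i))) = ennreal (S z)" unfolding S_def by (rule sum_ennreal) simp
   have "0 \<le> real j / n" "0 \<le> real j / n * S z" "0 \<le> j * ln n" using S0[of z] n by (auto simp: ln_ge_zero)
   then show ?thesis unfolding s using S0[of z] by (simp only: ennreal_plus ennreal_mult)
  qed
  finally show ?case by (auto simp: indicator_def)
 qed
 also have "\<dots> = ennreal (real j / n) * (\<Sum>i\<in>{1..n}. \<integral>\<^sup>+ z\<in>cball 0 R. ennreal (1 / cmod (z - \<zeta> i)) \<partial>lborel) + ennreal (j * ln n) * emeasure lborel (cball (0::complex) R)"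
 proof -
  have m: "(\<lambda>z. \<Sum>i\<in>{1..n}. ennreal (1 / cmod (z - \<zeta> i)) * indicator (cball 0 R) z) \<in> borel_measurable lborel" by measurable
  have s: "(\<integral>\<^sup>+ z. (\<Sum>i\<in>{1..n}. ennreal (1 / cmod (z - \<zeta> i)) * indicator (cball 0 R) z) \<partial>lborel)
   = (\<Sum>i\<in>{1..n}. \<integral>\<^sup>+ z\<in>cball 0 R. ennreal (1 / cmod (z - \<zeta> i)) \<partial>lborel)"
   by (rule nn_integral_sum) measurable
  have c: "(\<integral>\<^sup>+ z. ennreal (j * ln n) * indicator (cball (0::complex) R) z \<partial>lborel) = ennreal (j * ln n) * emeasure lborel (cball (0::complex) R)"
   by (rule nn_integral_cmult_indicator) simp
  show ?thesis
   by (subst nn_integral_add[OF borel_measurable_times_ennreal[OF borel_measurable_const m]]) (measurable, simp only: nn_integral_cmult[OF m] s c)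
 qed
 also have "\<dots> \<le> ennreal (real j / n) * (\<Sum>i\<in>{1..n}. ennreal (2 * pi) + ennreal (pi * R\<^sup>2)) + ennreal (j * ln n) * ennreal (pi * R\<^sup>2)"
  using nn_integral_inverse_cmod_le[of "cball 0 R"] R by (intro add_mono mult_left_mono sum_mono) (auto simp: emeasure_cball_complex)
 also have "\<dots> = ennreal (real j / n * (n * (2 * pi + pi * R\<^sup>2)) + j * ln n * (pi * R\<^sup>2))"
 proof -
  let ?c = "2 * pi + pi * R\<^sup>2"
  have "(\<Sum>i\<in>{1..n}. ennreal (2 * pi) + ennreal (pi * R\<^sup>2)) = ennreal n * ennreal ?c"
   by (subst ennreal_plus[symmetric]) (auto simp: ennreal_of_nat_eq_real_of_nat simp del: ennreal_plus)
  moreover have "0 \<le> real j / n" "0 \<le> n * ?c" "0 \<le> real j / n * (n * ?c)" "0 \<le> j * ln n" "0 \<le> j * ln n * (pi * R\<^sup>2)" "0 \<le> ?c" "0 \<le> pi * R\<^sup>2" "0 \<le> real n"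
   using n by (auto simp: ln_ge_zero)
  ultimately show ?thesis by (simp only: ennreal_plus[of "real j / n * (n * ?c)"] ennreal_mult)
 qed
 also have "real j / n * (n * (2 * pi + pi * R\<^sup>2)) + j * ln n * (pi * R\<^sup>2) = j * (2 * pi + pi * R\<^sup>2 + ln n * (pi * R\<^sup>2))"
  using n by (simp add: field_simps)
 finally show ?thesis .
qed

text \<open>With \<open>M = 2 * \<delta> * n\<close> the bound is a small multiple of n plus a term
  of order ln n.\<close>

lemma abs_log_bound:
 assumes R: "0 < R" and M: "0 \<le> M" and sum: "ratio_sum R k n \<zeta> \<le> ennreal (exp M)"
  and good: "k \<le> card {i \<in> {1..n}. \<zeta> i \<in> cball 0 R}" and n: "1 \<le> n"
 shows "(\<integral>\<^sup>+ z\<in>cball 0 R. ennreal \<bar>log_quotient n k z \<zeta>\<bar> \<partial>lborel)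
  \<le> ennreal (k * (1 + M * (pi * R\<^sup>2)) + k * (2 * pi + pi * R\<^sup>2 + ln n * (pi * R\<^sup>2)))"
proof -
 let ?x = "\<lambda>z. cmod (deriv_val {1..n} k z \<zeta>) / cmod (deriv_val {1..n} 0 z \<zeta>)"
 let ?y = "\<lambda>z. cmod (deriv_val {1..n} 0 z \<zeta>) / cmod (deriv_val {1..n} k z \<zeta>)"
 have "ennreal \<bar>ln (?x z)\<bar> \<le> ennreal (ln (?x z)) + ennreal (ln (?y z))" for z
 proof (cases "?x z = 0")
  case True
  then have "ln (?x z) = 0" by (simp only: ln_0)
  then show ?thesis by (simp only: abs_zero ennreal_0 zero_le)
 next
  case False
  then have "ln (?y z) = - ln (?x z)" by (simp add: ln_div)
  then show ?thesis by (cases "0 \<le> ln (?x z)") (auto simp: ennreal_neg)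
 qed
 then have "(\<integral>\<^sup>+ z\<in>cball 0 R. ennreal \<bar>ln (?x z)\<bar> \<partial>lborel)
  \<le> (\<integral>\<^sup>+ z. ennreal (ln (?x z)) * indicator (cball 0 R) z + ennreal (ln (?y z)) * indicator (cball 0 R) z \<partial>lborel)"
  by (intro nn_integral_mono) (auto simp: indicator_def)
 also have "\<dots> = (\<integral>\<^sup>+ z\<in>cball 0 R. ennreal (ln (?x z)) \<partial>lborel) + neg_part R {1..n} k \<zeta>"
 proof -
  have [measurable]: "(\<lambda>z. deriv_val {1..n} j z \<zeta>) \<in> borel_measurable borel" for j by (rule deriv_val_measurable_z) simp
  show ?thesis unfolding neg_part_def by (rule nn_integral_add) measurable
 qed
 also have "\<dots> \<le> ennreal (k * (2 * pi + pi * R\<^sup>2 + ln n * (pi * R\<^sup>2))) + ennreal (k * (1 + M * (pi * R\<^sup>2)))"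
  using neg_part_bound[OF R M sum good n, of "{}" k] by (intro add_mono pos_part_bound n R) simp
 also have "\<dots> = ennreal (k * (1 + M * (pi * R\<^sup>2)) + k * (2 * pi + pi * R\<^sup>2 + ln n * (pi * R\<^sup>2)))"
  using M n by (simp add: ennreal_plus[symmetric] ln_ge_zero add.commute del: ennreal_plus)
 finally show ?thesis .
qed

section \<open>Logarithmic potentials of circular averages\<close>

lemma abs_ln_le: "0 < (x::real) \<Longrightarrow> \<bar>ln x\<bar> \<le> 1 / x + x"
proof -
 assume x: "0 < x"
 have "ln x \<le> x" using ln_le_minus_one[OF x] by simp
 moreover have "ln (1 / x) \<le> 1 / x" using ln_le_minus_one[of "1 / x"] x by simp
 moreover have "ln (1 / x) = - ln x" using x by (simp add: ln_div)
 moreover have "0 < 1 / x" using x by simp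
 ultimately show ?thesis using x by (intro abs_leI) linarith+
qed

lemma integrable_ln_cball: "integrable lborel (\<lambda>z. indicator (cball 0 R) z * \<bar>ln (cmod (z - u))\<bar>)"
proof (rule integrableI_bounded)
 have "(\<integral>\<^sup>+ z. ennreal (norm (indicator (cball 0 R) z * \<bar>ln (cmod (z - u))\<bar>)) \<partial>lborel)
  \<le> (\<integral>\<^sup>+ z. ennreal (1 / cmod (z - u)) * indicator (cball 0 R) z + ennreal (\<bar>R\<bar> + cmod u) * indicator (cball 0 R) z \<partial>lborel)"
 proof (rule nn_integral_mono)
  fix z :: complex
  show "ennreal (norm (indicator (cball 0 R) z * \<bar>ln (cmod (z - u))\<bar>)) \<le> ennreal (1 / cmod (z - u)) * indicator (cball 0 R) z + ennreal (\<bar>R\<bar> + cmod u) * indicator (cball 0 R) z"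
  proof (cases "z \<in> cball 0 R \<and> z \<noteq> u")
   case True
   then have "\<bar>ln (cmod (z - u))\<bar> \<le> 1 / cmod (z - u) + cmod (z - u)" by (intro abs_ln_le) simp
   also have "\<dots> \<le> 1 / cmod (z - u) + (\<bar>R\<bar> + cmod u)" using norm_triangle_ineq4[of z u] True abs_ge_self[of R] unfolding mem_cball dist_0_norm by linarith
   finally have "ennreal \<bar>ln (cmod (z - u))\<bar> \<le> ennreal (1 / cmod (z - u)) + ennreal (\<bar>R\<bar> + cmod u)"
    by (subst ennreal_plus[symmetric]) (auto intro: ennreal_leI simp del: ennreal_plus)
   then show ?thesis using True by simp
  qed (auto simp: indicator_def)
 qed
 also have "\<dots> = (\<integral>\<^sup>+ z\<in>cball 0 R. ennreal (1 / cmod (z - u)) \<partial>lborel) + ennreal (\<bar>R\<bar> + cmod u) * emeasure lborel (cball (0::complex) R)"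
  by (subst nn_integral_add) (auto simp: nn_integral_cmult simp del: ennreal_plus)
 also have "\<dots> \<le> ennreal (2 * pi) + emeasure lborel (cball (0::complex) R) + ennreal (\<bar>R\<bar> + cmod u) * emeasure lborel (cball (0::complex) R)"
  by (intro add_mono nn_integral_inverse_cmod_le) auto
 also have "\<dots> < \<infinity>"
  using emeasure_bounded_finite[OF bounded_cball, of "0::complex" R] by (simp add: ennreal_mult_less_top del: ennreal_plus)
 finally show "(\<integral>\<^sup>+ z. ennreal (norm (indicator (cball 0 R) z * \<bar>ln (cmod (z - u))\<bar>)) \<partial>lborel) < \<infinity>" .
qed measurable

text \<open>Convolution of \<open>\<phi>\<close> with the uniform distribution on the circle of
  radius \<open>e\<close>.\<close>

definition circ_avg :: "(complex \<Rightarrow> real) \<Rightarrow> real \<Rightarrow> complex \<Rightarrow> real" where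
 "circ_avg \<phi> e z = (\<integral>t. indicator {0..2*pi} t * \<phi> (z - of_real e * cis t) \<partial>lborel) / (2 * pi)"

lemma circ_avg_measurable [measurable]:
 assumes [measurable]: "\<phi> \<in> borel_measurable borel"
 shows "circ_avg \<phi> e \<in> borel_measurable borel"
 unfolding circ_avg_def by measurable

lemma circ_avg_bound:
 assumes \<phi> [measurable]: "\<phi> \<in> borel_measurable borel" and B: "\<And>x. \<bar>\<phi> x\<bar> \<le> B"
 shows "\<bar>circ_avg \<phi> e z\<bar> \<le> B"
proof -
 have i: "integrable lborel (\<lambda>t. indicator {0..2*pi} t * B)" by simp
 have "\<bar>\<integral>t. indicator {0..2*pi} t * \<phi> (z - of_real e * cis t) \<partial>lborel\<bar> \<le> (\<integral>t. indicator {0..2*pi} t * B \<partial>lborel)"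
 proof (rule order_trans[OF integral_abs_bound integral_mono'[OF i]])
  show "\<bar>indicator {0..2*pi} t * \<phi> (z - of_real e * cis t)\<bar> \<le> indicator {0..2*pi} t * B" for t
   using B by (auto simp: indicator_def)
  show "0 \<le> indicator {0..2*pi} t * B" for t :: real using B[of 0] by (auto simp: indicator_def)
 qed
 also have "\<dots> = 2 * pi * B" by simp
 finally show ?thesis unfolding circ_avg_def by (simp add: abs_divide divide_le_eq mult.commute)
qed

lemma circ_avg_support:
 assumes "\<And>x. R < cmod x \<Longrightarrow> \<phi> x = 0" "0 \<le> e" "R + e < cmod z"
 shows "circ_avg \<phi> e z = 0"
proof -
 have "\<phi> (z - of_real e * cis t) = 0" for t
 proof (rule assms(1))
  have "cmod z - cmod (of_real e * cis t) \<le> cmod (z - of_real e * cis t)" by (rule norm_triangle_ineq2)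
  then show "R < cmod (z - of_real e * cis t)" using assms by (simp add: norm_mult)
 qed
 then show ?thesis by (simp add: circ_avg_def)
qed

lemma lborel_integral_translate:
 fixes f :: "complex \<Rightarrow> real"
 assumes [measurable]: "f \<in> borel_measurable borel"
 shows "(\<integral>z. f (c + z) \<partial>lborel) = (\<integral>z. f z \<partial>lborel)"
proof -
 have "(\<integral>z. f z \<partial>lborel) = (\<integral>z. f z \<partial>distr lborel borel ((+) c))" by (simp add: lborel_distr_plus)
 also have "\<dots> = (\<integral>z. f (c + z) \<partial>lborel)" by (rule integral_distr) auto
 finally show ?thesis by simp
qed

text \<open>The two integrands correspond under z = a + e cis t; Fubini is applied before and after
  this translation.\<close>

lemma integrable_circle_kernel:
 fixes F \<phi> :: "complex \<Rightarrow> real"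
 assumes [measurable]: "F \<in> borel_measurable borel" "\<phi> \<in> borel_measurable borel" and B: "\<And>x. \<bar>\<phi> x\<bar> \<le> B" 
  and supp: "\<And>x. R < cmod x \<Longrightarrow> \<phi> x = 0" and e: "0 \<le> e"
  and F: "integrable lborel (\<lambda>z. indicator (cball 0 (R + e)) z * \<bar>F z\<bar>)"
 shows "integrable (lborel \<Otimes>\<^sub>M lborel) (\<lambda>(z, t). F z * (indicator {0..2*pi} t * \<phi> (z - of_real e * cis t)))" (is ?A)
  and "integrable (lborel \<Otimes>\<^sub>M lborel) (\<lambda>(a, t). F (a + of_real e * cis t) * (indicator {0..2*pi} t * \<phi> a))" (is ?B)
proof -
 have B0: "0 \<le> B" using B[of 0] by simp
 define I where "I = (\<integral>\<^sup>+ z. ennreal (B * (indicator (cball 0 (R + e)) z * \<bar>F z\<bar>)) \<partial>lborel)"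
 have I: "I < \<infinity>" unfolding I_def
  using integrableD(2)[OF integrable_mult_right[OF F, of B]] B0 by (simp add: abs_mult less_top)
 have 1: "(\<integral>\<^sup>+ z. ennreal \<bar>F z * \<phi> (z - of_real e * cis t)\<bar> \<partial>lborel) \<le> I" for t
  unfolding I_def
 proof (rule nn_integral_mono)
  fix z
  show "ennreal \<bar>F z * \<phi> (z - of_real e * cis t)\<bar> \<le> ennreal (B * (indicator (cball 0 (R + e)) z * \<bar>F z\<bar>))"
  proof (cases "R + e < cmod z")
   case True
   have "cmod z - cmod (of_real e * cis t) \<le> cmod (z - of_real e * cis t)" by (rule norm_triangle_ineq2)
   then have "R < cmod (z - of_real e * cis t)" using True e by (simp add: norm_mult)
   then show ?thesis using supp by simp
  next
   case False
   then show ?thesis using B[of "z - of_real e * cis t"] mult_right_mono[OF B[of "z - of_real e * cis t"], of "\<bar>F z\<bar>"] by (auto simp: abs_mult mult.commute intro!: ennreal_leI)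
  qed
 qed
 have 2: "(\<integral>\<^sup>+ t. indicator {0..2*pi} t * I \<partial>lborel) < \<infinity>"
  using I by (subst nn_integral_multc) (auto simp: ennreal_mult_less_top)
 show ?A
 proof (rule integrableI_bounded)
  have "(\<integral>\<^sup>+ p. ennreal (norm ((\<lambda>(z, t). F z * (indicator {0..2*pi} t * \<phi> (z - of_real e * cis t))) p)) \<partial>(lborel \<Otimes>\<^sub>M lborel))
   = (\<integral>\<^sup>+ t. \<integral>\<^sup>+ z. ennreal \<bar>F z * (indicator {0..2*pi} t * \<phi> (z - of_real e * cis t))\<bar> \<partial>lborel \<partial>lborel)"
   by (subst lborel_pair.nn_integral_snd[symmetric]) (auto simp: split_beta')
  also have "\<dots> \<le> (\<integral>\<^sup>+ t. indicator {0..2*pi} t * I \<partial>lborel)"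
  proof (rule nn_integral_mono)
   fix t
   show "(\<integral>\<^sup>+ z. ennreal \<bar>F z * (indicator {0..2*pi} t * \<phi> (z - of_real e * cis t))\<bar> \<partial>lborel) \<le> indicator {0..2*pi} t * I"
    using 1[of t] by (cases "t \<in> {0..2*pi}") auto
  qed
  finally show "(\<integral>\<^sup>+ p. ennreal (norm ((\<lambda>(z, t). F z * (indicator {0..2*pi} t * \<phi> (z - of_real e * cis t))) p)) \<partial>(lborel \<Otimes>\<^sub>M lborel)) < \<infinity>"
   using 2 by (rule le_less_trans)
 qed measurable
 show ?B
 proof (rule integrableI_bounded)
  have "(\<integral>\<^sup>+ p. ennreal (norm ((\<lambda>(a, t). F (a + of_real e * cis t) * (indicator {0..2*pi} t * \<phi> a)) p)) \<partial>(lborel \<Otimes>\<^sub>M lborel))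
   = (\<integral>\<^sup>+ t. \<integral>\<^sup>+ a. ennreal \<bar>F (a + of_real e * cis t) * (indicator {0..2*pi} t * \<phi> a)\<bar> \<partial>lborel \<partial>lborel)"
   by (subst lborel_pair.nn_integral_snd[symmetric]) (auto simp: split_beta')
  also have "\<dots> \<le> (\<integral>\<^sup>+ t. indicator {0..2*pi} t * I \<partial>lborel)"
  proof (rule nn_integral_mono)
   fix t
   have "(\<integral>\<^sup>+ a. ennreal \<bar>F (a + of_real e * cis t) * \<phi> a\<bar> \<partial>lborel) = (\<integral>\<^sup>+ z. ennreal \<bar>F z * \<phi> (z - of_real e * cis t)\<bar> \<partial>lborel)"
    by (subst nn_integral_translate[symmetric, of "\<lambda>z. ennreal \<bar>F z * \<phi> (z - of_real e * cis t)\<bar>" "of_real e * cis t"]) (auto simp: add.commute)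
   then show "(\<integral>\<^sup>+ a. ennreal \<bar>F (a + of_real e * cis t) * (indicator {0..2*pi} t * \<phi> a)\<bar> \<partial>lborel) \<le> indicator {0..2*pi} t * I"
    using 1[of t] by (cases "t \<in> {0..2*pi}") auto
  qed
  finally show "(\<integral>\<^sup>+ p. ennreal (norm ((\<lambda>(a, t). F (a + of_real e * cis t) * (indicator {0..2*pi} t * \<phi> a)) p)) \<partial>(lborel \<Otimes>\<^sub>M lborel)) < \<infinity>"
   using 2 by (rule le_less_trans)
 qed measurable
qed

text \<open>Averaging is moved from \<open>\<phi>\<close> to \<open>F\<close> by a translation for
  each fixed angle.\<close>

lemma circ_avg_adjoint:
 fixes F \<phi> :: "complex \<Rightarrow> real"
 assumes [measurable]: "F \<in> borel_measurable borel" "\<phi> \<in> borel_measurable borel" and B: "\<And>x. \<bar>\<phi> x\<bar> \<le> B" 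
  and supp: "\<And>x. R < cmod x \<Longrightarrow> \<phi> x = 0" and e: "0 \<le> e"
  and F: "integrable lborel (\<lambda>z. indicator (cball 0 (R + e)) z * \<bar>F z\<bar>)"
 shows "integrable lborel (\<lambda>z. F z * circ_avg \<phi> e z)"
  and "AE a in lborel. integrable lborel (\<lambda>t. F (a + of_real e * cis t) * (indicator {0..2*pi} t * \<phi> a))"
  and "integrable lborel (\<lambda>a. \<integral>t. F (a + of_real e * cis t) * (indicator {0..2*pi} t * \<phi> a) \<partial>lborel)"
  and "(\<integral>z. F z * circ_avg \<phi> e z \<partial>lborel) = (\<integral>a. \<integral>t. F (a + of_real e * cis t) * (indicator {0..2*pi} t * \<phi> a) \<partial>lborel \<partial>lborel) / (2 * pi)"
proof -
 note A = integrable_circle_kernel(1)[OF assms] and B = integrable_circle_kernel(2)[OF assms]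
 have eq: "(\<integral>t. F z * (indicator {0..2*pi} t * \<phi> (z - of_real e * cis t)) \<partial>lborel) = 2 * pi * (F z * circ_avg \<phi> e z)" for z
  by (simp add: circ_avg_def)
 have "integrable lborel (\<lambda>z. \<integral>t. F z * (indicator {0..2*pi} t * \<phi> (z - of_real e * cis t)) \<partial>lborel)"
  using lborel_pair.integrable_fst'[OF A] by (simp add: split_beta')
 then have "integrable lborel (\<lambda>z. 1 / (2 * pi) * (2 * pi * (F z * circ_avg \<phi> e z)))" unfolding eq by (rule integrable_mult_right)
 then show "integrable lborel (\<lambda>z. F z * circ_avg \<phi> e z)" by simp
 show "AE a in lborel. integrable lborel (\<lambda>t. F (a + of_real e * cis t) * (indicator {0..2*pi} t * \<phi> a))"
  using lborel_pair.AE_integrable_fst'[OF B] by (simp add: split_beta')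
 show "integrable lborel (\<lambda>a. \<integral>t. F (a + of_real e * cis t) * (indicator {0..2*pi} t * \<phi> a) \<partial>lborel)"
  using lborel_pair.integrable_fst'[OF B] by (simp add: split_beta')
 have "(\<integral>z. 2 * pi * (F z * circ_avg \<phi> e z) \<partial>lborel) = (\<integral>z. \<integral>t. F z * (indicator {0..2*pi} t * \<phi> (z - of_real e * cis t)) \<partial>lborel \<partial>lborel)"
  unfolding eq ..
 also have "\<dots> = (\<integral>t. \<integral>z. F z * (indicator {0..2*pi} t * \<phi> (z - of_real e * cis t)) \<partial>lborel \<partial>lborel)"
  by (rule lborel_pair.Fubini_integral[symmetric]) (rule A)
 also have "\<dots> = (\<integral>t. \<integral>a. F (a + of_real e * cis t) * (indicator {0..2*pi} t * \<phi> a) \<partial>lborel \<partial>lborel)"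
 proof (rule Bochner_Integration.integral_cong[OF refl])
  fix t
  show "(\<integral>z. F z * (indicator {0..2*pi} t * \<phi> (z - of_real e * cis t)) \<partial>lborel) = (\<integral>a. F (a + of_real e * cis t) * (indicator {0..2*pi} t * \<phi> a) \<partial>lborel)"
   by (subst lborel_integral_translate[symmetric, of _ "of_real e * cis t"]) (auto simp: add.commute)
 qed
 also have "\<dots> = (\<integral>a. \<integral>t. F (a + of_real e * cis t) * (indicator {0..2*pi} t * \<phi> a) \<partial>lborel \<partial>lborel)"
  by (rule lborel_pair.Fubini_integral) (rule B)
 finally show "(\<integral>z. F z * circ_avg \<phi> e z \<partial>lborel) = (\<integral>a. \<integral>t. F (a + of_real e * cis t) * (indicator {0..2*pi} t * \<phi> a) \<partial>lborel \<partial>lborel) / (2 * pi)"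
  by (simp only: integral_mult_right_zero) (simp add: eq_divide_eq mult.commute)
qed

text \<open>Averaging is moved to the logarithm, whose mean over the circle about \<open>a\<close>
  is known from \<open>circle_mean_ln\<close>: it truncates the singularity at distance
  \<open>e\<close>.\<close>

lemma log_potential_circ_avg:
 fixes \<phi> :: "complex \<Rightarrow> real"
 assumes \<phi> [measurable]: "\<phi> \<in> borel_measurable borel" and B: "\<And>x. \<bar>\<phi> x\<bar> \<le> B" and supp: "\<And>x. R < cmod x \<Longrightarrow> \<phi> x = 0" and e: "0 < e"
 shows "integrable lborel (\<lambda>z. ln (cmod (z - u)) * circ_avg \<phi> e z)"
  and "integrable lborel (\<lambda>a. ln (max (cmod (u - a)) e) * \<phi> a)"
  and "(\<integral>z. ln (cmod (z - u)) * circ_avg \<phi> e z \<partial>lborel) = (\<integral>a. ln (max (cmod (u - a)) e) * \<phi> a \<partial>lborel)"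
proof -
 let ?F = "\<lambda>z. ln (cmod (z - u))"
 have F: "integrable lborel (\<lambda>z. indicator (cball 0 (R + e)) z * \<bar>?F z\<bar>)" by (rule integrable_ln_cball)
 have m: "?F \<in> borel_measurable borel" by measurable
 note adj = circ_avg_adjoint[where R=R and e=e, OF m \<phi> B supp less_imp_le[OF e] F] 
 have adj2: "AE a in lborel. integrable lborel (\<lambda>t. ?F (a + of_real e * cis t) * (indicator {0..2*pi} t * \<phi> a))"
  by (rule circ_avg_adjoint(2)[OF m \<phi> B supp less_imp_le[OF e] F])
 show "integrable lborel (\<lambda>z. ?F z * circ_avg \<phi> e z)" using adj(1) by simp
 have inner: "AE a in lborel. (\<integral>t. ?F (a + of_real e * cis t) * (indicator {0..2*pi} t * \<phi> a) \<partial>lborel) = 2 * pi * (ln (max (cmod (u - a)) e) * \<phi> a)"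
  using adj2 AE_cmod_neq[of u e]
 proof eventually_elim
  case (elim a)
  have hi: "((\<lambda>t. ?F (a + of_real e * cis t)) has_integral 2 * pi * ln (max (cmod (a - u)) e)) {0..2*pi}"
   using circle_mean_ln[OF e elim(2)] by (simp add: add_diff_eq add.commute diff_add_eq)
  have "((\<lambda>t. ?F (a + of_real e * cis t) * \<phi> a) has_integral 2 * pi * ln (max (cmod (a - u)) e) * \<phi> a) {0..2*pi}"
   by (rule has_integral_mult_left[OF hi])
  then have "((\<lambda>t. if t \<in> {0..2*pi} then ?F (a + of_real e * cis t) * \<phi> a else 0) has_integral 2 * pi * ln (max (cmod (a - u)) e) * \<phi> a) UNIV"
   by (subst has_integral_restrict_UNIV)
  moreover have "(\<lambda>t. if t \<in> {0..2*pi} then ?F (a + of_real e * cis t) * \<phi> a else 0) = (\<lambda>t. ?F (a + of_real e * cis t) * (indicator {0..2*pi} t * \<phi> a))"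
   by (auto simp: indicator_def)
  ultimately have "((\<lambda>t. ?F (a + of_real e * cis t) * (indicator {0..2*pi} t * \<phi> a)) has_integral 2 * pi * ln (max (cmod (a - u)) e) * \<phi> a) UNIV" by simp
  from has_integral_unique[OF has_integral_integral_lborel[OF elim(1)] this]
  show ?case by (simp add: norm_minus_commute)
 qed
 have "integrable lborel (\<lambda>a. 1 / (2 * pi) * (\<integral>t. ?F (a + of_real e * cis t) * (indicator {0..2*pi} t * \<phi> a) \<partial>lborel))"
  using adj(3) e by (intro integrable_mult_right) simp
 then show "integrable lborel (\<lambda>a. ln (max (cmod (u - a)) e) * \<phi> a)"
  by (rule integrable_cong_AE_imp) (use inner in \<open>auto elim!: eventually_mono\<close>)
 have "(\<integral>z. ?F z * circ_avg \<phi> e z \<partial>lborel) = (\<integral>a. \<integral>t. ?F (a + of_real e * cis t) * (indicator {0..2*pi} t * \<phi> a) \<partial>lborel \<partial>lborel) / (2 * pi)"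
  using adj(4) e by simp
 also have "(\<integral>a. \<integral>t. ?F (a + of_real e * cis t) * (indicator {0..2*pi} t * \<phi> a) \<partial>lborel \<partial>lborel) = (\<integral>a. 2 * pi * (ln (max (cmod (u - a)) e) * \<phi> a) \<partial>lborel)"
  using inner by (intro integral_cong_AE) auto
 finally show "(\<integral>z. ?F z * circ_avg \<phi> e z \<partial>lborel) = (\<integral>a. ln (max (cmod (u - a)) e) * \<phi> a \<partial>lborel)" by simp
qed

text \<open>The adjoint formula for F = 1. Consequently two averages of the same function differ by
  a function of integral 0.\<close>

lemma integral_circ_avg:
 fixes \<phi> :: "complex \<Rightarrow> real"
 assumes \<phi> [measurable]: "\<phi> \<in> borel_measurable borel" and B: "\<And>x. \<bar>\<phi> x\<bar> \<le> B" and supp: "\<And>x. R < cmod x \<Longrightarrow> \<phi> x = 0" and e: "0 \<le> e"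
 shows "integrable lborel (circ_avg \<phi> e)" "(\<integral>z. circ_avg \<phi> e z \<partial>lborel) = (\<integral>a. \<phi> a \<partial>lborel)"
proof -
 have F: "integrable lborel (\<lambda>z. indicator (cball (0::complex) (R + e)) z * \<bar>1\<bar> :: real)"
  using emeasure_bounded_finite[OF bounded_cball, of "0::complex" "R + e"] by simp
 note adj = circ_avg_adjoint[of "\<lambda>_. 1", OF _ \<phi> B supp e F]
 show "integrable lborel (circ_avg \<phi> e)" using adj(1) by simp
 have "(\<integral>z. circ_avg \<phi> e z \<partial>lborel) = (\<integral>a. 2 * pi * \<phi> a \<partial>lborel) / (2 * pi)"
  using adj(4) by simp
 then show "(\<integral>z. circ_avg \<phi> e z \<partial>lborel) = (\<integral>a. \<phi> a \<partial>lborel)" by simp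
qed

text \<open>The logarithmic potential of the uniform distribution on the circle of radius
  \<open>2 * e\<close> minus that on the circle of radius \<open>e\<close>. Outside the larger
  circle the two agree, so the difference is a compactly supported nonnegative bump.\<close>

definition tent :: "real \<Rightarrow> complex \<Rightarrow> real" where
 "tent e v = ln (max (cmod v) (2 * e)) - ln (max (cmod v) e)"

lemma tent_measurable [measurable]: "tent e \<in> borel_measurable borel"
 unfolding tent_def by measurable

lemma tent_props:
 assumes e: "0 < e"
 shows "0 \<le> tent e v" "tent e v \<le> ln 2" "2 * e \<le> cmod v \<Longrightarrow> tent e v = 0" "cmod v \<le> e \<Longrightarrow> tent e v = ln 2"
proof -
 have p: "0 < max (cmod v) e" "0 < max (cmod v) (2 * e)" using e by auto
 show "0 \<le> tent e v" unfolding tent_def using p e by (simp add: max_def)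
 have "max (cmod v) (2 * e) \<le> 2 * max (cmod v) e" using e by (auto simp: max_def)
 then have "ln (max (cmod v) (2 * e)) \<le> ln (2 * max (cmod v) e)" using p by (intro ln_mono) auto
 also have "\<dots> = ln 2 + ln (max (cmod v) e)" using p by (simp add: ln_mult)
 finally show "tent e v \<le> ln 2" by (simp add: tent_def)
 show "2 * e \<le> cmod v \<Longrightarrow> tent e v = 0" using e by (simp add: tent_def max_def)
 show "cmod v \<le> e \<Longrightarrow> tent e v = ln 2" using e by (simp add: tent_def max_def ln_mult)
qed

lemma tent_mass:
 assumes e: "0 < e"
 obtains m where "0 < m" "(\<integral>\<^sup>+ v. ennreal (tent e v) \<partial>lborel) = ennreal m"
proof -
 let ?I = "\<integral>\<^sup>+ v. ennreal (tent e v) \<partial>lborel"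
 have "?I \<le> (\<integral>\<^sup>+ v. ennreal (ln 2) * indicator (cball (0::complex) (2 * e)) v \<partial>lborel)"
  using tent_props[OF e] by (intro nn_integral_mono) (auto simp: indicator_def intro!: ennreal_leI)
 also have "\<dots> < \<infinity>" using e by (subst nn_integral_cmult_indicator) (auto simp: emeasure_cball_complex ennreal_mult_less_top)
 finally obtain m where m: "?I = ennreal m" "0 \<le> m" by (cases ?I) auto
 have "ennreal (ln 2 * (pi * e\<^sup>2)) = (\<integral>\<^sup>+ v. ennreal (ln 2) * indicator (cball (0::complex) e) v \<partial>lborel)"
  using e by (subst nn_integral_cmult_indicator) (auto simp: emeasure_cball_complex ennreal_mult)
 also have "\<dots> \<le> ?I" using tent_props[OF e] by (intro nn_integral_mono) (auto simp: indicator_def)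
 finally have "ln 2 * (pi * e\<^sup>2) \<le> m" unfolding m using m(2) by (simp add: ennreal_le_iff)
 moreover have "0 < ln 2 * (pi * e\<^sup>2)" using e by simp
 ultimately show ?thesis using that m by auto
qed

text \<open>The leading coefficient, which is not the same for a polynomial and its derivatives,
  contributes a constant to ln |p| and is killed by the vanishing integral of
  \<open>G\<close>.\<close>

lemma sum_roots_log_potential:
 fixes G :: "complex \<Rightarrow> real" and p :: "complex poly"
 assumes G [measurable]: "G \<in> borel_measurable borel" and iG: "integrable lborel G" and G0: "(\<integral>z. G z \<partial>lborel) = 0"
  and iL: "\<And>u. integrable lborel (\<lambda>z. ln (cmod (z - u)) * G z)" and p: "p \<noteq> 0"
 defines "\<psi> \<equiv> \<lambda>u. \<integral>z. ln (cmod (z - u)) * G z \<partial>lborel"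
 shows "integrable lborel (\<lambda>z. ln (cmod (poly p z)) * G z)"
  and "(\<integral>z. ln (cmod (poly p z)) * G z \<partial>lborel) = (\<Sum>u\<in>#proots p. \<psi> u)"
proof -
 have AEnz: "AE z in lborel. poly r z \<noteq> 0" if "r \<noteq> 0" for r :: "complex poly"
  using AE_not_in[OF finite_imp_null_set_lborel[OF poly_roots_finite[OF that]]] by simp
 have *: "integrable lborel (\<lambda>z. ln (cmod (poly (\<Prod>x\<in>#A. [:- x, 1:]) z)) * G z) \<and>
  (\<integral>z. ln (cmod (poly (\<Prod>x\<in>#A. [:- x, 1:]) z)) * G z \<partial>lborel) = (\<Sum>u\<in>#A. \<psi> u)" for A
 proof (induction A)
  case empty then show ?case by simp
 next
  case (add x A)
  let ?P = "\<Prod>x\<in>#A. [:- x, 1:]"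
  have P0: "?P \<noteq> 0" by (auto simp: prod_mset_zero_iff)
  have ae: "AE z in lborel. ln (cmod (z - x)) * G z + ln (cmod (poly ?P z)) * G z = ln (cmod (poly (\<Prod>x\<in>#add_mset x A. [:- x, 1:]) z)) * G z"
   using AEnz[OF P0] AE_lborel_singleton[of x]
  proof eventually_elim
   case (elim z)
   have "cmod (poly (\<Prod>x\<in>#add_mset x A. [:- x, 1:]) z) = cmod (z - x) * cmod (poly ?P z)"
    by (simp add: norm_mult[symmetric] algebra_simps)
   then have "ln (cmod (poly (\<Prod>x\<in>#add_mset x A. [:- x, 1:]) z)) = ln (cmod (z - x)) + ln (cmod (poly ?P z))"
    using elim by (simp add: ln_mult)
   then show ?case by (simp add: distrib_right)
  qed
  have m: "(\<lambda>z. ln (cmod (poly r z)) * G z) \<in> borel_measurable lborel" for r :: "complex poly"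
  proof -
   have [measurable]: "(\<lambda>z. poly r z) \<in> borel_measurable borel" by (intro borel_measurable_continuous_onI continuous_intros)
   show ?thesis by measurable
  qed
  have i: "integrable lborel (\<lambda>z. ln (cmod (z - x)) * G z + ln (cmod (poly ?P z)) * G z)"
   using iL add by auto
  have "integrable lborel (\<lambda>z. ln (cmod (poly (\<Prod>x\<in>#add_mset x A. [:- x, 1:]) z)) * G z)"
   using i m ae by (rule integrable_cong_AE_imp)
  moreover have "(\<integral>z. ln (cmod (poly (\<Prod>x\<in>#add_mset x A. [:- x, 1:]) z)) * G z \<partial>lborel) = (\<integral>z. ln (cmod (z - x)) * G z + ln (cmod (poly ?P z)) * G z \<partial>lborel)"
   using ae m[of ?P] m[of "\<Prod>x\<in>#add_mset x A. [:- x, 1:]"] by (intro integral_cong_AE) (auto elim!: eventually_mono)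
  moreover have "\<dots> = \<psi> x + (\<Sum>u\<in>#A. \<psi> u)" using iL add by (simp add: \<psi>_def)
  ultimately show ?case by simp
 qed
 define c where "c = lead_coeff p"
 have c: "c \<noteq> 0" using p by (simp add: c_def)
 let ?P = "\<Prod>x\<in>#proots p. [:- x, 1:]"
 have P0: "?P \<noteq> 0" by (auto simp: prod_mset_zero_iff)
 have dec: "p = smult c ?P" unfolding c_def by (rule complex_poly_decompose_multiset[symmetric])
 have "cmod (poly p z) = cmod c * cmod (poly ?P z)" for z by (subst dec) (simp add: norm_mult)
 then have ae: "AE z in lborel. ln (cmod c) * G z + ln (cmod (poly ?P z)) * G z = ln (cmod (poly p z)) * G z"
  using AEnz[OF P0] c by (auto elim!: eventually_mono simp: ln_mult distrib_right)
 have m: "(\<lambda>z. ln (cmod (poly r z)) * G z) \<in> borel_measurable lborel" for r :: "complex poly"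
 proof -
  have [measurable]: "(\<lambda>z. poly r z) \<in> borel_measurable borel" by (intro borel_measurable_continuous_onI continuous_intros)
  show ?thesis by measurable
 qed
 have i: "integrable lborel (\<lambda>z. ln (cmod c) * G z + ln (cmod (poly ?P z)) * G z)" using iG * by auto
 show "integrable lborel (\<lambda>z. ln (cmod (poly p z)) * G z)"
  using i m ae by (rule integrable_cong_AE_imp)
 have "(\<integral>z. ln (cmod (poly p z)) * G z \<partial>lborel) = (\<integral>z. ln (cmod c) * G z + ln (cmod (poly ?P z)) * G z \<partial>lborel)"
  using ae m[of ?P] m[of p] by (intro integral_cong_AE) (auto elim!: eventually_mono)
 also have "\<dots> = (\<Sum>u\<in>#proots p. \<psi> u)" using iG * G0 by simp
 finally show "(\<integral>z. ln (cmod (poly p z)) * G z \<partial>lborel) = (\<Sum>u\<in>#proots p. \<psi> u)" .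
qed

section \<open>Zeros of a polynomial and of its derivatives\<close>

lemma sum_proots_prod_linear:
 fixes f :: "complex \<Rightarrow> real"
 assumes "finite I"
 shows "(\<Sum>u\<in>#proots (\<Prod>i\<in>I. [:- \<zeta> i, 1:]). f u) = (\<Sum>i\<in>I. f (\<zeta> i))"
 using assms
proof (induction I)
 case (insert i I)
 then have "(\<Prod>i\<in>I. [:- \<zeta> i, 1:]) \<noteq> 0" by simp
 then have "proots (\<Prod>i\<in>insert i I. [:- \<zeta> i, 1:]) = {#\<zeta> i#} + proots (\<Prod>i\<in>I. [:- \<zeta> i, 1:])"
  using insert by (subst prod.insert) (auto simp: proots_mult simp del: mult_pCons_left)
 then show ?case using insert by simp
qed simp

abbreviation deriv_roots :: "nat \<Rightarrow> nat \<Rightarrow> (nat \<Rightarrow> complex) \<Rightarrow> complex multiset" where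
 "deriv_roots k n \<zeta> \<equiv> proots ((pderiv ^^ k) (gas_poly n \<zeta>))"

lemma size_proots_deriv:
 "k \<le> n \<Longrightarrow> size (deriv_roots k n \<zeta>) = n - k"
proof -
 assume "k \<le> n"
 moreover have d: "degree (gas_poly n \<zeta>) = n" unfolding gas_poly_def by (subst degree_prod_linear) auto
 moreover have "gas_poly n \<zeta> \<noteq> 0" by (simp add: gas_poly_def)
 ultimately show ?thesis using higher_pderiv_degree(2)[of k "gas_poly n \<zeta>"] by (simp add: size_proots_complex)
qed

lemma abs_sum_mset_diff_le:
 fixes f g :: "'a \<Rightarrow> real" and e :: real
 assumes "\<And>x. \<bar>f x - g x\<bar> \<le> e"
 shows "\<bar>(\<Sum>x\<in>#A. f x) - (\<Sum>x\<in>#A. g x)\<bar> \<le> real (size A) * e"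
proof (induction A)
 case (add x A)
 have "\<bar>(f x + a) - (g x + b)\<bar> \<le> \<bar>f x - g x\<bar> + \<bar>a - b\<bar>" for a b by linarith
 from order_trans[OF this add_mono[OF assms add.IH]] show ?case by (simp add: algebra_simps)
qed simp

text \<open>With \<open>G\<close> the difference of two circular averages of \<open>\<phi>\<close>,
  the integral of ln |P^(k) / P| against \<open>G\<close> is the difference of the sums of
  \<open>\<psi>\<close> over the zeros of P^(k) and of P. As \<open>\<psi>\<close> is the
  convolution of \<open>tent\<close> with \<open>\<phi>\<close>, it is nearly
  \<open>m * \<phi>\<close>; and \<open>G\<close> is bounded with compact support, so the integral
  of |ln |P^(k) / P|| over a disc controls that difference.\<close>

lemma derivative_zeros_close:
 fixes \<phi> :: "complex \<Rightarrow> real"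
 assumes c: "continuous_on UNIV \<phi>" and supp: "\<And>x. R0 < cmod x \<Longrightarrow> \<phi> x = 0" and e: "0 < e"
 shows "\<exists>R>0. \<exists>K\<ge>0. \<forall>n \<zeta> k R' a. k < n \<longrightarrow> R \<le> R' \<longrightarrow> 0 \<le> a \<longrightarrow>
  (\<integral>\<^sup>+ z\<in>cball 0 R'. ennreal \<bar>log_quotient n k z \<zeta>\<bar> \<partial>lborel) \<le> ennreal a \<longrightarrow>
  \<bar>(\<Sum>u\<in>#deriv_roots k n \<zeta>. \<phi> u) / real (n - k) - (\<Sum>i\<in>{1..n}. \<phi> (\<zeta> i)) / n\<bar> \<le> e + K * (a + k) / real (n - k)"
proof -
 have \<phi> [measurable]: "\<phi> \<in> borel_measurable borel" using c by (rule borel_measurable_continuous_onI)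
 from continuous_compact_support(1)[OF c supp] obtain B where B: "0 < B" "\<And>x. \<bar>\<phi> x\<bar> \<le> B" by blast
 from continuous_compact_support(2)[of \<phi> R0 "e / 4", OF c supp] e obtain \<rho> where \<rho>: "0 < \<rho>" "\<And>x y. cmod (x - y) < \<rho> \<Longrightarrow> \<bar>\<phi> x - \<phi> y\<bar> \<le> e / 4" by auto
 \<comment> \<open>Then \<open>tent \<epsilon>\<close> vanishes from distance \<rho> on, and the
   tail in \<open>approximate_identity\<close> is 0.\<close>
 define \<epsilon> where "\<epsilon> = \<rho> / 2"
 have \<epsilon>: "0 < \<epsilon>" "0 < 2 * \<epsilon>" using \<rho> by (auto simp: \<epsilon>_def)
 from tent_mass[OF \<epsilon>(1)] obtain m where m: "0 < m" "(\<integral>\<^sup>+ v. ennreal (tent \<epsilon> v) \<partial>lborel) = ennreal m" by blast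
 define G where "G z = circ_avg \<phi> (2 * \<epsilon>) z - circ_avg \<phi> \<epsilon> z" for z
 have Gm [measurable]: "G \<in> borel_measurable borel" unfolding G_def by measurable
 have GB: "\<bar>G z\<bar> \<le> 2 * B" for z
  using circ_avg_bound[OF \<phi> B(2), of "2 * \<epsilon>" z] circ_avg_bound[OF \<phi> B(2), of \<epsilon> z] unfolding G_def by linarith
 have Gsupp: "G z = 0" if "R0 + 2 * \<epsilon> < cmod z" for z
  using circ_avg_support[of R0 \<phi> "2 * \<epsilon>" z, OF supp] circ_avg_support[of R0 \<phi> \<epsilon> z, OF supp] that \<epsilon> unfolding G_def by simp
 note pot1 = log_potential_circ_avg[where R = R0 and e = "2 * \<epsilon>", OF \<phi> B(2) supp \<epsilon>(2)]
 note pot2 = log_potential_circ_avg[where R = R0 and e = \<epsilon>, OF \<phi> B(2) supp \<epsilon>(1)]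
 have iG: "integrable lborel G" "(\<integral>z. G z \<partial>lborel) = 0"
  using integral_circ_avg[where R = R0 and e = "2 * \<epsilon>", OF \<phi> B(2) supp less_imp_le[OF \<epsilon>(2)]]
   integral_circ_avg[where R = R0 and e = \<epsilon>, OF \<phi> B(2) supp less_imp_le[OF \<epsilon>(1)]]
  unfolding G_def by auto
 have iL: "integrable lborel (\<lambda>z. ln (cmod (z - u)) * G z)" for u
  using pot1(1)[of u] pot2(1)[of u] unfolding G_def by (simp add: right_diff_distrib)
 define \<psi> where "\<psi> u = (\<integral>z. ln (cmod (z - u)) * G z \<partial>lborel)" for u
 have \<psi>_eq: "\<psi> u = (\<integral>a. tent \<epsilon> (u - a) * \<phi> a \<partial>lborel)" for u
  using pot1[of u] pot2[of u] unfolding \<psi>_def G_def tent_def by (simp add: right_diff_distrib left_diff_distrib)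
 have close: "\<bar>\<psi> u - m * \<phi> u\<bar> \<le> m * (e / 4)" for u
 proof -
  have "(\<integral>\<^sup>+ v. ennreal (tent \<epsilon> v) * indicator {v. \<rho> \<le> cmod v} v \<partial>lborel) = 0"
   using tent_props(3)[OF \<epsilon>(1)] by (intro nn_integral_zero') (auto simp: \<epsilon>_def indicator_def)
  then show ?thesis
   using approximate_identity(1)[of "tent \<epsilon>" \<phi> m \<rho> 0 B "e / 4" u] tent_props(1)[OF \<epsilon>(1)] m B \<rho> e
   unfolding \<psi>_eq by simp
 qed
 \<comment> \<open>Collects \<open>2 * B / m\<close> from the integral against \<open>G\<close>,
   \<open>e / 4\<close> from the k additional zeros of P, and \<open>B\<close> from normalising by n
   - k instead of n.\<close>
 define K where "K = 2 * B / m + e / 4 + B"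
 define R where "R = \<bar>R0\<bar> + 2 * \<epsilon>"
 have K: "0 \<le> K" using B m e by (simp add: K_def)
 have R: "0 < R" using \<epsilon> by (simp add: R_def)
 show ?thesis
 proof (rule exI[of _ R], rule conjI[OF R], rule exI[of _ K], rule conjI[OF K], intro allI impI)
  fix n \<zeta> k R' a
  assume n: "k < n" and R': "R \<le> R'" and a: "0 \<le> (a::real)"
   and A: "(\<integral>\<^sup>+ z\<in>cball 0 R'. ennreal \<bar>log_quotient n k z \<zeta>\<bar> \<partial>lborel) \<le> ennreal a"
  let ?P = "gas_poly n \<zeta>" and ?D = "(pderiv ^^ k) (gas_poly n \<zeta>)"
  have P0: "?P \<noteq> 0" by (simp add: gas_poly_def)
  have "degree ?P = n" unfolding gas_poly_def by (subst degree_prod_linear) auto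
  then have D0: "?D \<noteq> 0" using higher_pderiv_degree(1)[of k ?P] n P0 by simp
  note sP = sum_roots_log_potential[OF Gm iG iL P0, folded \<psi>_def] and sD = sum_roots_log_potential[OF Gm iG iL D0, folded \<psi>_def]
  have dP: "deriv_val {1..n} 0 z \<zeta> = poly ?P z" and dD: "deriv_val {1..n} k z \<zeta> = poly ?D z" for z
   by (simp_all add: deriv_val_def gas_poly_def)
  have ae: "AE z in lborel. poly r z \<noteq> 0" if "r \<noteq> 0" for r :: "complex poly"
   using AE_not_in[OF finite_imp_null_set_lborel[OF poly_roots_finite[OF that]]] by simp
  define A1 where "A1 = (\<Sum>u\<in>#proots ?D. \<phi> u)"
  define A2 where "A2 = (\<Sum>i\<in>{1..n}. \<phi> (\<zeta> i))"
  define N where "N = real (n - k)"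
  have N: "0 < N" "real n = N + k" using n by (auto simp: N_def)
  have X: "\<bar>(\<Sum>u\<in>#proots ?D. \<psi> u) - (\<Sum>u\<in>#proots ?P. \<psi> u)\<bar> \<le> 2 * B * a"
  proof -
   have "(\<Sum>u\<in>#proots ?D. \<psi> u) - (\<Sum>u\<in>#proots ?P. \<psi> u) = (\<integral>z. ln (cmod (poly ?D z)) * G z - ln (cmod (poly ?P z)) * G z \<partial>lborel)"
    using sP sD by simp
   then have "ennreal \<bar>(\<Sum>u\<in>#proots ?D. \<psi> u) - (\<Sum>u\<in>#proots ?P. \<psi> u)\<bar> = ennreal \<bar>\<integral>z. ln (cmod (poly ?D z)) * G z - ln (cmod (poly ?P z)) * G z \<partial>lborel\<bar>" by (simp only:)
   also have "\<dots> \<le> (\<integral>\<^sup>+ z. ennreal \<bar>ln (cmod (poly ?D z)) * G z - ln (cmod (poly ?P z)) * G z\<bar> \<partial>lborel)"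
    using integral_norm_bound_ennreal[of lborel "\<lambda>z. ln (cmod (poly ?D z)) * G z - ln (cmod (poly ?P z)) * G z"] sP(1) sD(1) by simp
   also have "\<dots> \<le> (\<integral>\<^sup>+ z. ennreal (2 * B) * (ennreal \<bar>ln (cmod (poly ?D z) / cmod (poly ?P z))\<bar> * indicator (cball 0 R') z) \<partial>lborel)"
   proof (rule nn_integral_mono_AE, use ae[OF P0] ae[OF D0] in eventually_elim)
    case (elim z)
    then have l: "ln (cmod (poly ?D z)) * G z - ln (cmod (poly ?P z)) * G z = G z * ln (cmod (poly ?D z) / cmod (poly ?P z))"
     by (simp add: ln_div algebra_simps)
    show ?case
    proof (cases "z \<in> cball 0 R'")
     case True
     have "\<bar>G z\<bar> * \<bar>ln (cmod (poly ?D z) / cmod (poly ?P z))\<bar> \<le> 2 * B * \<bar>ln (cmod (poly ?D z) / cmod (poly ?P z))\<bar>"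
      using GB[of z] by (rule mult_right_mono) simp
     then have "ennreal \<bar>G z * ln (cmod (poly ?D z) / cmod (poly ?P z))\<bar> \<le> ennreal (2 * B * \<bar>ln (cmod (poly ?D z) / cmod (poly ?P z))\<bar>)"
      unfolding abs_mult by (rule ennreal_leI)
     also have "\<dots> = ennreal (2 * B) * ennreal \<bar>ln (cmod (poly ?D z) / cmod (poly ?P z))\<bar>" using B by (intro ennreal_mult) auto
     finally show ?thesis unfolding l using True by simp
    next
     case False
     then have "R0 + 2 * \<epsilon> < cmod z" using R' unfolding R_def by simp
     then show ?thesis using Gsupp[of z] by simp
    qed
   qed
   also have "\<dots> = ennreal (2 * B) * (\<integral>\<^sup>+ z. (ennreal \<bar>ln (cmod (poly ?D z) / cmod (poly ?P z))\<bar> * indicator (cball 0 R') z) \<partial>lborel)"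
   proof -
    have [measurable]: "(\<lambda>z. poly r z) \<in> borel_measurable borel" for r :: "complex poly" by (intro borel_measurable_continuous_onI continuous_intros)
    show ?thesis by (rule nn_integral_cmult) measurable
   qed
   also have "\<dots> \<le> ennreal (2 * B) * ennreal a" using A unfolding dP dD by (intro mult_left_mono) auto
   also have "\<dots> = ennreal (2 * B * a)" using B a by (simp add: ennreal_mult)
   finally have "ennreal \<bar>(\<Sum>u\<in>#proots ?D. \<psi> u) - (\<Sum>u\<in>#proots ?P. \<psi> u)\<bar> \<le> ennreal (2 * B * a)" .
   then show ?thesis using a B by (simp add: ennreal_le_iff)
  qed
  have e1: "\<bar>(\<Sum>u\<in>#proots ?D. \<psi> u) - (\<Sum>u\<in>#proots ?D. m * \<phi> u)\<bar> \<le> N * (m * (e / 4))"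
   using abs_sum_mset_diff_le[of \<psi> "\<lambda>u. m * \<phi> u" "m * (e / 4)" "proots ?D", OF close] n by (simp add: size_proots_deriv N_def)
  have e2: "\<bar>(\<Sum>u\<in>#proots ?P. \<psi> u) - (\<Sum>u\<in>#proots ?P. m * \<phi> u)\<bar> \<le> n * (m * (e / 4))"
   using abs_sum_mset_diff_le[of \<psi> "\<lambda>u. m * \<phi> u" "m * (e / 4)" "proots ?P", OF close] size_proots_deriv[of 0 n \<zeta>] by simp
  have m1: "(\<Sum>u\<in>#proots ?D. m * \<phi> u) = m * A1" unfolding A1_def by (simp add: sum_mset_distrib_left)
  have m2: "(\<Sum>u\<in>#proots ?P. m * \<phi> u) = m * A2"
   unfolding A2_def gas_poly_def by (subst sum_proots_prod_linear) (auto simp: sum_distrib_left)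
  have "\<bar>m * A1 - m * A2\<bar> \<le> 2 * B * a + N * (m * (e / 4)) + n * (m * (e / 4))"
   using X e1 e2 unfolding m1 m2 by linarith
  also have "\<bar>m * A1 - m * A2\<bar> = m * \<bar>A1 - A2\<bar>" using m by (simp add: abs_mult right_diff_distrib[symmetric])
  finally have "m * \<bar>A1 - A2\<bar> / m \<le> (2 * B * a + N * (m * (e / 4)) + n * (m * (e / 4))) / m" using m(1) by (intro divide_right_mono) auto
  then have d: "\<bar>A1 - A2\<bar> \<le> 2 * B / m * a + (N + n) * (e / 4)" using m(1) by (simp add: field_simps)
  have "\<bar>A2\<bar> \<le> (\<Sum>i\<in>{1..n}. \<bar>\<phi> (\<zeta> i)\<bar>)" unfolding A2_def by (rule sum_abs)
  also have "\<dots> \<le> (\<Sum>i\<in>{1..n}. B)" using B by (intro sum_mono)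
  finally have A2: "\<bar>A2\<bar> \<le> n * B" by simp
  have "A1 / N - A2 / n = (A1 - A2) / N + A2 * k / (N * n)"
  proof -
   have gen: "x / u - y / v = (x - y) / u + y * (v - u) / (u * v)" if "0 < u" "0 < v" for x y u v :: real
    using that by (simp add: field_simps)
   show ?thesis using gen[of N "real n" A1 A2] N n by simp
  qed
  then have "\<bar>A1 / N - A2 / n\<bar> \<le> \<bar>(A1 - A2) / N\<bar> + \<bar>A2 * k / (N * n)\<bar>" by (simp only: abs_triangle_ineq)
  also have "\<bar>(A1 - A2) / N\<bar> = \<bar>A1 - A2\<bar> / N" using N by (simp add: abs_divide)
  also have "\<bar>A2 * k / (N * n)\<bar> = \<bar>A2\<bar> * k / (N * n)" using N by (simp add: abs_divide abs_mult)
  also have "\<bar>A2\<bar> * k / (N * n) \<le> n * B * k / (N * n)" using A2 N by (intro divide_right_mono mult_right_mono) auto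
  also have "\<bar>A1 - A2\<bar> / N \<le> (2 * B / m * a + (N + n) * (e / 4)) / N" using d N by (intro divide_right_mono) auto
  finally have "\<bar>A1 / N - A2 / n\<bar> \<le> (2 * B / m * a + (N + n) * (e / 4)) / N + n * B * k / (N * n)" by simp
  also have "\<dots> = e / 2 + (2 * B / m * a + e / 4 * k + B * k) / N" 
  proof -
   have gen: "(x + (u + y) * (e / 4)) / u + y * b * j / (u * y) = e / 2 + (x + e / 4 * j + b * j) / u"
    if "0 < u" "y = u + j" "0 < y" for x u y b j :: real
   proof -
    have "y * b * j / (u * y) = b * j / u" using that by simp
    then show ?thesis using that by (simp add: add_divide_distrib distrib_right)
   qed
   show ?thesis using gen[of N "real n" "real k" "2 * B / m * a" B] N n by simp
  qed
  also have "\<dots> \<le> e + K * (a + k) / N"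
  proof (intro add_mono divide_right_mono)
   have "K * (a + k) = (2 * B / m * a + e / 4 * k + B * k) + ((e / 4 + B) * a + 2 * B / m * k)" unfolding K_def by (simp add: algebra_simps add_divide_distrib)
   moreover have "0 \<le> (e / 4 + B) * a + 2 * B / m * k" using e B m a by simp
   ultimately show "2 * B / m * a + e / 4 * k + B * k \<le> K * (a + k)" by linarith
  qed (use e N in auto)
  finally show "\<bar>(\<Sum>u\<in>#proots ?D. \<phi> u) / real (n - k) - (\<Sum>i\<in>{1..n}. \<phi> (\<zeta> i)) / n\<bar> \<le> e + K * (a + k) / real (n - k)"
   unfolding A1_def A2_def N_def .
 qed
qed

section \<open>Concentration of the zeros\<close>

context gas
begin

text \<open>Each point outside the disc costs at least n c1 R^2 \<ge> 2 n a in energy, and the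
  budget is n^2 a.\<close>

lemma many_points_in_ball:
 assumes n: "1 \<le> n" and a: "0 \<le> a" and H: "hamiltonian q n \<zeta> \<le> ennreal ((real n)\<^sup>2 * a)" and R: "0 < R" "2 * a \<le> c1 * R\<^sup>2"
 shows "real n / 2 \<le> card {i \<in> {1..n}. \<zeta> i \<in> cball 0 R}"
proof -
 let ?O = "{i \<in> {1..n}. \<zeta> i \<notin> cball 0 R}" and ?I = "{i \<in> {1..n}. \<zeta> i \<in> cball 0 R}"
 have "ennreal (real n * (card ?O * (c1 * R\<^sup>2))) = of_nat n * (\<Sum>i\<in>?O. ennreal (c1 * R\<^sup>2))"
  using c1 by (simp add: ennreal_mult ennreal_of_nat_eq_real_of_nat)
 also have "\<dots> \<le> of_nat n * (\<Sum>i\<in>?O. q (\<zeta> i))"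
 proof (intro mult_left_mono sum_mono)
  fix i assume "i \<in> ?O"
  then have "R\<^sup>2 \<le> (cmod (\<zeta> i))\<^sup>2" using R by (intro power_mono) auto
  then have "ennreal (c1 * R\<^sup>2) \<le> ennreal (c1 * (cmod (\<zeta> i))\<^sup>2)" using c1 by (intro ennreal_leI mult_left_mono) auto
  also have "\<dots> \<le> q (\<zeta> i)" by (rule q_ge)
  finally show "ennreal (c1 * R\<^sup>2) \<le> q (\<zeta> i)" .
 qed simp
 also have "\<dots> \<le> of_nat n * (\<Sum>i\<in>{1..n}. q (\<zeta> i))" by (intro mult_left_mono sum_mono2) auto
 also have "\<dots> \<le> hamiltonian q n \<zeta>" unfolding hamiltonian_def by (meson add_increasing add_increasing2 order_refl zero_le)
 also note H
 finally have "real n * (card ?O * (c1 * R\<^sup>2)) \<le> (real n)\<^sup>2 * a" using a by (simp add: ennreal_le_iff)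
 then have "card ?O * (c1 * R\<^sup>2) \<le> n * a" using n by (simp add: power2_eq_square)
 moreover have "card ?O * (2 * a) \<le> card ?O * (c1 * R\<^sup>2)" using R(2) by (rule mult_left_mono) simp
 moreover have "0 < c1 * R\<^sup>2" using c1 R by simp
 ultimately have "card ?O * (c1 * R\<^sup>2) \<le> n / 2 * (c1 * R\<^sup>2)"
  using mult_left_mono[OF R(2), of "real n / 2"] by simp
 then have O: "card ?O \<le> real n / 2" using \<open>0 < c1 * R\<^sup>2\<close> by (rule mult_right_le_imp_le)
 have "card ?I + card ?O = card (?I \<union> ?O)" by (rule card_Un_disjoint[symmetric]) auto
 also have "?I \<union> ?O = {1..n}" by blast
 finally have "card ?I + card ?O = n" by simp
 with O show ?thesis by linarith
qed

text \<open>The exceptional set consists of configurations of high energy and of those with large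
  \<open>ratio_sum\<close>. Off it, the gas points are close to \<open>\<sigma>\<close> by
  \<open>low_energy_close\<close>, and the zeros are close to the gas points by
  \<open>derivative_zeros_close\<close>.\<close>

lemma derivative_zeros_concentrate:
 fixes \<phi> :: "complex \<Rightarrow> real"
 assumes c: "continuous_on UNIV \<phi>" and supp: "\<And>x. R0 < cmod x \<Longrightarrow> \<phi> x = 0" and e: "0 < e"
 shows "\<exists>f. f \<longlonglongrightarrow> 0 \<and> (\<exists>N. \<forall>n\<ge>N. 0 \<le> f n \<and> (\<exists>B\<in>sets (vol n). (\<integral>\<^sup>+ \<zeta>\<in>B. weight n \<zeta> \<partial>vol n) \<le> ennreal (f n) * Zn n \<and>
  (\<forall>\<zeta>\<in>space (vol n) - B. \<bar>(\<Sum>u\<in>#deriv_roots k n \<zeta>. \<phi> u) / real (n - k) - (\<integral>x. \<phi> x \<partial>\<sigma>)\<bar> \<le> e)))"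
proof -
 have e3: "0 < e / 3" using e by simp
 from low_energy_close[OF c supp e3] obtain \<eta> N1 where \<eta>: "0 < \<eta>" and N1: "\<And>n \<zeta>. N1 \<le> n \<Longrightarrow> hamiltonian q n \<zeta> \<le> ennreal ((real n)\<^sup>2 * (S0 + q0 + \<eta>)) \<Longrightarrow>
   \<bar>(\<Sum>i\<in>{1..n}. \<phi> (\<zeta> i)) / n - (\<integral>x. \<phi> x \<partial>\<sigma>)\<bar> \<le> e / 3" by blast
 from derivative_zeros_close[OF c supp e3] obtain R1 K where R1: "0 < R1" and K: "0 \<le> K" and close: "\<And>n \<zeta> k R' a. k < n \<Longrightarrow> R1 \<le> R' \<Longrightarrow> 0 \<le> a \<Longrightarrow>
  (\<integral>\<^sup>+ z\<in>cball 0 R'. ennreal \<bar>log_quotient n k z \<zeta>\<bar> \<partial>lborel) \<le> ennreal a \<Longrightarrow>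
  \<bar>(\<Sum>u\<in>#deriv_roots k n \<zeta>. \<phi> u) / real (n - k) - (\<Sum>i\<in>{1..n}. \<phi> (\<zeta> i)) / n\<bar> \<le> e / 3 + K * (a + k) / real (n - k)" by blast
 define a2 where "a2 = S0 + q0 + \<eta>"
 have a2: "0 < a2" using S0(2) q0(2) \<eta> by (simp add: a2_def)
 \<comment> \<open>Large enough for \<open>derivative_zeros_close\<close> and for half of the points
   to lie in the disc.\<close>
 define R where "R = R1 + sqrt (2 * a2 / c1)"
 have R: "R1 \<le> R" "0 < R" using R1 a2 c1 by (auto simp: R_def add_pos_nonneg)
 have Rc: "2 * a2 \<le> c1 * R\<^sup>2"
 proof -
  have "(sqrt (2 * a2 / c1))\<^sup>2 \<le> R\<^sup>2" using R1 a2 c1 unfolding R_def by (intro power_mono) auto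
  then have "2 * a2 / c1 \<le> R\<^sup>2" using a2 c1 by simp
  then show ?thesis using c1 by (simp add: divide_le_eq mult.commute)
 qed
 define p where "p = pi * R\<^sup>2"
 have p: "0 \<le> p" by (simp add: p_def)
 \<comment> \<open>The limit \<open>K * (2 * k * \<delta> * p)\<close> of the error is then at most
   \<open>e / 6\<close>; the 1 keeps the denominator positive, for instance when
   \<open>k = 0\<close>.\<close>
 define \<delta> where "\<delta> = e / (12 * (K * k * p + 1))"
 have Kkp: "0 \<le> K * k * p" using K p by simp
 have \<delta>: "0 < \<delta>" unfolding \<delta>_def using e Kkp by (intro divide_pos_pos) auto
 \<comment> \<open>The bound of \<open>abs_log_bound\<close> for
   \<open>M = 2 * \<delta> * n\<close>.\<close>
 define a where "a n = k * (1 + 2 * \<delta> * n * p) + k * (2 * pi + p + ln n * p)" for n :: nat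
 have lim: "(\<lambda>n. K * (a n + k) / real (n - k)) \<longlonglongrightarrow> K * (2 * k * \<delta> * p)"
 proof -
  have l1: "(\<lambda>n. 1 / (real n - real k)) \<longlonglongrightarrow> 0" by real_asymp
  have l2: "(\<lambda>n. real n / (real n - real k)) \<longlonglongrightarrow> 1" by real_asymp
  have l3: "(\<lambda>n. ln (real n) / (real n - real k)) \<longlonglongrightarrow> 0" by real_asymp
  have "(\<lambda>n. K * ((k + k * (2 * pi + p) + k) * (1 / (real n - real k)) + 2 * k * \<delta> * p * (real n / (real n - real k)) + k * p * (ln (real n) / (real n - real k))))
   \<longlonglongrightarrow> K * ((k + k * (2 * pi + p) + k) * 0 + 2 * k * \<delta> * p * 1 + k * p * 0)"
   by (intro tendsto_intros l1 l2 l3)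
  moreover have "\<forall>\<^sub>F n in sequentially. K * ((k + k * (2 * pi + p) + k) * (1 / (real n - real k)) + 2 * k * \<delta> * p * (real n / (real n - real k)) + k * p * (ln (real n) / (real n - real k)))
   = K * (a n + k) / real (n - k)"
  proof (rule eventually_sequentiallyI)
   fix n assume "k + 1 \<le> n"
   then have "real (n - k) = real n - real k" "real n - real k \<noteq> 0" by (auto simp: of_nat_diff)
   then show "K * ((k + k * (2 * pi + p) + k) * (1 / (real n - real k)) + 2 * k * \<delta> * p * (real n / (real n - real k)) + k * p * (ln (real n) / (real n - real k)))
    = K * (a n + k) / real (n - k)" unfolding a_def by (simp add: add_divide_distrib distrib_left distrib_right mult_ac)
  qed
  ultimately show ?thesis by (auto dest: Lim_transform_eventually)
 qed
 have "K * (2 * k * \<delta> * p) < e / 3"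
 proof -
  have "K * (2 * k * \<delta> * p) = e / 6 * ((K * k * p) / (K * k * p + 1))" unfolding \<delta>_def using Kkp by (simp add: divide_simps)
  also have "\<dots> \<le> e / 6 * 1" using e Kkp by (intro mult_left_mono) (auto simp: divide_le_eq)
  also have "\<dots> < e / 3" using e by simp
  finally show ?thesis .
 qed
 from order_tendstoD(2)[OF lim this] obtain N2 where N2: "\<And>n. N2 \<le> n \<Longrightarrow> K * (a n + k) / real (n - k) < e / 3"
  unfolding eventually_sequentially by blast
 from tail_small[OF \<eta>] obtain f1 N3 where f1: "f1 \<longlonglongrightarrow> 0" and N3: "\<And>n. N3 \<le> n \<Longrightarrow> 0 \<le> f1 n \<and> (\<integral>\<^sup>+ \<zeta>. weight n \<zeta> * indicator {\<zeta>. ennreal ((real n)\<^sup>2 * a2) < hamiltonian q n \<zeta>} \<zeta> \<partial>vol n) \<le> ennreal (f1 n) * Zn n"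
  unfolding a2_def by blast
 from ratio_sum_small[OF \<delta> R(2), of k] obtain f2 N4 where f2: "f2 \<longlonglongrightarrow> 0" and N4: "\<And>n. N4 \<le> n \<Longrightarrow> 0 \<le> f2 n \<and> (\<integral>\<^sup>+ \<zeta>. weight n \<zeta> * indicator {\<zeta>. ennreal (exp (2 * \<delta> * n)) < ratio_sum R k n \<zeta>} \<zeta> \<partial>vol n) \<le> ennreal (f2 n) * Zn n"
  by blast
 \<comment> \<open>The summand \<open>2 * k\<close> ensures that the n / 2 points in the disc are at
   least \<open>k\<close>.\<close>
 define N where "N = N1 + N2 + N3 + N4 + 2 * k + 1"
 show ?thesis
 proof (rule exI[of _ "\<lambda>n. f1 n + f2 n"], rule conjI, goal_cases)
  case 1
  show ?case using tendsto_add[OF f1 f2] by simp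
 next
  case 2
  show ?case
  proof (rule exI[of _ N], intro allI impI conjI)
  fix n assume n: "N \<le> n"
  then have nn: "N1 \<le> n" "N2 \<le> n" "N3 \<le> n" "N4 \<le> n" "2 * k \<le> n" "1 \<le> n" "k < n" by (auto simp: N_def)
  show "0 \<le> f1 n + f2 n" using N3[OF nn(3)] N4[OF nn(4)] by simp
  let ?H = "{\<zeta>. ennreal ((real n)\<^sup>2 * a2) < hamiltonian q n \<zeta>}" and ?T = "{\<zeta>. ennreal (exp (2 * \<delta> * n)) < ratio_sum R k n \<zeta>}"
  have [measurable]: "ratio_sum R k n \<in> borel_measurable (vol n)" by (rule ratio_sum_measurable)
  define B where "B = {\<zeta> \<in> space (vol n). ennreal ((real n)\<^sup>2 * a2) < hamiltonian q n \<zeta> \<or> ennreal (exp (2 * \<delta> * n)) < ratio_sum R k n \<zeta>}"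
  have mH: "{\<zeta> \<in> space (vol n). ennreal ((real n)\<^sup>2 * a2) < hamiltonian q n \<zeta>} \<in> sets (vol n)" by measurable
  have mT: "{\<zeta> \<in> space (vol n). ennreal (exp (2 * \<delta> * n)) < ratio_sum R k n \<zeta>} \<in> sets (vol n)" by measurable
  have B: "B \<in> sets (vol n)" unfolding B_def by measurable
  have "(\<integral>\<^sup>+ \<zeta>\<in>B. weight n \<zeta> \<partial>vol n) \<le> (\<integral>\<^sup>+ \<zeta>. weight n \<zeta> * indicator {\<zeta> \<in> space (vol n). ennreal ((real n)\<^sup>2 * a2) < hamiltonian q n \<zeta>} \<zeta>
    + weight n \<zeta> * indicator {\<zeta> \<in> space (vol n). ennreal (exp (2 * \<delta> * n)) < ratio_sum R k n \<zeta>} \<zeta> \<partial>vol n)"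
   by (intro nn_integral_mono) (auto simp: B_def indicator_def)
  also have "\<dots> = (\<integral>\<^sup>+ \<zeta>. weight n \<zeta> * indicator {\<zeta> \<in> space (vol n). ennreal ((real n)\<^sup>2 * a2) < hamiltonian q n \<zeta>} \<zeta> \<partial>vol n)
    + (\<integral>\<^sup>+ \<zeta>. weight n \<zeta> * indicator {\<zeta> \<in> space (vol n). ennreal (exp (2 * \<delta> * n)) < ratio_sum R k n \<zeta>} \<zeta> \<partial>vol n)"
   by (rule nn_integral_add) (use mH mT in measurable)
  also have "\<dots> = (\<integral>\<^sup>+ \<zeta>. weight n \<zeta> * indicator ?H \<zeta> \<partial>vol n) + (\<integral>\<^sup>+ \<zeta>. weight n \<zeta> * indicator ?T \<zeta> \<partial>vol n)"
   by (intro arg_cong2[where f = "(+)"] nn_integral_cong) (auto simp: indicator_def)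
  also have "\<dots> \<le> ennreal (f1 n) * Zn n + ennreal (f2 n) * Zn n"
   using N3[OF nn(3)] N4[OF nn(4)] by (intro add_mono) auto
  also have "\<dots> = ennreal (f1 n + f2 n) * Zn n"
   using N3[OF nn(3)] N4[OF nn(4)] by (simp add: ennreal_plus distrib_right)
  finally have small: "(\<integral>\<^sup>+ \<zeta>\<in>B. weight n \<zeta> \<partial>vol n) \<le> ennreal (f1 n + f2 n) * Zn n" .
  have good: "\<bar>(\<Sum>u\<in>#deriv_roots k n \<zeta>. \<phi> u) / real (n - k) - (\<integral>x. \<phi> x \<partial>\<sigma>)\<bar> \<le> e" if "\<zeta> \<in> space (vol n) - B" for \<zeta>
  proof -
   have H: "hamiltonian q n \<zeta> \<le> ennreal ((real n)\<^sup>2 * a2)" and T: "ratio_sum R k n \<zeta> \<le> ennreal (exp (2 * \<delta> * n))"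
    using that by (auto simp: B_def)
   have "real k \<le> card {i \<in> {1..n}. \<zeta> i \<in> cball 0 R}"
    using many_points_in_ball[OF nn(6) less_imp_le[OF a2] H R(2) Rc] nn(5) by linarith
   then have cd: "k \<le> card {i \<in> {1..n}. \<zeta> i \<in> cball 0 R}" by linarith
   have "0 \<le> 2 * \<delta> * n" using \<delta> by simp
   from abs_log_bound[OF R(2) this T cd nn(6)]
   have L: "(\<integral>\<^sup>+ z\<in>cball 0 R. ennreal \<bar>log_quotient n k z \<zeta>\<bar> \<partial>lborel) \<le> ennreal (a n)"
    unfolding a_def p_def .
   have "0 \<le> a n" unfolding a_def using \<delta> p nn(6) by (intro add_nonneg_nonneg mult_nonneg_nonneg) (auto simp: ln_ge_zero)
   have gen: "\<bar>x - w\<bar> \<le> e" if "\<bar>x - y\<bar> \<le> e / 3 + z" "z < e / 3" "\<bar>y - w\<bar> \<le> e / 3" for w x y z :: real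
    using that by linarith
   show ?thesis by (rule gen[OF close[OF nn(7) R(1) \<open>0 \<le> a n\<close> L] N2[OF nn(2)] N1[OF nn(1) H[unfolded a2_def]]])
  qed
  show "\<exists>B\<in>sets (vol n). (\<integral>\<^sup>+ \<zeta>\<in>B. weight n \<zeta> \<partial>vol n) \<le> ennreal (f1 n + f2 n) * Zn n \<and>
   (\<forall>\<zeta>\<in>space (vol n) - B. \<bar>(\<Sum>u\<in>#deriv_roots k n \<zeta>. \<phi> u) / real (n - k) - (\<integral>x. \<phi> x \<partial>\<sigma>)\<bar> \<le> e)"
   using B small good by blast
  qed
 qed
qed

end

section \<open>Continuous dependence of the zeros\<close>

lemma zero_measure_prob: "zero_measure P \<in> complex_prob_measures"
 unfolding zero_measure_def complex_prob_measures_def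
 by (auto intro!: measure_pmf.prob_space_distr)

lemma integral_zero_measure:
 fixes \<phi> :: "complex \<Rightarrow> real"
 assumes [measurable]: "\<phi> \<in> borel_measurable borel" and P: "proots P \<noteq> {#}"
 shows "(\<integral>x. \<phi> x \<partial>zero_measure P) = (\<Sum>u\<in>#proots P. \<phi> u) / size (proots P)"
proof -
 have sum: "(\<Sum>u\<in>#A. \<phi> u) = (\<Sum>u\<in>set_mset A. count A u * \<phi> u)" for A :: "complex multiset"
 proof (induction A)
  case (add x A)
  have "(\<Sum>u\<in>set_mset (add_mset x A). count (add_mset x A) u * \<phi> u) = (\<Sum>u\<in>insert x (set_mset A). (if u = x then \<phi> x else 0) + count A u * \<phi> u)"
   by (intro sum.cong) (auto simp: distrib_right)
  also have "\<dots> = \<phi> x + (\<Sum>u\<in>insert x (set_mset A). count A u * \<phi> u)" by (subst sum.distrib) simp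
  also have "(\<Sum>u\<in>insert x (set_mset A). count A u * \<phi> u) = (\<Sum>u\<in>set_mset A. count A u * \<phi> u)"
   by (rule sum.mono_neutral_right) (auto simp: not_in_iff)
  finally show ?case using add by simp
 qed simp
 have "(\<integral>x. \<phi> x \<partial>zero_measure P) = measure_pmf.expectation (pmf_of_multiset (proots P)) \<phi>"
  unfolding zero_measure_def by (subst integral_distr) auto
 also have "\<dots> = (\<Sum>u\<in>set_mset (proots P). \<phi> u * (count (proots P) u / size (proots P)))"
  by (subst integral_measure_pmf_real[of "set_mset (proots P)"]) (use P in \<open>auto simp del: set_count_proots count_proots\<close>)
 also have "\<dots> = (\<Sum>u\<in>set_mset (proots P). count (proots P) u * \<phi> u) / size (proots P)"
  unfolding sum_divide_distrib by (rule sum.cong[OF refl]) simp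
 finally show ?thesis unfolding sum .
qed

text \<open>Gauss--Lucas for discs centred at the origin: if all roots \<open>x\<close> satisfy \<open>|x| < |u|\<close>, then every term of
 \<open>u P'(u) / P(u) = (\<Sum>x. 1 / (1 - x / u))\<close> has positive real part.\<close>

lemma pderiv_roots_bounded:
 fixes A :: "complex multiset"
 assumes "A \<noteq> {#}" "\<And>x. x \<in># A \<Longrightarrow> cmod x \<le> R" "poly (pderiv (\<Prod>x\<in>#A. [:- x, 1:])) u = 0"
 shows "cmod u \<le> R"
proof (rule ccontr)
 assume "\<not> cmod u \<le> R"
 then have lt: "cmod x < cmod u" if "x \<in># A" for x using assms(2)[OF that] by simp
 have "\<exists>x. x \<in># A" using assms(1) by auto
 then have u0: "u \<noteq> 0" using lt by force
 have log: "u * poly (pderiv (\<Prod>x\<in>#B. [:- x, 1:])) u = poly (\<Prod>x\<in>#B. [:- x, 1:]) u * (\<Sum>x\<in>#B. u / (u - x))"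
  if "\<And>x. x \<in># B \<Longrightarrow> x \<noteq> u" for B :: "complex multiset"
  using that
 proof (induction B)
  case (add x B)
  then have "u - x \<noteq> 0" by auto
  have "poly (pderiv (\<Prod>x\<in>#add_mset x B. [:- x, 1:])) u = (u - x) * poly (pderiv (\<Prod>x\<in>#B. [:- x, 1:])) u + poly (\<Prod>x\<in>#B. [:- x, 1:]) u"
   by (simp only: image_mset_add_mset prod_mset.add_mset pderiv_mult poly_add poly_mult) (simp add: pderiv_pCons algebra_simps)
  moreover have "poly (\<Prod>x\<in>#add_mset x B. [:- x, 1:]) u = (u - x) * poly (\<Prod>x\<in>#B. [:- x, 1:]) u"
   by (simp only: image_mset_add_mset prod_mset.add_mset poly_mult) (simp add: algebra_simps)
  moreover have "u * poly (pderiv (\<Prod>x\<in>#B. [:- x, 1:])) u = poly (\<Prod>x\<in>#B. [:- x, 1:]) u * (\<Sum>x\<in>#B. u / (u - x))"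
   using add by simp
  ultimately have "u * poly (pderiv (\<Prod>x\<in>#add_mset x B. [:- x, 1:])) u
   = (u - x) * (poly (\<Prod>x\<in>#B. [:- x, 1:]) u * (\<Sum>x\<in>#B. u / (u - x))) + u * poly (\<Prod>x\<in>#B. [:- x, 1:]) u" by (simp add: distrib_left mult.left_commute)
  also have "\<dots> = (u - x) * poly (\<Prod>x\<in>#B. [:- x, 1:]) u * (u / (u - x) + (\<Sum>x\<in>#B. u / (u - x)))"
   using \<open>u - x \<noteq> 0\<close> by (simp add: distrib_left)
  finally show ?case using \<open>poly (\<Prod>x\<in>#add_mset x B. [:- x, 1:]) u = (u - x) * poly (\<Prod>x\<in>#B. [:- x, 1:]) u\<close> by simp
 qed simp
 have pos: "0 < Re (u / (u - x))" if "x \<in># A" for x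
 proof -
  have xu: "u - x \<noteq> 0" using lt[OF that] by auto
  have "(cmod x) * (cmod u) < (cmod u)\<^sup>2" using mult_strict_right_mono[OF lt[OF that], of "cmod u"] u0 by (simp add: power2_eq_square)
  moreover have "Re (cnj x * u) \<le> cmod x * cmod u" using complex_Re_le_cmod[of "cnj x * u"] by (simp add: norm_mult)
  moreover have "Re (u * cnj (u - x)) = (cmod u)\<^sup>2 - Re (cnj x * u)" unfolding cmod_power2 by (simp add: power2_eq_square algebra_simps)
  ultimately have "0 < Re (u * cnj (u - x))" by linarith
  moreover have "0 < (cmod (u - x))\<^sup>2" using xu by simp
  moreover have "Re (u / (u - x)) = Re (u * cnj (u - x)) / (cmod (u - x))\<^sup>2"
   by (subst complex_div_cnj) (metis Re_divide_of_real of_real_power)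
  ultimately show ?thesis by simp
 qed
 have "0 < Re (\<Sum>x\<in>#B. u / (u - x))" if "B \<noteq> {#}" "\<And>x. x \<in># B \<Longrightarrow> 0 < Re (u / (u - x))" for B
  using that
 proof (induction B)
  case (add x B)
  then show ?case by (cases "B = {#}") (simp_all del: Re_divide add: add_pos_pos)
 qed simp
 from this[OF assms(1) pos] have "(\<Sum>x\<in>#A. u / (u - x)) \<noteq> 0" by auto
 moreover have "poly (\<Prod>x\<in>#A. [:- x, 1:]) u \<noteq> 0"
 proof -
  have "poly (\<Prod>x\<in>#B. [:- x, 1:]) u \<noteq> 0" if "\<And>x. x \<in># B \<Longrightarrow> x \<noteq> u" for B :: "complex multiset"
   using that by (induction B) auto
  then show ?thesis using lt by blast
 qed
 moreover have "u * poly (pderiv (\<Prod>x\<in>#A. [:- x, 1:])) u = poly (\<Prod>x\<in>#A. [:- x, 1:]) u * (\<Sum>x\<in>#A. u / (u - x))"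
  by (rule log) (use lt in blast)
 ultimately show False using assms(3) by simp
qed

lemma higher_pderiv_roots_bounded:
 fixes p :: "complex poly"
 assumes "p \<noteq> 0" "\<And>x. poly p x = 0 \<Longrightarrow> cmod x \<le> R" "k < degree p" "poly ((pderiv ^^ k) p) u = 0"
 shows "cmod u \<le> R"
 using assms(3,4)
proof (induction k arbitrary: u)
 case 0 then show ?case using assms(2) by simp
next
 case (Suc k)
 define D where "D = (pderiv ^^ k) p"
 have D: "D \<noteq> 0" "degree D = degree p - k" unfolding D_def using Suc.prems assms(1) by (intro higher_pderiv_degree; simp)+
 define c where "c = lead_coeff D"
 have dec: "D = smult c (\<Prod>x\<in>#proots D. [:- x, 1:])" unfolding c_def by (rule complex_poly_decompose_multiset[symmetric])
 have "proots D \<noteq> {#}" using size_proots_complex[of D] D Suc.prems by auto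
 moreover have "cmod x \<le> R" if "x \<in># proots D" for x using that Suc.IH[of x] Suc.prems D(1) by (simp add: D_def)
 moreover have "poly (pderiv (\<Prod>x\<in>#proots D. [:- x, 1:])) u = 0"
 proof -
  have "0 = poly (pderiv D) u" using Suc.prems by (simp add: D_def)
  also have "\<dots> = c * poly (pderiv (\<Prod>x\<in>#proots D. [:- x, 1:])) u" by (subst dec) (simp add: pderiv_smult)
  finally show ?thesis using D(1) by (simp add: c_def)
 qed
 ultimately show ?case by (rule pderiv_roots_bounded)
qed

text \<open>The factor n! / (n - k)! produced by k differentiations of a monic polynomial of degree
  n.\<close>

definition deriv_const :: "nat \<Rightarrow> nat \<Rightarrow> complex" where
 "deriv_const n k = pochhammer (of_nat (Suc (n - k))) k"

lemma deriv_const_nonzero: "deriv_const n k \<noteq> 0"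
 unfolding deriv_const_def pochhammer_eq_0_iff by (metis add_eq_0_iff_both_eq_0 nat.distinct(1) of_nat_add of_nat_eq_0_iff add_eq_0_iff2)

text \<open>Roots are listed as a vector so that compactness applies to them. Gauss--Lucas confines
  the entries to the disc that contains the gas points; entries beyond the degree are 0.\<close>

lemma deriv_root_vector:
 assumes k: "k < n" and R: "0 \<le> R" "\<And>i. i \<in> {1..n} \<Longrightarrow> cmod (\<zeta> i) \<le> R"
 obtains w :: "nat \<Rightarrow> complex" where "\<And>i. cmod (w i) \<le> R"
  "(pderiv ^^ k) (gas_poly n \<zeta>) = smult (deriv_const n k) (\<Prod>i\<in>{..<n - k}. [:- w i, 1:])"
proof -
 let ?D = "(pderiv ^^ k) (gas_poly n \<zeta>)"
 have d: "degree (gas_poly n \<zeta>) = n" unfolding gas_poly_def by (subst degree_prod_linear) auto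
 have g0: "gas_poly n \<zeta> \<noteq> 0" by (simp add: gas_poly_def)
 have D: "?D \<noteq> 0" "degree ?D = n - k" using higher_pderiv_degree[of k "gas_poly n \<zeta>"] k d g0 by auto
 have "lead_coeff (gas_poly n \<zeta>) = 1" unfolding gas_poly_def by (subst lead_coeff_prod) simp
 then have lc: "lead_coeff ?D = deriv_const n k" unfolding D(2) coeff_higher_pderiv deriv_const_def using k d by simp
 obtain xs where xs: "mset xs = proots ?D" using ex_mset by blast
 have len: "length xs = n - k" using size_proots_complex[of ?D] D xs by (metis size_mset)
 define w where "w i = (if i < n - k then xs ! i else 0)" for i
 have "cmod (w i) \<le> R" for i
 proof (cases "i < n - k")
  case True
  then have "xs ! i \<in># proots ?D" using len xs by (metis nth_mem set_mset_mset)
  then have z: "poly ?D (xs ! i) = 0" using D(1) by simp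
  have "cmod (xs ! i) \<le> R"
  proof (rule higher_pderiv_roots_bounded[OF g0 _ _ z])
   show "k < degree (gas_poly n \<zeta>)" using k d by simp
   fix x assume "poly (gas_poly n \<zeta>) x = 0"
   then obtain i where "i \<in> {1..n}" "\<zeta> i = x" by (auto simp: gas_poly_def poly_prod)
   then show "cmod x \<le> R" using R(2) by blast
  qed
  then show ?thesis using True by (simp add: w_def)
 qed (use R in \<open>simp add: w_def\<close>)
 moreover have "?D = smult (deriv_const n k) (\<Prod>i\<in>{..<n - k}. [:- w i, 1:])"
 proof -
  have "(\<Prod>x\<in>#proots ?D. [:- x, 1:]) = prod_list (map (\<lambda>x. [:- x, 1:]) xs)" unfolding xs[symmetric] by (simp add: prod_mset_prod_list[symmetric])
  also have "\<dots> = (\<Prod>i\<in>{..<n - k}. [:- (xs ! i), 1:])"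
   by (subst prod.list_conv_set_nth) (simp add: len lessThan_atLeast0)
  also have "\<dots> = (\<Prod>i\<in>{..<n - k}. [:- w i, 1:])" by (intro prod.cong) (auto simp: w_def)
  finally show ?thesis using complex_poly_decompose_multiset[of ?D] lc by simp
 qed
 ultimately show ?thesis using that by blast
qed

text \<open>Individual roots need not be followed: the root vectors along a sequence have a
  convergent subsequence, its limit lists the roots of the limiting polynomial because values
  converge pointwise, and the sum of \<open>\<phi>\<close> does not depend on the order of the
  entries.\<close>

lemma zero_mean_continuous:
 fixes \<phi> :: "complex \<Rightarrow> real"
 assumes c: "continuous_on UNIV \<phi>" and k: "k < n"
 shows "continuous_on UNIV (\<lambda>\<zeta> :: nat \<Rightarrow> complex. \<Sum>u\<in>#deriv_roots k n \<zeta>. \<phi> u)"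
proof (rule continuous_on_sequentiallyI)
 fix X :: "nat \<Rightarrow> nat \<Rightarrow> complex" and \<zeta> assume X: "X \<longlonglongrightarrow> \<zeta>"
 let ?F = "\<lambda>\<zeta> :: nat \<Rightarrow> complex. \<Sum>u\<in>#deriv_roots k n \<zeta>. \<phi> u"
 have coord: "(\<lambda>m. Y m i) \<longlonglongrightarrow> y i" if "Y \<longlonglongrightarrow> y" for Y :: "nat \<Rightarrow> nat \<Rightarrow> complex" and y i
  using continuous_on_tendsto_compose[OF continuous_on_product_coordinates[of i] that] by simp
 have "\<exists>B>0. \<forall>m. cmod (X m i) \<le> B" for i
  using convergent_imp_Bseq[OF convergentI[OF coord[OF X, of i]]] unfolding Bseq_def by blast
 then obtain B where B: "\<And>i. 0 < B i" "\<And>i m. cmod (X m i) \<le> B i" by metis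
 define R where "R = (\<Sum>i\<in>{1..n}. B i)"
 have R0: "0 \<le> R" unfolding R_def using B(1) by (intro sum_nonneg) (auto intro: less_imp_le)
 have XR: "cmod (X m i) \<le> R" if "i \<in> {1..n}" for m i
 proof -
  have "B i \<le> R" unfolding R_def using that B(1) by (intro member_le_sum) (auto intro: less_imp_le)
  then show ?thesis using B(2)[of m i] by simp
 qed
 have "\<exists>w :: nat \<Rightarrow> complex. (\<forall>i. cmod (w i) \<le> R) \<and> (pderiv ^^ k) (gas_poly n (X m)) = smult (deriv_const n k) (\<Prod>i\<in>{..<n - k}. [:- w i, 1:])" for m
  by (rule deriv_root_vector[OF k R0 XR[of _ m]]) auto
 then obtain W :: "nat \<Rightarrow> nat \<Rightarrow> complex" where W: "\<And>m i. cmod (W m i) \<le> R"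
  "\<And>m. (pderiv ^^ k) (gas_poly n (X m)) = smult (deriv_const n k) (\<Prod>i\<in>{..<n - k}. [:- W m i, 1:])"
  by metis
 have FW: "?F (X m) = (\<Sum>i\<in>{..<n - k}. \<phi> (W m i))" for m
  unfolding W(2) proots_smult[OF deriv_const_nonzero] by (rule sum_proots_prod_linear) simp
 \<comment> \<open>Tychonoff's theorem; the index set is countable, so compactness yields convergent
   subsequences.\<close>
 have "compactin (product_topology (\<lambda>_. euclidean) UNIV) (PiE UNIV (\<lambda>_::nat. cball (0::complex) R))"
  unfolding compactin_PiE by simp
 then have "seq_compact (PiE UNIV (\<lambda>_::nat. cball (0::complex) R))"
  unfolding euclidean_product_topology by (intro compact_imp_seq_compact) simp
 then have sub: "\<exists>l r. strict_mono (r :: nat \<Rightarrow> nat) \<and> (Y \<circ> r) \<longlonglongrightarrow> l" if "\<And>m i. cmod (Y m i) \<le> R" for Y :: "nat \<Rightarrow> nat \<Rightarrow> complex"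
  using that unfolding seq_compact_def by (metis PiE_UNIV_domain UNIV_I mem_cball_0 Pi_I)
 show "(\<lambda>m. ?F (X m)) \<longlonglongrightarrow> ?F \<zeta>"
 proof (rule ccontr)
  assume "\<not> ?thesis"
  then obtain e where e: "0 < e" "\<And>N. \<exists>m\<ge>N. e \<le> \<bar>?F (X m) - ?F \<zeta>\<bar>"
   unfolding LIMSEQ_iff by (auto simp: not_less)
  have "infinite {m. e \<le> \<bar>?F (X m) - ?F \<zeta>\<bar>}" unfolding infinite_nat_iff_unbounded_le using e(2) by blast
  from infinite_enumerate[OF this] obtain s :: "nat \<Rightarrow> nat" where s: "strict_mono s" "\<And>m. e \<le> \<bar>?F (X (s m)) - ?F \<zeta>\<bar>" by blast
  from sub[of "\<lambda>m. W (s m)"] W(1) obtain l r where r: "strict_mono (r :: nat \<Rightarrow> nat)" and l: "((\<lambda>m. W (s m)) \<circ> r) \<longlonglongrightarrow> l" by blast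
  define t where "t = s \<circ> r"
  have t: "strict_mono t" unfolding t_def using s(1) r by (rule strict_mono_o)
  have Wl: "(\<lambda>m. W (t m) i) \<longlonglongrightarrow> l i" for i using coord[OF l, of i] by (simp add: t_def o_def)
  have "poly ((pderiv ^^ k) (gas_poly n \<zeta>)) z = poly (smult (deriv_const n k) (\<Prod>i\<in>{..<n - k}. [:- l i, 1:])) z" for z
  proof (rule LIMSEQ_unique)
   have "(\<lambda>m. deriv_val {1..n} k z (X (t m))) \<longlonglongrightarrow> deriv_val {1..n} k z \<zeta>"
    using continuous_on_tendsto_compose[OF deriv_val_continuous LIMSEQ_subseq_LIMSEQ[OF X t, unfolded o_def]] by simp
   then show "(\<lambda>m. poly ((pderiv ^^ k) (gas_poly n (X (t m)))) z) \<longlonglongrightarrow> poly ((pderiv ^^ k) (gas_poly n \<zeta>)) z"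
    by (simp add: deriv_val_def gas_poly_def)
   have "(\<lambda>m. deriv_const n k * (\<Prod>i\<in>{..<n - k}. - W (t m) i + z)) \<longlonglongrightarrow> deriv_const n k * (\<Prod>i\<in>{..<n - k}. - l i + z)"
    by (intro tendsto_intros Wl)
   then show "(\<lambda>m. poly ((pderiv ^^ k) (gas_poly n (X (t m)))) z) \<longlonglongrightarrow> poly (smult (deriv_const n k) (\<Prod>i\<in>{..<n - k}. [:- l i, 1:])) z"
    unfolding W(2) by (simp add: poly_prod)
  qed
  then have "(pderiv ^^ k) (gas_poly n \<zeta>) = smult (deriv_const n k) (\<Prod>i\<in>{..<n - k}. [:- l i, 1:])"
   by (intro poly_eqI_degree_lead_coeff poly_eq_poly_eq_iff[THEN iffD1]) auto
  then have "?F \<zeta> = (\<Sum>i\<in>{..<n - k}. \<phi> (l i))"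
   by (simp only: proots_smult[OF deriv_const_nonzero]) (rule sum_proots_prod_linear, simp)
  moreover have "(\<lambda>m. \<Sum>i\<in>{..<n - k}. \<phi> (W (t m) i)) \<longlonglongrightarrow> (\<Sum>i\<in>{..<n - k}. \<phi> (l i))"
   by (intro tendsto_sum continuous_on_tendsto_compose[OF c Wl]) auto
  ultimately have "(\<lambda>m. ?F (X (t m))) \<longlonglongrightarrow> ?F \<zeta>" unfolding FW by simp
  then have "\<forall>\<^sub>F m in sequentially. dist (?F (X (t m))) (?F \<zeta>) < e" using e(1) by (rule tendstoD)
  then obtain m where "dist (?F (X (t m))) (?F \<zeta>) < e" unfolding eventually_sequentially by blast
  then show False using s(2)[of "r m"] by (simp add: t_def dist_real_def)
 qed
qed

section \<open>Weak convergence in probability\<close>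

definition zeros :: "nat \<Rightarrow> nat \<Rightarrow> (nat \<Rightarrow> complex) \<Rightarrow> complex measure" where
 "zeros k n \<zeta> = zero_measure ((pderiv ^^ k) (gas_poly n \<zeta>))"

lemma zeros_prob: "zeros k n \<zeta> \<in> complex_prob_measures"
 unfolding zeros_def by (rule zero_measure_prob)

lemma integral_zeros:
 fixes \<phi> :: "complex \<Rightarrow> real"
 assumes "\<phi> \<in> borel_measurable borel" "k < n"
 shows "(\<integral>x. \<phi> x \<partial>zeros k n \<zeta>) = (\<Sum>u\<in>#deriv_roots k n \<zeta>. \<phi> u) / real (n - k)"
proof -
 have "size (deriv_roots k n \<zeta>) = n - k" using assms by (intro size_proots_deriv) simp
 then show ?thesis unfolding zeros_def using assms by (subst integral_zero_measure) auto
qed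

text \<open>The weak topology is given by a subbasis. For its members openness is the continuity of
  the zero means, and intersections and unions inherit it.\<close>

lemma zeros_weakly_open:
 assumes k: "k < n" and U: "openin weak_topology U"
 shows "open {\<zeta>. zeros k n \<zeta> \<in> U}"
proof -
 have "generate_topology_on {{\<mu> \<in> complex_prob_measures. (\<integral>z. \<phi> z \<partial>\<mu>) \<in> V} | \<phi> V.
    continuous_on UNIV (\<phi> :: complex \<Rightarrow> real) \<and> bounded (range \<phi>) \<and> open V} U"
  using U unfolding weak_topology_def by (rule openin_topology_generated_by)
 then show ?thesis
 proof induction
  case (Int a b)
  then show ?case using open_Int[OF Int.IH] by (simp add: Collect_conj_eq)
 next
  case (UN K)
  have "{\<zeta>. zeros k n \<zeta> \<in> \<Union>K} = (\<Union>a\<in>K. {\<zeta>. zeros k n \<zeta> \<in> a})" by blast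
  then show ?case using UN.IH by (simp only:) (intro open_UN ballI)
 next
  case (Basis s)
  then obtain \<phi> :: "complex \<Rightarrow> real" and V where s: "s = {\<mu> \<in> complex_prob_measures. (\<integral>z. \<phi> z \<partial>\<mu>) \<in> V}" and \<phi>: "continuous_on UNIV \<phi>" and V: "open V" by blast
  have m: "\<phi> \<in> borel_measurable borel" using \<phi> by (rule borel_measurable_continuous_onI)
  have "{\<zeta>. zeros k n \<zeta> \<in> s} = (\<lambda>\<zeta>. (\<Sum>u\<in>#deriv_roots k n \<zeta>. \<phi> u) / real (n - k)) -` V"
   unfolding s using zeros_prob by (auto simp: integral_zeros[OF m k])
  moreover have "continuous_on UNIV (\<lambda>\<zeta> :: nat \<Rightarrow> complex. (\<Sum>u\<in>#deriv_roots k n \<zeta>. \<phi> u) / real (n - k))"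
   by (intro continuous_on_divide zero_mean_continuous[OF \<phi> k] continuous_on_const) (use k in simp)
  ultimately show ?case using open_vimage[OF V] by simp
 qed simp
qed

lemma zeros_event_measurable:
 assumes k: "k < n" and U: "openin weak_topology U"
 shows "{\<zeta> \<in> space (vol n). zeros k n \<zeta> \<in> U} \<in> sets (vol n)"
proof -
 \<comment> \<open>Points of \<open>vol n\<close> are \<open>undefined\<close> outside
   \<open>{1..n}\<close>. Setting these coordinates to 0 maps them measurably into the full product,
   where the product sigma-algebra is the Borel one; the polynomial does not see the change.\<close>
 define T where "T \<zeta> i = (if i \<in> {1..n} then \<zeta> i else (0::complex))" for \<zeta> and i :: nat
 have "(\<lambda>\<zeta>. T \<zeta> i) \<in> borel_measurable (vol n)" for i
 proof (cases "i \<in> {1..n}")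
  case True
  then have "(\<lambda>\<zeta>. \<zeta> i) \<in> borel_measurable (vol n)"
   using measurable_component_singleton[of i "{1..n}" "\<lambda>_. lborel :: complex measure"] by simp
  then show ?thesis using True by (simp only: T_def if_True)
 next
  case False
  then have "(\<lambda>\<zeta>. T \<zeta> i) = (\<lambda>_. 0)" unfolding T_def by (simp only: if_False)
  then show ?thesis by simp
 qed
 then have "T \<in> measurable (vol n) (Pi\<^sub>M UNIV (\<lambda>_. borel))"
  by (intro measurable_PiM_single') auto
 then have T: "T \<in> borel_measurable (vol n)" using measurable_cong_sets[OF refl sets_PiM_equal_borel] by blast
 have "zeros k n (T \<zeta>) = zeros k n \<zeta>" for \<zeta>
 proof -
  have "gas_poly n (T \<zeta>) = gas_poly n \<zeta>" unfolding gas_poly_def by (rule prod.cong[OF refl]) (simp only: T_def if_True)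
  then show ?thesis by (simp add: zeros_def)
 qed
 then have "{\<zeta> \<in> space (vol n). zeros k n \<zeta> \<in> U} = T -` {\<zeta>. zeros k n \<zeta> \<in> U} \<inter> space (vol n)" by auto
 also have "\<dots> \<in> sets (vol n)" using T borel_open[OF zeros_weakly_open[OF k U]] by (rule measurable_sets)
 finally show ?thesis .
qed

text \<open>Bad events are only required to be contained in small measurable sets, so that this can be
 used before the measurability of the zeros is known.\<close>

definition likely :: "(nat \<Rightarrow> (nat \<Rightarrow> complex) measure) \<Rightarrow> (nat \<Rightarrow> (nat \<Rightarrow> complex) \<Rightarrow> bool) \<Rightarrow> bool" where
 "likely \<nu> P \<longleftrightarrow> (\<exists>f. f \<longlonglongrightarrow> 0 \<and> (\<exists>N. \<forall>n\<ge>N. \<exists>B\<in>sets (vol n). measure (\<nu> n) B \<le> f n \<and> (\<forall>\<zeta>\<in>space (vol n) - B. P n \<zeta>)))"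

lemma likely_mono: "likely \<nu> P \<Longrightarrow> (\<And>n \<zeta>. P n \<zeta> \<Longrightarrow> P' n \<zeta>) \<Longrightarrow> likely \<nu> P'"
 unfolding likely_def by meson

lemma likely_conj:
 assumes \<nu>: "\<And>n. n \<ge> 1 \<Longrightarrow> prob_space (\<nu> n) \<and> sets (\<nu> n) = sets (vol n)" and P: "likely \<nu> P" "likely \<nu> P'"
 shows "likely \<nu> (\<lambda>n \<zeta>. P n \<zeta> \<and> P' n \<zeta>)"
proof -
 obtain f N where f: "f \<longlonglongrightarrow> 0" and N: "\<And>n. N \<le> n \<Longrightarrow> \<exists>B\<in>sets (vol n). measure (\<nu> n) B \<le> f n \<and> (\<forall>\<zeta>\<in>space (vol n) - B. P n \<zeta>)"
  using P(1) unfolding likely_def by blast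
 obtain g M where g: "g \<longlonglongrightarrow> 0" and M: "\<And>n. M \<le> n \<Longrightarrow> \<exists>B\<in>sets (vol n). measure (\<nu> n) B \<le> g n \<and> (\<forall>\<zeta>\<in>space (vol n) - B. P' n \<zeta>)"
  using P(2) unfolding likely_def by blast
 have "\<exists>B\<in>sets (vol n). measure (\<nu> n) B \<le> f n + g n \<and> (\<forall>\<zeta>\<in>space (vol n) - B. P n \<zeta> \<and> P' n \<zeta>)" if "N + M + 1 \<le> n" for n
 proof -
  have n: "N \<le> n" "M \<le> n" "1 \<le> n" using that by auto
  from N[OF n(1)] obtain B1 where B1: "B1 \<in> sets (vol n)" "measure (\<nu> n) B1 \<le> f n" "\<forall>\<zeta>\<in>space (vol n) - B1. P n \<zeta>" by blast
  from M[OF n(2)] obtain B2 where B2: "B2 \<in> sets (vol n)" "measure (\<nu> n) B2 \<le> g n" "\<forall>\<zeta>\<in>space (vol n) - B2. P' n \<zeta>" by blast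
  have "measure (\<nu> n) (B1 \<union> B2) \<le> measure (\<nu> n) B1 + measure (\<nu> n) B2"
   using \<nu>[OF n(3)] B1(1) B2(1) by (intro measure_Un_le) auto
  then show ?thesis using B1 B2 by (intro bexI[of _ "B1 \<union> B2"]) auto
 qed
 then show ?thesis unfolding likely_def
  using tendsto_add[OF f g] by (intro exI[of _ "\<lambda>n. f n + g n"] conjI exI[of _ "N + M + 1"]) auto
qed

section \<open>From compactly supported test functions to weak convergence\<close>

definition concentrates :: "(nat \<Rightarrow> (nat \<Rightarrow> complex) measure) \<Rightarrow> nat \<Rightarrow> complex measure \<Rightarrow> (complex \<Rightarrow> real) \<Rightarrow> bool" where
 "concentrates \<nu> k \<sigma> \<phi> \<longleftrightarrow> (\<forall>e>0. likely \<nu> (\<lambda>n \<zeta>. \<bar>(\<integral>x. \<phi> x \<partial>zeros k n \<zeta>) - (\<integral>x. \<phi> x \<partial>\<sigma>)\<bar> \<le> e))"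

lemma prob_integrable_bounded:
 fixes \<phi> :: "complex \<Rightarrow> real"
 assumes "\<mu> \<in> complex_prob_measures" "\<phi> \<in> borel_measurable borel" "\<And>x. \<bar>\<phi> x\<bar> \<le> B"
 shows "integrable \<mu> \<phi>"
proof -
 interpret prob_space \<mu> using assms(1) by (simp add: complex_prob_measures_def)
 have "\<phi> \<in> borel_measurable \<mu>" using assms(1,2) by (simp add: complex_prob_measures_def measurable_cong_sets[of \<mu> borel])
 then show ?thesis by (rule integrable_const_bound[of _ B, rotated]) (use assms(3) in auto)
qed

text \<open>The cutoff \<open>\<xi>\<close> has integral at least 1 - d for \<open>\<sigma>\<close>,
  hence at least 1 - 2 d for \<open>\<mu>\<close>. Replacing \<open>\<phi>\<close> by
  \<open>\<phi> * \<xi>\<close> costs at most \<open>B * d\<close> and \<open>2 * B * d\<close>,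
  respectively.\<close>

lemma bounded_test_function:
 fixes \<phi> \<xi> :: "complex \<Rightarrow> real"
 assumes \<mu>: "\<mu> \<in> complex_prob_measures" "\<sigma> \<in> complex_prob_measures"
  and m: "\<phi> \<in> borel_measurable borel" "\<xi> \<in> borel_measurable borel" and B: "\<And>x. \<bar>\<phi> x\<bar> \<le> B" and \<xi>: "\<And>x. 0 \<le> \<xi> x" "\<And>x. \<xi> x \<le> 1"
  and s: "1 - d \<le> (\<integral>x. \<xi> x \<partial>\<sigma>)" and 1: "\<bar>(\<integral>x. \<xi> x \<partial>\<mu>) - (\<integral>x. \<xi> x \<partial>\<sigma>)\<bar> \<le> d" and 2: "\<bar>(\<integral>x. \<phi> x * \<xi> x \<partial>\<mu>) - (\<integral>x. \<phi> x * \<xi> x \<partial>\<sigma>)\<bar> \<le> d"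
 shows "\<bar>(\<integral>x. \<phi> x \<partial>\<mu>) - (\<integral>x. \<phi> x \<partial>\<sigma>)\<bar> \<le> d + 3 * B * d"
proof -
 have B0: "0 \<le> B" using B[of 0] by simp
 have *: "\<bar>(\<integral>x. \<phi> x \<partial>\<tau>) - (\<integral>x. \<phi> x * \<xi> x \<partial>\<tau>)\<bar> \<le> B * (1 - (\<integral>x. \<xi> x \<partial>\<tau>))" if \<tau>: "\<tau> \<in> complex_prob_measures" for \<tau>
 proof -
  interpret prob_space \<tau> using \<tau> by (simp add: complex_prob_measures_def)
  have i1: "integrable \<tau> \<phi>" by (rule prob_integrable_bounded[OF \<tau> m(1) B])
  have i2: "integrable \<tau> \<xi>" by (rule prob_integrable_bounded[OF \<tau> m(2), of 1]) (use \<xi> in auto)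
  have i3: "integrable \<tau> (\<lambda>x. \<phi> x * \<xi> x)"
  proof (rule prob_integrable_bounded[OF \<tau>, of _ B])
   show "(\<lambda>x. \<phi> x * \<xi> x) \<in> borel_measurable borel" using m by measurable
   show "\<bar>\<phi> x * \<xi> x\<bar> \<le> B" for x using mult_mono[OF B[of x] \<xi>(2)[of x]] \<xi>(1)[of x] B0 by (simp add: abs_mult)
  qed
  have "(\<integral>x. \<phi> x \<partial>\<tau>) - (\<integral>x. \<phi> x * \<xi> x \<partial>\<tau>) = (\<integral>x. \<phi> x - \<phi> x * \<xi> x \<partial>\<tau>)" using i1 i3 by simp
  then have "\<bar>(\<integral>x. \<phi> x \<partial>\<tau>) - (\<integral>x. \<phi> x * \<xi> x \<partial>\<tau>)\<bar> \<le> (\<integral>x. \<bar>\<phi> x - \<phi> x * \<xi> x\<bar> \<partial>\<tau>)" by simp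
  also have "\<dots> \<le> (\<integral>x. B * (1 - \<xi> x) \<partial>\<tau>)"
  proof (rule integral_mono)
   fix x
   have "\<bar>\<phi> x - \<phi> x * \<xi> x\<bar> = \<bar>\<phi> x\<bar> * (1 - \<xi> x)"
   proof -
    have "\<phi> x - \<phi> x * \<xi> x = \<phi> x * (1 - \<xi> x)" by (simp add: algebra_simps)
    then show ?thesis using \<xi>(2)[of x] by (simp add: abs_mult)
   qed
   also have "\<dots> \<le> B * (1 - \<xi> x)" using B \<xi>(2)[of x] by (intro mult_right_mono) auto
   finally show "\<bar>\<phi> x - \<phi> x * \<xi> x\<bar> \<le> B * (1 - \<xi> x)" .
  qed (use i1 i2 i3 in auto)
  also have "\<dots> = B * (1 - (\<integral>x. \<xi> x \<partial>\<tau>))" using i2 by (simp add: prob_space)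
  finally show ?thesis .
 qed
 have a: "B * (1 - (\<integral>x. \<xi> x \<partial>\<mu>)) \<le> B * (2 * d)" using s 1 B0 by (intro mult_left_mono) (linarith+)
 have b: "B * (1 - (\<integral>x. \<xi> x \<partial>\<sigma>)) \<le> B * d" using s B0 by (intro mult_left_mono) (linarith+)
 show ?thesis using *[OF \<mu>(1)] *[OF \<mu>(2)] a b 2 by linarith
qed

text \<open>No mass escapes to infinity: a continuous cutoff is itself an admissible test function,
  and its integral against the probability measure \<open>\<sigma>\<close> is nearly 1.\<close>

lemma concentrates_bounded:
 fixes \<phi> :: "complex \<Rightarrow> real"
 assumes \<sigma>: "\<sigma> \<in> complex_prob_measures" and \<nu>: "\<And>n. n \<ge> 1 \<Longrightarrow> prob_space (\<nu> n) \<and> sets (\<nu> n) = sets (vol n)"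
  and C: "\<And>\<phi> R. continuous_on UNIV \<phi> \<Longrightarrow> (\<forall>x. R < cmod x \<longrightarrow> \<phi> x = 0) \<Longrightarrow> concentrates \<nu> k \<sigma> \<phi>"
  and \<phi>: "continuous_on UNIV \<phi>" "bounded (range \<phi>)"
 shows "concentrates \<nu> k \<sigma> \<phi>"
 unfolding concentrates_def
proof (intro allI impI)
 fix e :: real assume e: "0 < e"
 obtain B where B: "0 < B" "\<And>x. \<bar>\<phi> x\<bar> \<le> B" using \<phi>(2) unfolding bounded_pos by auto
 have m: "\<phi> \<in> borel_measurable borel" using \<phi>(1) by (rule borel_measurable_continuous_onI)
 \<comment> \<open>Solves \<open>d + 3 * B * d = e\<close>.\<close>
 define d where "d = e / (1 + 3 * B)"
 have d: "0 < d" "d + 3 * B * d = e"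
 proof -
  show "0 < d" using e B by (simp add: d_def)
  have "d + 3 * B * d = d * (1 + 3 * B)" by (simp add: algebra_simps)
  then show "d + 3 * B * d = e" using B by (simp add: d_def)
 qed
 interpret s: prob_space \<sigma> using \<sigma> by (simp add: complex_prob_measures_def)
 have sets\<sigma> [measurable_cong]: "sets \<sigma> = sets borel" using \<sigma> by (simp add: complex_prob_measures_def)
 have sp: "space \<sigma> = UNIV" using sets_eq_imp_space_eq[OF sets\<sigma>] by simp
 have "(\<lambda>j. measure \<sigma> (cball (0::complex) (real j))) \<longlonglongrightarrow> measure \<sigma> (\<Union>j. cball (0::complex) (real j))"
  by (rule s.finite_Lim_measure_incseq) (auto simp: incseq_def sets\<sigma>)
 moreover have "(\<Union>j. cball (0::complex) (real j)) = space \<sigma>" unfolding sp by (auto simp: real_arch_simple)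
 ultimately have "(\<lambda>j. measure \<sigma> (cball (0::complex) (real j))) \<longlonglongrightarrow> 1" by (simp add: s.prob_space)
 moreover have "1 - d < (1::real)" using d by simp
 ultimately have "\<forall>\<^sub>F j in sequentially. 1 - d < measure \<sigma> (cball (0::complex) (real j))" by (rule order_tendstoD)
 then obtain j where j: "1 - d < measure \<sigma> (cball (0::complex) (real j))" unfolding eventually_sequentially by blast
 define \<xi> where "\<xi> x = max 0 (min 1 (real j + 1 - cmod x))" for x
 have c\<xi>: "continuous_on UNIV \<xi>" unfolding \<xi>_def by (intro continuous_intros)
 have m\<xi>: "\<xi> \<in> borel_measurable borel" using c\<xi> by (rule borel_measurable_continuous_onI)
 have \<xi>: "0 \<le> \<xi> x" "\<xi> x \<le> 1" for x by (auto simp: \<xi>_def)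
 have \<xi>0: "\<forall>x. real j + 1 < cmod x \<longrightarrow> \<xi> x = 0" by (auto simp: \<xi>_def)
 have s\<xi>: "1 - d \<le> (\<integral>x. \<xi> x \<partial>\<sigma>)"
 proof -
  have "measure \<sigma> (cball (0::complex) (real j)) = (\<integral>x. indicator (cball 0 (real j)) x \<partial>\<sigma>)" by (simp add: sp)
  also have "\<dots> \<le> (\<integral>x. \<xi> x \<partial>\<sigma>)"
  proof (rule integral_mono)
   show "integrable \<sigma> \<xi>" by (rule prob_integrable_bounded[OF \<sigma> m\<xi>, of 1]) (use \<xi> in auto)
   show "integrable \<sigma> (indicator (cball (0::complex) (real j)) :: _ \<Rightarrow> real)" by (rule prob_integrable_bounded[OF \<sigma>, of _ 1]) (auto simp: indicator_def)
   show "indicator (cball 0 (real j)) x \<le> \<xi> x" for x by (auto simp: indicator_def \<xi>_def)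
  qed
  finally show ?thesis using j by simp
 qed
 have "concentrates \<nu> k \<sigma> \<xi>" by (rule C[OF c\<xi> \<xi>0])
 moreover have "concentrates \<nu> k \<sigma> (\<lambda>x. \<phi> x * \<xi> x)"
  by (rule C[of _ "real j + 1"]) (use \<phi>(1) c\<xi> \<xi>0 in \<open>auto intro: continuous_on_mult\<close>)
 ultimately have "likely \<nu> (\<lambda>n \<zeta>. \<bar>(\<integral>x. \<xi> x \<partial>zeros k n \<zeta>) - (\<integral>x. \<xi> x \<partial>\<sigma>)\<bar> \<le> d \<and> \<bar>(\<integral>x. \<phi> x * \<xi> x \<partial>zeros k n \<zeta>) - (\<integral>x. \<phi> x * \<xi> x \<partial>\<sigma>)\<bar> \<le> d)"
  using d(1) unfolding concentrates_def by (intro likely_conj[OF \<nu>]) auto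
 then show "likely \<nu> (\<lambda>n \<zeta>. \<bar>(\<integral>x. \<phi> x \<partial>zeros k n \<zeta>) - (\<integral>x. \<phi> x \<partial>\<sigma>)\<bar> \<le> e)"
  by (rule likely_mono) (use bounded_test_function[OF zeros_prob \<sigma> m m\<xi> B(2) \<xi> s\<xi>] d(2) in auto)
qed

text \<open>Induction over the generation of \<open>U\<close> from the subbasis: a union bound for
  bad events handles intersections, and for a union one member containing \<open>\<sigma>\<close>
  suffices.\<close>

lemma weak_convergence:
 assumes \<sigma>: "\<sigma> \<in> complex_prob_measures" and \<nu>: "\<And>n. n \<ge> 1 \<Longrightarrow> prob_space (\<nu> n) \<and> sets (\<nu> n) = sets (vol n)"
  and C: "\<And>\<phi>. continuous_on UNIV \<phi> \<Longrightarrow> bounded (range \<phi>) \<Longrightarrow> concentrates \<nu> k \<sigma> \<phi>"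
  and U: "openin weak_topology U" "\<sigma> \<in> U"
 shows "(\<lambda>n. measure (\<nu> n) {\<zeta> \<in> space (vol n). zeros k n \<zeta> \<in> U}) \<longlonglongrightarrow> 1"
proof -
 have "generate_topology_on {{\<mu> \<in> complex_prob_measures. (\<integral>z. \<phi> z \<partial>\<mu>) \<in> V} | \<phi> V.
    continuous_on UNIV (\<phi> :: complex \<Rightarrow> real) \<and> bounded (range \<phi>) \<and> open V} U"
  using U(1) unfolding weak_topology_def by (rule openin_topology_generated_by)
 then have "\<sigma> \<in> U \<longrightarrow> likely \<nu> (\<lambda>n \<zeta>. zeros k n \<zeta> \<in> U)"
 proof induction
  case (Int a b)
  then show ?case using likely_conj[OF \<nu>, of "\<lambda>n \<zeta>. zeros k n \<zeta> \<in> a" "\<lambda>n \<zeta>. zeros k n \<zeta> \<in> b"] by simp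
 next
  case (UN K)
  show ?case
  proof
   assume "\<sigma> \<in> \<Union>K"
   then obtain a where a: "a \<in> K" "\<sigma> \<in> a" by blast
   then have "likely \<nu> (\<lambda>n \<zeta>. zeros k n \<zeta> \<in> a)" using UN.IH by blast
   then show "likely \<nu> (\<lambda>n \<zeta>. zeros k n \<zeta> \<in> \<Union>K)" by (rule likely_mono) (use a in blast)
  qed
 next
  case (Basis s)
  then obtain \<phi> :: "complex \<Rightarrow> real" and V where s: "s = {\<mu> \<in> complex_prob_measures. (\<integral>z. \<phi> z \<partial>\<mu>) \<in> V}"
   and \<phi>: "continuous_on UNIV \<phi>" "bounded (range \<phi>)" and V: "open V" by blast
  show ?case
  proof
   assume "\<sigma> \<in> s"
   then obtain e where e: "0 < e" "cball (\<integral>z. \<phi> z \<partial>\<sigma>) e \<subseteq> V" using V unfolding s open_contains_cball by blast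
   have "likely \<nu> (\<lambda>n \<zeta>. \<bar>(\<integral>x. \<phi> x \<partial>zeros k n \<zeta>) - (\<integral>x. \<phi> x \<partial>\<sigma>)\<bar> \<le> e)" using C[OF \<phi>] e(1) unfolding concentrates_def by blast
   then show "likely \<nu> (\<lambda>n \<zeta>. zeros k n \<zeta> \<in> s)"
   proof (rule likely_mono)
    fix n \<zeta> assume "\<bar>(\<integral>x. \<phi> x \<partial>zeros k n \<zeta>) - (\<integral>x. \<phi> x \<partial>\<sigma>)\<bar> \<le> e"
    then have "(\<integral>x. \<phi> x \<partial>zeros k n \<zeta>) \<in> V" using e(2) by (auto simp: dist_real_def abs_minus_commute)
    then show "zeros k n \<zeta> \<in> s" unfolding s using zeros_prob by simp
   qed
  qed
 qed simp
 then obtain f N where f: "f \<longlonglongrightarrow> 0" and N: "\<And>n. N \<le> n \<Longrightarrow> \<exists>B\<in>sets (vol n). measure (\<nu> n) B \<le> f n \<and> (\<forall>\<zeta>\<in>space (vol n) - B. zeros k n \<zeta> \<in> U)"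
  using U(2) unfolding likely_def by blast
 have bnd: "1 - f n \<le> measure (\<nu> n) {\<zeta> \<in> space (vol n). zeros k n \<zeta> \<in> U} \<and> measure (\<nu> n) {\<zeta> \<in> space (vol n). zeros k n \<zeta> \<in> U} \<le> 1"
  if "N + k + 1 \<le> n" for n
 proof -
  have n: "N \<le> n" "k < n" "1 \<le> n" using that by auto
  let ?A = "{\<zeta> \<in> space (vol n). zeros k n \<zeta> \<in> U}"
  interpret prob_space "\<nu> n" using \<nu>[OF n(3)] by simp
  have sets: "sets (\<nu> n) = sets (vol n)" and sp: "space (\<nu> n) = space (vol n)" using \<nu>[OF n(3)] sets_eq_imp_space_eq by auto
  \<comment> \<open>On a nonmeasurable event \<open>measure\<close> would be 0.\<close>
  have A: "?A \<in> events" unfolding sets by (rule zeros_event_measurable[OF n(2) U(1)])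
  from N[OF n(1)] obtain B where B: "B \<in> events" "prob B \<le> f n" "\<forall>\<zeta>\<in>space (vol n) - B. zeros k n \<zeta> \<in> U" unfolding sets by blast
  have "1 - prob B = prob (space (\<nu> n) - B)" by (rule prob_compl[symmetric, OF B(1)])
  also have "\<dots> \<le> prob ?A" using A B by (intro finite_measure_mono) (auto simp: sp)
  finally show ?thesis using B(2) by simp
 qed
 show ?thesis
 proof (rule tendsto_sandwich)
  show "(\<lambda>n. 1 - f n) \<longlonglongrightarrow> 1" using tendsto_diff[OF tendsto_const f, of 1] by simp
  show "\<forall>\<^sub>F n in sequentially. 1 - f n \<le> measure (\<nu> n) {\<zeta> \<in> space (vol n). zeros k n \<zeta> \<in> U}"
   using bnd by (intro eventually_sequentiallyI) blast
  show "\<forall>\<^sub>F n in sequentially. measure (\<nu> n) {\<zeta> \<in> space (vol n). zeros k n \<zeta> \<in> U} \<le> 1"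
   using bnd by (intro eventually_sequentiallyI) blast
 qed simp
qed

context gas
begin

text \<open>Passes from integrals bounded relative to \<open>Zn\<close> to probabilities, which
  requires \<open>Zn\<close> to be neither 0 nor \<infinity>.\<close>

lemma gas_zeros_converge:
 assumes Z: "\<And>n. n \<ge> 1 \<Longrightarrow> 0 < Zn n \<and> Zn n < \<infinity>" and U: "openin weak_topology U" "\<sigma> \<in> U"
 shows "(\<lambda>n. measure (density (vol n) (\<lambda>\<zeta>. weight n \<zeta> / Zn n)) {\<zeta> \<in> space (vol n). zeros k n \<zeta> \<in> U}) \<longlonglongrightarrow> 1"
proof -
 define \<nu> where "\<nu> n = density (vol n) (\<lambda>\<zeta>. weight n \<zeta> / Zn n)" for n
 have em: "emeasure (\<nu> n) B = (\<integral>\<^sup>+ \<zeta>\<in>B. weight n \<zeta> \<partial>vol n) / Zn n" if "B \<in> sets (vol n)" for n B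
 proof -
  have "emeasure (\<nu> n) B = (\<integral>\<^sup>+ \<zeta>. weight n \<zeta> * indicator B \<zeta> / Zn n \<partial>vol n)"
  proof -
   have m: "(\<lambda>\<zeta>. weight n \<zeta> / Zn n) \<in> borel_measurable (vol n)" by (intro borel_measurable_divide_ennreal weight_measurable borel_measurable_const)
   show ?thesis unfolding \<nu>_def emeasure_density[OF m that] by (intro nn_integral_cong) (auto simp: indicator_def)
  qed
  also have "\<dots> = (\<integral>\<^sup>+ \<zeta>\<in>B. weight n \<zeta> \<partial>vol n) / Zn n" by (rule nn_integral_divide) (use that in measurable)
  finally show ?thesis .
 qed
 have \<nu>: "prob_space (\<nu> n) \<and> sets (\<nu> n) = sets (vol n)" if "n \<ge> 1" for n
 proof
  show s: "sets (\<nu> n) = sets (vol n)" by (simp add: \<nu>_def)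
  have "emeasure (\<nu> n) (space (vol n)) = Zn n / Zn n"
   unfolding em[OF sets.top] Zn_def by (intro arg_cong2[where f = "(/)"] nn_integral_cong) auto
  also have "\<dots> = 1" using Z[OF that] by (intro ennreal_divide_self) auto
  finally show "prob_space (\<nu> n)" by (intro prob_spaceI) (simp add: \<nu>_def)
 qed
 have s: "\<sigma> \<in> complex_prob_measures" using prob_sigma sets_sigma by (simp add: complex_prob_measures_def)
 have C: "concentrates \<nu> k \<sigma> \<phi>" if \<phi>: "continuous_on UNIV \<phi>" "\<forall>x. R < cmod x \<longrightarrow> \<phi> x = 0" for \<phi> R
  unfolding concentrates_def
 proof (intro allI impI)
  fix e :: real assume e: "0 < e"
  have m: "\<phi> \<in> borel_measurable borel" using \<phi>(1) by (rule borel_measurable_continuous_onI)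
  from derivative_zeros_concentrate[OF \<phi>(1) _ e, of R k] \<phi>(2) obtain f N where f: "f \<longlonglongrightarrow> 0" and N: "\<And>n. n \<ge> N \<Longrightarrow> 0 \<le> f n \<and> (\<exists>B\<in>sets (vol n). (\<integral>\<^sup>+ \<zeta>\<in>B. weight n \<zeta> \<partial>vol n) \<le> ennreal (f n) * Zn n \<and>
   (\<forall>\<zeta>\<in>space (vol n) - B. \<bar>(\<Sum>u\<in>#deriv_roots k n \<zeta>. \<phi> u) / real (n - k) - (\<integral>x. \<phi> x \<partial>\<sigma>)\<bar> \<le> e))"
   by blast
  have "\<exists>B\<in>sets (vol n). measure (\<nu> n) B \<le> f n \<and> (\<forall>\<zeta>\<in>space (vol n) - B. \<bar>(\<integral>x. \<phi> x \<partial>zeros k n \<zeta>) - (\<integral>x. \<phi> x \<partial>\<sigma>)\<bar> \<le> e)"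
   if n: "N + k + 1 \<le> n" for n
  proof -
   have n': "N \<le> n" "k < n" "1 \<le> n" using n by auto
   from N[OF n'(1)] obtain B where B: "0 \<le> f n" "B \<in> sets (vol n)" "(\<integral>\<^sup>+ \<zeta>\<in>B. weight n \<zeta> \<partial>vol n) \<le> ennreal (f n) * Zn n"
    "\<forall>\<zeta>\<in>space (vol n) - B. \<bar>(\<Sum>u\<in>#deriv_roots k n \<zeta>. \<phi> u) / real (n - k) - (\<integral>x. \<phi> x \<partial>\<sigma>)\<bar> \<le> e" by blast
   have "emeasure (\<nu> n) B \<le> ennreal (f n) * Zn n / Zn n" unfolding em[OF B(2)] using B(3) by (rule divide_right_mono_ennreal)
   also have "\<dots> = ennreal (f n)" using Z[OF n'(3)] by (intro ennreal_mult_divide_eq) auto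
   finally have "measure (\<nu> n) B \<le> f n" unfolding measure_def using B(1) by (metis enn2real_leI)
   then show ?thesis using B(2,4) integral_zeros[OF m n'(2)] by (intro bexI[of _ B]) auto
  qed
  then show "likely \<nu> (\<lambda>n \<zeta>. \<bar>(\<integral>x. \<phi> x \<partial>zeros k n \<zeta>) - (\<integral>x. \<phi> x \<partial>\<sigma>)\<bar> \<le> e)" unfolding likely_def using f by blast
 qed
 show ?thesis
  unfolding \<nu>_def[symmetric] by (rule weak_convergence[OF s \<nu> concentrates_bounded[OF s \<nu> C] U])
qed

end

section \<open>Superharmonic functions\<close>

text \<open>The lower bound by an integrable \<open>- k\<close> keeps the negative part finite, so
  \<infinity> - \<infinity> cannot occur. The proof compares J + N with P + K, which involves no
  subtraction.\<close>

lemma ereal_integral_shift: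
 assumes f: "f \<in> borel_measurable M" and k: "k \<in> borel_measurable M"
  and low: "\<And>x. x \<in> space M \<Longrightarrow> 0 \<le> k x \<and> ereal (- k x) \<le> f x" and K: "(\<integral>\<^sup>+ x. ennreal (k x) \<partial>M) = ennreal K" "0 \<le> K"
 shows "ereal_integral M f + ereal K = enn2ereal (\<integral>\<^sup>+ x. e2ennreal (f x + ereal (k x)) \<partial>M)"
proof -
 note [measurable] = f k
 define P where "P = (\<integral>\<^sup>+ x. e2ennreal (f x) \<partial>M)"
 define N where "N = (\<integral>\<^sup>+ x. e2ennreal (- f x) \<partial>M)"
 define J where "J = (\<integral>\<^sup>+ x. e2ennreal (f x + ereal (k x)) \<partial>M)"
 have "J + N = (\<integral>\<^sup>+ x. e2ennreal (f x + ereal (k x)) + e2ennreal (- f x) \<partial>M)"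
  unfolding J_def N_def by (subst nn_integral_add) auto
 also have "\<dots> = (\<integral>\<^sup>+ x. e2ennreal (f x) + ennreal (k x) \<partial>M)"
 proof (rule nn_integral_cong)
  fix x assume x: "x \<in> space M"
  show "e2ennreal (f x + ereal (k x)) + e2ennreal (- f x) = e2ennreal (f x) + ennreal (k x)"
  proof (cases "f x")
   case (real r)
   have "0 \<le> k x" "- k x \<le> r" using low[OF x] real by auto
   then show ?thesis using real by (cases "0 \<le> r") (simp_all add: ennreal_plus[symmetric] ennreal_neg del: ennreal_plus)
  qed (use low[OF x] in auto)
 qed
 also have "\<dots> = P + ennreal K" unfolding P_def by (subst nn_integral_add) (auto simp: K)
 finally have eq: "J + N = P + ennreal K" .
 have "N \<le> (\<integral>\<^sup>+ x. ennreal (k x) \<partial>M)" unfolding N_def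
 proof (rule nn_integral_mono)
  fix x assume x: "x \<in> space M"
  have "- f x \<le> ereal (k x)" using low[OF x] by (cases "f x") auto
  then show "e2ennreal (- f x) \<le> ennreal (k x)" using e2ennreal_mono by fastforce
 qed
 then have "N < \<infinity>" unfolding K by (rule le_less_trans) simp
 then obtain n where n: "N = ennreal n" "0 \<le> n" by (cases N) auto
 show ?thesis
 proof (cases P)
  case (real p)
  then have "J \<noteq> \<infinity>" using eq K(2) by (auto simp: ennreal_plus[symmetric] simp del: ennreal_plus)
  then obtain j where j: "J = ennreal j" "0 \<le> j" by (cases J) auto
  have "j + n = p + K" using eq real j n K(2) by (simp add: ennreal_plus[symmetric] del: ennreal_plus)
  then show ?thesis unfolding ereal_integral_def P_def[symmetric] N_def[symmetric] J_def[symmetric]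
   using real j n K(2) by simp
 next
  case top
  then have "J = \<infinity>" using eq n by (cases J) (auto simp: ennreal_plus[symmetric] simp del: ennreal_plus)
  then show ?thesis unfolding ereal_integral_def P_def[symmetric] N_def[symmetric] J_def[symmetric]
   using top n by simp
 qed
qed

section \<open>Lower semicontinuity and disc means\<close>

definition lsc :: "(complex \<Rightarrow> ereal) \<Rightarrow> bool" where
 "lsc f \<longleftrightarrow> (\<forall>a. open {x. a < f x})"

lemma lsc_measurable: "lsc f \<Longrightarrow> f \<in> borel_measurable borel"
 unfolding lsc_def by (intro borel_measurableI_greater) auto

text \<open>A sum exceeds a real level exactly if some real b lies below one summand while the
  remainder lies below the other, so the superlevel set is a union of open sets.\<close>

lemma lsc_add_continuous:
 assumes f: "lsc f" "\<And>x. f x \<noteq> -\<infinity>" and g: "continuous_on UNIV g"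
 shows "lsc (\<lambda>x. ereal (g x) + f x)"
 unfolding lsc_def
proof
 fix a :: ereal
 show "open {x. a < ereal (g x) + f x}"
 proof (cases a)
  case (real r)
  have eq: "ereal r < ereal (g x) + f x \<longleftrightarrow> (\<exists>b. ereal b < f x \<and> r - b < g x)" for x
  proof (cases "f x")
   case (real y)
   have "r < g x + y \<longleftrightarrow> (\<exists>b. b < y \<and> r - b < g x)"
   proof
    assume "r < g x + y"
    then show "\<exists>b. b < y \<and> r - b < g x" by (intro exI[of _ "(y + (r - g x)) / 2"]) (simp add: field_simps)
   qed auto
   then show ?thesis using real by simp
  next
   case PInf
   have "r - (r - g x + 1) < g x" by simp
   then show ?thesis using PInf by (auto intro!: exI[of _ "r - g x + 1"])
  qed (use f(2)[of x] in auto)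
  have "{x. a < ereal (g x) + f x} = (\<Union>b. {x. ereal b < f x} \<inter> {x. r - b < g x})" unfolding real eq by blast
  moreover have "open ({x. ereal b < f x} \<inter> {x. r - b < g x})" for b
   using f(1) open_Collect_less[OF continuous_on_const g, of "r - b"] unfolding lsc_def by (intro open_Int) auto
  ultimately show ?thesis by (simp only:) (intro open_UN ballI)
 next
  case MInf
  have "{x. a < ereal (g x) + f x} = UNIV" using f(2) by (auto simp: MInf)
  then show ?thesis by simp
 qed simp
qed

lemma lsc_bounded_below:
 assumes f: "lsc f" "\<And>x. f x \<noteq> -\<infinity>"
 shows "\<exists>m\<ge>0. \<forall>z\<in>cball 0 R. ereal (- m) \<le> f z"
proof -
 have op: "\<And>B. B \<in> range (\<lambda>m::nat. {x. ereal (- real m) < f x}) \<Longrightarrow> open B" using f(1) by (auto simp: lsc_def)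
 have cov: "cball 0 R \<subseteq> \<Union>(range (\<lambda>m::nat. {x. ereal (- real m) < f x}))"
 proof
  fix z :: complex
  have "\<exists>m::nat. ereal (- real m) < f z"
  proof (cases "f z")
   case (real y)
   obtain m :: nat where "- y < real m" using reals_Archimedean2 by blast
   then show ?thesis using real by (intro exI[of _ m]) simp
  qed (use f(2)[of z] in auto)
  then show "z \<in> \<Union>(range (\<lambda>m::nat. {x. ereal (- real m) < f x}))" by auto
 qed
 obtain D where D: "D \<subseteq> range (\<lambda>m::nat. {x. ereal (- real m) < f x})" "finite D" "cball 0 R \<subseteq> \<Union>D"
  by (rule compactE[OF compact_cball cov op])
 then obtain T where T: "finite T" "D = (\<lambda>m::nat. {x. ereal (- real m) < f x}) ` T" by (meson finite_subset_image)
 show ?thesis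
 proof (intro exI[of _ "real (\<Sum>T)"] conjI ballI)
  fix z assume "z \<in> cball (0::complex) R"
  then obtain m where m: "m \<in> T" "ereal (- real m) < f z" using D(3) T(2) by auto
  have "m \<le> \<Sum>T" using member_le_sum[of m T "\<lambda>x. x"] m(1) T(1) by simp
  then have "ereal (- real (\<Sum>T)) \<le> ereal (- real m)" by (simp del: of_nat_sum)
  then show "ereal (- real (\<Sum>T)) \<le> f z" using m(2) by (rule less_imp_le[OF le_less_trans])
 qed (simp add: sum_nonneg)
qed

lemma superharmonic_lsc: "superharmonic h \<Longrightarrow> lsc h"
 unfolding lsc_def
proof
 fix a assume h: "superharmonic h"
 show "open {x. a < h x}"
 proof (subst open_subopen, intro ballI)
  fix x assume "x \<in> {x. a < h x}"
  then have a: "a < h x" by simp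
  have "h x \<le> Liminf (at x) h" using h by (simp add: superharmonic_def)
  then have "\<forall>\<^sub>F y in at x. a < h y" using a unfolding le_Liminf_iff by blast
  \<comment> \<open>The filter \<open>at x\<close> leaves out the point itself, where the inequality
    is the assumption \<open>a\<close>.\<close>
  then have "\<forall>\<^sub>F y in nhds x. a < h y" using a by (simp add: eventually_nhds_conv_at)
  then show "\<exists>T. open T \<and> x \<in> T \<and> T \<subseteq> {x. a < h x}" unfolding eventually_nhds by blast
 qed
qed

text \<open>The definition of superharmonicity speaks of circles only; averaging over rotations
  assembles them into the disc. The shift by \<open>k\<close> makes the integrand nonnegative there,
  so that nothing is truncated.\<close>

lemma superharmonic_disc_mean:
 assumes h: "superharmonic h" and k: "0 \<le> k" "\<And>u. u \<in> ball z r \<Longrightarrow> ereal (- k) \<le> h u" and hz: "h z = ereal b" and r: "0 < r"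
 shows "(\<integral>\<^sup>+ u\<in>ball z r. e2ennreal (h u + ereal k) \<partial>lborel) \<le> ennreal (pi * r\<^sup>2 * (b + k))"
proof -
 have hm [measurable]: "h \<in> borel_measurable borel" using h by (intro lsc_measurable superharmonic_lsc)
 have bk: "0 \<le> b + k" using k(2)[of z] hz r by simp
 have circle: "(\<integral>\<^sup>+ t\<in>{0..2*pi}. e2ennreal (h (z + of_real s * cis t) + ereal k) \<partial>lborel) \<le> ennreal (2 * pi * (b + k))"
  if s: "0 < s" "s < r" for s
 proof -
  let ?M = "restrict_space lborel {0..2 * pi} :: real measure" and ?F = "\<lambda>t. h (z + of_real s * cis t)"
  define I where "I = ereal_integral ?M ?F"
  define J where "J = (\<integral>\<^sup>+ t. e2ennreal (?F t + ereal k) \<partial>?M)"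
  have J: "(\<integral>\<^sup>+ t\<in>{0..2*pi}. e2ennreal (?F t + ereal k) \<partial>lborel) = J"
   unfolding J_def by (rule nn_integral_restrict_space[symmetric]) simp
  have "I + ereal (2 * pi * k) = enn2ereal J" unfolding I_def J_def
  proof (rule ereal_integral_shift)
   show "?F \<in> borel_measurable ?M" by (rule measurable_restrict_space1) measurable
   show "(\<integral>\<^sup>+ x. ennreal k \<partial>?M) = ennreal (2 * pi * k)"
    using k(1) by (simp add: emeasure_restrict_space ennreal_mult mult.commute)
   show "0 \<le> k \<and> ereal (- k) \<le> ?F t" for t
    using k s by (auto simp: dist_norm norm_mult)
  qed (use k in auto)
  moreover have "I \<le> ereal (2 * pi * b)"
  proof -
   have "ereal (1 / (2 * pi)) * I \<le> ereal b" using h s(1) hz unfolding superharmonic_def circle_mean_def I_def by metis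
   then show ?thesis by (cases I) (auto simp: field_simps)
  qed
  ultimately have "enn2ereal J \<le> ereal (2 * pi * (b + k))"
   by (metis add_right_mono distrib_left plus_ereal.simps(1))
  then have "e2ennreal (enn2ereal J) \<le> e2ennreal (ereal (2 * pi * (b + k)))" by (rule e2ennreal_mono)
  then show ?thesis unfolding J by simp
 qed
 let ?H = "\<lambda>v. e2ennreal (h (z + v) + ereal k)"
 have "ennreal (2 * pi) * (\<integral>\<^sup>+ v\<in>ball 0 r. ?H v \<partial>lborel) = (\<integral>\<^sup>+ v\<in>ball 0 r. (\<integral>\<^sup>+ t\<in>{0..2*pi}. ?H (of_real (cmod v) * cis t) \<partial>lborel) \<partial>lborel)"
  by (rule nn_integral_rotation_average) measurable
 also have "\<dots> \<le> (\<integral>\<^sup>+ v. ennreal (2 * pi * (b + k)) * indicator (ball (0::complex) r) v \<partial>lborel)"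
 proof (rule nn_integral_mono_AE)
  have "AE v in lborel. cmod (v - 0) \<noteq> 0" by (rule AE_cmod_neq)
  then show "AE v in lborel. (\<integral>\<^sup>+ t\<in>{0..2*pi}. ?H (of_real (cmod v) * cis t) \<partial>lborel) * indicator (ball 0 r) v \<le> ennreal (2 * pi * (b + k)) * indicator (ball 0 r) v"
  proof eventually_elim
   case (elim v)
   then show ?case using circle[of "cmod v"] by (auto simp: indicator_def)
  qed
 qed
 also have "\<dots> = ennreal (2 * pi * (b + k)) * ennreal (pi * r\<^sup>2)"
  using r by (subst nn_integral_cmult_indicator) (auto simp: emeasure_ball_complex)
 also have "\<dots> = ennreal (2 * pi) * ennreal (pi * r\<^sup>2 * (b + k))"
  using bk by (simp add: ennreal_mult'[symmetric] mult_ac)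
 finally have "(\<integral>\<^sup>+ v\<in>ball 0 r. ?H v \<partial>lborel) \<le> ennreal (pi * r\<^sup>2 * (b + k))"
  by (subst (asm) ennreal_mult_le_mult_iff) auto
 moreover have "(\<integral>\<^sup>+ u\<in>ball z r. e2ennreal (h u + ereal k) \<partial>lborel) = (\<integral>\<^sup>+ v\<in>ball 0 r. ?H v \<partial>lborel)"
  by (subst nn_integral_ball_shift) auto
 ultimately show ?thesis by simp
qed

text \<open>The continuous part changes by at most \<open>e\<close> on the disc, and the
  superharmonic part has mean at most its value at the centre. If \<open>h\<close> is infinite at
  the centre, the bound is trivial.\<close>

lemma disc_usc_superharmonic:
 assumes h: "superharmonic h" and g: "continuous_on UNIV g" and pos: "\<And>z. 0 \<le> ereal (g z) + h z"
 shows "disc_usc (\<lambda>z. e2ennreal (ereal (g z) + h z))"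
 unfolding disc_usc_def
proof (intro allI impI)
 fix R e :: real assume e: "0 < e"
 have lh: "lsc h" using h by (rule superharmonic_lsc)
 have nh: "h z \<noteq> -\<infinity>" for z using h by (simp add: superharmonic_def)
 have hm [measurable]: "h \<in> borel_measurable borel" using lh by (rule lsc_measurable)
 have gm [measurable]: "g \<in> borel_measurable borel" using g by (rule borel_measurable_continuous_onI)
 from uniform_close_on_balls[OF g e, of R] obtain r0 where r0: "0 < r0" "r0 \<le> 1" "\<forall>z\<in>cball 0 R. \<forall>u\<in>ball z r0. \<bar>g u - g z\<bar> \<le> e" by blast
 from lsc_bounded_below[OF lh nh, of "R + 1"] obtain m where m: "0 \<le> m" "\<And>z. z \<in> cball 0 (R + 1) \<Longrightarrow> ereal (- m) \<le> h z" by blast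
 have "bounded (g ` cball 0 R)" using g by (intro compact_imp_bounded compact_continuous_image) (auto intro: continuous_on_subset)
 then obtain G where "\<forall>x\<in>g ` cball 0 R. norm x \<le> G" unfolding bounded_iff by blast
 then have G: "\<bar>g z\<bar> \<le> G" if "z \<in> cball 0 R" for z using that by (simp del: mem_cball)
 \<comment> \<open>Covers the lower bound of \<open>h\<close> on the larger disc and keeps
   \<open>k - g z - e\<close> nonnegative, the amount added for the comparison with
   \<open>h + k\<close>.\<close>
 define k where "k = m + \<bar>G\<bar> + e"
 have "(\<integral>\<^sup>+ u\<in>ball z r. e2ennreal (ereal (g u) + h u) \<partial>lborel) \<le> ennreal (pi * r\<^sup>2) * (e2ennreal (ereal (g z) + h z) + ennreal e)"
  if r: "0 < r" "r \<le> r0" and z: "z \<in> cball 0 R" for r z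
 proof (cases "h z")
  case (real b)
  have kz: "0 \<le> k - g z - e" using G[OF z] m e by (simp add: k_def)
  have hk: "ereal (- k) \<le> h u" if "u \<in> ball z r" for u
  proof -
   have "cmod u \<le> cmod z + cmod (u - z)" by (metis add.commute diff_add_cancel norm_triangle_ineq)
   moreover have "cmod (u - z) < 1" using that r r0 by (simp add: dist_norm norm_minus_commute)
   ultimately have "u \<in> cball 0 (R + 1)" using z by simp
   then have "ereal (- m) \<le> h u" by (rule m(2))
   moreover have "ereal (- k) \<le> ereal (- m)" using e by (simp add: k_def)
   ultimately show ?thesis by (rule order_trans[rotated])
  qed
  have "(\<integral>\<^sup>+ u\<in>ball z r. e2ennreal (ereal (g u) + h u) \<partial>lborel) + ennreal (k - g z - e) * ennreal (pi * r\<^sup>2)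
   = (\<integral>\<^sup>+ u. e2ennreal (ereal (g u) + h u) * indicator (ball z r) u + ennreal (k - g z - e) * indicator (ball z r) u \<partial>lborel)"
   using r by (subst nn_integral_add) (auto simp: nn_integral_cmult_indicator emeasure_ball_complex)
  also have "\<dots> \<le> (\<integral>\<^sup>+ u\<in>ball z r. e2ennreal (h u + ereal k) \<partial>lborel)"
  proof (rule nn_integral_mono)
   fix u
   show "e2ennreal (ereal (g u) + h u) * indicator (ball z r) u + ennreal (k - g z - e) * indicator (ball z r) u \<le> e2ennreal (h u + ereal k) * indicator (ball z r) u"
   proof (cases "u \<in> ball z r")
    case True
    then have "\<bar>g u - g z\<bar> \<le> e" using r0(3) z r(2) by auto
    then have gu: "g u \<le> g z + e" by simp
    show ?thesis
    proof (cases "h u")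
     case (real y)
     have "0 \<le> g u + y" using pos[of u] real by simp
     then show ?thesis using True real gu kz by (simp add: ennreal_plus[symmetric] ennreal_leI del: ennreal_plus)
    qed (use True nh in auto)
   qed simp
  qed
  also have "\<dots> \<le> ennreal (pi * r\<^sup>2 * (b + k))"
   using m e by (intro superharmonic_disc_mean[OF h _ hk real r(1)]) (auto simp: k_def)
  finally have le: "(\<integral>\<^sup>+ u\<in>ball z r. e2ennreal (ereal (g u) + h u) \<partial>lborel) + ennreal ((k - g z - e) * (pi * r\<^sup>2)) \<le> ennreal (pi * r\<^sup>2 * (b + k))"
   using kz by (simp add: ennreal_mult)
  have gb: "0 \<le> g z + b" using pos[of z] real by simp
  have "(\<integral>\<^sup>+ u\<in>ball z r. e2ennreal (ereal (g u) + h u) \<partial>lborel) \<noteq> \<infinity>" using le by (auto simp: top_unique)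
  then obtain x where x: "(\<integral>\<^sup>+ u\<in>ball z r. e2ennreal (ereal (g u) + h u) \<partial>lborel) = ennreal x" "0 \<le> x"
   by (cases "\<integral>\<^sup>+ u\<in>ball z r. e2ennreal (ereal (g u) + h u) \<partial>lborel") auto
  have "0 \<le> (k - g z - e) * (pi * r\<^sup>2)" using kz by simp
  then have sum: "ennreal (x + (k - g z - e) * (pi * r\<^sup>2)) \<le> ennreal (pi * r\<^sup>2 * (b + k))" using le x by simp
  have "0 \<le> b + k" using hk[of z] real r by simp
  then have "x + (k - g z - e) * (pi * r\<^sup>2) \<le> pi * r\<^sup>2 * (b + k)" using sum by (simp add: ennreal_le_iff)
  then have "x \<le> pi * r\<^sup>2 * (g z + b + e)" by (simp add: algebra_simps)
  then have "ennreal x \<le> ennreal (pi * r\<^sup>2 * (g z + b + e))" by (rule ennreal_leI)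
  also have "\<dots> = ennreal (pi * r\<^sup>2) * (ennreal (g z + b) + ennreal e)"
   using gb e by (simp add: ennreal_mult'[symmetric] ennreal_plus[symmetric] del: ennreal_plus)
  finally show ?thesis using x real by simp
 qed (use r nh in \<open>auto simp: ennreal_mult_eq_top_iff\<close>)
 then show "\<exists>r0>0. \<forall>r>0. r \<le> r0 \<longrightarrow> (\<forall>z\<in>cball 0 R. (\<integral>\<^sup>+ u\<in>ball z r. e2ennreal (ereal (g u) + h u) \<partial>lborel) \<le> ennreal (pi * r\<^sup>2) * (e2ennreal (ereal (g z) + h z) + ennreal e))"
  using r0(1) by blast
qed

lemma lsc_sequentially:
 assumes f: "lsc f" "\<And>x. 0 \<le> f x" and X: "X \<longlonglongrightarrow> z"
 shows "e2ennreal (f z) \<le> liminf (\<lambda>n. e2ennreal (f (X n)))"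
 unfolding le_Liminf_iff
proof (intro allI impI)
 fix y assume "y < e2ennreal (f z)"
 then have "enn2ereal y < f z" using enn2ereal_e2ennreal[OF f(2)[of z]] by (metis less_ennreal.rep_eq)
 moreover have "open {x. enn2ereal y < f x}" using f(1) by (simp add: lsc_def)
 ultimately have "\<forall>\<^sub>F n in sequentially. X n \<in> {x. enn2ereal y < f x}" using X by (intro topological_tendstoD) auto
 then show "\<forall>\<^sub>F n in sequentially. y < e2ennreal (f (X n))"
 proof eventually_elim
  case (elim n)
  then show ?case using enn2ereal_e2ennreal[OF f(2)[of "X n"]] by (simp add: less_ennreal.rep_eq)
 qed
qed

text \<open>Half of the quadratic growth is spent on absorbing \<open>ell\<close>, so that Q - ell
  still grows quadratically and becomes nonnegative after adding a constant.\<close>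

lemma quadratic_growth:
 assumes lq: "lsc Q" "\<And>z. Q z \<noteq> -\<infinity>" and L: "Liminf at_infinity (\<lambda>z. Q z / ereal ((cmod z)\<^sup>2)) > 0"
 shows "\<exists>c>0. \<exists>C\<ge>0. \<forall>z. ereal (c * (cmod z)\<^sup>2 + ell z) \<le> Q z + ereal C"
proof -
 obtain c where c: "0 < ereal c" "ereal c < Liminf at_infinity (\<lambda>z. Q z / ereal ((cmod z)\<^sup>2))" using ereal_dense2[OF L] by blast
 then have c0: "0 < c" by simp
 from less_LiminfD[OF c(2)] obtain b where b: "\<And>z. b \<le> cmod z \<Longrightarrow> ereal c < Q z / ereal ((cmod z)\<^sup>2)" unfolding eventually_at_infinity by blast
 define R where "R = max b 1"
 have big: "ereal (c * (cmod z)\<^sup>2) \<le> Q z" if "R \<le> cmod z" for z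
 proof -
  have z: "b \<le> cmod z" "0 < (cmod z)\<^sup>2" using that by (auto simp: R_def)
  show ?thesis using b[OF z(1)] z(2) lq(2)[of z] by (cases "Q z") (auto simp: field_simps)
 qed
 define a where "a = c / 2"
 have a0: "0 < a" using c0 by (simp add: a_def)
 \<comment> \<open>From ln y \<le> y - 1 at y = a (1 + |z|^2).\<close>
 define K where "K = \<bar>a - 1 - ln a\<bar>"
 have ellK: "ell z \<le> a * (cmod z)\<^sup>2 + K" for z
 proof -
  have p: "0 < 1 + (cmod z)\<^sup>2" by (simp add: add_pos_nonneg)
  have "ln (a * (1 + (cmod z)\<^sup>2)) \<le> a * (1 + (cmod z)\<^sup>2) - 1" using a0 p by (intro ln_le_minus_one) simp
  moreover have "ln (a * (1 + (cmod z)\<^sup>2)) = ln a + ell z" unfolding ell_def using a0 p by (simp add: ln_mult)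
  ultimately show ?thesis unfolding K_def by (simp add: algebra_simps)
 qed
 from lsc_bounded_below[OF lq, of R] obtain m where m: "0 \<le> m" "\<And>z. z \<in> cball 0 R \<Longrightarrow> ereal (- m) \<le> Q z" by blast
 define C where "C = K + m + R\<^sup>2 + a * R\<^sup>2"
 have "ereal (a * (cmod z)\<^sup>2 + ell z) \<le> Q z + ereal C" for z
 proof (cases "R \<le> cmod z")
  case True
  have "a * (cmod z)\<^sup>2 + ell z \<le> c * (cmod z)\<^sup>2 + K" using ellK[of z] by (simp add: a_def)
  also have "\<dots> \<le> c * (cmod z)\<^sup>2 + C" using m(1) a0 by (simp add: C_def)
  finally have "ereal (a * (cmod z)\<^sup>2 + ell z) \<le> ereal (c * (cmod z)\<^sup>2) + ereal C" by simp
  also have "\<dots> \<le> Q z + ereal C" using big[OF True] by (rule add_right_mono)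
  finally show ?thesis .
 next
  case False
  have sq: "(cmod z)\<^sup>2 \<le> R\<^sup>2" using False by (intro power_mono) auto
  then have "a * (cmod z)\<^sup>2 + ell z \<le> a * R\<^sup>2 + R\<^sup>2" using ell_le[of z] a0 by (intro add_mono mult_left_mono) auto
  also have "\<dots> \<le> - m + C" by (simp add: C_def K_def)
  finally have "ereal (a * (cmod z)\<^sup>2 + ell z) \<le> ereal (- m) + ereal C" by simp
  also have "\<dots> \<le> Q z + ereal C" using m(2)[of z] False by (intro add_right_mono) auto
  finally show ?thesis .
 qed
 moreover have "0 \<le> C" using m(1) a0 by (simp add: C_def K_def)
 ultimately show ?thesis using a0 by blast
qed

section \<open>Weighted energies and Gibbs weights\<close>

text \<open>On some bounded set of positive measure \<open>q\<close> is bounded; the uniform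
  distribution there has finite energy, so the minimal energy is finite.\<close>

lemma finite_energy_competitor:
 assumes [measurable]: "q \<in> borel_measurable borel" and pos: "0 < emeasure lborel {z :: complex. q z < \<infinity>}"
 shows "\<exists>\<nu>\<in>complex_prob_measures. kap_energy \<nu> + (\<integral>\<^sup>+ z. q z \<partial>\<nu>) < \<infinity>"
proof -
 define A where "A j = {z \<in> cball 0 (real j). q z \<le> of_nat j}" for j :: nat
 have [measurable]: "A j \<in> sets borel" for j unfolding A_def by measurable
 have rA: "range A \<subseteq> sets lborel" by auto
 have "{z. q z < \<infinity>} \<subseteq> (\<Union>j. A j)"
 proof
  fix z assume "z \<in> {z. q z < \<infinity>}"
  then obtain x where x: "q z = ennreal x" "0 \<le> x" by (cases "q z") auto
  obtain j :: nat where j: "max x (cmod z) \<le> real j" using real_arch_simple by blast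
  then have "z \<in> A j" unfolding A_def using x by (simp add: ennreal_of_nat_eq_real_of_nat ennreal_leI)
  then show "z \<in> (\<Union>j. A j)" by blast
 qed
 then have "emeasure lborel {z. q z < \<infinity>} \<le> emeasure lborel (\<Union>j. A j)" by (intro emeasure_mono) auto
 then have "emeasure lborel (\<Union>j. A j) \<noteq> 0" using pos by auto
 then obtain j where j: "emeasure lborel (A j) \<noteq> 0" using emeasure_UN_eq_0[of lborel A, OF _ rA] by blast
 have "emeasure lborel (A j) \<le> emeasure lborel (cball (0::complex) (real j))" by (intro emeasure_mono) (auto simp: A_def)
 also have "\<dots> < \<infinity>" by (simp add: emeasure_cball_complex)
 finally have fin: "emeasure lborel (A j) < \<infinity>" .
 define c where "c = 1 / emeasure lborel (A j)"
 have c: "c < \<infinity>" "c * emeasure lborel (A j) = 1"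
 proof -
  obtain a where a: "emeasure lborel (A j) = ennreal a" "0 < a" using j fin by (cases "emeasure lborel (A j)") (auto simp: less_le)
  have "c = ennreal (1 / a)" unfolding c_def a using divide_ennreal[of 1 a] a by simp
  then show "c < \<infinity>" "c * emeasure lborel (A j) = 1" using a by (simp_all add: ennreal_mult[symmetric])
 qed
 define \<nu> where "\<nu> = density lborel (\<lambda>z. c * indicator (A j) z)"
 have "emeasure \<nu> (space \<nu>) = c * emeasure lborel (A j)"
  unfolding \<nu>_def by (simp add: emeasure_density nn_integral_cmult_indicator)
 then have "prob_space \<nu>" using c by (intro prob_spaceI) simp
 then have "\<nu> \<in> complex_prob_measures" by (simp add: complex_prob_measures_def \<nu>_def)
 moreover have "kap_energy \<nu> < \<infinity>" unfolding \<nu>_def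
  by (rule kap_energy_bounded_density[of _ "real j"]) (use c in \<open>auto simp: A_def\<close>)
 moreover have "(\<integral>\<^sup>+ z. q z \<partial>\<nu>) < \<infinity>"
 proof -
  have "(\<integral>\<^sup>+ z. q z \<partial>\<nu>) = (\<integral>\<^sup>+ z. c * indicator (A j) z * q z \<partial>lborel)" unfolding \<nu>_def by (simp add: nn_integral_density)
  also have "\<dots> \<le> (\<integral>\<^sup>+ z. c * of_nat j * indicator (A j) z \<partial>lborel)"
   by (intro nn_integral_mono) (auto simp: A_def indicator_def intro!: mult_left_mono)
  also have "\<dots> = c * of_nat j * emeasure lborel (A j)" by (simp add: nn_integral_cmult_indicator)
  also have "\<dots> < \<infinity>" using c(1) fin by (simp add: ennreal_mult_less_top of_nat_less_top)
  finally show ?thesis .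
 qed
 ultimately show ?thesis by (intro bexI[of _ \<nu>]) (auto simp: less_top)
qed

text \<open>The weight \<open>ell\<close> moves between the kernel and the potential: with \<open>L = (\<integral>ell d\<nu>)\<close>, the logarithmic
 energy is \<open>2 kap_energy \<nu> - 2 L\<close> and \<open>\<integral>Q d\<nu> = (\<integral>q d\<nu>) + L - C\<close>, so \<open>L\<close> cancels in the weighted energy.\<close>

lemma ereal_integral_potential:
 assumes \<nu>: "\<nu> \<in> complex_prob_measures" and Qm: "Q \<in> borel_measurable borel" and qm: "q \<in> borel_measurable borel"
  and C: "0 \<le> C" and Q: "\<And>z. Q z = enn2ereal (q z) + ereal (ell z - C)"
 shows "ereal_integral \<nu> Q + ereal C = enn2ereal ((\<integral>\<^sup>+ z. q z \<partial>\<nu>) + (\<integral>\<^sup>+ z. ennreal (ell z) \<partial>\<nu>))"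
proof -
 interpret prob_space \<nu> using \<nu> by (simp add: complex_prob_measures_def)
 have s [measurable_cong]: "sets \<nu> = sets borel" using \<nu> by (simp add: complex_prob_measures_def)
 note [measurable] = Qm qm
 have "ereal_integral \<nu> Q + ereal C = enn2ereal (\<integral>\<^sup>+ z. e2ennreal (Q z + ereal C) \<partial>\<nu>)"
 proof (rule ereal_integral_shift)
  show "0 \<le> C \<and> ereal (- C) \<le> Q z" for z
  proof -
   have "ereal (- C) \<le> ereal (ell z - C)" by simp
   also have "\<dots> \<le> Q z" unfolding Q by (rule add_increasing) auto
   finally show ?thesis using C by simp
  qed
  show "(\<integral>\<^sup>+ z. ennreal C \<partial>\<nu>) = ennreal C" by (simp add: emeasure_space_1)
 qed (use C in auto)
 also have "(\<integral>\<^sup>+ z. e2ennreal (Q z + ereal C) \<partial>\<nu>) = (\<integral>\<^sup>+ z. q z + ennreal (ell z) \<partial>\<nu>)"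
 proof (rule nn_integral_cong)
  fix z
  show "e2ennreal (Q z + ereal C) = q z + ennreal (ell z)"
   unfolding Q by (cases "q z") (simp_all add: ennreal_plus)
 qed
 also have "\<dots> = (\<integral>\<^sup>+ z. q z \<partial>\<nu>) + (\<integral>\<^sup>+ z. ennreal (ell z) \<partial>\<nu>)" by (rule nn_integral_add) auto
 finally show ?thesis .
qed

lemma ereal_integral_log_kernel:
 assumes \<nu>: "\<nu> \<in> complex_prob_measures" and L: "(\<integral>\<^sup>+ z. ennreal (ell z) \<partial>\<nu>) = ennreal L" "0 \<le> L"
 shows "ereal_integral (\<nu> \<Otimes>\<^sub>M \<nu>) (\<lambda>(z, w). log_kernel z w) + ereal (2 * L) = enn2ereal (2 * kap_energy \<nu>)"
proof -
 interpret prob_space \<nu> using \<nu> by (simp add: complex_prob_measures_def)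
 have s [measurable_cong]: "sets \<nu> = sets borel" using \<nu> by (simp add: complex_prob_measures_def)
 let ?k = "\<lambda>(z, w). ell z + ell w"
 have lm: "(\<lambda>(z, w). log_kernel z w) \<in> borel_measurable (\<nu> \<Otimes>\<^sub>M \<nu>)" unfolding log_kernel_def split_beta' by measurable
 have eq: "log_kernel z w + ereal (ell z + ell w) = enn2ereal (2 * kap z w)" and low: "ereal (- (ell z + ell w)) \<le> log_kernel z w" for z w
 proof -
  have "log_kernel z w + ereal (ell z + ell w) = enn2ereal (2 * kap z w) \<and> ereal (- (ell z + ell w)) \<le> log_kernel z w"
  proof (cases "z = w")
   case True
   then show ?thesis by (simp add: log_kernel_def kap_def ennreal_mult_top)
  next
   case False
   have l: "ln (1 / (cmod (z - w))\<^sup>2) = - 2 * ln (cmod (z - w))" using False by (simp add: ln_div ln_realpow)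
   have "ln (cmod (z - w)) \<le> (ell z + ell w) / 2" by (rule ln_cmod_diff_le[OF False])
   then have p: "0 \<le> (ell z + ell w) / 2 - ln (cmod (z - w))" by simp
   have "2 * kap z w = ennreal (2 * ((ell z + ell w) / 2 - ln (cmod (z - w))))"
    using ennreal_mult[of 2 "(ell z + ell w) / 2 - ln (cmod (z - w))"] False p by (simp add: kap_def)
   then show ?thesis using False p l by (simp add: log_kernel_def)
  qed
  then show "log_kernel z w + ereal (ell z + ell w) = enn2ereal (2 * kap z w)" "ereal (- (ell z + ell w)) \<le> log_kernel z w" by auto
 qed
 have "ereal_integral (\<nu> \<Otimes>\<^sub>M \<nu>) (\<lambda>(z, w). log_kernel z w) + ereal (2 * L)
  = enn2ereal (\<integral>\<^sup>+ p. e2ennreal ((\<lambda>(z, w). log_kernel z w) p + ereal (?k p)) \<partial>(\<nu> \<Otimes>\<^sub>M \<nu>))"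
 proof (rule ereal_integral_shift[OF lm])
  show "?k \<in> borel_measurable (\<nu> \<Otimes>\<^sub>M \<nu>)" by measurable
  show "0 \<le> ?k p \<and> ereal (- ?k p) \<le> (\<lambda>(z, w). log_kernel z w) p" for p
   using low by (cases p) (simp add: add_nonneg_nonneg)
  have "(\<integral>\<^sup>+ p. ennreal (?k p) \<partial>(\<nu> \<Otimes>\<^sub>M \<nu>)) = (\<integral>\<^sup>+ z. \<integral>\<^sup>+ w. ennreal (ell z) + ennreal (ell w) \<partial>\<nu> \<partial>\<nu>)"
   by (subst nn_integral_fst[symmetric]) (auto simp: ennreal_plus split_beta')
  also have "\<dots> = (\<integral>\<^sup>+ z. ennreal (ell z) + ennreal L \<partial>\<nu>)"
   by (intro nn_integral_cong) (subst nn_integral_add, auto simp: L emeasure_space_1)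
  also have "\<dots> = ennreal L + ennreal L" by (subst nn_integral_add) (auto simp: L emeasure_space_1)
  also have "\<dots> = ennreal (2 * L)" using L(2) by (simp add: ennreal_plus[symmetric] del: ennreal_plus)
  finally show "(\<integral>\<^sup>+ p. ennreal (?k p) \<partial>(\<nu> \<Otimes>\<^sub>M \<nu>)) = ennreal (2 * L)" .
  show "0 \<le> 2 * L" using L by simp
 qed
 also have "(\<integral>\<^sup>+ p. e2ennreal ((\<lambda>(z, w). log_kernel z w) p + ereal (?k p)) \<partial>(\<nu> \<Otimes>\<^sub>M \<nu>)) = (\<integral>\<^sup>+ p. 2 * (\<lambda>(z, w). kap z w) p \<partial>(\<nu> \<Otimes>\<^sub>M \<nu>))"
  by (intro nn_integral_cong) (auto simp: eq simp del: plus_ereal.simps)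
 also have "\<dots> = 2 * (\<integral>\<^sup>+ p. (\<lambda>(z, w). kap z w) p \<partial>(\<nu> \<Otimes>\<^sub>M \<nu>))" by (rule nn_integral_cmult) measurable
 also have "(\<integral>\<^sup>+ p. (\<lambda>(z, w). kap z w) p \<partial>(\<nu> \<Otimes>\<^sub>M \<nu>)) = kap_energy \<nu>"
  unfolding kap_energy_def by (subst nn_integral_fst[symmetric]) auto
 finally show ?thesis .
qed

text \<open>When the integral of \<open>q\<close> is finite, so is that of \<open>ell\<close>, by
  \<open>c1 * ell \<le> q\<close>, and both parts of the weighted energy can be computed. When it is
  infinite, the potential term is \<infinity>, and by the convention of \<open>ereal\<close> so is
  the sum.\<close>

lemma weighted_energy_kap:
 assumes \<nu>: "\<nu> \<in> complex_prob_measures" and Qm: "Q \<in> borel_measurable borel" and qm: "q \<in> borel_measurable borel"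
  and C: "0 \<le> C" and Q: "\<And>z. Q z = enn2ereal (q z) + ereal (ell z - C)"
  and c1: "0 < c1" "\<And>z. ennreal (c1 * (cmod z)\<^sup>2) \<le> q z"
 defines "J \<equiv> kap_energy \<nu> + (\<integral>\<^sup>+ z. q z \<partial>\<nu>)"
 shows "J < \<infinity> \<Longrightarrow> weighted_energy Q \<nu> = ereal (2 * enn2real J - 2 * C)"
  and "weighted_energy Q \<nu> < \<infinity> \<Longrightarrow> J < \<infinity>"
proof -
 interpret prob_space \<nu> using \<nu> by (simp add: complex_prob_measures_def)
 have s [measurable_cong]: "sets \<nu> = sets borel" using \<nu> by (simp add: complex_prob_measures_def)
 note [measurable] = Qm qm
 define E1 where "E1 = ereal_integral (\<nu> \<Otimes>\<^sub>M \<nu>) (\<lambda>(z, w). log_kernel z w)"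
 define E2 where "E2 = ereal_integral \<nu> Q"
 have W: "weighted_energy Q \<nu> = E1 + 2 * E2" by (simp add: weighted_energy_def E1_def E2_def)
 note P = ereal_integral_potential[OF \<nu> Qm qm C Q, folded E2_def]
 have fin: "\<exists>x L. (\<integral>\<^sup>+ z. q z \<partial>\<nu>) = ennreal x \<and> 0 \<le> x \<and> (\<integral>\<^sup>+ z. ennreal (ell z) \<partial>\<nu>) = ennreal L \<and> 0 \<le> L" if f: "(\<integral>\<^sup>+ z. q z \<partial>\<nu>) < \<infinity>"
 proof -
  have "ennreal c1 * (\<integral>\<^sup>+ z. ennreal (ell z) \<partial>\<nu>) = (\<integral>\<^sup>+ z. ennreal c1 * ennreal (ell z) \<partial>\<nu>)" by (rule nn_integral_cmult[symmetric]) measurable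
  also have "\<dots> \<le> (\<integral>\<^sup>+ z. q z \<partial>\<nu>)"
  proof (rule nn_integral_mono)
   fix z
   have "ennreal c1 * ennreal (ell z) \<le> ennreal (c1 * (cmod z)\<^sup>2)"
    using c1(1) ell_le[of z] by (simp add: ennreal_mult'[symmetric] ennreal_leI)
   then show "ennreal c1 * ennreal (ell z) \<le> q z" using c1(2)[of z] by (rule order_trans)
  qed
  finally have "ennreal c1 * (\<integral>\<^sup>+ z. ennreal (ell z) \<partial>\<nu>) < \<infinity>" using f by (rule le_less_trans)
  then have "(\<integral>\<^sup>+ z. ennreal (ell z) \<partial>\<nu>) < \<infinity>" using c1(1)
   by (cases "\<integral>\<^sup>+ z. ennreal (ell z) \<partial>\<nu>") (simp_all add: ennreal_mult_top)
  then show ?thesis using f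
   by (cases "\<integral>\<^sup>+ z. ennreal (ell z) \<partial>\<nu>"; cases "\<integral>\<^sup>+ z. q z \<partial>\<nu>") auto
 qed
 have E2: "E2 = ereal (x + L - C)" if "(\<integral>\<^sup>+ z. q z \<partial>\<nu>) = ennreal x" "0 \<le> x" "(\<integral>\<^sup>+ z. ennreal (ell z) \<partial>\<nu>) = ennreal L" "0 \<le> L" for x L
  using P that by (cases E2) (simp_all add: ennreal_plus[symmetric] del: ennreal_plus)
 show "weighted_energy Q \<nu> = ereal (2 * enn2real J - 2 * C)" if J: "J < \<infinity>"
 proof -
  have f: "(\<integral>\<^sup>+ z. q z \<partial>\<nu>) < \<infinity>" "kap_energy \<nu> < \<infinity>" using J by (auto simp: J_def)
  from fin[OF f(1)] obtain x L where x: "(\<integral>\<^sup>+ z. q z \<partial>\<nu>) = ennreal x" "0 \<le> x" "(\<integral>\<^sup>+ z. ennreal (ell z) \<partial>\<nu>) = ennreal L" "0 \<le> L" by blast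
  from f(2) obtain y where y: "kap_energy \<nu> = ennreal y" "0 \<le> y" by (cases "kap_energy \<nu>") auto
  have "E1 + ereal (2 * L) = ereal (2 * y)"
  proof -
   have "2 * ennreal y = ennreal (2 * y)" using ennreal_mult[of 2 y] y by simp
   moreover have "enn2ereal (ennreal (2 * y)) = ereal (2 * y)" using y by (intro enn2ereal_ennreal) simp
   ultimately show ?thesis using ereal_integral_log_kernel[OF \<nu> x(3,4), folded E1_def] y(1) by (simp only:)
  qed
  then have "E1 = ereal (2 * y - 2 * L)" by (cases E1) auto
  moreover have "enn2real J = y + x" unfolding J_def using x y by (simp add: ennreal_plus[symmetric] del: ennreal_plus)
  ultimately show ?thesis unfolding W E2[OF x] by (simp add: algebra_simps)
 qed
 show "J < \<infinity>" if "weighted_energy Q \<nu> < \<infinity>"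
 proof -
  have f: "(\<integral>\<^sup>+ z. q z \<partial>\<nu>) < \<infinity>"
  proof (rule ccontr)
   assume "\<not> ?thesis"
   then have "(\<integral>\<^sup>+ z. q z \<partial>\<nu>) = \<infinity>" by (simp add: less_top[symmetric])
   then have "E2 = \<infinity>" using P by (cases E2) auto
   then show False using that unfolding W by simp
  qed
  from fin[OF f] obtain x L where x: "(\<integral>\<^sup>+ z. q z \<partial>\<nu>) = ennreal x" "0 \<le> x" "(\<integral>\<^sup>+ z. ennreal (ell z) \<partial>\<nu>) = ennreal L" "0 \<le> L" by blast
  have "kap_energy \<nu> < \<infinity>"
  proof (rule ccontr)
   assume "\<not> ?thesis"
   then have "kap_energy \<nu> = \<infinity>" by (simp add: less_top[symmetric])
   then have "E1 + ereal (2 * L) = \<infinity>" using ereal_integral_log_kernel[OF \<nu> x(3,4), folded E1_def] by (simp add: ennreal_mult_top)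
   then have "E1 = \<infinity>" by (cases E1) auto
   then show False using that unfolding W E2[OF x] by simp
  qed
  then show ?thesis using f by (simp add: J_def less_top)
 qed
qed

section \<open>The Gibbs weight in terms of the Hamiltonian\<close>

lemma sum_offdiagonal:
 fixes a :: "nat \<Rightarrow> nat \<Rightarrow> real"
 assumes sym: "\<And>i j. a i j = a j i"
 shows "(\<Sum>i\<in>{1..n}. \<Sum>j\<in>{1..n} - {i}. a i j) = 2 * (\<Sum>k\<in>{1..n}. \<Sum>j\<in>{1..<k}. a j k)"
proof -
 have "(\<Sum>i\<in>{1..n}. \<Sum>j\<in>{1..n} - {i}. a i j) = (\<Sum>i\<in>{1..n}. (\<Sum>j\<in>{j\<in>{1..n}. j < i}. a i j) + (\<Sum>j\<in>{j\<in>{1..n}. i < j}. a i j))"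
 proof (rule sum.cong[OF refl])
  fix i assume "i \<in> {1..n}"
  have eq: "{1..n} - {i} = {j\<in>{1..n}. j < i} \<union> {j\<in>{1..n}. i < j}" by auto
  show "(\<Sum>j\<in>{1..n} - {i}. a i j) = (\<Sum>j\<in>{j\<in>{1..n}. j < i}. a i j) + (\<Sum>j\<in>{j\<in>{1..n}. i < j}. a i j)"
   by (subst eq) (rule sum.union_disjoint, auto)
 qed
 also have "\<dots> = (\<Sum>i\<in>{1..n}. \<Sum>j\<in>{j\<in>{1..n}. j < i}. a i j) + (\<Sum>i\<in>{1..n}. \<Sum>j\<in>{j\<in>{1..n}. i < j}. a i j)" by (rule sum.distrib)
 also have "(\<Sum>i\<in>{1..n}. \<Sum>j\<in>{j\<in>{1..n}. i < j}. a i j) = (\<Sum>j\<in>{1..n}. \<Sum>i\<in>{i\<in>{1..n}. i < j}. a i j)"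
  by (rule sum.swap_restrict) auto
 also have "(\<Sum>i\<in>{1..n}. \<Sum>j\<in>{j\<in>{1..n}. j < i}. a i j) = (\<Sum>j\<in>{1..n}. \<Sum>i\<in>{i\<in>{1..n}. i < j}. a i j)"
  using sym by (intro sum.cong) auto
 also have "(\<Sum>j\<in>{1..n}. \<Sum>i\<in>{i\<in>{1..n}. i < j}. a i j) = (\<Sum>k\<in>{1..n}. \<Sum>j\<in>{1..<k}. a j k)"
  by (intro sum.cong) auto
 finally show ?thesis by simp
qed

lemma sum_offdiagonal_add:
 fixes l :: "nat \<Rightarrow> real"
 assumes "1 \<le> n"
 shows "(\<Sum>i\<in>{1..n}. \<Sum>j\<in>{1..n} - {i}. (l i + l j) / 2) = (real n - 1) * (\<Sum>i\<in>{1..n}. l i)"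
proof -
 let ?T = "\<Sum>i\<in>{1..n}. l i"
 have "(\<Sum>i\<in>{1..n}. \<Sum>j\<in>{1..n} - {i}. (l i + l j) / 2) = (\<Sum>i\<in>{1..n}. ((real n - 2) * l i + ?T) / 2)"
 proof (rule sum.cong[OF refl])
  fix i assume i: "i \<in> {1..n}"
  have "(\<Sum>j\<in>{1..n} - {i}. (l i + l j) / 2) = (\<Sum>j\<in>{1..n}. (l i + l j) / 2) - l i" using i by (subst sum_diff1) auto
  also have "(\<Sum>j\<in>{1..n}. (l i + l j) / 2) = (real n * l i + ?T) / 2" by (simp add: sum_divide_distrib[symmetric] sum.distrib)
  finally show "(\<Sum>j\<in>{1..n} - {i}. (l i + l j) / 2) = ((real n - 2) * l i + ?T) / 2" by (simp add: field_simps)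
 qed
 also have "\<dots> = ((real n - 2) * ?T + real n * ?T) / 2" by (simp add: sum_divide_distrib[symmetric] sum.distrib sum_distrib_left[symmetric])
 also have "\<dots> = (real n - 1) * ?T"
 proof -
  have "((x - 2) * t + x * t) / 2 = (x - 1) * t" for x t :: real by (simp add: field_simps)
  then show ?thesis .
 qed
 finally show ?thesis .
qed

text \<open>Coinciding points or an infinite potential give 0 on both sides. Otherwise exponents are
  compared: with A, B, T the sums of \<open>q\<close>, of \<open>ell\<close> and of the logarithms
  over unordered pairs, the pair sum of \<open>kap\<close> is (n - 1) B - 2 T, the Hamiltonian adds
  n A + B, and only the constant C is left over.\<close>

lemma gas_weight_boltzmann:
 assumes \<beta>: "0 < \<beta>" and n: "1 \<le> n" and Q: "\<And>z. Q z = enn2ereal (q z) + ereal (ell z - C)"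
 shows "ennreal (gas_weight \<beta> Q n \<zeta>) = ennreal (exp (\<beta> * C * (real n)\<^sup>2)) * boltzmann \<beta> (hamiltonian q n \<zeta>)"
proof (cases "\<exists>i\<in>{1..n}. q (\<zeta> i) = \<infinity>")
 case True
 then obtain i where i: "i \<in> {1..n}" "q (\<zeta> i) = \<infinity>" by blast
 have "Q (\<zeta> i) = \<infinity>" using i by (simp add: Q)
 then have "(\<Sum>i\<in>{1..n}. Q (\<zeta> i)) = \<infinity>" using i unfolding sum_Pinfty by blast
 then have "exp_neg (ereal (\<beta> * real n) * (\<Sum>i\<in>{1..n}. Q (\<zeta> i))) = 0" using \<beta> n by (simp add: exp_neg_def)
 then have w: "gas_weight \<beta> Q n \<zeta> = 0" unfolding gas_weight_def by (simp only: mult_zero_right)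
 have "\<infinity> = q (\<zeta> i)" using i by simp
 also have "\<dots> \<le> (\<Sum>i\<in>{1..n}. q (\<zeta> i))" using i(1) by (intro member_le_sum) auto
 finally have "(\<Sum>i\<in>{1..n}. q (\<zeta> i)) = \<infinity>" by (simp add: top_unique)
 then have "hamiltonian q n \<zeta> = \<infinity>" unfolding hamiltonian_def using n by (simp only:) (simp add: ennreal_mult_top)
 then show ?thesis by (simp add: w boltzmann_def)
next
 case False
 note fin = False
 show ?thesis
 proof (cases "\<exists>i\<in>{1..n}. \<exists>j\<in>{1..n}. i < j \<and> \<zeta> i = \<zeta> j")
  case True
  then obtain i j where ij: "i \<in> {1..n}" "j \<in> {1..n}" "i < j" "\<zeta> i = \<zeta> j" by blast
  have "(\<Prod>l\<in>{1..<j}. cmod (\<zeta> l - \<zeta> j) powr (2 * \<beta>)) = 0"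
   using ij by (intro prod_zero) (auto intro!: bexI[of _ i])
  then have "(\<Prod>k\<in>{1..n}. \<Prod>j\<in>{1..<k}. cmod (\<zeta> j - \<zeta> k) powr (2 * \<beta>)) = 0"
   by (intro prod_zero bexI[OF _ ij(2)]) auto
  then have w: "gas_weight \<beta> Q n \<zeta> = 0" unfolding gas_weight_def by (simp only: mult_zero_left)
  have "\<infinity> = kap (\<zeta> i) (\<zeta> j)" using ij by (simp add: kap_def)
  also have "\<dots> \<le> (\<Sum>j\<in>{1..n} - {i}. kap (\<zeta> i) (\<zeta> j))" using ij by (intro member_le_sum) auto
  also have "\<dots> \<le> (\<Sum>i\<in>{1..n}. \<Sum>j\<in>{1..n} - {i}. kap (\<zeta> i) (\<zeta> j))" using ij(1) by (intro member_le_sum[of i]) auto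
  finally have "(\<Sum>i\<in>{1..n}. \<Sum>j\<in>{1..n} - {i}. kap (\<zeta> i) (\<zeta> j)) = \<infinity>" by (simp add: top_unique)
  then have "hamiltonian q n \<zeta> = \<infinity>" unfolding hamiltonian_def by (simp only:) simp
  then show ?thesis by (simp add: w boltzmann_def)
 next
  case False
  then have ne: "\<zeta> i \<noteq> \<zeta> j" if "i \<in> {1..n}" "j \<in> {1..n}" "i \<noteq> j" for i j
   using that by (metis linorder_neqE_nat)
  define r where "r i = enn2real (q (\<zeta> i))" for i
  have r: "q (\<zeta> i) = ennreal (r i)" if "i \<in> {1..n}" for i using fin that by (auto simp: r_def ennreal_enn2real_if)
  have r0: "0 \<le> r i" for i by (simp add: r_def)
  define l where "l i = ell (\<zeta> i)" for i
  define d where "d i j = ln (cmod (\<zeta> i - \<zeta> j))" for i j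
  define T where "T = (\<Sum>k\<in>{1..n}. \<Sum>j\<in>{1..<k}. d j k)"
  define A where "A = (\<Sum>i\<in>{1..n}. r i)"
  define B where "B = (\<Sum>i\<in>{1..n}. l i)"
  have "Q (\<zeta> i) = ereal (r i + l i - C)" if "i \<in> {1..n}" for i using r[OF that] r0[of i] by (simp add: Q l_def)
  then have "(\<Sum>i\<in>{1..n}. Q (\<zeta> i)) = (\<Sum>i\<in>{1..n}. ereal (r i + l i - C))" by (rule sum.cong[OF refl])
  also have "\<dots> = ereal (\<Sum>i\<in>{1..n}. r i + l i - C)" by (rule sum_ereal)
  also have "(\<Sum>i\<in>{1..n}. r i + l i - C) = A + B - n * C" by (simp add: A_def B_def sum.distrib sum_subtractf)
  finally have e: "exp_neg (ereal (\<beta> * real n) * (\<Sum>i\<in>{1..n}. Q (\<zeta> i))) = exp (- (\<beta> * n * (A + B - n * C)))"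
   by (simp only: exp_neg_def) simp
  have "(\<Prod>k\<in>{1..n}. \<Prod>j\<in>{1..<k}. cmod (\<zeta> j - \<zeta> k) powr (2 * \<beta>)) = (\<Prod>k\<in>{1..n}. \<Prod>j\<in>{1..<k}. exp (2 * \<beta> * d j k))"
  proof (intro prod.cong refl)
   fix k j assume "k \<in> {1..n}" "j \<in> {1..<k}"
   then have "\<zeta> j \<noteq> \<zeta> k" by (intro ne) auto
   then show "cmod (\<zeta> j - \<zeta> k) powr (2 * \<beta>) = exp (2 * \<beta> * d j k)" by (simp add: powr_def d_def)
  qed
  also have "\<dots> = exp (2 * \<beta> * T)" unfolding T_def by (simp add: exp_sum[symmetric] sum_distrib_left)
  finally have p: "(\<Prod>k\<in>{1..n}. \<Prod>j\<in>{1..<k}. cmod (\<zeta> j - \<zeta> k) powr (2 * \<beta>)) = exp (2 * \<beta> * T)" .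
  have kp: "kap (\<zeta> i) (\<zeta> j) = ennreal ((l i + l j) / 2 - d i j)" "0 \<le> (l i + l j) / 2 - d i j"
   if "i \<in> {1..n}" "j \<in> {1..n} - {i}" for i j
  proof -
   have "\<zeta> i \<noteq> \<zeta> j" using that by (intro ne) auto
   then show "kap (\<zeta> i) (\<zeta> j) = ennreal ((l i + l j) / 2 - d i j)" "0 \<le> (l i + l j) / 2 - d i j"
    using ln_cmod_diff_le[of "\<zeta> i" "\<zeta> j"] by (auto simp: kap_def l_def d_def)
  qed
  define K where "K = (\<Sum>i\<in>{1..n}. \<Sum>j\<in>{1..n} - {i}. (l i + l j) / 2 - d i j)"
  have K0: "0 \<le> K" unfolding K_def using kp(2) by (intro sum_nonneg) auto
  have "(\<Sum>i\<in>{1..n}. \<Sum>j\<in>{1..n} - {i}. kap (\<zeta> i) (\<zeta> j)) = (\<Sum>i\<in>{1..n}. \<Sum>j\<in>{1..n} - {i}. ennreal ((l i + l j) / 2 - d i j))"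
   by (intro sum.cong refl kp(1))
  also have "\<dots> = (\<Sum>i\<in>{1..n}. ennreal (\<Sum>j\<in>{1..n} - {i}. (l i + l j) / 2 - d i j))"
   by (intro sum.cong refl sum_ennreal kp(2))
  also have "\<dots> = ennreal K" unfolding K_def by (intro sum_ennreal sum_nonneg kp(2))
  finally have h1: "(\<Sum>i\<in>{1..n}. \<Sum>j\<in>{1..n} - {i}. kap (\<zeta> i) (\<zeta> j)) = ennreal K" .
  have "(\<Sum>i\<in>{1..n}. q (\<zeta> i)) = (\<Sum>i\<in>{1..n}. ennreal (r i))" by (intro sum.cong refl r)
  also have "\<dots> = ennreal A" unfolding A_def by (intro sum_ennreal r0)
  finally have h2: "(\<Sum>i\<in>{1..n}. q (\<zeta> i)) = ennreal A" .
  have h3: "(\<Sum>i\<in>{1..n}. ennreal (ell (\<zeta> i))) = ennreal B" unfolding B_def l_def by (intro sum_ennreal) simp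
  have A0: "0 \<le> A" "0 \<le> B" unfolding A_def B_def l_def using r0 by (auto intro: sum_nonneg)
  have H: "hamiltonian q n \<zeta> = ennreal (K + n * A + B)"
   unfolding hamiltonian_def h1 h2 h3 using K0 A0 by (simp add: ennreal_plus ennreal_mult ennreal_of_nat_eq_real_of_nat)
  have "K = (\<Sum>i\<in>{1..n}. \<Sum>j\<in>{1..n} - {i}. (l i + l j) / 2) - (\<Sum>i\<in>{1..n}. \<Sum>j\<in>{1..n} - {i}. d i j)"
   unfolding K_def by (simp add: sum_subtractf)
  also have "\<dots> = (real n - 1) * B - 2 * T"
   unfolding sum_offdiagonal_add[OF n] B_def T_def by (subst sum_offdiagonal) (auto simp: d_def norm_minus_commute)
  finally have K: "K = (real n - 1) * B - 2 * T" .
  have b: "boltzmann \<beta> (hamiltonian q n \<zeta>) = ennreal (exp (- \<beta> * (K + n * A + B)))"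
   unfolding H using K0 A0 by (intro boltzmann_ennreal) simp
  have "ennreal (exp (\<beta> * C * (real n)\<^sup>2)) * boltzmann \<beta> (hamiltonian q n \<zeta>) = ennreal (exp (\<beta> * C * (real n)\<^sup>2 + - \<beta> * (K + n * A + B)))"
   by (simp only: b exp_add ennreal_mult exp_ge_zero)
  also have "\<beta> * C * (real n)\<^sup>2 + - \<beta> * (K + n * A + B) = 2 * \<beta> * T + - (\<beta> * n * (A + B - n * C))"
   unfolding K by (simp add: algebra_simps power2_eq_square)
  also have "exp \<dots> = gas_weight \<beta> Q n \<zeta>" unfolding gas_weight_def e p by (rule exp_add)
  finally show ?thesis by simp
 qed
qed

section \<open>From the external potential to the gas\<close>

text \<open>The density is only Lebesgue measurable, so null sets pass through the completed measure
  before returning to the Borel sets.\<close>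

lemma laplacian_form_absolutely_continuous:
 assumes "has_laplacian_form \<sigma> Q S"
 shows "absolutely_continuous lborel \<sigma>"
 unfolding absolutely_continuous_def
proof
 fix N :: "complex set" assume N: "N \<in> null_sets lborel"
 let ?f = "\<lambda>z. ennreal (laplacian_density Q S z)"
 have [measurable]: "laplacian_density Q S \<in> borel_measurable lebesgue" using assms by (simp add: has_laplacian_form_def)
 have m: "?f \<in> borel_measurable lebesgue" by measurable
 have Nb: "N \<in> sets borel" using N by auto
 have "N \<in> null_sets (density lebesgue ?f)"
  using absolutely_continuousI_density[OF m] null_sets_completionI[OF N] by (auto simp: absolutely_continuous_def)
 then have "emeasure (density lebesgue ?f) N = 0" by auto
 moreover have "emeasure (laplacian_measure Q S) N = emeasure (density lebesgue ?f) N"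
 proof -
  have "(\<lambda>z. z) \<in> measurable (density lebesgue ?f) borel"
   using measurable_completion[of "\<lambda>z. z" lborel "borel :: complex measure"] by (simp add: measurable_cong_sets[of "density lebesgue ?f" lebesgue])
  then show ?thesis unfolding laplacian_measure_def by (subst emeasure_distr) (auto simp: Nb)
 qed
 moreover have "\<sigma> = laplacian_measure Q S" using assms by (simp add: has_laplacian_form_def)
 ultimately show "N \<in> null_sets \<sigma>" using Nb by (intro null_setsI) (auto simp: laplacian_measure_def)
qed

text \<open>\<open>q\<close> is Q - ell + C, written as \<open>F = g + h\<close> with continuous
  \<open>g\<close> and superharmonic \<open>h\<close>: this decomposition gives lower semicontinuity
  and \<open>q_disc\<close>, and the growth of \<open>Q\<close> gives the quadratic lower
  bound.\<close>

lemma gas_of_potential: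
 assumes \<beta>: "\<beta> > 0" and Qn: "\<And>z. Q z \<noteq> -\<infinity>" and pos: "emeasure lebesgue {z. Q z < \<infinity>} > 0"
  and \<sigma>: "is_equilibrium_measure Q \<sigma>" and form: "has_laplacian_form \<sigma> Q S"
  and growth: "Liminf at_infinity (\<lambda>z. Q z / ereal ((cmod z)\<^sup>2)) > 0"
  and Q: "\<And>z. Q z = ereal (Qt z) + h z" and Qt: "twice_differentiable Qt" and h: "superharmonic h"
 shows "\<exists>q c1 C. gas q c1 \<sigma> \<beta> \<and> (\<forall>z. Q z = enn2ereal (q z) + ereal (ell z - C))"
proof -
 obtain G where "\<forall>z. (Qt has_derivative (\<lambda>v. G z \<bullet> v)) (at z) \<and> G differentiable (at z)"
  using Qt unfolding twice_differentiable_def by blast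
 then have "isCont Qt z" for z using has_derivative_continuous[of Qt "\<lambda>v. G z \<bullet> v" z UNIV] by blast
 then have cQt: "continuous_on UNIV Qt" by (simp add: continuous_at_imp_continuous_on)
 have lh: "lsc h" using h by (rule superharmonic_lsc)
 have nh: "h z \<noteq> -\<infinity>" for z using h by (simp add: superharmonic_def)
 have "Q = (\<lambda>z. ereal (Qt z) + h z)" using Q by (rule ext)
 then have lQ: "lsc Q" using lsc_add_continuous[OF lh nh cQt] by simp
 have Qm [measurable]: "Q \<in> borel_measurable borel" using lQ by (rule lsc_measurable)
 from quadratic_growth[OF lQ Qn growth] obtain c1 C where c1: "0 < c1" and C: "0 \<le> C"
  and gr: "\<And>z. ereal (c1 * (cmod z)\<^sup>2 + ell z) \<le> Q z + ereal C" by blast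
 define g where "g z = Qt z - ell z + C" for z
 have cg: "continuous_on UNIV g" unfolding g_def by (intro continuous_intros cQt)
 define F where "F z = ereal (g z) + h z" for z
 have F_ge: "ereal (c1 * (cmod z)\<^sup>2) \<le> F z" for z
  using gr[of z] nh[of z] unfolding F_def g_def Q by (cases "h z") auto
 have F0: "0 \<le> F z" for z
 proof -
  have "0 \<le> ereal (c1 * (cmod z)\<^sup>2)" using c1 by simp
  then show ?thesis using F_ge by (rule order_trans)
 qed
 have lF: "lsc F" unfolding F_def[abs_def] by (rule lsc_add_continuous[OF lh nh cg])
 define q where "q z = e2ennreal (F z)" for z
 have qm: "q \<in> borel_measurable borel"
  unfolding q_def using lsc_measurable[OF lF] by measurable
 have Fq: "enn2ereal (q z) = F z" for z unfolding q_def by (rule enn2ereal_e2ennreal[OF F0])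
 have Qq: "Q z = enn2ereal (q z) + ereal (ell z - C)" for z
  unfolding Fq F_def g_def Q using nh[of z] by (cases "h z") auto
 have q_ge: "ennreal (c1 * (cmod z)\<^sup>2) \<le> q z" for z
  using e2ennreal_mono[OF F_ge[of z]] by (simp add: q_def)
 have s: "\<sigma> \<in> complex_prob_measures" and min: "\<And>\<nu>. \<nu> \<in> complex_prob_measures \<Longrightarrow> weighted_energy Q \<sigma> \<le> weighted_energy Q \<nu>"
  using \<sigma> by (auto simp: is_equilibrium_measure_def energy_minimizer_def)
 let ?J = "\<lambda>\<nu>. kap_energy \<nu> + (\<integral>\<^sup>+ z. q z \<partial>\<nu>)"
 note W = weighted_energy_kap[OF _ Qm qm C Qq c1 q_ge]
 have "Q z < \<infinity> \<longleftrightarrow> q z < \<infinity>" for z unfolding Qq by (cases "q z") auto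
 then have "0 < emeasure lborel {z. q z < \<infinity>}"
  using pos qm by (simp add: emeasure_completion main_part_sets)
 from finite_energy_competitor[OF qm this] obtain \<nu> where \<nu>: "\<nu> \<in> complex_prob_measures" "?J \<nu> < \<infinity>" by blast
 \<comment> \<open>The energy of \<open>\<sigma>\<close> is finite because \<open>\<sigma>\<close>
   is a minimiser and some competitor has finite energy.\<close>
 have "weighted_energy Q \<sigma> \<le> weighted_energy Q \<nu>" using \<nu>(1) by (rule min)
 also have "\<dots> < \<infinity>" unfolding W(1)[OF \<nu>] by simp
 finally have J\<sigma>: "?J \<sigma> < \<infinity>" by (rule W(2)[OF s])
 have "equilibrium q c1 \<sigma>"
 proof (rule equilibrium.intro)
  show "0 < c1" by (rule c1)
  show "q \<in> borel_measurable borel" by (rule qm)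
  show "ennreal (c1 * (cmod z)\<^sup>2) \<le> q z" for z by (rule q_ge)
  show "q z \<le> liminf (\<lambda>n. q (X n))" if "X \<longlonglongrightarrow> z" for X z
   unfolding q_def by (rule lsc_sequentially[OF lF F0 that])
  show "\<exists>r0>0. \<forall>r>0. r \<le> r0 \<longrightarrow> (\<forall>z\<in>cball 0 R. (\<integral>\<^sup>+ u\<in>ball z r. q u \<partial>lborel) \<le> ennreal (pi * r\<^sup>2) * (q z + ennreal e))" if "0 < e" for e R
   using disc_usc_superharmonic[OF h cg F0[unfolded F_def]] that unfolding disc_usc_def q_def F_def by blast
  show "prob_space \<sigma>" "sets \<sigma> = sets borel" using s by (auto simp: complex_prob_measures_def)
  show "absolutely_continuous lborel \<sigma>" using form by (rule laplacian_form_absolutely_continuous)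
  show "?J \<sigma> < \<infinity>" by (rule J\<sigma>)
  show "?J \<sigma> \<le> ?J \<nu>" if "prob_space \<nu>" "sets \<nu> = sets borel" for \<nu>
  proof (cases "?J \<nu> < \<infinity>")
   case True
   have \<nu>: "\<nu> \<in> complex_prob_measures" using that by (simp add: complex_prob_measures_def)
   have "ereal (2 * enn2real (?J \<sigma>) - 2 * C) \<le> ereal (2 * enn2real (?J \<nu>) - 2 * C)"
    unfolding W(1)[OF s J\<sigma>, symmetric] W(1)[OF \<nu> True, symmetric] using \<nu> by (rule min)
   then have "enn2real (?J \<sigma>) \<le> enn2real (?J \<nu>)" by simp
   then have "ennreal (enn2real (?J \<sigma>)) \<le> ennreal (enn2real (?J \<nu>))" by (rule ennreal_leI)
   then show ?thesis using J\<sigma> True by (simp only: ennreal_enn2real infinity_ennreal_def)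
  next
   case False
   then have "?J \<nu> = \<infinity>" by (simp add: less_top[symmetric])
   then show ?thesis by (simp only: infinity_ennreal_def top_greatest)
  qed
 qed
 then have "gas q c1 \<sigma> \<beta>" using \<beta> by (intro gas.intro gas_axioms.intro)
 then show ?thesis using Qq by blast
qed

theorem theorem1p8:
  fixes \<beta> :: real
    and Q h :: "complex \<Rightarrow> ereal"
    and Qt :: "complex \<Rightarrow> real"
    and \<sigma> :: "complex measure"
    and S :: "complex set"
    and M :: "nat \<Rightarrow> 'w measure"
    and \<zeta> :: "nat \<Rightarrow> 'w \<Rightarrow> nat \<Rightarrow> complex"
    and k :: nat
  assumes "\<beta> > 0"
    and "\<And>z. Q z \<noteq> -\<infinity>"
    and "emeasure lebesgue {z. Q z < \<infinity>} > 0"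
    and "is_equilibrium_measure Q \<sigma>"
    and "S = measure_support \<sigma>"
    and "has_laplacian_form \<sigma> Q S"
    and "Liminf at_infinity (\<lambda>z. Q z / ereal ((cmod z)\<^sup>2)) > 0"
    and "\<And>z. Q z = ereal (Qt z) + h z"
    and "twice_differentiable Qt"
    and "\<forall>\<^sub>F z in at_infinity. Qt z \<noteq> 0"
    and "Limsup at_infinity
           (\<lambda>z. ereal (1 / Qt z) * (SUP w\<in>ball z 1. ereal (laplacian (\<lambda>u. ereal (Qt u)) w))) < 4"
    and "superharmonic h"
    and "\<And>n. n \<ge> 1 \<Longrightarrow> prob_space (M n)"
    and "\<And>n. n \<ge> 1 \<Longrightarrow> distributed (M n) (vol n) (\<zeta> n) (gas_density \<beta> Q n)"
  shows "converges_weakly_in_probability M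
           (\<lambda>n \<omega>. zero_measure ((pderiv ^^ k) (gas_poly n (\<zeta> n \<omega>))))
           (laplacian_measure Q S)"
proof -
 let ?A = "\<lambda>n U. {\<omega> \<in> space (M n). zero_measure ((pderiv ^^ k) (gas_poly n (\<zeta> n \<omega>))) \<in> U}"
 have \<sigma>: "\<sigma> = laplacian_measure Q S" using assms(6) by (simp add: has_laplacian_form_def)
 obtain q c1 C where gas: "gas q c1 \<sigma> \<beta>" and Q: "\<And>z. Q z = enn2ereal (q z) + ereal (ell z - C)"
  using gas_of_potential[OF assms(1,2,3,4,6,7,8,9,12)] by blast
 interpret gas q c1 \<sigma> \<beta> by (rule gas)
 \<comment> \<open>The constant factor between \<open>gas_weight\<close> and \<open>weight\<close>;
   it cancels in the normalised density.\<close>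
 define E where "E n = ennreal (exp (\<beta> * C * (real n)\<^sup>2))" for n :: nat
 have E: "E n \<noteq> 0" "E n \<noteq> \<infinity>" for n by (simp_all add: E_def)
 have weight: "ennreal (gas_weight \<beta> Q n \<xi>) = E n * weight n \<xi>" if "n \<ge> 1" for n \<xi>
  unfolding E_def weight_def by (rule gas_weight_boltzmann[OF assms(1) that Q])
 have PF: "partition_function \<beta> Q n = E n * Zn n" if "n \<ge> 1" for n
  unfolding partition_function_def Zn_def weight[OF that] by (rule nn_integral_cmult[OF weight_measurable])
 have law: "distr (M n) (vol n) (\<zeta> n) = density (vol n) (gas_density \<beta> Q n)" "\<zeta> n \<in> measurable (M n) (vol n)"
  "gas_density \<beta> Q n \<in> borel_measurable (vol n)" if "n \<ge> 1" for n
  using assms(14)[OF that] by (simp_all add: distributed_def)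
 \<comment> \<open>Read off from the law: its total mass is the quotient of E n * Zn n by itself,
   and this is 1 only if \<open>Zn n\<close> is neither 0 nor \<infinity>.\<close>
 have Z: "0 < Zn n \<and> Zn n < \<infinity>" if n: "n \<ge> 1" for n
 proof -
  have m: "(\<lambda>\<xi>. E n * weight n \<xi>) \<in> borel_measurable (vol n)" by (intro borel_measurable_times_ennreal borel_measurable_const weight_measurable)
  have "prob_space (density (vol n) (gas_density \<beta> Q n))"
   unfolding law(1)[OF n, symmetric] by (rule prob_space.prob_space_distr[OF assms(13)[OF n] law(2)[OF n]])
  then have "emeasure (density (vol n) (gas_density \<beta> Q n)) (space (vol n)) = 1"
   using prob_space.emeasure_space_1 by fastforce
  then have "1 = (\<integral>\<^sup>+ \<xi>. gas_density \<beta> Q n \<xi> * indicator (space (vol n)) \<xi> \<partial>vol n)"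
   by (simp only: emeasure_density[OF law(3)[OF n] sets.top])
  also have "\<dots> = (\<integral>\<^sup>+ \<xi>. E n * weight n \<xi> / partition_function \<beta> Q n \<partial>vol n)"
   by (intro nn_integral_cong) (simp only: gas_density_def weight[OF n] indicator_simps mult_1_right)
  also have "\<dots> = (\<integral>\<^sup>+ \<xi>. E n * weight n \<xi> \<partial>vol n) / partition_function \<beta> Q n" by (rule nn_integral_divide[OF m])
  also have "\<dots> = E n * Zn n / (E n * Zn n)" unfolding PF[OF n] by (simp only: nn_integral_cmult[OF weight_measurable] Zn_def)
  finally have "E n * Zn n / (E n * Zn n) = 1" ..
  then have "Zn n \<noteq> 0" "Zn n \<noteq> \<infinity>" using E[of n] by (auto simp: divide_ennreal_def ennreal_mult_top)
  then show ?thesis by (simp add: less_top zero_less_iff_neq_zero)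
 qed
 have dens: "gas_density \<beta> Q n \<xi> = weight n \<xi> / Zn n" if n: "n \<ge> 1" for n \<xi>
 proof -
  obtain z where z: "Zn n = ennreal z" "0 < z" using Z[OF n] by (cases "Zn n") auto
  obtain w where w: "weight n \<xi> = ennreal w" "0 \<le> w" unfolding weight_def boltzmann_def by (metis ennreal_0 exp_ge_zero order_refl)
  define e where "e = exp (\<beta> * C * (real n)\<^sup>2)"
  have e: "0 < e" "E n = ennreal e" by (simp_all add: e_def E_def)
  show ?thesis unfolding gas_density_def PF[OF n] weight[OF n] z w e(2)
   using z w e by (simp add: ennreal_mult[symmetric] divide_ennreal)
 qed
 \<comment> \<open>Restricted to n > k, where \<open>zeros_event_measurable\<close> applies.\<close>
 have prob: "measure (M n) (?A n U)
  = measure (density (vol n) (\<lambda>\<xi>. weight n \<xi> / Zn n)) {\<xi> \<in> space (vol n). zeros k n \<xi> \<in> U}"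
  if n: "k + 1 \<le> n" and U: "openin weak_topology U" for n U
 proof -
  have n': "n \<ge> 1" "k < n" using n by auto
  let ?B = "{\<xi> \<in> space (vol n). zeros k n \<xi> \<in> U}"
  have A: "?B \<in> sets (vol n)" by (rule zeros_event_measurable[OF n'(2) U])
  have "?A n U = \<zeta> n -` ?B \<inter> space (M n)"
   using measurable_space[OF law(2)[OF n'(1)]] by (auto simp: zeros_def)
  then have "measure (M n) (?A n U) = measure (distr (M n) (vol n) (\<zeta> n)) ?B"
   by (simp only: measure_distr[OF law(2)[OF n'(1)] A])
  also have "distr (M n) (vol n) (\<zeta> n) = density (vol n) (\<lambda>\<xi>. weight n \<xi> / Zn n)"
   unfolding law(1)[OF n'(1)] by (rule arg_cong[where f = "density (vol n)"]) (rule ext, rule dens[OF n'(1)])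
  finally show ?thesis .
 qed
 have "(\<lambda>n. measure (M n) (?A n U)) \<longlonglongrightarrow> 1"
  if U: "openin weak_topology U" "\<sigma> \<in> U" for U
 proof (rule Lim_transform_eventually[OF gas_zeros_converge[OF Z U]])
  show "\<forall>\<^sub>F n in sequentially. measure (density (vol n) (\<lambda>\<xi>. weight n \<xi> / Zn n)) {\<xi> \<in> space (vol n). zeros k n \<xi> \<in> U}
   = measure (M n) (?A n U)"
   using prob[OF _ U(1)] by (intro eventually_sequentiallyI[of "k + 1"]) simp
 qed
 moreover have "\<sigma> \<in> complex_prob_measures" using prob_sigma sets_sigma by (simp add: complex_prob_measures_def)
 ultimately show ?thesis unfolding \<sigma>[symmetric] converges_weakly_in_probability_def by blast
qed

end
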